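(* Let $\varphi \in C(\Gamma)$. Then there exists a $\Phi \in C(\overline\Omega) \cap H^1_{\mathrm{loc}}(\Omega)$ such that $\Phi|_\Gamma = \varphi$ and $\mathcal A\Phi \in H^{-1}(\Omega)$. Moreover, for every such $\Phi$ there exists a unique $v \in H^1_0(\Omega)$ such that $\mathcal A v = \mathcal A\Phi$, and it follows that $T\varphi = \Phi|_\Omega - v$.
   Context: Setting: $d \ge 2$, $\Omega \subset \mathbb R^d$ is open and bounded with boundary $\Gamma = \partial\Omega$; functions are complex-valued unless said otherwise. For $k,l \in \{1,\ldots,d\}$, $a_{kl} \colon \Omega \to \mathbb R$ is bounded and measurable, and there is $\mu \in (0,1]$ with $\mathrm{Re} \sum_{k,l=1}^d a_{kl}(x)\,\xi_k\,\overline{\xi_l} \ge \mu|\xi|^2$ for all $x \in \Omega$, $\xi \in \mathbb C^d$. Further $b_k, c_0 \colon \Omega \to \mathbb C$ and $c_k \colon \Omega \to \mathbb R$ ($k=1,\ldots,d$) are bounded and measurable. $\mathcal D'(\Omega)$ is the antidual of $\mathcal D(\Omega) = C_c^\infty(\Omega)$. Define $\mathcal A \colon H^1_{\mathrm{loc}}(\Omega) \to \mathcal D'(\Omega)$ by $$\langle \mathcal A u, v\rangle = \sum_{k,l=1}^d \int_\Omega a_{kl}(\partial_l u)\overline{\partial_k v} + \sum_{k=1}^d \int_\Omega b_k u\,\overline{\partial_k v} + \sum_{k=1}^d \int_\Omega c_k(\partial_k u)\overline v + \int_\Omega c_0 u \overline v$$ for $v \in C_c^\infty(\Omega)$. A function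 $u$ is called $\mathcal A$-harmonic if $u \in H^1_{\mathrm{loc}}(\Omega)$ and $\mathcal A u = 0$. Standing assumption: $0$ is not a Dirichlet eigenvalue, i.e. if $u \in H^1_0(\Omega)$ and $\mathcal A u = 0$, then $u = 0$. Perron solution operator: $T \colon C(\Gamma) \to C_b(\Omega)$ is the unique bounded linear map (supremum norms; $C_b(\Omega)$ is the space of bounded continuous functions) such that $T\varphi$ is $\mathcal A$-harmonic for all $\varphi \in C(\Gamma)$ and $\Phi|_\Omega - T(\Phi|_\Gamma) \in H^1_0(\Omega)$ for all $\Phi \in C(\overline\Omega)\cap H^1(\Omega)$. Such a map exists and is unique. $H^{-1}(\Omega)$ is the antidual of $H^1_0(\Omega)$, identified with the set of all $F \in \mathcal D'(\Omega)$ for which there is $c>0$ with $|\langle F,v\rangle| \le c\|v\|_{H^1(\Omega)}$ for all $v \in C_c^\infty(\Omega)$. *)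

theory Defs
  imports "HOL-Analysis.Analysis"
begin

text \<open>
  A function on a set \<open>\<Omega>\<close> is represented by a total function on \<open>real^'n\<close>; only its values
  on \<open>\<Omega>\<close> matter. The Sobolev spaces below are sets of representatives (not of equivalence
  classes modulo null sets), so equality of their elements has to be stated almost everywhere.
\<close>

type_synonym 'n cfun = "real^'n \<Rightarrow> complex"

definition partial :: "'n::finite \<Rightarrow> 'n cfun \<Rightarrow> 'n cfun" where
  "partial k f = (\<lambda>x. frechet_derivative f (at x) (axis k 1))"

text \<open>
  Iterated partial derivatives are indexed by lists of directions, which for smooth functions
  amounts to multi-indices. A function is \<open>C\<^sup>\<infinity>\<close> iff all of them are differentiable
  (hence continuous).
\<close>

definition partials :: "'n::finite list \<Rightarrow> 'n cfun \<Rightarrow> 'n cfun" where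
  "partials ks f = foldr partial ks f"

definition smooth :: "'n::finite cfun \<Rightarrow> bool" where
  "smooth f \<longleftrightarrow> (\<forall>ks x. partials ks f differentiable (at x))"

definition supp :: "'n::finite cfun \<Rightarrow> (real^'n) set" where
  "supp f = closure {x. f x \<noteq> 0}"

text \<open>\<open>C\<^sub>c\<^sup>\<infinity>(\<Omega>)\<close>, each element being extended by zero to the whole space.\<close>

definition test_functions :: "(real^'n::finite) set \<Rightarrow> 'n cfun set" where
  "test_functions \<Omega> = {v. smooth v \<and> compact (supp v) \<and> supp v \<subseteq> \<Omega>}"

definition L2 :: "(real^'n::finite) set \<Rightarrow> 'n cfun set" where
  "L2 S = {u. u \<in> borel_measurable (lebesgue_on S) \<and>
              integrable (lebesgue_on S) (\<lambda>x. (cmod (u x))\<^sup>2)}"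

definition L1_loc :: "(real^'n::finite) set \<Rightarrow> 'n cfun set" where
  "L1_loc \<Omega> = {u. \<forall>K. compact K \<and> K \<subseteq> \<Omega> \<longrightarrow> integrable (lebesgue_on K) u}"

definition L2_loc :: "(real^'n::finite) set \<Rightarrow> 'n cfun set" where
  "L2_loc \<Omega> = {u. \<forall>K. compact K \<and> K \<subseteq> \<Omega> \<longrightarrow> u \<in> L2 K}"

definition has_weak_partial :: "(real^'n::finite) set \<Rightarrow> 'n \<Rightarrow> 'n cfun \<Rightarrow> 'n cfun \<Rightarrow> bool" where
  "has_weak_partial \<Omega> k u g \<longleftrightarrow>
     u \<in> L1_loc \<Omega> \<and> g \<in> L1_loc \<Omega> \<and>
     (\<forall>v\<in>test_functions \<Omega>.
        (LINT x|lebesgue_on \<Omega>. u x * partial k v x) = - (LINT x|lebesgue_on \<Omega>. g x * v x))"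

text \<open>The weak derivative is unique only almost everywhere; this picks a representative.\<close>

definition weak_partial :: "(real^'n::finite) set \<Rightarrow> 'n \<Rightarrow> 'n cfun \<Rightarrow> 'n cfun" where
  "weak_partial \<Omega> k u = (SOME g. has_weak_partial \<Omega> k u g)"

definition H1_loc :: "(real^'n::finite) set \<Rightarrow> 'n cfun set" where
  "H1_loc \<Omega> = {u \<in> L2_loc \<Omega>. \<forall>k. \<exists>g\<in>L2_loc \<Omega>. has_weak_partial \<Omega> k u g}"

definition H1 :: "(real^'n::finite) set \<Rightarrow> 'n cfun set" where
  "H1 \<Omega> = {u \<in> L2 \<Omega>. \<forall>k. \<exists>g\<in>L2 \<Omega>. has_weak_partial \<Omega> k u g}"

definition H1_norm :: "(real^'n::finite) set \<Rightarrow> 'n cfun \<Rightarrow> real" where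
  "H1_norm \<Omega> u =
     sqrt ((LINT x|lebesgue_on \<Omega>. (cmod (u x))\<^sup>2) +
           (\<Sum>k\<in>UNIV. LINT x|lebesgue_on \<Omega>. (cmod (weak_partial \<Omega> k u x))\<^sup>2))"

text \<open>The closure of \<open>C\<^sub>c\<^sup>\<infinity>(\<Omega>)\<close> in \<open>H\<^sup>1(\<Omega>)\<close>.\<close>

definition H1_0 :: "(real^'n::finite) set \<Rightarrow> 'n cfun set" where
  "H1_0 \<Omega> = {u \<in> H1 \<Omega>. \<forall>e>0. \<exists>v\<in>test_functions \<Omega>. H1_norm \<Omega> (\<lambda>x. u x - v x) < e}"

text \<open>
  The antidual \<open>D'(\<Omega>)\<close> of \<open>C\<^sub>c\<^sup>\<infinity>(\<Omega>)\<close>. Functionals are extended by \<open>0\<close> to arguments that are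
  not test functions, so that equality of distributions is equality in HOL. Continuity for the
  inductive limit topology is expressed by the usual seminorm estimate on every compact set.
\<close>

definition distributions :: "(real^'n::finite) set \<Rightarrow> ('n cfun \<Rightarrow> complex) set" where
  "distributions \<Omega> = {F.
     (\<forall>v. v \<notin> test_functions \<Omega> \<longrightarrow> F v = 0) \<and>
     (\<forall>v\<in>test_functions \<Omega>. \<forall>w\<in>test_functions \<Omega>. \<forall>\<alpha> \<beta>.
        F (\<lambda>x. \<alpha> * v x + \<beta> * w x) = cnj \<alpha> * F v + cnj \<beta> * F w) \<and>
     (\<forall>K. compact K \<and> K \<subseteq> \<Omega> \<longrightarrow>
        (\<exists>C m. \<forall>v\<in>test_functions \<Omega>. supp v \<subseteq> K \<longrightarrow>
           cmod (F v) \<le> C * (\<Sum>ks | length ks \<le> m. SUP x. cmod (partials ks v x))))}"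

definition H_minus_1 :: "(real^'n::finite) set \<Rightarrow> ('n cfun \<Rightarrow> complex) set" where
  "H_minus_1 \<Omega> = {F \<in> distributions \<Omega>.
     \<exists>c>0. \<forall>v\<in>test_functions \<Omega>. cmod (F v) \<le> c * H1_norm \<Omega> v}"

text \<open>The operator \<open>\<A>\<close> as a map into \<open>distributions \<Omega>\<close>; it is meaningful for \<open>u \<in> H1_loc \<Omega>\<close>.\<close>

definition ell_op ::
  "(real^'n::finite) set \<Rightarrow> ('n \<Rightarrow> 'n \<Rightarrow> real^'n \<Rightarrow> real) \<Rightarrow> ('n \<Rightarrow> real^'n \<Rightarrow> complex) \<Rightarrow>
   ('n \<Rightarrow> real^'n \<Rightarrow> real) \<Rightarrow> (real^'n \<Rightarrow> complex) \<Rightarrow> 'n cfun \<Rightarrow> 'n cfun \<Rightarrow> complex" where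
  "ell_op \<Omega> a b c c0 u = (\<lambda>v. if v \<in> test_functions \<Omega> then
       (\<Sum>k\<in>UNIV. \<Sum>l\<in>UNIV.
          LINT x|lebesgue_on \<Omega>. of_real (a k l x) * weak_partial \<Omega> l u x * cnj (partial k v x))
     + (\<Sum>k\<in>UNIV. LINT x|lebesgue_on \<Omega>. b k x * u x * cnj (partial k v x))
     + (\<Sum>k\<in>UNIV. LINT x|lebesgue_on \<Omega>. of_real (c k x) * weak_partial \<Omega> k u x * cnj (v x))
     + (LINT x|lebesgue_on \<Omega>. c0 x * u x * cnj (v x))
     else 0)"

definition harmonic ::
  "(real^'n::finite) set \<Rightarrow> ('n \<Rightarrow> 'n \<Rightarrow> real^'n \<Rightarrow> real) \<Rightarrow> ('n \<Rightarrow> real^'n \<Rightarrow> complex) \<Rightarrow>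
   ('n \<Rightarrow> real^'n \<Rightarrow> real) \<Rightarrow> (real^'n \<Rightarrow> complex) \<Rightarrow> 'n cfun \<Rightarrow> bool" where
  "harmonic \<Omega> a b c c0 u \<longleftrightarrow> u \<in> H1_loc \<Omega> \<and> ell_op \<Omega> a b c c0 u = (\<lambda>_. 0)"

text \<open>
  The defining properties of the Perron solution operator \<open>T : C(\<Gamma>) \<rightarrow> C\<^sub>b(\<Omega>)\<close>, where \<open>\<Gamma>\<close> is the
  frontier of \<open>\<Omega>\<close>. Linearity and the norm estimate imply that the values of \<open>T \<phi>\<close> on \<open>\<Omega>\<close> depend only on
  the restriction of \<open>\<phi>\<close> to \<open>\<Gamma>\<close>; in particular \<open>T \<Phi>\<close> below is \<open>T\<close> applied to that restriction.
\<close>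

definition perron_operator ::
  "(real^'n::finite) set \<Rightarrow> ('n \<Rightarrow> 'n \<Rightarrow> real^'n \<Rightarrow> real) \<Rightarrow> ('n \<Rightarrow> real^'n \<Rightarrow> complex) \<Rightarrow>
   ('n \<Rightarrow> real^'n \<Rightarrow> real) \<Rightarrow> (real^'n \<Rightarrow> complex) \<Rightarrow> ('n cfun \<Rightarrow> 'n cfun) \<Rightarrow> bool" where
  "perron_operator \<Omega> a b c c0 T \<longleftrightarrow>
     (\<forall>\<phi>. continuous_on (frontier \<Omega>) \<phi> \<longrightarrow>
        continuous_on \<Omega> (T \<phi>) \<and> bounded (T \<phi> ` \<Omega>) \<and> harmonic \<Omega> a b c c0 (T \<phi>)) \<and>
     (\<forall>\<phi> \<psi>. continuous_on (frontier \<Omega>) \<phi> \<and> continuous_on (frontier \<Omega>) \<psi> \<longrightarrow>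
        (\<forall>\<alpha> \<beta>. \<forall>x\<in>\<Omega>. T (\<lambda>y. \<alpha> * \<phi> y + \<beta> * \<psi> y) x = \<alpha> * T \<phi> x + \<beta> * T \<psi> x)) \<and>
     (\<exists>C. \<forall>\<phi>. continuous_on (frontier \<Omega>) \<phi> \<longrightarrow>
        (\<forall>x\<in>\<Omega>. cmod (T \<phi> x) \<le> C * (SUP y\<in>frontier \<Omega>. cmod (\<phi> y)))) \<and>
     (\<forall>\<Phi>. continuous_on (closure \<Omega>) \<Phi> \<and> \<Phi> \<in> H1 \<Omega> \<longrightarrow> (\<lambda>x. \<Phi> x - T \<Phi> x) \<in> H1_0 \<Omega>)"

end

theory Submission
  imports Defs
begin

text \<open>
  Let \<open>A\<^sub>1\<close> have the same leading coefficients and first-order coefficients \<open>c k\<close> as the given operator, but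
  \<open>b = 0\<close> and a large constant zero-order coefficient. Its form is coercive, and because the \<open>a k l\<close> are real,
  testing with \<open>g h(|g|\<^sup>2)\<close> for increasing \<open>h\<close> yields a maximum principle. The original form is coercive up to a
  form of finite rank, so by injectivity it is invertible on \<open>H\<^sup>1\<^sub>0\<close> with bounded inverse.

  Extension: \<open>\<phi>\<close> is, on the boundary, a uniformly convergent geometric series of polynomials. Subtracting a test
  function from each term makes its image under \<open>A\<^sub>1\<close> small in the antidual while the supremum norm grows only by a
  constant factor; a Caccioppoli estimate then gives convergence of the series in \<open>H\<^sup>1\<^sub>l\<^sub>o\<^sub>c\<close>.

  Identification of \<open>T \<phi>\<close>: for a polynomial \<open>Q\<close> within \<open>\<epsilon>\<close> of \<open>\<Phi>\<close>, the function \<open>Q - T Q\<close> is the solution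
  belonging to \<open>Q\<close>. For \<open>\<Psi> = \<Phi> - Q\<close> with solution \<open>z\<close>, the maximum principle for \<open>A\<^sub>1\<close>, applied to mollifications
  of \<open>\<Psi>\<close>, and invertibility of the full operator on the lower-order remainder give
  \<open>\<parallel>\<Psi> - z\<parallel> \<le> C \<epsilon>\<close> in \<open>L\<^sup>2\<close>; now let \<open>\<epsilon>\<close> tend to \<open>0\<close>.
\<close>

subsection \<open>Smooth functions\<close>

text \<open>The obstacle is that uniform approximation says nothing about energy. Polynomials
  converging uniformly to \<open>\<phi>\<close> may have unbounded gradients, so they need not stay
  bounded in \<open>H\<^sup>1\<close>, nor their images in the antidual; this is why the extension
  has only a local gradient, and why \<open>T \<phi>\<close> cannot be identified by continuity of
  the solution map. Each limit rests instead on a bound by the supremum norm alone. The terms with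
  \<open>b\<close> are dropped because they spoil such a bound: where the truncation sets in, the
  derivative of \<open>h\<close> is not controlled by \<open>h\<close>, and there these terms have
  no sign. What is dropped involves only the undifferentiated function, so it is restored at the
  cost of an \<open>L\<^sup>2\<close> norm. Nonlinear tests are applied to smooth functions only,
  where the chain rule is elementary; members of \<open>H\<^sup>1\<^sub>0\<close> are approximated
  beforehand. Gradients are carried along as data, since the representative chosen by
  \<open>weak_partial\<close> is fixed only almost everywhere, and averages over finitely many balls
  replace the compact embedding.\<close>

text \<open>The family is closed under differentiation: \<open>t \<mapsto> p(1/t) exp (-1/t)\<close> has the derivative
  \<open>t \<mapsto> (p(1/t) - p'(1/t)) exp (-1/t) / t\<^sup>2\<close>.\<close>

definition expinv :: "real poly \<Rightarrow> real \<Rightarrow> real" where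
  "expinv p t = (if t > 0 then poly p (1 / t) * exp (- (1 / t)) else 0)"

definition expinv_deriv :: "real poly \<Rightarrow> real poly" where
  "expinv_deriv p = monom 1 2 * (p - pderiv p)"

lemma poly_times_exp_minus_tendsto_0: "((\<lambda>s::real. poly p s * exp (- s)) \<longlongrightarrow> 0) at_top"
proof -
  have "((\<lambda>s::real. \<Sum>i\<le>degree p. coeff p i * (s ^ i / exp s)) \<longlongrightarrow> (\<Sum>i\<le>degree p. coeff p i * 0)) at_top"
    by (intro tendsto_intros tendsto_power_div_exp_0)
  then show ?thesis
    by (simp add: poly_altdef exp_minus sum_distrib_right divide_inverse mult.assoc)
qed

lemma expinv_at_right_0: "((\<lambda>t. expinv p t) \<longlongrightarrow> 0) (at_right 0)"
proof -
  have "((\<lambda>t. poly p (inverse t) * exp (- inverse t)) \<longlongrightarrow> 0) (at_right 0)"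
    by (rule filterlim_compose[OF poly_times_exp_minus_tendsto_0 filterlim_inverse_at_top_right])
  moreover have "\<forall>\<^sub>F t in at_right 0. poly p (inverse t) * exp (- inverse t) = expinv p t"
    by (auto simp: eventually_at_right_field expinv_def inverse_eq_divide intro!: exI[of _ 1])
  ultimately show ?thesis by (rule Lim_transform_eventually)
qed

lemma DERIV_expinv: "(expinv p has_real_derivative expinv (expinv_deriv p) t) (at t)"
proof -
  consider "t < 0" | "t > 0" | "t = 0" by linarith
  then show ?thesis
  proof cases
    case 1
    have "((\<lambda>_. 0) has_real_derivative expinv (expinv_deriv p) t) (at t)"
      using 1 by (simp add: expinv_def)
    then show ?thesis
      by (rule DERIV_cong_ev[THEN iffD1, rotated -1])
        (use 1 in \<open>auto simp: expinv_def eventually_nhds intro!: exI[of _ "{..<0}"]\<close>)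
  next
    case 2
    have "((\<lambda>t. poly p (1 / t) * exp (- (1 / t))) has_real_derivative expinv (expinv_deriv p) t) (at t)"
      unfolding expinv_def expinv_deriv_def using 2
      by (auto intro!: derivative_eq_intros poly_DERIV[THEN DERIV_chain2]
        simp: poly_monom field_simps power2_eq_square)
    then show ?thesis
      by (rule DERIV_cong_ev[THEN iffD1, rotated -1])
        (use 2 in \<open>auto simp: expinv_def eventually_nhds intro!: exI[of _ "{0<..}"]\<close>)
  next
    case 3
    have "((\<lambda>h. (expinv p (0 + h) - expinv p 0) / h) \<longlongrightarrow> 0) (at_right 0)"
    \<comment> \<open>Dividing by the increment multiplies the polynomial by its variable, so the
      difference quotient at 0 is itself a member of the family and tends to 0.\<close>
    proof (rule Lim_transform_eventually[OF expinv_at_right_0[of "monom 1 1 * p"]])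
      show "\<forall>\<^sub>F x in at_right 0. expinv (monom 1 1 * p) x = (expinv p (0 + x) - expinv p 0) / x"
        by (auto simp: eventually_at_right_field expinv_def poly_monom intro!: exI[of _ 1])
    qed
    moreover have "((\<lambda>h. (expinv p (0 + h) - expinv p 0) / h) \<longlongrightarrow> 0) (at_left 0)"
      by (rule tendsto_eventually)
        (auto simp: eventually_at_left_field expinv_def intro!: exI[of _ "-1"])
    ultimately have "((\<lambda>h. (expinv p (0 + h) - expinv p 0) / h) \<longlongrightarrow> 0) (at 0)"
      by (simp add: filterlim_split_at_real)
    then show ?thesis
      using 3 by (simp add: DERIV_def expinv_def)
  qed
qed

section \<open>Calculus of partial derivatives\<close>

lemma has_derivative_partial:
  assumes "(f has_derivative f') (at x)"
  shows "partial k f x = f' (axis k 1)"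
  using frechet_derivative_at[OF assms] by (simp add: partial_def)

lemma smoothD: "smooth f \<Longrightarrow> f differentiable (at x)"
  unfolding smooth_def partials_def by (metis foldr.simps(1) id_apply)

lemma partials_append: "partials (ks @ ls) f = partials ks (partials ls f)"
  by (simp add: partials_def)

lemma partials_Cons: "partials (k # ks) f = partial k (partials ks f)"
  by (simp add: partials_def)

lemma partials_Nil[simp]: "partials [] f = f"
  by (simp add: partials_def)

lemma partials_singleton[simp]: "partials [k] f = partial k f"
  by (simp add: partials_def)

lemma smooth_partial: "smooth f \<Longrightarrow> smooth (partial k f)"
  unfolding smooth_def by (metis partials_append partials_singleton)

text \<open>An invariant that implies differentiability and survives \<open>partial\<close> holds
  for all iterated partial derivatives; this spares formulas for derivatives of higher
  order.\<close>

lemma smooth_coinduct: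
  assumes "P f" and "\<And>f x. P f \<Longrightarrow> f differentiable (at x)" and "\<And>f k. P f \<Longrightarrow> P (partial k f)"
  shows "smooth f"
proof -
  have "P (partials ks f)" for ks
    by (induction ks) (auto simp: partials_Cons assms)
  then show ?thesis using assms(2) by (auto simp: smooth_def)
qed

text \<open>Derivatives of products, conjugates and compositions with \<open>expinv\<close> are
  combinations of functions of the same kind, so a class generated by these operations is closed
  under \<open>partial\<close> and can serve as the invariant. The real part needed in the
  derivative of \<open>expinv\<close> is available as half of the sum with the conjugate.\<close>

inductive smooth_gen :: "'n::finite cfun \<Rightarrow> bool" where
  base: "smooth f \<Longrightarrow> smooth_gen f"
| zero: "smooth_gen (\<lambda>_. 0)"
| const: "smooth_gen (\<lambda>_. c)"
| coord: "smooth_gen (\<lambda>x. of_real (x $ k))"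
| add: "smooth_gen f \<Longrightarrow> smooth_gen g \<Longrightarrow> smooth_gen (\<lambda>x. f x + g x)"
| mult: "smooth_gen f \<Longrightarrow> smooth_gen g \<Longrightarrow> smooth_gen (\<lambda>x. f x * g x)"
| cnj: "smooth_gen f \<Longrightarrow> smooth_gen (\<lambda>x. cnj (f x))"
| expinv: "smooth_gen f \<Longrightarrow> smooth_gen (\<lambda>x. of_real (expinv p (Re (f x))))"

lemma differentiable_frechet: "f differentiable (at x) \<Longrightarrow> (f has_derivative frechet_derivative f (at x)) (at x)"
  by (simp add: frechet_derivative_works)

lemma has_derivative_expinv_Re:
  assumes "(f has_derivative f') (at x)"
  shows "((\<lambda>x. of_real (expinv p (Re (f x))) :: complex) has_derivative
    (\<lambda>h. of_real (expinv (expinv_deriv p) (Re (f x)) * Re (f' h)))) (at x)"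
proof -
  have "((\<lambda>x. expinv p (Re (f x))) has_derivative (\<lambda>h. Re (f' h) * expinv (expinv_deriv p) (Re (f x)))) (at x)"
    using has_derivative_compose[OF has_derivative_Re[OF assms] DERIV_expinv[unfolded has_field_derivative_def]]
    by (simp add: mult.commute)
  from has_derivative_of_real[OF this, where 'a=complex] show ?thesis by (simp add: mult.commute)
qed

lemma partial_const[simp]: "partial k (\<lambda>_. c) = (\<lambda>_. 0)"
  by (auto simp: fun_eq_iff has_derivative_partial[OF has_derivative_const])

lemma partial_coord: "partial j (\<lambda>x. of_real (x $ k)) = (\<lambda>_. if j = k then 1 else 0)"
  by (auto simp: fun_eq_iff axis_def has_derivative_partial[OF has_derivative_of_real[OF
        bounded_linear_imp_has_derivative[OF bounded_linear_vec_nth]]])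

lemma partial_add:
  "f differentiable (at x) \<Longrightarrow> g differentiable (at x) \<Longrightarrow>
    partial k (\<lambda>x. f x + g x) x = partial k f x + partial k g x"
  using has_derivative_partial[OF has_derivative_add[OF differentiable_frechet differentiable_frechet]]
  by (simp add: partial_def)

lemma partial_diff:
  "f differentiable (at x) \<Longrightarrow> g differentiable (at x) \<Longrightarrow>
    partial k (\<lambda>x. f x - g x) x = partial k f x - partial k g x"
  using has_derivative_partial[OF has_derivative_diff[OF differentiable_frechet differentiable_frechet]]
  by (simp add: partial_def)

lemma partial_mult:
  "f differentiable (at x) \<Longrightarrow> g differentiable (at x) \<Longrightarrow>
    partial k (\<lambda>x. f x * g x) x = f x * partial k g x + partial k f x * g x"
  using has_derivative_partial[OF has_derivative_mult[OF differentiable_frechet differentiable_frechet]]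
  by (simp add: partial_def)

lemma partial_cnj:
  "f differentiable (at x) \<Longrightarrow> partial k (\<lambda>x. cnj (f x)) x = cnj (partial k f x)"
  using has_derivative_partial[OF has_derivative_cnj[OF differentiable_frechet]]
  by (simp add: partial_def)

lemma partial_expinv:
  "f differentiable (at x) \<Longrightarrow> partial k (\<lambda>x. of_real (expinv p (Re (f x)))) x =
    of_real (expinv (expinv_deriv p) (Re (f x))) * of_real (Re (partial k f x))"
  using has_derivative_partial[OF has_derivative_expinv_Re[OF differentiable_frechet]]
  by (simp add: partial_def)

lemma smooth_gen_differentiable: "smooth_gen f \<Longrightarrow> f differentiable (at x)"
proof (induction rule: smooth_gen.induct)
  case (coord k)
  show ?case
    using has_derivative_of_real[OF bounded_linear_imp_has_derivative[OF bounded_linear_vec_nth]]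
    by (rule differentiableI)
next
  case (cnj f)
  then show ?case using has_derivative_cnj differentiable_def by blast
next
  case (expinv f p)
  then show ?case using has_derivative_expinv_Re differentiable_def by blast
qed (auto simp: smoothD)

lemma smooth_gen_Re: "smooth_gen f \<Longrightarrow> smooth_gen (\<lambda>x. of_real (Re (f x)))"
proof -
  assume "smooth_gen f"
  then have "smooth_gen (\<lambda>x. (1/2) * (f x + cnj (f x)))"
    by (intro smooth_gen.mult smooth_gen.const smooth_gen.add smooth_gen.cnj)
  moreover have "(\<lambda>x. (1/2) * (f x + cnj (f x))) = (\<lambda>x. of_real (Re (f x)))"
    by (auto simp: fun_eq_iff complex_add_cnj)
  ultimately show ?thesis by simp
qed

lemma smooth_gen_partial: "smooth_gen f \<Longrightarrow> smooth_gen (partial k f)"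
proof (induction rule: smooth_gen.induct)
  case (base f)
  then show ?case by (simp add: smooth_gen.base smooth_partial)
next
  case (coord k')
  show ?case by (simp add: partial_coord smooth_gen.const)
next
  case (add f g)
  then have "partial k (\<lambda>x. f x + g x) = (\<lambda>x. partial k f x + partial k g x)"
    by (auto simp: fun_eq_iff smooth_gen_differentiable partial_add)
  with add show ?case by (simp add: smooth_gen.add)
next
  case (mult f g)
  then have "partial k (\<lambda>x. f x * g x) = (\<lambda>x. f x * partial k g x + partial k f x * g x)"
    by (auto simp: fun_eq_iff smooth_gen_differentiable partial_mult)
  with mult show ?case by (simp add: smooth_gen.add smooth_gen.mult)
next
  case (cnj f)
  then have "partial k (\<lambda>x. cnj (f x)) = (\<lambda>x. cnj (partial k f x))"
    by (auto simp: fun_eq_iff smooth_gen_differentiable partial_cnj)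
  with cnj show ?case by (simp add: smooth_gen.cnj)
next
  case (expinv f p)
  then have "partial k (\<lambda>x. of_real (expinv p (Re (f x)))) =
    (\<lambda>x. of_real (expinv (expinv_deriv p) (Re (f x))) * of_real (Re (partial k f x)))"
    by (auto simp: fun_eq_iff smooth_gen_differentiable partial_expinv)
  with expinv show ?case
    using smooth_gen.mult[OF smooth_gen.expinv smooth_gen_Re] by simp
qed (auto intro: smooth_gen.intros)

lemma smooth_gen_imp_smooth: "smooth_gen f \<Longrightarrow> smooth f"
  by (rule smooth_coinduct[where P=smooth_gen]) (auto simp: smooth_gen_differentiable smooth_gen_partial)

lemma smooth_const[simp]: "smooth (\<lambda>_. c)"
  and smooth_coord: "smooth (\<lambda>x. of_real (x $ k))"
  and smooth_add: "smooth f \<Longrightarrow> smooth g \<Longrightarrow> smooth (\<lambda>x. f x + g x)"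
  and smooth_mult: "smooth f \<Longrightarrow> smooth g \<Longrightarrow> smooth (\<lambda>x. f x * g x)"
  and smooth_cnj: "smooth f \<Longrightarrow> smooth (\<lambda>x. cnj (f x))"
  and smooth_expinv: "smooth f \<Longrightarrow> smooth (\<lambda>x. of_real (expinv p (Re (f x))))"
  by (auto intro!: smooth_gen_imp_smooth intro: smooth_gen.intros)

lemma smooth_diff: "smooth f \<Longrightarrow> smooth g \<Longrightarrow> smooth (\<lambda>x. f x - g x)"
  using smooth_add[OF _ smooth_mult[OF smooth_const[of "-1"]]] by force

lemma smooth_sum: "(\<And>i. i \<in> I \<Longrightarrow> smooth (f i)) \<Longrightarrow> smooth (\<lambda>x. \<Sum>i\<in>I. f i x)"
  by (induction I rule: infinite_finite_induct) (auto simp: smooth_add)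

lemma smooth_prod: "(\<And>i. i \<in> I \<Longrightarrow> smooth (f i)) \<Longrightarrow> smooth (\<lambda>x. \<Prod>i\<in>I. f i x)"
  by (induction I rule: infinite_finite_induct) (auto simp: smooth_mult)

lemma smooth_continuous: "smooth f \<Longrightarrow> continuous_on S f"
  by (meson continuous_at_imp_continuous_on differentiable_imp_continuous_within smoothD)

lemma smooth_borel: "smooth f \<Longrightarrow> f \<in> borel_measurable borel"
  by (simp add: borel_measurable_continuous_onI smooth_continuous)

lemma frechet_eq_sum_partial:
  fixes f :: "'n::finite cfun"
  assumes "f differentiable (at x)"
  shows "frechet_derivative f (at x) h = (\<Sum>k\<in>UNIV. of_real (h $ k) * partial k f x)"
proof -
  have lin: "linear (frechet_derivative f (at x))"
    using assms by (simp add: linear_frechet_derivative)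
  have "h = (\<Sum>k\<in>UNIV. (h $ k) *\<^sub>R axis k 1)"
    by (simp add: vec_eq_iff axis_def if_distrib[of "\<lambda>x. _ * x"] cong: if_cong)
  then have "frechet_derivative f (at x) h = frechet_derivative f (at x) (\<Sum>k\<in>UNIV. (h $ k) *\<^sub>R axis k 1)"
    by simp
  also have "\<dots> = (\<Sum>k\<in>UNIV. (h $ k) *\<^sub>R partial k f x)"
    by (simp add: linear_sum[OF lin] linear_cmul[OF lin] partial_def)
  finally show ?thesis by (simp add: scaleR_conv_of_real)
qed

lemma has_derivative_sum_partial:
  fixes f :: "'n::finite cfun"
  assumes "f differentiable (at x)"
  shows "(f has_derivative (\<lambda>h. \<Sum>k\<in>UNIV. of_real (h $ k) * partial k f x)) (at x)"
proof -
  have "frechet_derivative f (at x) = (\<lambda>h. \<Sum>k\<in>UNIV. of_real (h $ k) * partial k f x)"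
    by (rule ext) (rule frechet_eq_sum_partial[OF assms])
  then show ?thesis using differentiable_frechet[OF assms] by simp
qed

subsection \<open>Test functions\<close>

lemma not_in_supp: "x \<notin> supp f \<Longrightarrow> f x = 0"
  using closure_subset[of "{x. f x \<noteq> 0}"] by (auto simp: supp_def)

lemma supp_subset: "closed K \<Longrightarrow> (\<And>x. x \<notin> K \<Longrightarrow> f x = 0) \<Longrightarrow> supp f \<subseteq> K"
  unfolding supp_def by (rule closure_minimal) auto

lemma closed_supp[simp]: "closed (supp f)"
  by (simp add: supp_def)

lemma test_functionI:
  assumes "smooth v" "compact K" "K \<subseteq> \<Omega>" "\<And>x. x \<notin> K \<Longrightarrow> v x = 0"
  shows "v \<in> test_functions \<Omega>"
proof -
  have "supp v \<subseteq> K" using assms supp_subset compact_imp_closed by blast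
  then show ?thesis
    using assms compact_Int_closed[OF \<open>compact K\<close> closed_supp[of v]]
    by (auto simp: test_functions_def Int_absorb1)
qed

lemma test_smooth: "v \<in> test_functions \<Omega> \<Longrightarrow> smooth v"
  and test_compact: "v \<in> test_functions \<Omega> \<Longrightarrow> compact (supp v)"
  and test_supp: "v \<in> test_functions \<Omega> \<Longrightarrow> supp v \<subseteq> \<Omega>"
  by (auto simp: test_functions_def)

lemma test_outside: "v \<in> test_functions \<Omega> \<Longrightarrow> x \<notin> \<Omega> \<Longrightarrow> v x = 0"
  using test_supp not_in_supp by blast

lemma test_mono: "v \<in> test_functions \<Omega> \<Longrightarrow> supp v \<subseteq> \<Omega>' \<Longrightarrow> v \<in> test_functions \<Omega>'"
  by (auto simp: test_functions_def)

lemma test_zero[simp]: "(\<lambda>_. 0) \<in> test_functions \<Omega>"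
  by (rule test_functionI[of _ "{}"]) auto

lemma test_add: "v \<in> test_functions \<Omega> \<Longrightarrow> w \<in> test_functions \<Omega> \<Longrightarrow> (\<lambda>x. v x + w x) \<in> test_functions \<Omega>"
  by (rule test_functionI[of _ "supp v \<union> supp w"])
    (auto simp: test_functions_def not_in_supp smooth_add)

lemma test_mult_smooth: "smooth f \<Longrightarrow> v \<in> test_functions \<Omega> \<Longrightarrow> (\<lambda>x. f x * v x) \<in> test_functions \<Omega>"
  by (rule test_functionI[of _ "supp v"]) (auto simp: test_functions_def not_in_supp smooth_mult)

lemma test_cmult: "v \<in> test_functions \<Omega> \<Longrightarrow> (\<lambda>x. c * v x) \<in> test_functions \<Omega>"
  by (rule test_mult_smooth) auto

lemma test_comb:
  "v \<in> test_functions \<Omega> \<Longrightarrow> w \<in> test_functions \<Omega> \<Longrightarrow> (\<lambda>x. \<alpha> * v x + \<beta> * w x) \<in> test_functions \<Omega>"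
  by (intro test_add test_cmult)

lemma test_cnj: "v \<in> test_functions \<Omega> \<Longrightarrow> (\<lambda>x. cnj (v x)) \<in> test_functions \<Omega>"
  by (rule test_functionI[of _ "supp v"]) (auto simp: test_functions_def not_in_supp smooth_cnj)

lemma partial_eq_0_outside_supp: "x \<notin> supp f \<Longrightarrow> partial k f x = 0"
proof -
  assume "x \<notin> supp f"
  have "(f has_derivative (\<lambda>_. 0)) (at x)"
  proof (rule has_derivative_transform_within_open)
    show "((\<lambda>_. 0) has_derivative (\<lambda>_. 0)) (at x)" by simp
    show "open (- supp f)" by (simp add: open_Compl)
  qed (use \<open>x \<notin> supp f\<close> in \<open>auto simp: not_in_supp\<close>)
  then show ?thesis by (simp add: has_derivative_partial)
qed

lemma test_partial: "v \<in> test_functions \<Omega> \<Longrightarrow> partial k v \<in> test_functions \<Omega>"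
  by (rule test_functionI[of _ "supp v"])
    (auto simp: test_functions_def partial_eq_0_outside_supp smooth_partial)

lemma test_partials: "v \<in> test_functions \<Omega> \<Longrightarrow> partials ks v \<in> test_functions \<Omega>"
  by (induction ks) (auto simp: partials_Cons test_partial)

lemma test_bounded:
  assumes "v \<in> test_functions \<Omega>"
  obtains B where "B > 0" "\<And>x. cmod (v x) \<le> B"
proof -
  have "bounded (v ` supp v)"
    using assms by (intro compact_imp_bounded compact_continuous_image smooth_continuous)
      (auto simp: test_functions_def)
  then obtain B where B: "B > 0" "\<And>x. x \<in> supp v \<Longrightarrow> cmod (v x) \<le> B"
    by (auto simp: bounded_pos)
  show thesis
    by (rule that[OF B(1)]) (metis B not_in_supp norm_zero less_imp_le)
qed

lemma smooth_bounded_on: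
  assumes "smooth f" "bounded S"
  obtains B where "B > 0" "\<And>x. x \<in> S \<Longrightarrow> cmod (f x) \<le> B"
proof -
  have "bounded (f ` closure S)"
    using assms by (intro compact_imp_bounded compact_continuous_image smooth_continuous)
      (auto simp: compact_closure)
  then obtain B where B: "B > 0" "\<And>x. x \<in> closure S \<Longrightarrow> cmod (f x) \<le> B"
    by (auto simp: bounded_pos)
  show thesis by (rule that[OF B(1)]) (use B(2) closure_subset in blast)
qed

section \<open>Integration over Lebesgue measurable subsets\<close>

lemma id_measurable_lebesgue_on: "(\<lambda>x. x) \<in> borel_measurable (lebesgue_on S)"
  by (intro measurable_restrict_space1 measurable_completion) simp

lemma sigma_finite_lebesgue: "sigma_finite_measure (lebesgue :: 'a::euclidean_space measure)"
proof
  show "\<exists>A::'a set set. countable A \<and> A \<subseteq> sets lebesgue \<and> \<Union>A = space lebesgue \<and> (\<forall>a\<in>A. emeasure lebesgue a \<noteq> \<infinity>)"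
  proof (intro exI[of _ "range (\<lambda>n. ball 0 (real n))"] conjI ballI)
    show "\<Union>(range (\<lambda>n. ball (0::'a) (real n))) = space lebesgue"
      using reals_Archimedean2 by auto
    show "emeasure lebesgue a \<noteq> \<infinity>" if "a \<in> range (\<lambda>n. ball (0::'a) (real n))" for a
      using that emeasure_bounded_finite[of a] by auto
  qed auto
qed

lemma smooth_measurable_lebesgue: "smooth f \<Longrightarrow> f \<in> borel_measurable (lebesgue_on S)"
  by (intro measurable_restrict_space1 measurable_completion) (simp add: smooth_borel)

text \<open>Serves to move integrals between \<open>\<Omega>\<close> and a compact set carrying the
  support of a test function; this is how functions that are only locally integrable are paired with
  test functions.\<close>

lemma
  fixes f :: "_ \<Rightarrow> 'b::{banach, second_countable_topology}"
  assumes "S \<subseteq> T" "S \<in> sets lebesgue" "T \<in> sets lebesgue" "\<And>x. x \<in> T - S \<Longrightarrow> f x = 0"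
  shows integral_lebesgue_on_mono_set: "integral\<^sup>L (lebesgue_on T) f = integral\<^sup>L (lebesgue_on S) f"
    and integrable_lebesgue_on_mono_set: "integrable (lebesgue_on T) f \<longleftrightarrow> integrable (lebesgue_on S) f"
proof -
  have "(\<lambda>x. indicator T x *\<^sub>R f x) = (\<lambda>x. indicator S x *\<^sub>R f x)"
    using assms by (auto simp: indicator_def fun_eq_iff)
  then show "integral\<^sup>L (lebesgue_on T) f = integral\<^sup>L (lebesgue_on S) f"
    "integrable (lebesgue_on T) f \<longleftrightarrow> integrable (lebesgue_on S) f"
    using assms by (simp_all add: integral_restrict_space integrable_restrict_space)
qed

lemma finite_measure_lebesgue_on: "S \<in> sets lebesgue \<Longrightarrow> bounded S \<Longrightarrow> finite_measure (lebesgue_on S)"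
proof
  assume S: "S \<in> sets lebesgue" "bounded S"
  then have "S \<in> lmeasurable" by (simp add: bounded_set_imp_lmeasurable)
  then show "emeasure (lebesgue_on S) (space (lebesgue_on S)) \<noteq> \<infinity>"
    using S by (simp add: emeasure_restrict_space fmeasurable_def less_top[symmetric])
qed

lemma integrable_bounded_lebesgue_on:
  fixes f :: "_ \<Rightarrow> 'b::{banach, second_countable_topology}"
  assumes "S \<in> sets lebesgue" "bounded S" "f \<in> borel_measurable (lebesgue_on S)"
    "\<And>x. x \<in> S \<Longrightarrow> norm (f x) \<le> B"
  shows "integrable (lebesgue_on S) f"
proof -
  interpret finite_measure "lebesgue_on S" by (rule finite_measure_lebesgue_on) fact+
  show ?thesis using assms(3,4) by (auto intro!: integrable_const_bound[of _ B])
qed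

lemma test_integrable: "\<Omega> \<in> sets lebesgue \<Longrightarrow> v \<in> test_functions \<Omega> \<Longrightarrow> integrable (lebesgue_on \<Omega>) v"
proof -
  assume "\<Omega> \<in> sets lebesgue" and v: "v \<in> test_functions \<Omega>"
  obtain B where "\<And>x. cmod (v x) \<le> B" using test_bounded v by metis
  then have "integrable (lebesgue_on (supp v)) v"
    using v by (intro integrable_bounded_lebesgue_on)
      (auto simp: test_functions_def compact_imp_bounded lmeasurable_compact fmeasurableD smooth_measurable_lebesgue)
  then show ?thesis
    using integrable_lebesgue_on_mono_set[of "supp v" \<Omega> v] v \<open>\<Omega> \<in> _\<close>
    by (auto simp: test_functions_def not_in_supp lmeasurable_compact fmeasurableD)
qed

lemma L1_loc_mult_test:
  assumes "\<Omega> \<in> sets lebesgue" "g \<in> L1_loc \<Omega>" and v: "v \<in> test_functions \<Omega>"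
  shows "integrable (lebesgue_on \<Omega>) (\<lambda>x. g x * v x)"
proof -
  obtain B where B: "\<And>x. cmod (v x) \<le> B" using test_bounded v by metis
  have g: "integrable (lebesgue_on (supp v)) g"
    using assms by (auto simp: L1_loc_def test_functions_def)
  have "integrable (lebesgue_on (supp v)) (\<lambda>x. g x * v x)"
  proof (rule Bochner_Integration.integrable_bound)
    show "integrable (lebesgue_on (supp v)) (\<lambda>x. B * cmod (g x))" using g by simp
    have [measurable]: "g \<in> borel_measurable (lebesgue_on (supp v))" using g by auto
    have [measurable]: "v \<in> borel_measurable (lebesgue_on (supp v))"
      using v by (simp add: test_smooth smooth_measurable_lebesgue)
    show "(\<lambda>x. g x * v x) \<in> borel_measurable (lebesgue_on (supp v))" by measurable
    show "AE x in lebesgue_on (supp v). norm (g x * v x) \<le> norm (B * cmod (g x))"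
    proof (rule AE_I2)
      fix x
      have "cmod (g x) * cmod (v x) \<le> cmod (g x) * B" using B by (rule mult_left_mono) simp
      then show "norm (g x * v x) \<le> norm (B * cmod (g x))"
        using abs_ge_self[of "B * cmod (g x)"] by (simp add: norm_mult mult.commute)
    qed
  qed
  then show ?thesis
    using integrable_lebesgue_on_mono_set[of "supp v" \<Omega> "\<lambda>x. g x * v x"] assms
    by (auto simp: test_functions_def not_in_supp lmeasurable_compact fmeasurableD)
qed

subsection \<open>The fundamental lemma of the calculus of variations\<close>

text \<open>The classical flat function: \<open>exp (- (1 / t))\<close> for positive
  \<open>t\<close>, otherwise 0. It rises to 1 at infinity, so rescaling its argument approximates
  the indicator of the positive half-line.\<close>

definition bump1 :: "real \<Rightarrow> real" where "bump1 = expinv 1"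

lemma bump1_nonneg: "bump1 t \<ge> 0"
  and bump1_le_1: "bump1 t \<le> 1"
  and bump1_pos_iff: "bump1 t > 0 \<longleftrightarrow> t > 0"
  and bump1_eq_0_iff: "bump1 t = 0 \<longleftrightarrow> t \<le> 0"
  by (auto simp: bump1_def expinv_def)

lemma bump1_tendsto_1: "t > 0 \<Longrightarrow> (\<lambda>n. bump1 (real n * t)) \<longlonglongrightarrow> 1"
proof -
  assume t: "t > 0"
  have "(\<lambda>n. exp (- (inverse t * inverse (real n)))) \<longlonglongrightarrow> exp (- (inverse t * 0))"
    by (intro tendsto_intros lim_inverse_n)
  moreover have "\<forall>\<^sub>F n in sequentially. exp (- (inverse t * inverse (real n))) = bump1 (real n * t)"
    using eventually_gt_at_top[of 0]
    by eventually_elim (use t in \<open>auto simp: bump1_def expinv_def field_simps\<close>)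
  ultimately show ?thesis using Lim_transform_eventually by fastforce
qed

text \<open>A product of one-dimensional flat functions, one for each face of the box. For positive
  \<open>s\<close> it is positive exactly inside the box, and increasing \<open>s\<close> drives it
  to the indicator.\<close>

definition box_bump :: "real^'n::finite \<Rightarrow> real^'n \<Rightarrow> real \<Rightarrow> 'n cfun" where
  "box_bump a b s x = (\<Prod>k\<in>UNIV. of_real (bump1 (s * (x $ k - a $ k))) * of_real (bump1 (s * (b $ k - x $ k))))"

lemma smooth_bump1_Re: "smooth f \<Longrightarrow> smooth (\<lambda>x. of_real (bump1 (Re (f x))))"
  unfolding bump1_def by (rule smooth_expinv)

lemma smooth_box_bump: "smooth (box_bump a b s)"
proof -
  have 1: "smooth (\<lambda>x. of_real (bump1 (Re (of_real s * (of_real (x $ k) - of_real (a $ k))))))" for a :: "real^'n" and k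
    by (intro smooth_bump1_Re smooth_mult smooth_diff smooth_const smooth_coord)
  have 2: "smooth (\<lambda>x. of_real (bump1 (Re (of_real s * (of_real (b $ k) - of_real (x $ k))))))" for b :: "real^'n" and k
    by (intro smooth_bump1_Re smooth_mult smooth_diff smooth_const smooth_coord)
  show ?thesis
    unfolding box_bump_def using smooth_prod[OF smooth_mult[OF 1 2]] by simp
qed

lemma box_bump_outside: "s > 0 \<Longrightarrow> x \<notin> box a b \<Longrightarrow> box_bump a b s x = 0"
  by (auto simp: box_bump_def mem_box_cart bump1_eq_0_iff not_less mult_le_0_iff zero_le_mult_iff split_mult_pos_le)

lemma box_bump_nonneg: "\<exists>r\<ge>0. box_bump a b s x = of_real r \<and> r \<le> 1 \<and> (s > 0 \<and> x \<in> box a b \<longrightarrow> r > 0)"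
proof -
  let ?r = "\<Prod>k\<in>UNIV. bump1 (s * (x $ k - a $ k)) * bump1 (s * (b $ k - x $ k))"
  have "box_bump a b s x = of_real ?r" by (simp add: box_bump_def)
  moreover have "?r \<ge> 0" by (intro prod_nonneg) (simp add: bump1_nonneg)
  moreover have "?r \<le> 1"
    by (intro prod_le_1) (simp add: bump1_nonneg bump1_le_1 mult_le_one)
  moreover have "s > 0 \<and> x \<in> box a b \<longrightarrow> ?r > 0"
    by (auto simp: mem_box_cart bump1_pos_iff intro!: prod_pos)
  ultimately show ?thesis by blast
qed

lemma norm_box_bump_le: "cmod (box_bump a b s x) \<le> 1"
  using box_bump_nonneg[of a b s x] by (auto)

lemma box_bump_tendsto: "(\<lambda>n. box_bump a b (real n) x) \<longlonglongrightarrow> indicator (box a b) x"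
proof (cases "x \<in> box a b")
  case True
  then have "(\<lambda>n. box_bump a b (real n) x) \<longlonglongrightarrow> (\<Prod>k\<in>(UNIV::'a set). of_real 1 * of_real 1)"
    unfolding box_bump_def
    by (intro tendsto_intros bump1_tendsto_1) (auto simp: mem_box_cart)
  then show ?thesis using True by simp
next
  case False
  have "\<forall>\<^sub>F n in sequentially. box_bump a b (real n) x = 0"
    using eventually_gt_at_top[of 0] by eventually_elim (use False in \<open>auto simp: box_bump_outside\<close>)
  then show ?thesis using False by (simp add: tendsto_eventually)
qed

lemma box_bump_test: "s > 0 \<Longrightarrow> cbox a b \<subseteq> \<Omega> \<Longrightarrow> box_bump a b s \<in> test_functions \<Omega>"
  by (rule test_functionI[of _ "cbox a b"])
    (use box_subset_cbox in \<open>auto simp: smooth_box_bump intro!: box_bump_outside\<close>)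

text \<open>Boxes are stable under intersection and generate the Borel sets, so a pi-lambda
  induction carries the vanishing from boxes to Borel sets; complements use the integral over the
  whole space.\<close>

lemma integrals_indicator_zero_imp_AE:
  fixes f :: "'a::euclidean_space \<Rightarrow> complex"
  assumes f: "integrable lebesgue f"
    and UNIV: "integral\<^sup>L lebesgue f = 0"
    and box: "\<And>a b. (LINT x|lebesgue. indicator (box a b) x *\<^sub>R f x) = 0"
  shows "AE x in lebesgue. f x = 0"
proof (rule sigma_finite_measure.density_zero[OF sigma_finite_lebesgue f])
  have [measurable]: "f \<in> borel_measurable lebesgue" using f by auto
  let ?G = "range (\<lambda>(a,b). box a b :: 'a set)"
  have int: "integrable lebesgue (\<lambda>x. indicator A x *\<^sub>R f x)" if "A \<in> sets lebesgue" for A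
    using f that by (rule integrable_mult_indicator[rotated])
  have borel: "(LINT x|lebesgue. indicator A x *\<^sub>R f x) = 0" if "A \<in> sets borel" for A :: "'a set"
  proof -
    have sub: "sigma_sets UNIV ?G = sets borel" by (subst borel_eq_box) simp
    have "Int_stable ?G" by (auto simp: Int_stable_def Int_interval box_Int_box)
    moreover have "?G \<subseteq> Pow UNIV" by simp
    moreover have "A \<in> sigma_sets UNIV ?G" using that sub by simp
    ultimately show ?thesis
    proof (induction rule: sigma_sets_induct_disjoint)
      case (basic A)
      then show ?case using box by auto
    next
      case empty
      then show ?case by simp
    next
      case (compl A)
      then have A: "A \<in> sets lebesgue" using sub by (simp add: sets_completionI_sets)
      have "(LINT x|lebesgue. indicator (UNIV - A) x *\<^sub>R f x) =
          (LINT x|lebesgue. f x - indicator A x *\<^sub>R f x)"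
        by (intro Bochner_Integration.integral_cong) (auto simp: indicator_def)
      also have "\<dots> = 0" using compl UNIV f int[OF A] by simp
      finally show ?case .
    next
      case (union A)
      then have "A i \<in> sets lebesgue" for i using sub by (auto simp: sets_completionI_sets)
      then have A: "set_integrable lebesgue (A i) f" "(\<Union>i. A i) \<in> sets lebesgue" "A i \<in> sets lebesgue" for i
        using int by (auto simp: set_integrable_def)
      have "set_lebesgue_integral lebesgue (\<Union>i. A i) f = (\<Sum>i. set_lebesgue_integral lebesgue (A i) f)"
      proof (rule lebesgue_integral_countable_add)
        show "set_integrable lebesgue (\<Union>i. A i) f" using int A by (auto simp: set_integrable_def)
        show "A i \<inter> A j = {}" if "i \<noteq> j" for i j
          using union that by (auto simp: disjoint_family_on_def)
      qed (use A in auto)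
      also have "\<dots> = 0" using union by (simp add: set_lebesgue_integral_def)
      finally show ?case by (simp add: set_lebesgue_integral_def)
    qed
  qed
  fix A :: "'a set" assume A: "A \<in> sets lebesgue"
  \<comment> \<open>A Lebesgue set and its Borel part differ by a null set, which the integral does
    not see.\<close>
  have "(LINT x|lebesgue. indicator A x *\<^sub>R f x) = (LINT x|lebesgue. indicator (main_part lborel A) x *\<^sub>R f x)"
  proof (rule integral_cong_AE)
    have "AE x in lebesgue. x \<in> main_part lborel A \<longleftrightarrow> x \<in> A"
      by (intro AE_completion AE_in_main_part) (use A in simp)
    then show "AE x in lebesgue. indicator A x *\<^sub>R f x = indicator (main_part lborel A) x *\<^sub>R f x"
      by eventually_elim (auto simp: indicator_def)
    have "main_part lborel A \<in> sets lebesgue" using A by (auto intro!: sets_completionI_sets main_part_sets)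
    then show "(\<lambda>x. indicator (main_part lborel A) x *\<^sub>R f x) \<in> borel_measurable lebesgue" by measurable
  qed (use A in measurable)
  also have "\<dots> = 0" using A main_part_sets[of A lborel] by (intro borel) simp
  finally show "set_lebesgue_integral lebesgue A f = 0" by (simp add: set_lebesgue_integral_def)
qed

text \<open>Smooth bounded functions times \<open>box_bump p q n\<close> are test functions; in the
  limit, dominated by \<open>g\<close>, the hypothesis becomes the vanishing of the integrals of
  \<open>g\<close> over intersections with boxes.\<close>

lemma fundamental_lemma_box:
  assumes \<Omega>: "\<Omega> \<in> sets lebesgue" and g: "g \<in> L1_loc \<Omega>"
    and z: "\<And>v. v \<in> test_functions \<Omega> \<Longrightarrow> (LINT x|lebesgue_on \<Omega>. g x * v x) = 0"
    and pq: "cbox p q \<subseteq> \<Omega>"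
  shows "AE x in lebesgue. x \<in> box p q \<longrightarrow> g x = 0"
proof -
  let ?f = "\<lambda>x. indicator (box p q) x *\<^sub>R g x"
  let ?K = "lebesgue_on (cbox p q)"
  have gK: "integrable ?K g" using g pq by (simp add: L1_loc_def)
  have [measurable]: "g \<in> borel_measurable ?K" using gK by auto
  note id_measurable_lebesgue_on[measurable]
  have lim: "(LINT x|?K. g x * (h x * indicator (box p q) x)) = 0"
    if h: "\<And>n. smooth (hn n)" "\<And>n x. cmod (hn n x) \<le> 1" "\<And>x. (\<lambda>n. hn n x) \<longlonglongrightarrow> h x" for hn h
  proof (rule LIMSEQ_unique)
    \<comment> \<open>The index is shifted by one because the bumps are known to be test functions
      only for a positive parameter.\<close>
    show "(\<lambda>n. LINT x|?K. g x * (hn (Suc n) x * box_bump p q (real (Suc n)) x)) \<longlonglongrightarrow>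
        (LINT x|?K. g x * (h x * indicator (box p q) x))"
    proof (rule integral_dominated_convergence[where w="\<lambda>x. cmod (g x)"])
      have hm[measurable]: "hn n \<in> borel_measurable ?K" for n using h(1) by (rule smooth_measurable_lebesgue)
      have [measurable]: "box_bump p q s \<in> borel_measurable ?K" for s by (rule smooth_measurable_lebesgue[OF smooth_box_bump])
      show "(\<lambda>x. g x * (hn (Suc n) x * box_bump p q (real (Suc n)) x)) \<in> borel_measurable ?K" for n
        by measurable
      have [measurable]: "h \<in> borel_measurable ?K"
        by (rule borel_measurable_LIMSEQ_metric[OF hm h(3)])
      show "(\<lambda>x. g x * (h x * indicator (box p q) x)) \<in> borel_measurable ?K" by measurable
      show "AE x in ?K. (\<lambda>n. g x * (hn (Suc n) x * box_bump p q (real (Suc n)) x)) \<longlonglongrightarrow> g x * (h x * indicator (box p q) x)"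
        using LIMSEQ_Suc[OF tendsto_mult[OF tendsto_const tendsto_mult[OF h(3) box_bump_tendsto]]] by (intro AE_I2)
      show "AE x in ?K. norm (g x * (hn (Suc n) x * box_bump p q (real (Suc n)) x)) \<le> cmod (g x)" for n
      proof (rule AE_I2)
        fix x
        have "cmod (hn (Suc n) x) * cmod (box_bump p q (real (Suc n)) x) \<le> 1"
          by (intro mult_le_one h norm_box_bump_le) auto
        then show "norm (g x * (hn (Suc n) x * box_bump p q (real (Suc n)) x)) \<le> cmod (g x)"
          unfolding norm_mult by (rule mult_left_le) simp
      qed
    qed (use gK in auto)
    have "(LINT x|?K. g x * (hn (Suc n) x * box_bump p q (real (Suc n)) x)) = 0" for n
    proof -
      have "(LINT x|lebesgue_on \<Omega>. g x * (hn (Suc n) x * box_bump p q (real (Suc n)) x)) = 0"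
        by (intro z test_mult_smooth box_bump_test h pq) simp
      then show ?thesis
        using box_subset_cbox[of p q] box_bump_outside[of "real (Suc n)" _ p q]
        by (subst (asm) integral_lebesgue_on_mono_set[OF pq]) (use \<Omega> in auto)
    qed
    then show "(\<lambda>n. LINT x|?K. g x * (hn (Suc n) x * box_bump p q (real (Suc n)) x)) \<longlonglongrightarrow> 0" by simp
  qed
  have eq: "(LINT x|lebesgue. h x *\<^sub>R ?f x) = (LINT x|?K. g x * (of_real (h x) * indicator (box p q) x))" for h :: "_ \<Rightarrow> real"
    using box_subset_cbox[of p q]
    by (subst integral_restrict_space)
      (auto intro!: Bochner_Integration.integral_cong simp: indicator_def scaleR_conv_of_real)
  have "AE x in lebesgue. ?f x = 0"
  proof (rule integrals_indicator_zero_imp_AE)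
    have "integrable lebesgue (\<lambda>x. indicator (cbox p q) x *\<^sub>R g x)"
      using gK by (simp add: integrable_restrict_space)
    then have "integrable lebesgue (\<lambda>x. indicator (box p q) x *\<^sub>R (indicator (cbox p q) x *\<^sub>R g x))"
      by (rule integrable_mult_indicator[rotated]) auto
    moreover have "(\<lambda>x. indicator (box p q) x *\<^sub>R (indicator (cbox p q) x *\<^sub>R g x)) = ?f"
      using box_subset_cbox[of p q] by (auto simp: indicator_def fun_eq_iff)
    ultimately show "integrable lebesgue ?f" by simp
    show "integral\<^sup>L lebesgue ?f = 0"
      using eq[of "\<lambda>_. 1"] lim[of "\<lambda>_ _. 1" "\<lambda>_. 1"] by simp
    show "(LINT x|lebesgue. indicator (box a b) x *\<^sub>R ?f x) = 0" for a b
      using eq[of "indicator (box a b)"] lim[of "\<lambda>n. box_bump a b (real n)", OF smooth_box_bump norm_box_bump_le box_bump_tendsto]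
      by (simp add: of_real_indicator)
  qed
  then show ?thesis by eventually_elim (auto simp: indicator_def)
qed

text \<open>Lindelof's theorem reduces the claim to countably many open boxes whose closures lie in
  \<open>\<Omega>\<close>, so the exceptional null sets can be united.\<close>

lemma fundamental_lemma:
  assumes \<Omega>: "open \<Omega>" and g: "g \<in> L1_loc \<Omega>"
    and z: "\<And>v. v \<in> test_functions \<Omega> \<Longrightarrow> (LINT x|lebesgue_on \<Omega>. g x * v x) = 0"
  shows "AE x in lebesgue_on \<Omega>. g x = 0"
proof -
  have \<Omega>': "\<Omega> \<in> sets lebesgue" using \<Omega> by auto
  obtain D where D: "countable D" "D \<subseteq> Pow \<Omega>" "\<And>X. X \<in> D \<Longrightarrow> \<exists>a b. cbox a b \<subseteq> \<Omega> \<and> X = box a b" "\<Union>D = \<Omega>"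
  proof -
    obtain D where D: "D \<subseteq> {box a b |a b. cbox a b \<subseteq> \<Omega>}" "countable D" "\<Union>D = \<Union>{box a b |a b. cbox a b \<subseteq> \<Omega>}"
      by (rule Lindelof[of "{box a b |a b. cbox a b \<subseteq> \<Omega>}"]) auto
    have "\<Union>{box a b |a b. cbox a b \<subseteq> \<Omega>} = \<Omega>"
    proof (intro equalityI subsetI)
      fix x assume "x \<in> \<Omega>"
      then obtain a b where "cbox a b \<subseteq> \<Omega>" "x \<in> box a b" using open_contains_cbox[OF \<Omega>] by metis
      then show "x \<in> \<Union>{box a b |a b. cbox a b \<subseteq> \<Omega>}" by blast
    qed (use box_subset_cbox in blast)
    with D have D': "\<Union>D = \<Omega>" by simp
    show thesis
    proof (rule that[OF D(2) _ _ D'])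
      show "\<exists>a b. cbox a b \<subseteq> \<Omega> \<and> X = box a b" if "X \<in> D" for X using that D(1) by blast
    qed (use D' in blast)
  qed
  have "AE x in lebesgue. \<forall>X\<in>D. x \<in> X \<longrightarrow> g x = 0"
    using D(3) fundamental_lemma_box[OF \<Omega>' g z] by (subst AE_ball_countable[OF D(1)]) blast
  then have "AE x in lebesgue. x \<in> \<Omega> \<longrightarrow> g x = 0"
    by eventually_elim (use D(4) in blast)
  then show ?thesis using \<Omega>' by (subst AE_restrict_space_iff) auto
qed

subsection \<open>Integration by parts and weak derivatives\<close>

lemma test_lipschitz:
  assumes v: "v \<in> test_functions \<Omega>"
  obtains B where "B > 0" "\<And>x y. cmod (v x - v y) \<le> B * norm (x - y)"
proof -
  have "\<exists>B>0. \<forall>x. cmod (partial k v x) \<le> B" for k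
    using test_bounded[OF test_partial[OF v]] by metis
  then obtain B where B: "\<And>k. B k > 0" "\<And>k x. cmod (partial k v x) \<le> B k" by metis
  let ?B = "\<Sum>k\<in>UNIV. B k"
  have diff: "v differentiable (at x)" for x using v by (simp add: test_smooth smoothD)
  have "cmod (v x - v y) \<le> ?B * norm (x - y)" for x y
  proof (rule differentiable_bound[of UNIV])
    show "(v has_derivative (\<lambda>h. \<Sum>k\<in>UNIV. of_real (h $ k) * partial k v x)) (at x within UNIV)" for x
      by (rule has_derivative_sum_partial[OF diff])
    show "onorm (\<lambda>h. \<Sum>k\<in>UNIV. of_real (h $ k) * partial k v x) \<le> ?B" for x
    proof (rule onorm_bound)
      show "?B \<ge> 0" using B(1) by (intro sum_nonneg) (simp add: less_imp_le)
      fix h :: "real^'a"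
      have "cmod (\<Sum>k\<in>UNIV. of_real (h $ k) * partial k v x) \<le> (\<Sum>k\<in>UNIV. norm h * B k)"
        by (intro sum_norm_le) (simp add: norm_mult mult_mono component_le_norm_cart B)
      then show "cmod (\<Sum>k\<in>UNIV. of_real (h $ k) * partial k v x) \<le> ?B * norm h"
        by (simp add: sum_distrib_left mult.commute)
    qed
  qed auto
  moreover have "?B > 0" using B(1) by (intro sum_pos) auto
  ultimately show thesis using that by blast
qed

lemma test_lborel_integrable: "v \<in> test_functions \<Omega> \<Longrightarrow> integrable lborel v"
proof -
  assume "v \<in> test_functions \<Omega>"
  then have v: "v \<in> test_functions UNIV" "smooth v" by (auto simp: test_functions_def)
  then show ?thesis
    using test_integrable[OF _ v(1)] by (simp add: integrable_completion smooth_borel lebesgue_on_UNIV_eq)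
qed

lemma integral_lborel_translate:
  fixes f :: "'a::euclidean_space \<Rightarrow> 'b::{banach, second_countable_topology}"
  assumes "f \<in> borel_measurable borel"
  shows "(LINT x|lborel. f (x + c)) = integral\<^sup>L lborel f"
proof -
  have "integral\<^sup>L lborel f = integral\<^sup>L (distr lborel borel ((+) c)) f" by (simp add: lborel_distr_plus)
  also have "\<dots> = (LINT x|lborel. f (c + x))" by (rule integral_distr) (use assms in auto)
  finally show ?thesis by (simp add: add.commute)
qed

lemma partial_difference_quotient:
  assumes "f differentiable (at x)"
  shows "((\<lambda>t. (f (x + t *\<^sub>R axis k 1) - f x) / of_real t) \<longlongrightarrow> partial k f x) (at 0)"
proof -
  have f: "(f has_derivative frechet_derivative f (at x)) (at x)"
    using assms by (rule differentiable_frechet)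
  have "((\<lambda>t::real. x + t *\<^sub>R axis k 1) has_derivative (\<lambda>t. t *\<^sub>R axis k 1)) (at 0)"
    by (auto intro!: derivative_eq_intros)
  then have "((\<lambda>t. f (x + t *\<^sub>R axis k 1)) has_derivative (\<lambda>t. frechet_derivative f (at x) (t *\<^sub>R axis k 1))) (at 0)"
    using has_derivative_compose[of "\<lambda>t. x + t *\<^sub>R axis k 1" _ 0 UNIV f] f by simp
  then have "((\<lambda>t. f (x + t *\<^sub>R axis k 1)) has_vector_derivative partial k f x) (at 0)"
    using linear_cmul[OF linear_frechet_derivative[OF assms]]
    by (simp add: has_vector_derivative_def partial_def)
  then have "((\<lambda>t. cmod (f (x + t *\<^sub>R axis k 1) - f x - t *\<^sub>R partial k f x) / norm t) \<longlongrightarrow> 0) (at 0)"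
    by (simp add: has_vector_derivative_def has_derivative_at)
  then have "((\<lambda>t. cmod ((f (x + t *\<^sub>R axis k 1) - f x) / of_real t - partial k f x)) \<longlongrightarrow> 0) (at 0)"
  proof (rule Lim_transform_eventually)
    show "\<forall>\<^sub>F t in at 0. cmod (f (x + t *\<^sub>R axis k 1) - f x - t *\<^sub>R partial k f x) / norm t =
        cmod ((f (x + t *\<^sub>R axis k 1) - f x) / of_real t - partial k f x)"
      unfolding eventually_at_filter
    proof (intro always_eventually allI impI)
      fix t :: real assume "t \<noteq> 0"
      then have "(f (x + t *\<^sub>R axis k 1) - f x) / of_real t - partial k f x =
          (f (x + t *\<^sub>R axis k 1) - f x - t *\<^sub>R partial k f x) / of_real t"
        by (simp add: diff_divide_distrib scaleR_conv_of_real)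
      then show "cmod (f (x + t *\<^sub>R axis k 1) - f x - t *\<^sub>R partial k f x) / norm t =
        cmod ((f (x + t *\<^sub>R axis k 1) - f x) / of_real t - partial k f x)"
        by (simp add: norm_divide)
    qed
  qed
  then show ?thesis by (rule LIM_zero_cancel[OF tendsto_norm_zero_cancel])
qed

text \<open>By translation invariance each difference quotient integrates to 0; the Lipschitz bound
  dominates the quotients on a fixed ball, so the limit inherits the value.\<close>

lemma integral_partial_test_eq_0:
  assumes v: "v \<in> test_functions \<Omega>"
  shows "(LINT x|lborel. partial k v x) = 0"
proof -
  obtain B where B: "B > 0" "\<And>x y. cmod (v x - v y) \<le> B * norm (x - y)"
    using test_lipschitz v by metis
  obtain R where R: "\<And>x. x \<in> supp v \<Longrightarrow> norm x \<le> R"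
    using test_compact[OF v] compact_imp_bounded bounded_iff by metis
  define t where "t n = inverse (real (Suc n))" for n
  have t: "t n > 0" "t n \<le> 1" for n by (auto simp: t_def divide_simps)
  have t0: "filterlim t (at 0) sequentially"
    unfolding t_def filterlim_at
    using LIMSEQ_inverse_real_of_nat by auto
  let ?q = "\<lambda>n x. (v (x + t n *\<^sub>R axis k 1) - v x) / of_real (t n)"
  have [measurable]: "v \<in> borel_measurable borel" "partial k v \<in> borel_measurable borel"
    using v by (auto intro!: smooth_borel smooth_partial simp: test_smooth)
  have "(\<lambda>n. LINT x|lborel. ?q n x) \<longlonglongrightarrow> (LINT x|lborel. partial k v x)"
  \<comment> \<open>The increments \<open>t n\<close> are at most 1, so all translates involved
    vanish outside the ball of radius \<open>R + 1\<close>.\<close>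
  proof (rule integral_dominated_convergence[where w="\<lambda>x. indicator (cball 0 (R + 1)) x * B"])
    show "integrable lborel (\<lambda>x::real^'a. indicator (cball 0 (R + 1)) x * B)"
      using emeasure_bounded_finite[of "cball 0 (R + 1)"] by (intro integrable_mult_left integrable_real_indicator) auto
    show "AE x in lborel. (\<lambda>n. ?q n x) \<longlonglongrightarrow> partial k v x"
      using filterlim_compose[OF partial_difference_quotient t0] test_smooth[OF v] smoothD by blast
    show "AE x in lborel. norm (?q n x) \<le> indicator (cball 0 (R + 1)) x * B" for n
    proof (rule AE_I2)
      fix x
      show "norm (?q n x) \<le> indicator (cball 0 (R + 1)) x * B"
      proof (cases "x \<in> cball 0 (R + 1)")
        case True
        have "cmod (v (x + t n *\<^sub>R axis k 1) - v x) \<le> B * t n"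
          using B(2)[of "x + t n *\<^sub>R axis k 1" x] t[of n] by simp
        then show ?thesis using True t[of n] by (simp add: norm_divide divide_simps)
      next
        case False
        have "norm x \<le> norm (x + t n *\<^sub>R axis k 1) + norm (t n *\<^sub>R axis k (1::real) :: real^'a)"
          using norm_triangle_ineq4[of "x + t n *\<^sub>R axis k 1" "t n *\<^sub>R axis k 1"] by simp
        then have "norm x \<le> norm (x + t n *\<^sub>R axis k 1) + 1"
          using t[of n] by simp
        with False have "x \<notin> supp v" "x + t n *\<^sub>R axis k 1 \<notin> supp v"
          using R[of x] R[of "x + t n *\<^sub>R axis k 1"] by (auto simp: dist_norm)
        then show ?thesis using False by (simp add: not_in_supp)
      qed
    qed
    show "partial k v \<in> borel_measurable lborel" "?q n \<in> borel_measurable lborel" for n by simp_all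
  qed
  moreover have "(LINT x|lborel. ?q n x) = 0" for n
  proof -
    have "integrable lborel (\<lambda>x. v (x + t n *\<^sub>R axis k 1))"
      using integrable_distr_eq[of "(+) (t n *\<^sub>R axis k 1)" lborel borel v] test_lborel_integrable[OF v]
      by (simp add: lborel_distr_plus add.commute)
    then show ?thesis
      using integral_lborel_translate[of v "t n *\<^sub>R axis k 1"] test_lborel_integrable[OF v] by simp
  qed
  ultimately have "(\<lambda>_::nat. 0) \<longlonglongrightarrow> (LINT x|lborel. partial k v x)" by (simp only:)
  then show ?thesis by (simp add: LIMSEQ_const_iff)
qed

lemma integral_test_lebesgue_on:
  assumes "\<Omega> \<in> sets lebesgue" "v \<in> test_functions \<Omega>"
  shows "integral\<^sup>L (lebesgue_on \<Omega>) v = integral\<^sup>L lborel v"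
proof -
  have "integral\<^sup>L (lebesgue_on UNIV) v = integral\<^sup>L (lebesgue_on \<Omega>) v"
    by (rule integral_lebesgue_on_mono_set) (use assms test_outside in auto)
  moreover have "integral\<^sup>L lebesgue v = integral\<^sup>L lborel v"
    by (rule integral_completion) (use assms in \<open>auto intro!: smooth_borel simp: test_smooth\<close>)
  ultimately show ?thesis by (simp add: lebesgue_on_UNIV_eq)
qed

lemma continuous_L1_loc: "continuous_on \<Omega> f \<Longrightarrow> f \<in> L1_loc \<Omega>"
  unfolding L1_loc_def
proof safe
  fix K assume K: "compact K" "K \<subseteq> \<Omega>" and f: "continuous_on \<Omega> f"
  then have "bounded (f ` K)" by (intro compact_imp_bounded compact_continuous_image) (auto intro: continuous_on_subset)
  then obtain B where B: "\<And>x. x \<in> K \<Longrightarrow> cmod (f x) \<le> B" by (auto simp: bounded_iff)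
  show "integrable (lebesgue_on K) f"
    by (rule integrable_bounded_lebesgue_on[OF _ _ _ B])
      (use K f in \<open>auto simp: compact_imp_bounded lmeasurable_compact fmeasurableD
         intro!: continuous_imp_measurable_on_sets_lebesgue intro: continuous_on_subset\<close>)
qed

lemma smooth_L1_loc: "smooth f \<Longrightarrow> f \<in> L1_loc \<Omega>"
  by (intro continuous_L1_loc smooth_continuous)

text \<open>For a test function \<open>v\<close> the product of \<open>f\<close> and
  \<open>v\<close> is a test function, and the integral of its derivative vanishes.\<close>

lemma smooth_has_weak_partial:
  assumes \<Omega>: "\<Omega> \<in> sets lebesgue" and f: "smooth f"
  shows "has_weak_partial \<Omega> k f (partial k f)"
  unfolding has_weak_partial_def
proof (intro conjI ballI)
  fix v assume v: "v \<in> test_functions \<Omega>"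
  have "(LINT x|lebesgue_on \<Omega>. f x * partial k v x + partial k f x * v x) =
      (LINT x|lebesgue_on \<Omega>. partial k (\<lambda>x. f x * v x) x)"
    using v f by (simp add: partial_mult smoothD test_smooth)
  also have "\<dots> = 0"
    using integral_test_lebesgue_on[OF \<Omega> test_partial[OF test_mult_smooth[OF f v]]]
      integral_partial_test_eq_0[OF test_mult_smooth[OF f v]] by metis
  finally show "(LINT x|lebesgue_on \<Omega>. f x * partial k v x) = - (LINT x|lebesgue_on \<Omega>. partial k f x * v x)"
    using L1_loc_mult_test[OF \<Omega> smooth_L1_loc[OF f] test_partial[OF v]]
      L1_loc_mult_test[OF \<Omega> smooth_L1_loc[OF smooth_partial[OF f]] v]
    by (simp add: eq_neg_iff_add_eq_0)
qed (use f in \<open>auto intro!: smooth_L1_loc smooth_partial\<close>)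

lemma L1_loc_comb: "f \<in> L1_loc \<Omega> \<Longrightarrow> g \<in> L1_loc \<Omega> \<Longrightarrow> (\<lambda>x. \<alpha> * f x + \<beta> * g x) \<in> L1_loc \<Omega>"
  by (auto simp: L1_loc_def)

lemma has_weak_partial_comb:
  assumes \<Omega>: "\<Omega> \<in> sets lebesgue" and f: "has_weak_partial \<Omega> k f f'" and g: "has_weak_partial \<Omega> k g g'"
  shows "has_weak_partial \<Omega> k (\<lambda>x. \<alpha> * f x + \<beta> * g x) (\<lambda>x. \<alpha> * f' x + \<beta> * g' x)"
  unfolding has_weak_partial_def
proof (intro conjI ballI)
  fix v assume v: "v \<in> test_functions \<Omega>"
  have int: "integrable (lebesgue_on \<Omega>) (\<lambda>x. f x * partial k v x)" "integrable (lebesgue_on \<Omega>) (\<lambda>x. g x * partial k v x)"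
    "integrable (lebesgue_on \<Omega>) (\<lambda>x. f' x * v x)" "integrable (lebesgue_on \<Omega>) (\<lambda>x. g' x * v x)"
    using f g v by (auto simp: has_weak_partial_def intro!: L1_loc_mult_test[OF \<Omega>] test_partial)
  then show "(LINT x|lebesgue_on \<Omega>. (\<alpha> * f x + \<beta> * g x) * partial k v x) =
      - (LINT x|lebesgue_on \<Omega>. (\<alpha> * f' x + \<beta> * g' x) * v x)"
    using f g v by (simp add: has_weak_partial_def distrib_right mult.assoc)
qed (use f g in \<open>auto simp: has_weak_partial_def intro!: L1_loc_comb\<close>)

text \<open>The two functions are allowed to differ on a null set because members of the Sobolev
  spaces are representatives; the difference of the derivatives is annihilated by all test
  functions.\<close>

lemma has_weak_partial_unique_AE:
  assumes \<Omega>: "open \<Omega>" and f: "has_weak_partial \<Omega> k f g" and f': "has_weak_partial \<Omega> k f' g'"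
    and eq: "AE x in lebesgue_on \<Omega>. f x = f' x"
  shows "AE x in lebesgue_on \<Omega>. g x = g' x"
proof -
  have \<Omega>': "\<Omega> \<in> sets lebesgue" using \<Omega> by auto
  have L: "f \<in> L1_loc \<Omega>" "f' \<in> L1_loc \<Omega>" "g \<in> L1_loc \<Omega>" "g' \<in> L1_loc \<Omega>"
    using f f' by (auto simp: has_weak_partial_def)
  have "AE x in lebesgue_on \<Omega>. 1 * g x + (-1) * g' x = 0"
  proof (rule fundamental_lemma[OF \<Omega> L1_loc_comb[OF L(3,4)]])
    fix v assume v: "v \<in> test_functions \<Omega>"
    have "(LINT x|lebesgue_on \<Omega>. f x * partial k v x) = (LINT x|lebesgue_on \<Omega>. f' x * partial k v x)"
    proof (rule integral_cong_AE)
      show "AE x in lebesgue_on \<Omega>. f x * partial k v x = f' x * partial k v x"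
        using eq by eventually_elim simp
    qed (use L1_loc_mult_test[OF \<Omega>' _ test_partial[OF v]] L in auto)
    then have "(LINT x|lebesgue_on \<Omega>. g x * v x) = (LINT x|lebesgue_on \<Omega>. g' x * v x)"
      using f f' v by (auto simp: has_weak_partial_def)
    then show "(LINT x|lebesgue_on \<Omega>. (1 * g x + (-1) * g' x) * v x) = 0"
      using L1_loc_mult_test[OF \<Omega>' _ v] L by (simp add: left_diff_distrib)
  qed
  then show ?thesis by eventually_elim simp
qed

lemma weak_partial_works: "has_weak_partial \<Omega> k u g \<Longrightarrow> has_weak_partial \<Omega> k u (weak_partial \<Omega> k u)"
  unfolding weak_partial_def by (rule someI[of "has_weak_partial \<Omega> k u"])

lemma weak_partial_AE:
  assumes "open \<Omega>" "has_weak_partial \<Omega> k u g"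
  shows "AE x in lebesgue_on \<Omega>. weak_partial \<Omega> k u x = g x"
  using has_weak_partial_unique_AE[OF assms(1) weak_partial_works[OF assms(2)] assms(2)] by simp

subsection \<open>Semi-inner product spaces and the Lax--Milgram theorem\<close>

text \<open>Gaussian elimination by induction on the number of unknowns. Injectivity survives the
  step because a kernel vector of the reduced system extends to one of the full system.\<close>

lemma finite_linear_system_solvable:
  fixes A :: "'j \<Rightarrow> 'i \<Rightarrow> complex"
  assumes "finite I" "finite J" "card I = card J"
    and "\<And>t. (\<And>j. j \<in> J \<Longrightarrow> (\<Sum>i\<in>I. A j i * t i) = 0) \<Longrightarrow> (\<forall>i\<in>I. t i = 0)"
  shows "\<exists>t. \<forall>j\<in>J. (\<Sum>i\<in>I. A j i * t i) = y j"
  using assms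
proof (induction "card I" arbitrary: I J A y)
  case 0
  then show ?case by auto
next
  case (Suc n)
  obtain i0 where i0: "i0 \<in> I" using Suc.hyps(2) by fastforce
  \<comment> \<open>Otherwise the unit vector at \<open>i0\<close> would lie in the kernel.\<close>
  obtain j0 where j0: "j0 \<in> J" "A j0 i0 \<noteq> 0"
  proof (rule ccontr)
    assume "\<not> thesis"
    with that have "\<And>j. j \<in> J \<Longrightarrow> (\<Sum>i\<in>I. A j i * (if i = i0 then 1 else 0)) = 0"
      using i0 Suc.prems(1) by (auto simp: if_distrib cong: if_cong)
    from Suc.prems(4)[OF this] show False using i0 by auto
  qed
  define p where "p = A j0 i0"
  define A' where "A' j i = A j i - A j i0 * A j0 i / p" for j i
  let ?I = "I - {i0}" let ?J = "J - {j0}"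
  have split: "(\<Sum>i\<in>I. f i) = f i0 + (\<Sum>i\<in>?I. f i)" for f :: "'i \<Rightarrow> complex"
    using Suc.prems(1) i0 by (simp add: sum.remove)
  \<comment> \<open>Fills in the eliminated unknown so that row \<open>j0\<close> holds with
    right-hand side \<open>y0\<close>; off \<open>i0\<close> nothing changes.\<close>
  define ext where "ext t y0 = t(i0 := (y0 - (\<Sum>i\<in>?I. A j0 i * t i)) / p)" for t :: "'i \<Rightarrow> complex" and y0
  have ext_other: "(\<Sum>i\<in>?I. B i * ext t y0 i) = (\<Sum>i\<in>?I. B i * t i)" for B t y0
    by (intro sum.cong) (auto simp: ext_def)
  have j0_row: "(\<Sum>i\<in>I. A j0 i * ext t y0 i) = y0" for t y0
    using j0 unfolding split ext_other by (simp add: ext_def p_def)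
  have row: "(\<Sum>i\<in>I. A j i * ext t y0 i) = A j i0 * y0 / p + (\<Sum>i\<in>?I. A' j i * t i)" for j t y0
  proof -
    have "(\<Sum>i\<in>?I. A' j i * t i) = (\<Sum>i\<in>?I. A j i * t i - A j i0 / p * (A j0 i * t i))"
      by (intro sum.cong) (auto simp: A'_def field_simps)
    also have "\<dots> = (\<Sum>i\<in>?I. A j i * t i) - A j i0 / p * (\<Sum>i\<in>?I. A j0 i * t i)"
      by (simp add: sum_subtractf sum_distrib_left)
    finally show ?thesis
      unfolding split ext_other by (simp add: ext_def diff_divide_distrib right_diff_distrib)
  qed
  have "\<exists>t. \<forall>j\<in>?J. (\<Sum>i\<in>?I. A' j i * t i) = y j - A j i0 * y j0 / p"
  proof (rule Suc.hyps(1))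
    show "n = card ?I" "finite ?I" "finite ?J" "card ?I = card ?J"
      using Suc.hyps(2) Suc.prems i0 j0 by auto
    fix t assume t: "\<And>j. j \<in> ?J \<Longrightarrow> (\<Sum>i\<in>?I. A' j i * t i) = 0"
    have "(\<Sum>i\<in>I. A j i * ext t 0 i) = 0" if "j \<in> J" for j
      using t[of j] that row[of j t 0] j0_row[of t 0] by (cases "j = j0") auto
    from Suc.prems(4)[OF this] have "\<forall>i\<in>I. ext t 0 i = 0" by blast
    then show "\<forall>i\<in>?I. t i = 0" by (auto simp: ext_def split: if_splits)
  qed
  then obtain t where t: "\<And>j. j \<in> ?J \<Longrightarrow> (\<Sum>i\<in>?I. A' j i * t i) = y j - A j i0 * y j0 / p" by blast
  have "(\<Sum>i\<in>I. A j i * ext t (y j0) i) = y j" if "j \<in> J" for j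
    using t[of j] that row[of j t "y j0"] j0_row[of t "y j0"] by (cases "j = j0") auto
  then show ?case by blast
qed

text \<open>Stated for a carrier set with an abstract combination because it is applied both to
  square-integrable functions and to jets. Elements are representatives, so the form is only
  semidefinite, and no algebraic laws are imposed on \<open>comb\<close>: identities between vectors
  are replaced by identities between inner products.\<close>

locale semi_inner =
  fixes V :: "'v set" and comb :: "complex \<Rightarrow> 'v \<Rightarrow> complex \<Rightarrow> 'v \<Rightarrow> 'v" and ip :: "'v \<Rightarrow> 'v \<Rightarrow> complex"
  assumes comb_closed: "u \<in> V \<Longrightarrow> v \<in> V \<Longrightarrow> comb \<alpha> u \<beta> v \<in> V"
    and ip_comb: "u \<in> V \<Longrightarrow> v \<in> V \<Longrightarrow> w \<in> V \<Longrightarrow> ip (comb \<alpha> u \<beta> v) w = \<alpha> * ip u w + \<beta> * ip v w"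
    and ip_sym: "u \<in> V \<Longrightarrow> v \<in> V \<Longrightarrow> ip v u = cnj (ip u v)"
    and ip_nonneg: "u \<in> V \<Longrightarrow> Re (ip u u) \<ge> 0"
begin

definition nrm :: "'v \<Rightarrow> real" where "nrm u = sqrt (Re (ip u u))"

abbreviation dif :: "'v \<Rightarrow> 'v \<Rightarrow> 'v" where "dif u v \<equiv> comb 1 u (-1) v"

lemma nrm_nonneg[simp]: "u \<in> V \<Longrightarrow> nrm u \<ge> 0"
  by (simp add: nrm_def ip_nonneg)

lemma ip_self: "u \<in> V \<Longrightarrow> ip u u = of_real ((nrm u)\<^sup>2)"
  using ip_sym[of u u] ip_nonneg[of u] by (simp add: nrm_def complex_eq_iff)

lemma norm_ip_self: "u \<in> V \<Longrightarrow> cmod (ip u u) = nrm u * nrm u"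
  unfolding ip_self by (simp only: norm_of_real) (simp add: power2_eq_square)

lemma ip_comb_right:
  "u \<in> V \<Longrightarrow> v \<in> V \<Longrightarrow> w \<in> V \<Longrightarrow> ip w (comb \<alpha> u \<beta> v) = cnj \<alpha> * ip w u + cnj \<beta> * ip w v"
  using ip_sym[of "comb \<alpha> u \<beta> v" w] ip_sym[of u w] ip_sym[of v w]
  by (simp add: comb_closed ip_comb)

lemma nrm_comb_sq:
  assumes "u \<in> V" "v \<in> V"
  shows "(nrm (comb \<alpha> u \<beta> v))\<^sup>2 = (cmod \<alpha>)\<^sup>2 * (nrm u)\<^sup>2 + (cmod \<beta>)\<^sup>2 * (nrm v)\<^sup>2 + 2 * Re (\<alpha> * cnj \<beta> * ip u v)"
proof -
  have "ip (comb \<alpha> u \<beta> v) (comb \<alpha> u \<beta> v) =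
      \<alpha> * cnj \<alpha> * ip u u + \<beta> * cnj \<beta> * ip v v + (\<alpha> * cnj \<beta> * ip u v + cnj (\<alpha> * cnj \<beta> * ip u v))"
    using assms ip_sym[of u v] by (simp add: ip_comb ip_comb_right comb_closed algebra_simps)
  also have "\<dots> = of_real ((cmod \<alpha>)\<^sup>2 * (nrm u)\<^sup>2 + (cmod \<beta>)\<^sup>2 * (nrm v)\<^sup>2 + 2 * Re (\<alpha> * cnj \<beta> * ip u v))"
    unfolding complex_add_cnj by (simp add: assms ip_self flip: complex_norm_square)
  finally show ?thesis
    using assms ip_self[of "comb \<alpha> u \<beta> v"] by (metis comb_closed of_real_eq_iff)
qed

lemma cauchy_schwarz:
  assumes "u \<in> V" "v \<in> V"
  shows "cmod (ip u v) \<le> nrm u * nrm v"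
proof -
  let ?w = "ip u v"
  have key: "0 \<le> (nrm u)\<^sup>2 + s\<^sup>2 * (cmod ?w)\<^sup>2 * (nrm v)\<^sup>2 - 2 * s * (cmod ?w)\<^sup>2" for s :: real
  proof -
    have "Re (1 * cnj (- of_real s * ?w) * ?w) = - s * (cmod ?w)\<^sup>2"
      by (simp add: cmod_power2) (simp add: algebra_simps power2_eq_square)
    then show ?thesis
      using nrm_comb_sq[OF assms, of 1 "- of_real s * ?w"] zero_le_power2[of "nrm (comb 1 u (- of_real s * ?w) v)"]
      by (simp add: norm_mult power_mult_distrib)
  qed
  have "(cmod ?w)\<^sup>2 \<le> (nrm u)\<^sup>2 * (nrm v)\<^sup>2"
  proof (cases "nrm v = 0 \<or> ?w = 0")
    case True
    show ?thesis
    proof (cases "?w = 0")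
      case False
      then have v: "nrm v = 0" using True by simp
      \<comment> \<open>If \<open>v\<close> has norm 0, the quadratic polynomial in
        \<open>key\<close> is affine in \<open>s\<close>; this large \<open>s\<close> makes it
        negative.\<close>
      from key[of "((nrm u)\<^sup>2 + 1) / (cmod ?w)\<^sup>2"] v False
      have "0 \<le> (nrm u)\<^sup>2 - 2 * ((nrm u)\<^sup>2 + 1)" by simp
      then have "(nrm u)\<^sup>2 \<le> - 2" by simp
      then show ?thesis by (smt (verit) zero_le_power2)
    qed auto
  next
    case False
    then have v: "(nrm v)\<^sup>2 > 0" "(cmod ?w)\<^sup>2 > 0" by auto
    have "(1 / r)\<^sup>2 * W * r = W / r" if "r > 0" for r W :: real
      using that by (simp add: power2_eq_square)
    from this[OF v(1)] key[of "1 / (nrm v)\<^sup>2"]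
    have "0 \<le> (nrm u)\<^sup>2 - (cmod ?w)\<^sup>2 / (nrm v)\<^sup>2" by simp
    then show ?thesis using v by (simp add: divide_simps)
  qed
  then show ?thesis
    using assms by (metis abs_le_square_iff abs_norm_cancel abs_of_nonneg mult_nonneg_nonneg nrm_nonneg power_mult_distrib)
qed

lemma nrm_comb_le:
  assumes "u \<in> V" "v \<in> V"
  shows "nrm (comb \<alpha> u \<beta> v) \<le> cmod \<alpha> * nrm u + cmod \<beta> * nrm v"
proof (rule power2_le_imp_le)
  have "Re (\<alpha> * cnj \<beta> * ip u v) \<le> cmod (\<alpha> * cnj \<beta> * ip u v)" by (rule complex_Re_le_cmod)
  also have "\<dots> \<le> cmod \<alpha> * cmod \<beta> * (nrm u * nrm v)"
    unfolding norm_mult complex_mod_cnj using cauchy_schwarz[OF assms] by (intro mult_left_mono) auto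
  finally show "(nrm (comb \<alpha> u \<beta> v))\<^sup>2 \<le> (cmod \<alpha> * nrm u + cmod \<beta> * nrm v)\<^sup>2"
    unfolding nrm_comb_sq[OF assms] by (simp add: power2_sum power_mult_distrib algebra_simps)
qed (use assms in simp)

text \<open>The substitute for rewriting vectors: sums may be rearranged after pairing with an
  arbitrary \<open>w\<close>, where the arithmetic takes place in the complex numbers.\<close>

lemma nrm_cong:
  assumes "u \<in> V" "v \<in> V" "\<And>w. w \<in> V \<Longrightarrow> ip u w = ip v w"
  shows "nrm u = nrm v"
  using assms(3)[of u] assms(3)[of v] ip_sym[OF assms(1,2)] assms(1,2) by (simp add: nrm_def)

lemma nrm_dif_sym:
  assumes "u \<in> V" "v \<in> V"
  shows "nrm (dif u v) = nrm (dif v u)"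
proof (rule power2_eq_imp_eq)
  show "(nrm (dif u v))\<^sup>2 = (nrm (dif v u))\<^sup>2"
    using nrm_comb_sq[OF assms, of 1 "-1"] nrm_comb_sq[OF assms(2,1), of 1 "-1"] ip_sym[OF assms] by simp
qed (use assms in \<open>simp_all add: comb_closed\<close>)

lemma nrm_dif_triangle:
  assumes "u \<in> V" "v \<in> V" "w \<in> V"
  shows "nrm (dif u w) \<le> nrm (dif u v) + nrm (dif v w)"
proof -
  have "nrm (dif u w) = nrm (comb 1 (dif u v) 1 (dif v w))"
    by (rule nrm_cong) (auto simp: assms comb_closed ip_comb)
  also have "\<dots> \<le> nrm (dif u v) + nrm (dif v w)"
    using nrm_comb_le[of "dif u v" "dif v w" 1 1] by (simp add: assms comb_closed)
  finally show ?thesis .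
qed

lemma nrm_le_dif: "u \<in> V \<Longrightarrow> v \<in> V \<Longrightarrow> nrm u \<le> nrm v + nrm (dif u v)"
proof -
  assume *: "u \<in> V" "v \<in> V"
  have "nrm u = nrm (comb 1 v 1 (dif u v))"
    by (rule nrm_cong) (auto simp: * comb_closed ip_comb)
  then show ?thesis
    using nrm_comb_le[of v "dif u v" 1 1] by (simp add: * comb_closed)
qed

lemma nrm_tendsto:
  assumes "\<And>n. X n \<in> V" "u \<in> V" "(\<lambda>n. nrm (dif (X n) u)) \<longlonglongrightarrow> 0"
  shows "(\<lambda>n. nrm (X n)) \<longlonglongrightarrow> nrm u"
proof (rule LIM_zero_cancel, rule Lim_null_comparison[OF _ assms(3)], rule always_eventually, rule allI)
  fix n
  show "norm (nrm (X n) - nrm u) \<le> nrm (dif (X n) u)"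
    using nrm_le_dif[OF assms(1,2)] nrm_le_dif[OF assms(2,1)] nrm_dif_sym[OF assms(1,2)]
    by (smt (verit) real_norm_def)
qed

definition bounded_on :: "'v set \<Rightarrow> real \<Rightarrow> ('v \<Rightarrow> complex) \<Rightarrow> bool" where
  "bounded_on D K G \<longleftrightarrow> (\<forall>d\<in>D. cmod (G d) \<le> K * nrm d)"

definition antilinear_on :: "'v set \<Rightarrow> ('v \<Rightarrow> complex) \<Rightarrow> bool" where
  "antilinear_on D G \<longleftrightarrow> (\<forall>u\<in>D. \<forall>v\<in>D. \<forall>\<alpha> \<beta>. G (comb \<alpha> u \<beta> v) = cnj \<alpha> * G u + cnj \<beta> * G v)"

definition sesquilinear :: "('v \<Rightarrow> 'v \<Rightarrow> complex) \<Rightarrow> bool" where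
  "sesquilinear F \<longleftrightarrow> (\<forall>u\<in>V. antilinear_on V (F u)) \<and>
     (\<forall>u\<in>V. \<forall>v\<in>V. \<forall>w\<in>V. \<forall>\<alpha> \<beta>. F (comb \<alpha> u \<beta> v) w = \<alpha> * F u w + \<beta> * F v w) \<and>
     (\<exists>C. \<forall>u\<in>V. bounded_on V (C * nrm u) (F u))"

lemma sesquilinear_bound:
  assumes "sesquilinear F"
  obtains C where "C > 0" "\<And>u v. u \<in> V \<Longrightarrow> v \<in> V \<Longrightarrow> cmod (F u v) \<le> C * nrm u * nrm v"
proof -
  obtain C where "\<forall>u\<in>V. bounded_on V (C * nrm u) (F u)"
    using assms unfolding sesquilinear_def by blast
  then have C: "\<And>u v. u \<in> V \<Longrightarrow> v \<in> V \<Longrightarrow> cmod (F u v) \<le> C * nrm u * nrm v"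
    by (simp add: bounded_on_def)
  have "cmod (F u v) \<le> (\<bar>C\<bar> + 1) * nrm u * nrm v" if "u \<in> V" "v \<in> V" for u v
  proof -
    have "C * (nrm u * nrm v) \<le> (\<bar>C\<bar> + 1) * (nrm u * nrm v)"
      using that by (intro mult_right_mono) auto
    then show ?thesis using C[OF that] by (simp add: mult.assoc)
  qed
  then show thesis using that[of "\<bar>C\<bar> + 1"] by simp
qed

lemma antilinear_tendsto:
  assumes "antilinear_on V G" "bounded_on V K G" "\<And>n. X n \<in> V" "u \<in> V"
    and "(\<lambda>n. nrm (dif (X n) u)) \<longlonglongrightarrow> 0"
  shows "(\<lambda>n. G (X n)) \<longlonglongrightarrow> G u"
proof (rule LIM_zero_cancel, rule Lim_null_comparison)
  show "\<forall>\<^sub>F n in sequentially. norm (G (X n) - G u) \<le> K * nrm (dif (X n) u)"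
  proof (rule always_eventually, rule allI)
    fix n
    have "G (X n) - G u = G (dif (X n) u)" using assms(1,3,4) by (simp add: antilinear_on_def)
    then show "norm (G (X n) - G u) \<le> K * nrm (dif (X n) u)"
      using assms(2,3,4) by (simp add: bounded_on_def comb_closed)
  qed
  show "(\<lambda>n. K * nrm (dif (X n) u)) \<longlonglongrightarrow> 0" using tendsto_mult_right_zero[OF assms(5)] by simp
qed

lemma linear_tendsto:
  assumes "\<And>u v \<alpha> \<beta>. u \<in> V \<Longrightarrow> v \<in> V \<Longrightarrow> G (comb \<alpha> u \<beta> v) = \<alpha> * G u + \<beta> * G v"
    and "\<And>u. u \<in> V \<Longrightarrow> cmod (G u) \<le> K * nrm u" "\<And>n. X n \<in> V" "u \<in> V"
    and "(\<lambda>n. nrm (dif (X n) u)) \<longlonglongrightarrow> 0"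
  shows "(\<lambda>n. G (X n)) \<longlonglongrightarrow> G u"
proof (rule LIM_zero_cancel, rule Lim_null_comparison)
  show "\<forall>\<^sub>F n in sequentially. norm (G (X n) - G u) \<le> K * nrm (dif (X n) u)"
  proof (rule always_eventually, rule allI)
    fix n
    have "G (X n) - G u = G (dif (X n) u)" using assms(1,3,4) by simp
    then show "norm (G (X n) - G u) \<le> K * nrm (dif (X n) u)"
      using assms(2,3,4) by (simp add: comb_closed)
  qed
  show "(\<lambda>n. K * nrm (dif (X n) u)) \<longlonglongrightarrow> 0" using tendsto_mult_right_zero[OF assms(5)] by simp
qed

text \<open>The increments are summed as a geometric series; this serves the iteration behind
  Lax--Milgram as well as series of functions.\<close>

lemma geometric_Cauchy:
  assumes X: "\<And>n. X n \<in> V" and q: "0 \<le> q" "q < 1"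
    and step: "\<And>n. nrm (dif (X (Suc n)) (X n)) \<le> A * q ^ n" and e: "e > 0"
  shows "\<exists>N. \<forall>m\<ge>N. \<forall>n\<ge>N. nrm (dif (X m) (X n)) < e"
proof -
  have A: "A \<ge> 0" using step[of 0] nrm_nonneg[OF comb_closed[OF X X], of 1 "Suc 0" "-1" 0] by simp
  have far: "nrm (dif (X (n + k)) (X n)) \<le> A * q ^ n / (1 - q)" for n k
  proof -
    have "nrm (dif (X (n + k)) (X n)) \<le> (\<Sum>i<k. A * q ^ (n + i))"
    proof (induction k)
      case 0
      show ?case using nrm_comb_sq[OF X X, of 1 n "-1" n] by (simp add: ip_self[OF X])
    next
      case (Suc k)
      then show ?case
        using nrm_dif_triangle[OF X[of "n + Suc k"] X[of "n + k"] X[of n]] step[of "n + k"] by simp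
    qed
    also have "\<dots> = A * q ^ n * (\<Sum>i<k. q ^ i)" by (simp add: power_add sum_distrib_left mult.assoc)
    also have "\<dots> \<le> A * q ^ n * (1 / (1 - q))"
    proof (rule mult_left_mono)
      have "(\<Sum>i<k. q ^ i) \<le> (\<Sum>i. q ^ i)" using q by (intro sum_le_suminf) auto
      then show "(\<Sum>i<k. q ^ i) \<le> 1 / (1 - q)" using q by (simp add: suminf_geometric)
    qed (use A q in auto)
    finally show ?thesis by simp
  qed
  have "(\<lambda>n. A * q ^ n / (1 - q)) \<longlonglongrightarrow> A * 0 / (1 - q)"
    using q by (intro tendsto_intros LIMSEQ_realpow_zero) auto
  then have "\<forall>\<^sub>F n in sequentially. A * q ^ n / (1 - q) < e" using e by (intro order_tendstoD) auto
  then obtain N where N: "\<And>n. n \<ge> N \<Longrightarrow> A * q ^ n / (1 - q) < e" by (auto simp: eventually_sequentially)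
  show ?thesis
  proof (intro exI[of _ N] allI impI)
    fix m n assume mn: "m \<ge> N" "n \<ge> N"
    show "nrm (dif (X m) (X n)) < e"
    proof (cases "n \<le> m")
      case True
      then show ?thesis using far[of n "m - n"] N[OF mn(2)] by simp
    next
      case False
      then show ?thesis using far[of m "n - m"] N[OF mn(1)] nrm_dif_sym[OF X X, of m n] by simp
    qed
  qed
qed

end

text \<open>The dense subset \<open>D\<close> belongs to the structure because functionals and
  equations are given on test functions only, while solutions are sought in the complete space
  \<open>V\<close>.\<close>

locale semi_hilbert = semi_inner +
  fixes D :: "'a set"
  assumes D_subset: "D \<subseteq> V" and D_nonempty: "D \<noteq> {}"
    and D_comb: "u \<in> D \<Longrightarrow> v \<in> D \<Longrightarrow> comb \<alpha> u \<beta> v \<in> D"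
    and D_dense: "u \<in> V \<Longrightarrow> e > 0 \<Longrightarrow> \<exists>d\<in>D. nrm (dif u d) < e"
    and complete: "(\<And>n. X n \<in> V) \<Longrightarrow> (\<And>e. e > 0 \<Longrightarrow> \<exists>N. \<forall>m\<ge>N. \<forall>n\<ge>N. nrm (dif (X m) (X n)) < e) \<Longrightarrow>
      \<exists>u\<in>V. (\<lambda>n. nrm (dif (X n) u)) \<longlonglongrightarrow> 0"
begin

lemma D_in_V[simp]: "d \<in> D \<Longrightarrow> d \<in> V"
  using D_subset by auto

lemma D_approx:
  assumes "u \<in> V"
  obtains X where "\<And>n. X n \<in> D" "(\<lambda>n. nrm (dif (X n) u)) \<longlonglongrightarrow> 0"
proof -
  have "\<exists>d\<in>D. nrm (dif u d) < inverse (real (Suc n))" for n using D_dense[OF assms] by simp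
  then obtain X where X: "\<And>n. X n \<in> D" "\<And>n. nrm (dif u (X n)) < inverse (real (Suc n))" by metis
  have "(\<lambda>n. nrm (dif (X n) u)) \<longlonglongrightarrow> 0"
  proof (rule Lim_null_comparison[OF _ LIMSEQ_inverse_real_of_nat])
    show "\<forall>\<^sub>F n in sequentially. norm (nrm (dif (X n) u)) \<le> inverse (real (Suc n))"
      using X assms nrm_dif_sym[of u] by (intro always_eventually allI) (simp add: comb_closed less_imp_le)
  qed
  with X show thesis using that by blast
qed

lemma antilinear_eq_on_V:
  assumes "antilinear_on V G" "bounded_on V K G" "antilinear_on V H" "bounded_on V L H"
    and "\<And>d. d \<in> D \<Longrightarrow> G d = H d" and "u \<in> V"
  shows "G u = H u"
proof -
  obtain X where X: "\<And>n. X n \<in> D" "(\<lambda>n. nrm (dif (X n) u)) \<longlonglongrightarrow> 0" using D_approx[OF assms(6)] by blast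
  have "(\<lambda>n. G (X n)) \<longlonglongrightarrow> G u" "(\<lambda>n. H (X n)) \<longlonglongrightarrow> H u"
    by (rule antilinear_tendsto[OF assms(1,2) _ assms(6) X(2)], simp add: X)
      (rule antilinear_tendsto[OF assms(3,4) _ assms(6) X(2)], simp add: X)
  then show ?thesis using assms(5) X(1) LIMSEQ_unique by simp
qed

lemma antilinear_ip: "u \<in> V \<Longrightarrow> antilinear_on V (ip u)"
  by (simp add: antilinear_on_def ip_comb_right)

lemma bounded_ip: "u \<in> V \<Longrightarrow> bounded_on V (nrm u) (ip u)"
  by (simp add: bounded_on_def cauchy_schwarz)

text \<open>Minimises the quadratic functional \<open>J\<close> over the dense set: the
  parallelogram identity makes minimising sequences Cauchy, and the first variation at the limit is
  the equation. Since \<open>G\<close> is known on \<open>D\<close> only, the sequence stays in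
  \<open>D\<close> and \<open>J\<close> is never evaluated at its limit.\<close>

theorem riesz:
  assumes G: "antilinear_on D G" "bounded_on D K G" and K: "K \<ge> 0"
  shows "\<exists>u\<in>V. nrm u \<le> K \<and> (\<forall>d\<in>D. ip u d = G d)"
proof -
  define J where "J d = (nrm d)\<^sup>2 - 2 * Re (G d)" for d
  have J_ge: "J d \<ge> - K\<^sup>2" if "d \<in> D" for d
  proof -
    have "Re (G d) \<le> K * nrm d"
      using G(2) that complex_Re_le_cmod[of "G d"] by (force simp: bounded_on_def)
    then show ?thesis
      using zero_le_power2[of "nrm d - K"] by (simp add: J_def power2_diff mult.commute)
  qed
  define I where "I = (INF d\<in>D. J d)"
  have bdd: "bdd_below (J ` D)" using J_ge by (auto intro!: bdd_belowI)
  have I_le: "I \<le> J d" if "d \<in> D" for d unfolding I_def by (rule cINF_lower[OF bdd that])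
  have "\<exists>d\<in>D. J d < I + inverse (real (Suc n))" for n
  proof -
    have "(INF d\<in>D. J d) < I + inverse (real (Suc n))" by (simp add: I_def)
    then show ?thesis using cINF_less_iff[OF D_nonempty bdd] by blast
  qed
  then obtain X where X: "\<And>n. X n \<in> D" "\<And>n. J (X n) < I + inverse (real (Suc n))" by metis
  have XV[simp]: "X n \<in> V" for n using X by simp
  \<comment> \<open>The midpoint of \<open>u\<close> and \<open>v\<close> cannot fall below the
    infimum, so near-minimality of both bounds their distance.\<close>
  have par: "(nrm (dif u v))\<^sup>2 \<le> 2 * (J u - I) + 2 * (J v - I)" if "u \<in> D" "v \<in> D" for u v
  proof -
    let ?m = "comb (1/2) u (1/2) v"
    have "G ?m = (1/2) * G u + (1/2) * G v" using G(1) that by (simp add: antilinear_on_def)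
    then have "J ?m = (nrm u)\<^sup>2 / 4 + (nrm v)\<^sup>2 / 4 + Re (ip u v) / 2 - Re (G u) - Re (G v)"
      using nrm_comb_sq[of u v "1/2" "1/2"] that by (simp add: J_def power2_eq_square)
    moreover have "J ?m \<ge> I" using that by (intro I_le D_comb)
    ultimately show ?thesis
      using nrm_comb_sq[of u v 1 "-1"] that by (simp add: J_def)
  qed
  have "\<exists>u\<in>V. (\<lambda>n. nrm (dif (X n) u)) \<longlonglongrightarrow> 0"
  proof (rule complete)
    fix e :: real assume e: "e > 0"
    obtain N where N: "inverse (real (Suc N)) < e\<^sup>2 / 4" using reals_Archimedean[of "e\<^sup>2 / 4"] e by auto
    show "\<exists>N. \<forall>m\<ge>N. \<forall>n\<ge>N. nrm (dif (X m) (X n)) < e"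
    proof (intro exI[of _ N] allI impI)
      fix m n assume mn: "m \<ge> N" "n \<ge> N"
      have J: "J (X k) < I + e\<^sup>2 / 4" if "k \<ge> N" for k
      proof -
        have "inverse (real (Suc k)) \<le> inverse (real (Suc N))" using that by (simp add: divide_simps)
        with N have "inverse (real (Suc k)) < e\<^sup>2 / 4" by (rule order_le_less_trans[rotated])
        with X(2)[of k] show ?thesis by (meson add_strict_left_mono order.strict_trans)
      qed
      have "(nrm (dif (X m) (X n)))\<^sup>2 < e\<^sup>2"
        using par[OF X(1)[of m] X(1)[of n]] J[OF mn(1)] J[OF mn(2)] by (simp add: field_simps)
      then show "nrm (dif (X m) (X n)) < e" using e by (simp add: power_less_imp_less_base)
    qed
  qed simp
  then obtain u where u: "u \<in> V" "(\<lambda>n. nrm (dif (X n) u)) \<longlonglongrightarrow> 0" by blast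
  have eq: "ip u d = G d" if d: "d \<in> D" for d
  proof -
    define w where "w = ip u d - G d"
    have lim: "(\<lambda>n. ip (X n) d) \<longlonglongrightarrow> ip u d"
      by (rule linear_tendsto[where G="\<lambda>u. ip u d" and K="nrm d"])
        (use d u in \<open>auto simp: ip_comb cauchy_schwarz mult.commute[of "nrm d"]\<close>)
    \<comment> \<open>\<open>X n\<close> is within \<open>inverse (real (Suc n))\<close> of the
      infimum, hence moving it by any multiple of \<open>d\<close> lowers \<open>J\<close> by at
      most this amount; the inequality is the limit of these comparisons.\<close>
    have ineq: "0 \<le> (cmod \<alpha>)\<^sup>2 * (nrm d)\<^sup>2 + 2 * Re (cnj \<alpha> * w)" for \<alpha>
    proof (rule LIMSEQ_le)
      have "(\<lambda>n. - inverse (real (Suc n))) \<longlonglongrightarrow> - 0" by (intro tendsto_minus LIMSEQ_inverse_real_of_nat)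
      then show "(\<lambda>n. - inverse (real (Suc n))) \<longlonglongrightarrow> 0" by simp
      show "(\<lambda>n. (cmod \<alpha>)\<^sup>2 * (nrm d)\<^sup>2 + 2 * Re (cnj \<alpha> * (ip (X n) d - G d))) \<longlonglongrightarrow>
          (cmod \<alpha>)\<^sup>2 * (nrm d)\<^sup>2 + 2 * Re (cnj \<alpha> * w)"
        unfolding w_def by (intro tendsto_intros lim)
      show "\<exists>N. \<forall>n\<ge>N. - inverse (real (Suc n)) \<le> (cmod \<alpha>)\<^sup>2 * (nrm d)\<^sup>2 + 2 * Re (cnj \<alpha> * (ip (X n) d - G d))"
      proof (intro exI allI impI)
        fix n
        have "J (comb 1 (X n) \<alpha> d) \<ge> I" using X d by (intro I_le D_comb)
        moreover have "G (comb 1 (X n) \<alpha> d) = G (X n) + cnj \<alpha> * G d"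
          using G(1) X d by (simp add: antilinear_on_def)
        ultimately show "- inverse (real (Suc n)) \<le> (cmod \<alpha>)\<^sup>2 * (nrm d)\<^sup>2 + 2 * Re (cnj \<alpha> * (ip (X n) d - G d))"
          using X(2)[of n] nrm_comb_sq[of "X n" d 1 \<alpha>] d by (simp add: J_def algebra_simps)
      qed
    qed
    \<comment> \<open>With the multiple \<open>- ?s * w\<close> of \<open>d\<close> the quadratic
      term stays below the linear one, which forces \<open>w = 0\<close>.\<close>
    let ?s = "1 / ((nrm d)\<^sup>2 + 1)"
    have pos: "(nrm d)\<^sup>2 + 1 > 0" by (simp add: add_nonneg_pos)
    have "Re (cnj (- of_real s * w) * w) = - s * (cmod w)\<^sup>2" for s
      by (simp add: cmod_power2) (simp add: algebra_simps power2_eq_square)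
    then have "0 \<le> s\<^sup>2 * (cmod w)\<^sup>2 * (nrm d)\<^sup>2 - 2 * s * (cmod w)\<^sup>2" for s
      using ineq[of "- of_real s * w"] by (simp add: norm_mult power_mult_distrib)
    from this[of ?s]
    have "0 \<le> ?s * (cmod w)\<^sup>2 * (?s * (nrm d)\<^sup>2 - 2)" by (simp add: power2_eq_square algebra_simps)
    moreover have "?s * (nrm d)\<^sup>2 - 2 < 0" using pos by (simp add: divide_simps)
    moreover have "x \<le> 0" if "0 \<le> x * y" "y < 0" for x y :: real
      using that by (meson linorder_not_le mult_pos_neg)
    ultimately have "?s * (cmod w)\<^sup>2 \<le> 0" by blast
    then have "w = 0" using pos by (simp add: divide_le_0_iff)
    then show ?thesis by (simp add: w_def)
  qed
  have "nrm u \<le> K"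
  proof -
    have "(\<lambda>n. ip u (X n)) \<longlonglongrightarrow> ip u u"
      by (rule antilinear_tendsto[OF antilinear_ip bounded_ip]) (use u in auto)
    then have "(\<lambda>n. cmod (ip u (X n))) \<longlonglongrightarrow> cmod (ip u u)" by (rule tendsto_norm)
    moreover have "(\<lambda>n. K * nrm (X n)) \<longlonglongrightarrow> K * nrm u" by (intro tendsto_intros nrm_tendsto u) simp
    moreover have "cmod (ip u (X n)) \<le> K * nrm (X n)" for n
      using eq[OF X(1)] G(2) X(1) by (simp add: bounded_on_def)
    ultimately have "cmod (ip u u) \<le> K * nrm u" by (intro LIMSEQ_le) auto
    then have "nrm u * nrm u \<le> K * nrm u" using u by (simp add: norm_ip_self)
    then show ?thesis using K nrm_nonneg[OF u(1)] by (cases "nrm u = 0") auto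
  qed
  with u eq show ?thesis by blast
qed

end

section \<open>The Lax--Milgram theorem and perturbations of finite rank\<close>

context semi_hilbert
begin

text \<open>Richardson iteration: with \<open>T\<close> the Riesz representation of \<open>F\<close>
  and \<open>r\<close> that of \<open>G\<close>, the map \<open>x - \<rho> (T x - r)\<close>
  contracts differences by the factor \<open>sqrt (1 - \<alpha>\<^sup>2 / C\<^sup>2)\<close> for
  \<open>\<rho> = \<alpha> / C\<^sup>2\<close>. The norm bound follows by testing with
  approximations of the solution itself.\<close>

theorem lax_milgram:
  assumes F: "sesquilinear F" and \<alpha>: "\<alpha> > 0" and coercive: "\<And>u. u \<in> V \<Longrightarrow> \<alpha> * (nrm u)\<^sup>2 \<le> Re (F u u)"
    and G: "antilinear_on D G" "bounded_on D K G" and K: "K \<ge> 0"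
  shows "\<exists>u\<in>V. \<alpha> * nrm u \<le> K \<and> (\<forall>d\<in>D. F u d = G d)"
proof -
  obtain C0 where C0: "C0 > 0" "\<And>u v. u \<in> V \<Longrightarrow> v \<in> V \<Longrightarrow> cmod (F u v) \<le> C0 * nrm u * nrm v"
    using sesquilinear_bound[OF F] by blast
  \<comment> \<open>Adding \<open>\<alpha>\<close> makes the continuity constant strictly larger
    than the coercivity constant, so that the radicand in the contraction factor is
    positive.\<close>
  define C where "C = C0 + \<alpha>"
  have C: "C > 0" "C > \<alpha>" using C0 \<alpha> by (auto simp: C_def)
  have Fanti: "antilinear_on V (F u)" "bounded_on V (C * nrm u) (F u)" if "u \<in> V" for u
  proof -
    show "antilinear_on V (F u)" using F that by (auto simp: sesquilinear_def)
    have "C0 * (nrm u * nrm v) \<le> C * (nrm u * nrm v)" if "v \<in> V" for v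
      using that \<open>u \<in> V\<close> \<alpha> by (intro mult_right_mono) (auto simp: C_def)
    then show "bounded_on V (C * nrm u) (F u)"
      using C0(2)[OF that] by (fastforce simp: bounded_on_def mult.assoc)
  qed
  have Flin: "F (comb a u b v) w = a * F u w + b * F v w" if "u \<in> V" "v \<in> V" "w \<in> V" for a b u v w
    using F that by (auto simp: sesquilinear_def)
  have "\<exists>t\<in>V. nrm t \<le> C * nrm u \<and> (\<forall>d\<in>D. ip t d = F u d)" if "u \<in> V" for u
    using Fanti[OF that] D_subset C that
    by (intro riesz) (auto simp: antilinear_on_def bounded_on_def subset_iff)
  then obtain T where T: "\<And>u. u \<in> V \<Longrightarrow> T u \<in> V" "\<And>u d. u \<in> V \<Longrightarrow> d \<in> D \<Longrightarrow> ip (T u) d = F u d"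
    by metis
  have TV: "ip (T u) v = F u v" if "u \<in> V" "v \<in> V" for u v
    by (rule antilinear_eq_on_V[OF antilinear_ip bounded_ip Fanti]) (use T that in auto)
  obtain r where r: "r \<in> V" "\<And>d. d \<in> D \<Longrightarrow> ip r d = G d" using riesz[OF G K] by blast
  define \<rho> where "\<rho> = \<alpha> / C\<^sup>2"
  have \<rho>: "\<rho> > 0" using \<alpha> C by (simp add: \<rho>_def)
  obtain d0 where d0: "d0 \<in> D" using D_nonempty by blast
  define X where "X = rec_nat d0 (\<lambda>n x. comb 1 x (- of_real \<rho>) (dif (T x) r))"
  have XSuc: "X (Suc n) = comb 1 (X n) (- of_real \<rho>) (dif (T (X n)) r)" for n by (simp add: X_def)
  have X[simp]: "X n \<in> V" for n
  proof (induction n)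
    case 0 show ?case using d0 by (simp add: X_def)
  next
    case (Suc n) then show ?case unfolding XSuc using r T by (intro comb_closed) auto
  qed
  define q where "q = sqrt (1 - \<alpha>\<^sup>2 / C\<^sup>2)"
  have "\<alpha>\<^sup>2 < C\<^sup>2" using C \<alpha> by (intro power_strict_mono) auto
  then have ratio: "0 < \<alpha>\<^sup>2 / C\<^sup>2" "\<alpha>\<^sup>2 / C\<^sup>2 < 1" using C \<alpha> by auto
  then have q: "0 \<le> q" "q < 1" "q\<^sup>2 = 1 - \<alpha>\<^sup>2 / C\<^sup>2" by (auto simp: q_def real_sqrt_lt_1_iff)
  have contr: "nrm (dif (X (Suc (Suc n))) (X (Suc n))) \<le> q * nrm (dif (X (Suc n)) (X n))" for n
  proof (rule power2_le_imp_le)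
    define e where "e = dif (X (Suc n)) (X n)"
    define f where "f = T e"
    have e[simp]: "e \<in> V" unfolding e_def by (intro comb_closed X)
    have f[simp]: "f \<in> V" by (simp add: f_def T)
    \<comment> \<open>\<open>T\<close> consists of arbitrarily chosen representatives and is linear
      only up to norm 0, so both sides are compared through inner products.\<close>
    have "nrm (dif (X (Suc (Suc n))) (X (Suc n))) = nrm (comb 1 e (- of_real \<rho>) f)"
    proof (rule nrm_cong)
      fix w assume w: "w \<in> V"
      have "ip f w = ip (T (X (Suc n))) w - ip (T (X n)) w"
        using w unfolding f_def TV[OF e w] by (simp add: TV e_def Flin)
      moreover have xs: "ip (X (Suc n)) w = ip (X n) w - of_real \<rho> * (ip (T (X n)) w - ip r w)" for n
        using w r T by (simp add: XSuc ip_comb comb_closed algebra_simps)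
      moreover have "ip e w = ip (X (Suc n)) w - ip (X n) w" using w by (simp add: e_def ip_comb)
      ultimately show "ip (dif (X (Suc (Suc n))) (X (Suc n))) w = ip (comb 1 e (- of_real \<rho>) f) w"
        using w xs[of "Suc n"] xs[of n] by (simp add: ip_comb right_diff_distrib)
    qed (auto intro!: comb_closed)
    then have "(nrm (dif (X (Suc (Suc n))) (X (Suc n))))\<^sup>2 = (nrm e)\<^sup>2 + \<rho>\<^sup>2 * (nrm f)\<^sup>2 - 2 * \<rho> * Re (ip f e)"
      using nrm_comb_sq[OF e f, of 1 "- of_real \<rho>"] ip_sym[OF e f] \<rho> by simp
    also have "\<dots> \<le> (nrm e)\<^sup>2 + \<rho>\<^sup>2 * (C * nrm e)\<^sup>2 - 2 * \<rho> * (\<alpha> * (nrm e)\<^sup>2)"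
    proof -
      have "nrm f \<le> C * nrm e"
      proof (cases "nrm f = 0")
        case False
        have "nrm f * nrm f = cmod (ip f f)" by (simp add: norm_ip_self)
        also have "\<dots> \<le> C * nrm e * nrm f"
          using Fanti(2)[OF e] f by (simp add: f_def TV T bounded_on_def)
        finally show ?thesis using False nrm_nonneg[OF f] by simp
      qed (use C in simp)
      then have "(nrm f)\<^sup>2 \<le> (C * nrm e)\<^sup>2" by (intro power_mono) auto
      then have "\<rho>\<^sup>2 * (nrm f)\<^sup>2 \<le> \<rho>\<^sup>2 * (C * nrm e)\<^sup>2" by (intro mult_left_mono) auto
      moreover have "2 * \<rho> * (\<alpha> * (nrm e)\<^sup>2) \<le> 2 * \<rho> * Re (ip f e)"
        using coercive[OF e] \<rho> by (intro mult_left_mono) (auto simp: f_def TV)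
      ultimately show ?thesis by linarith
    qed
    \<comment> \<open>Here the choice of \<open>\<rho>\<close> enters:
      \<open>1 - 2 \<rho> \<alpha> + \<rho>\<^sup>2 C\<^sup>2\<close> takes its minimum,
      \<open>q\<^sup>2\<close>.\<close>
    also have "\<dots> = (q * nrm e)\<^sup>2"
      unfolding power_mult_distrib q(3) using C by (simp add: \<rho>_def power2_eq_square field_simps)
    finally show "(nrm (dif (X (Suc (Suc n))) (X (Suc n))))\<^sup>2 \<le> (q * nrm (dif (X (Suc n)) (X n)))\<^sup>2"
      by (simp add: e_def)
  qed (use q comb_closed in simp)
  have step: "nrm (dif (X (Suc n)) (X n)) \<le> nrm (dif (X 1) (X 0)) * q ^ n" for n
  proof (induction n)
    case (Suc n)
    have "nrm (dif (X (Suc (Suc n))) (X (Suc n))) \<le> q * nrm (dif (X (Suc n)) (X n))" by (rule contr)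
    also have "\<dots> \<le> q * (nrm (dif (X 1) (X 0)) * q ^ n)" using Suc q by (intro mult_left_mono) auto
    finally show ?case by (simp add: mult_ac)
  qed simp
  obtain u where u: "u \<in> V" "(\<lambda>n. nrm (dif (X n) u)) \<longlonglongrightarrow> 0"
    using complete[OF X geometric_Cauchy[OF X q(1,2) step]] by blast
  have eq: "F u d = G d" if d: "d \<in> D" for d
  proof -
    have ip_lim: "(\<lambda>n. ip (X n) d) \<longlonglongrightarrow> ip u d"
      by (rule linear_tendsto[where G="\<lambda>u. ip u d" and K="nrm d"])
        (use d u in \<open>auto simp: ip_comb cauchy_schwarz mult.commute[of "nrm d"]\<close>)
    have F_lim: "(\<lambda>n. F (X n) d) \<longlonglongrightarrow> F u d"
      by (rule linear_tendsto[where G="\<lambda>u. F u d" and K="C0 * nrm d"])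
        (use d u C0(2)[of _ d] in \<open>auto simp: Flin mult_ac\<close>)
    have "(\<lambda>n. ip (X (Suc n)) d) \<longlonglongrightarrow> ip u d - of_real \<rho> * (F u d - G d)"
    proof (rule Lim_transform_eventually)
      show "(\<lambda>n. ip (X n) d - of_real \<rho> * (F (X n) d - G d)) \<longlonglongrightarrow> ip u d - of_real \<rho> * (F u d - G d)"
        by (intro tendsto_intros ip_lim F_lim)
      show "\<forall>\<^sub>F n in sequentially. ip (X n) d - of_real \<rho> * (F (X n) d - G d) = ip (X (Suc n)) d"
        using d r T by (simp add: XSuc ip_comb comb_closed)
    qed
    with LIMSEQ_Suc[OF ip_lim] have "ip u d - of_real \<rho> * (F u d - G d) = ip u d"
      by (rule LIMSEQ_unique[rotated])
    then show ?thesis using \<rho> by simp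
  qed
  have "\<alpha> * nrm u \<le> K"
  proof -
    obtain Y where Y: "\<And>n. Y n \<in> D" "(\<lambda>n. nrm (dif (Y n) u)) \<longlonglongrightarrow> 0" using D_approx[OF u(1)] by blast
    have "(\<lambda>n. F u (Y n)) \<longlonglongrightarrow> F u u"
      by (rule antilinear_tendsto[OF Fanti]) (use u Y in auto)
    then have "(\<lambda>n. cmod (F u (Y n))) \<longlonglongrightarrow> cmod (F u u)" by (rule tendsto_norm)
    moreover have "(\<lambda>n. K * nrm (Y n)) \<longlonglongrightarrow> K * nrm u" by (intro tendsto_intros nrm_tendsto u Y) (simp add: Y)
    moreover have "cmod (F u (Y n)) \<le> K * nrm (Y n)" for n
      using eq[OF Y(1)] G(2) Y(1) by (simp add: bounded_on_def)
    ultimately have "cmod (F u u) \<le> K * nrm u" by (intro LIMSEQ_le) auto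
    then have "\<alpha> * nrm u * nrm u \<le> K * nrm u"
      using coercive[OF u(1)] complex_Re_le_cmod[of "F u u"] by (simp add: power2_eq_square mult.assoc)
    then show ?thesis using K nrm_nonneg[OF u(1)] by (cases "nrm u = 0") auto
  qed
  with u eq show ?thesis by blast
qed

text \<open>A form that becomes coercive after adding a form of finite rank is onto as soon as it is
  injective: the perturbation reduces the problem to a square linear system. This replaces the
  Fredholm alternative for compact perturbations.\<close>

theorem finite_rank_fredholm:
  fixes l :: "'j \<Rightarrow> 'a \<Rightarrow> complex"
  assumes F: "sesquilinear F" and J: "finite J"
    and l: "\<And>j u v \<alpha> \<beta>. j \<in> J \<Longrightarrow> u \<in> V \<Longrightarrow> v \<in> V \<Longrightarrow> l j (comb \<alpha> u \<beta> v) = \<alpha> * l j u + \<beta> * l j v"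
    and lb: "\<And>j u. j \<in> J \<Longrightarrow> u \<in> V \<Longrightarrow> cmod (l j u) \<le> L * nrm u"
    and \<alpha>: "\<alpha> > 0" and coercive: "\<And>u. u \<in> V \<Longrightarrow> \<alpha> * (nrm u)\<^sup>2 \<le> Re (F u u) + \<gamma> * (\<Sum>j\<in>J. (cmod (l j u))\<^sup>2)"
    and inj: "\<And>u. u \<in> V \<Longrightarrow> (\<And>d. d \<in> D \<Longrightarrow> F u d = 0) \<Longrightarrow> nrm u = 0"
  obtains C where "C \<ge> 0"
    "\<And>G K. antilinear_on D G \<Longrightarrow> bounded_on D K G \<Longrightarrow> K \<ge> 0 \<Longrightarrow>
        \<exists>u\<in>V. nrm u \<le> C * K \<and> (\<forall>d\<in>D. F u d = G d)"
proof -
  \<comment> \<open>The coercive form to which Lax--Milgram applies; \<open>F\<close> differs from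
    it by finite rank.\<close>
  define F' where "F' u v = F u v + of_real \<gamma> * (\<Sum>j\<in>J. l j u * cnj (l j v))" for u v
  obtain C0 where C0: "C0 > 0" "\<And>u v. u \<in> V \<Longrightarrow> v \<in> V \<Longrightarrow> cmod (F u v) \<le> C0 * nrm u * nrm v"
    using sesquilinear_bound[OF F] by blast
  have Flin: "F (comb a u b v) w = a * F u w + b * F v w" if "u \<in> V" "v \<in> V" "w \<in> V" for a b u v w
    using F that by (auto simp: sesquilinear_def)
  have Fanti: "F w (comb a u b v) = cnj a * F w u + cnj b * F w v" if "u \<in> V" "v \<in> V" "w \<in> V" for a b u v w
    using F that by (auto simp: sesquilinear_def antilinear_on_def)
  have lb': "cmod (l j u) \<le> \<bar>L\<bar> * nrm u" if "j \<in> J" "u \<in> V" for j u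
    using lb[OF that] mult_right_mono[of L "\<bar>L\<bar>" "nrm u"] that by fastforce
  have F': "sesquilinear F'"
    unfolding sesquilinear_def antilinear_on_def bounded_on_def
  proof (intro conjI ballI allI exI)
    fix u v w a b assume uvw: "u \<in> V" "v \<in> V" "w \<in> V"
    show "F' u (comb a v b w) = cnj a * F' u v + cnj b * F' u w"
      using uvw by (simp add: F'_def Fanti l sum.distrib sum_distrib_left algebra_simps)
    show "F' (comb a u b v) w = a * F' u w + b * F' v w"
      using uvw by (simp add: F'_def Flin l sum.distrib sum_distrib_left algebra_simps)
  next
    fix u v assume uv: "u \<in> V" "v \<in> V"
    have "cmod (\<Sum>j\<in>J. l j u * cnj (l j v)) \<le> (\<Sum>j\<in>J. (\<bar>L\<bar> * nrm u) * (\<bar>L\<bar> * nrm v))"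
      using uv by (intro sum_norm_le) (auto simp: norm_mult intro!: mult_mono lb')
    then have "cmod (of_real \<gamma> * (\<Sum>j\<in>J. l j u * cnj (l j v))) \<le> \<bar>\<gamma>\<bar> * (\<Sum>j\<in>J. (\<bar>L\<bar> * nrm u) * (\<bar>L\<bar> * nrm v))"
      unfolding norm_mult by (simp add: mult_left_mono)
    then show "cmod (F' u v) \<le> (C0 + \<bar>\<gamma>\<bar> * real (card J) * L\<^sup>2) * nrm u * nrm v"
      using C0(2)[OF uv] norm_triangle_ineq[of "F u v" "of_real \<gamma> * (\<Sum>j\<in>J. l j u * cnj (l j v))"]
      by (simp add: F'_def algebra_simps power2_eq_square)
  qed
  have coercive': "\<alpha> * (nrm u)\<^sup>2 \<le> Re (F' u u)" if "u \<in> V" for u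
  proof -
    have "(\<Sum>j\<in>J. l j u * cnj (l j u)) = of_real (\<Sum>j\<in>J. (cmod (l j u))\<^sup>2)"
      by (simp add: complex_norm_square del: of_real_power)
    then show ?thesis using coercive[OF that] by (simp add: F'_def)
  qed
  note lm = lax_milgram[OF F' \<alpha> coercive']
  have "\<exists>e\<in>V. \<forall>d\<in>D. F' e d = of_real \<gamma> * cnj (l j d)" if "j \<in> J" for j
  proof -
    have "\<exists>u\<in>V. \<alpha> * nrm u \<le> \<bar>\<gamma>\<bar> * \<bar>L\<bar> \<and> (\<forall>d\<in>D. F' u d = of_real \<gamma> * cnj (l j d))"
    proof (rule lm)
      show "antilinear_on D (\<lambda>d. of_real \<gamma> * cnj (l j d))"
        by (auto simp: antilinear_on_def l that algebra_simps)
      show "bounded_on D (\<bar>\<gamma>\<bar> * \<bar>L\<bar>) (\<lambda>d. of_real \<gamma> * cnj (l j d))"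
        using lb'[OF that] by (auto simp: bounded_on_def norm_mult mult.assoc intro!: mult_left_mono)
    qed simp_all
    then show ?thesis by blast
  qed
  then obtain e where e: "\<And>j. j \<in> J \<Longrightarrow> e j \<in> V" "\<And>j d. j \<in> J \<Longrightarrow> d \<in> D \<Longrightarrow> F' (e j) d = of_real \<gamma> * cnj (l j d)"
    by metis
  obtain d0 where d0: "d0 \<in> D" using D_nonempty by blast
  \<comment> \<open>The structure has no finite sums, so the combination
    \<open>w + \<Sum> t j * p j\<close> is built by iterating \<open>comb\<close> and is known only
    through its values under linear functionals.\<close>
  have comb_exists: "\<exists>u\<in>V. \<forall>G. (\<forall>x\<in>V. \<forall>y\<in>V. \<forall>a b. G (comb a x b y) = a * G x + b * G y) \<longrightarrow>
      G u = (G w :: complex) + (\<Sum>j\<in>I. t j * G (p j))" if "finite I" "w \<in> V" "\<forall>j\<in>I. p j \<in> V" for I w p and t :: "'j \<Rightarrow> complex"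
    using that
  proof (induction I rule: finite_induct)
    case empty
    then show ?case by auto
  next
    case (insert i I)
    then obtain u where u: "u \<in> V" "\<forall>G. (\<forall>x\<in>V. \<forall>y\<in>V. \<forall>a b. G (comb a x b y) = a * G x + b * G y) \<longrightarrow>
      G u = (G w :: complex) + (\<Sum>j\<in>I. t j * G (p j))" by blast
    show ?case
    proof (intro bexI[of _ "comb 1 u (t i) (p i)"] allI impI)
      fix G :: "'a \<Rightarrow> complex" assume G: "\<forall>x\<in>V. \<forall>y\<in>V. \<forall>a b. G (comb a x b y) = a * G x + b * G y"
      then have "G (comb 1 u (t i) (p i)) = G u + t i * G (p i)" using u insert by simp
      then show "G (comb 1 u (t i) (p i)) = G w + (\<Sum>j\<in>insert i I. t j * G (p j))"
        using u(2)[rule_format, OF G[rule_format]] insert by simp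
    qed (use u insert in \<open>auto intro: comb_closed\<close>)
  qed
  have F_in_F': "F u d = F' u d - of_real \<gamma> * (\<Sum>j\<in>J. l j u * cnj (l j d))" for u d
    by (simp add: F'_def)
  have l_dep: "l j u = 0" if "nrm u = 0" "u \<in> V" "j \<in> J" for u j
    using lb'[OF that(3,2)] that by simp
  have row: "(\<Sum>i\<in>J. ((if i = j then 1 else 0) - l j (e i)) * t i) = t j - (\<Sum>i\<in>J. t i * l j (e i))"
    if "j \<in> J" for j t
  proof -
    have "(\<Sum>i\<in>J. (if i = j then 1 else 0) * t i) = (\<Sum>i\<in>J. if i = j then t i else 0)"
      by (intro sum.cong) auto
    also have "\<dots> = t j" using J that by simp
    finally show ?thesis by (simp add: right_diff_distrib sum_subtractf mult.commute)
  qed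
  \<comment> \<open>\<open>A j i = \<delta>\<^sub>i\<^sub>j - l j (e i)\<close>; a kernel vector \<open>t\<close> yields the kernel element \<open>\<Sum> t i e i\<close> of \<open>F\<close>.\<close>
  have sys: "\<exists>t. \<forall>j\<in>J. (\<Sum>i\<in>J. ((if i = j then 1 else 0) - l j (e i)) * t i) = y j" for y
  proof (rule finite_linear_system_solvable[OF J J refl])
    fix t assume t: "\<And>j. j \<in> J \<Longrightarrow> (\<Sum>i\<in>J. ((if i = j then 1 else 0) - l j (e i)) * t i) = 0"
    have t': "t j = (\<Sum>i\<in>J. t i * l j (e i))" if "j \<in> J" for j
      using t[OF that] row[OF that] by simp
    obtain u where u: "u \<in> V" "\<And>G. (\<forall>x\<in>V. \<forall>y\<in>V. \<forall>a b. G (comb a x b y) = a * G x + b * G y) \<Longrightarrow>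
      G u = (G (dif d0 d0) :: complex) + (\<Sum>j\<in>J. t j * G (e j))"
      using comb_exists[OF J, of "dif d0 d0" e t] e d0 by (auto simp: comb_closed)
    have lu: "l j u = t j" if "j \<in> J" for j
      using u(2)[of "l j"] t'[OF that] that l d0 by simp
    have "F u d = 0" if d: "d \<in> D" for d
    proof -
      have "F' u d = (\<Sum>j\<in>J. t j * F' (e j) d)"
        using u(2)[of "\<lambda>u. F' u d"] F' d d0 by (simp add: sesquilinear_def)
      also have "\<dots> = of_real \<gamma> * (\<Sum>j\<in>J. t j * cnj (l j d))"
        using e(2) d by (simp add: sum_distrib_left mult_ac)
      finally show ?thesis using lu by (simp add: F_in_F')
    qed
    then have "nrm u = 0" using inj u by blast
    then show "\<forall>i\<in>J. t i = 0" using lu l_dep u by auto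
  qed
  \<comment> \<open>Solves the original equation for the functionals of the perturbation:
    \<open>p\<close> is \<open>e k\<close> plus a combination of the \<open>e i\<close>, with
    coefficients from the system with right-hand side \<open>l j (e k)\<close>.\<close>
  have "\<exists>p\<in>V. \<forall>d\<in>D. F p d = of_real \<gamma> * cnj (l k d)" if k: "k \<in> J" for k
  proof -
    obtain t where t: "\<And>j. j \<in> J \<Longrightarrow> (\<Sum>i\<in>J. ((if i = j then 1 else 0) - l j (e i)) * t i) = l j (e k)"
      using sys[of "\<lambda>j. l j (e k)"] by blast
    have t': "t j = l j (e k) + (\<Sum>i\<in>J. t i * l j (e i))" if "j \<in> J" for j
      using t[OF that] unfolding row[OF that] by (simp only: diff_eq_eq)
    obtain u where u: "u \<in> V" "\<And>G. (\<forall>x\<in>V. \<forall>y\<in>V. \<forall>a b. G (comb a x b y) = a * G x + b * G y) \<Longrightarrow>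
      G u = (G (e k) :: complex) + (\<Sum>j\<in>J. t j * G (e j))"
      using comb_exists[OF J, of "e k" e t] e k by auto
    have lu: "l j u = t j" if "j \<in> J" for j
      using u(2)[of "l j"] t'[OF that] that l by simp
    have "F u d = of_real \<gamma> * cnj (l k d)" if d: "d \<in> D" for d
    proof -
      have "F' u d = F' (e k) d + (\<Sum>j\<in>J. t j * F' (e j) d)"
        using u(2)[of "\<lambda>u. F' u d"] F' d by (simp add: sesquilinear_def)
      also have "\<dots> = of_real \<gamma> * cnj (l k d) + of_real \<gamma> * (\<Sum>j\<in>J. t j * cnj (l j d))"
        using e(2) d k by (simp add: sum_distrib_left mult_ac)
      finally show ?thesis using lu by (simp add: F_in_F')
    qed
    with u(1) show ?thesis by blast
  qed
  then obtain p where p: "\<And>j. j \<in> J \<Longrightarrow> p j \<in> V" "\<And>j d. j \<in> J \<Longrightarrow> d \<in> D \<Longrightarrow> F (p j) d = of_real \<gamma> * cnj (l j d)"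
    by metis
  \<comment> \<open>The solution will be \<open>w + \<Sum> l j w * p j\<close> with \<open>w\<close>
    the Lax--Milgram solution, of norm at most \<open>K / \<alpha>\<close>; this yields the
    constant.\<close>
  define C where "C = (1 + (\<Sum>j\<in>J. \<bar>L\<bar> * nrm (p j))) / \<alpha>"
  show thesis
  proof (rule that)
    show "C \<ge> 0" using p \<alpha> unfolding C_def
      by (intro divide_nonneg_nonneg add_nonneg_nonneg sum_nonneg mult_nonneg_nonneg) auto
    fix G K assume G: "antilinear_on D G" "bounded_on D K G" "K \<ge> (0::real)"
    obtain w where w: "w \<in> V" "\<alpha> * nrm w \<le> K" "\<And>d. d \<in> D \<Longrightarrow> F' w d = G d"
      using lm[OF _ G] by blast
    obtain u where u: "u \<in> V" "\<And>G. (\<forall>x\<in>V. \<forall>y\<in>V. \<forall>a b. G (comb a x b y) = a * G x + b * G y) \<Longrightarrow>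
      G u = (G w :: complex) + (\<Sum>j\<in>J. l j w * G (p j))"
      using comb_exists[OF J, of w p "\<lambda>j. l j w"] p w by auto
    have "F u d = G d" if d: "d \<in> D" for d
    proof -
      have "F u d = F w d + (\<Sum>j\<in>J. l j w * F (p j) d)"
        using u(2)[of "\<lambda>u. F u d"] Flin d by simp
      also have "\<dots> = F w d + of_real \<gamma> * (\<Sum>j\<in>J. l j w * cnj (l j d))"
        using p(2) d by (simp add: sum_distrib_left mult_ac)
      finally show ?thesis using w(3)[OF d] by (simp add: F'_def)
    qed
    moreover have "nrm u \<le> C * K"
    proof -
      have "cmod (ip u u) \<le> nrm w * nrm u + (\<Sum>j\<in>J. (\<bar>L\<bar> * nrm w) * (nrm (p j) * nrm u))"
      proof -
        have "cmod (ip u u) = cmod (ip w u + (\<Sum>j\<in>J. l j w * ip (p j) u))"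
          using u(2)[of "\<lambda>x. ip x u"] u(1) by (simp add: ip_comb)
        also have "\<dots> \<le> cmod (ip w u) + (\<Sum>j\<in>J. cmod (l j w * ip (p j) u))"
          by (intro norm_triangle_le add_mono norm_sum) simp
        also have "\<dots> \<le> nrm w * nrm u + (\<Sum>j\<in>J. (\<bar>L\<bar> * nrm w) * (nrm (p j) * nrm u))"
          unfolding norm_mult using p w u
          by (intro add_mono cauchy_schwarz sum_mono mult_mono lb') auto
        finally show ?thesis .
      qed
      also have "\<dots> = (C * \<alpha>) * nrm w * nrm u"
      proof -
        have "C * \<alpha> = 1 + (\<Sum>j\<in>J. \<bar>L\<bar> * nrm (p j))" using \<alpha> by (simp add: C_def)
        then show ?thesis by (simp add: algebra_simps sum_distrib_left)
      qed
      finally have "nrm u * nrm u \<le> C * (\<alpha> * nrm w) * nrm u"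
        using u by (simp add: norm_ip_self mult_ac)
      moreover have "C * (\<alpha> * nrm w) * nrm u \<le> C * K * nrm u"
        using w \<open>C \<ge> 0\<close> u by (intro mult_right_mono mult_left_mono) auto
      ultimately have "nrm u * nrm u \<le> C * K * nrm u" by linarith
      then show ?thesis using G \<open>C \<ge> 0\<close> nrm_nonneg[OF u(1)] by (cases "nrm u = 0") auto
    qed
    ultimately show "\<exists>u\<in>V. nrm u \<le> C * K \<and> (\<forall>d\<in>D. F u d = G d)" using u by blast
  qed
qed

end

text \<open>Produces both the jets modelling \<open>H\<^sup>1\<^sub>0\<close> and the closure of the
  test functions in \<open>L\<^sup>2\<close>. Completeness holds because a limit of approximable
  elements is approximated through a late member of the sequence.\<close>

lemma (in semi_inner) closure_semi_hilbert:
  assumes complete: "\<And>X. (\<And>n. X n \<in> V) \<Longrightarrow> (\<And>e. e > 0 \<Longrightarrow> \<exists>N. \<forall>m\<ge>N. \<forall>n\<ge>N. nrm (dif (X m) (X n)) < e) \<Longrightarrow>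
      \<exists>u\<in>V. (\<lambda>n. nrm (dif (X n) u)) \<longlonglongrightarrow> 0"
    and D: "D \<subseteq> V" "D \<noteq> {}" "\<And>u v \<alpha> \<beta>. u \<in> D \<Longrightarrow> v \<in> D \<Longrightarrow> comb \<alpha> u \<beta> v \<in> D"
  shows "semi_hilbert {u \<in> V. \<forall>e>0. \<exists>d\<in>D. nrm (dif u d) < e} comb ip D"
proof -
  define W where "W = {u \<in> V. \<forall>e>0. \<exists>d\<in>D. nrm (dif u d) < e}"
  have sub: "W \<subseteq> V" by (auto simp: W_def)
  have Wcomb: "comb \<alpha> p \<beta> q \<in> W" if p: "p \<in> W" and q: "q \<in> W" for \<alpha> p \<beta> q
  proof -
    have pq: "p \<in> V" "q \<in> V" using p q sub by auto
    have "\<exists>d\<in>D. nrm (dif (comb \<alpha> p \<beta> q) d) < e" if e: "e > 0" for e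
    proof -
      \<comment> \<open>The summand 1 keeps the divisor positive when both coefficients vanish and
        makes the final inequality strict.\<close>
      let ?c = "cmod \<alpha> + cmod \<beta> + 1"
      have c: "?c > 0" by (simp add: add_nonneg_pos)
      then have ec: "e / ?c > 0" using e by simp
      obtain d where d: "d \<in> D" "nrm (dif p d) < e / ?c" using p ec unfolding W_def by blast
      obtain d' where d': "d' \<in> D" "nrm (dif q d') < e / ?c" using q ec unfolding W_def by blast
      have dj: "d \<in> V" "d' \<in> V" using d d' D by auto
      have "nrm (dif (comb \<alpha> p \<beta> q) (comb \<alpha> d \<beta> d')) = nrm (comb \<alpha> (dif p d) \<beta> (dif q d'))"
        by (rule nrm_cong) (auto simp: pq dj comb_closed ip_comb algebra_simps)
      also have "\<dots> \<le> cmod \<alpha> * nrm (dif p d) + cmod \<beta> * nrm (dif q d')"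
        by (intro nrm_comb_le comb_closed pq dj)
      also have "\<dots> \<le> cmod \<alpha> * (e / ?c) + cmod \<beta> * (e / ?c)"
        using d d' by (intro add_mono mult_left_mono) auto
      also have "\<dots> = (?c - 1) * (e / ?c)" by (simp add: algebra_simps add_divide_distrib)
      also have "\<dots> = e - e / ?c"
      proof -
        have "(s - 1) * (e / s) = e - e / s" if "s > 0" for s :: real
          using that by (simp add: field_simps)
        from this[OF c] show ?thesis .
      qed
      also have "\<dots> < e" using ec by simp
      finally show ?thesis by (rule bexI[OF _ D(3)[OF d(1) d'(1)]])
    qed
    then show ?thesis using comb_closed[OF pq] by (simp add: W_def)
  qed
  interpret W: semi_inner W comb ip
  proof
    fix u v w \<alpha> \<beta>
    assume u: "u \<in> W"
    then have u': "u \<in> V" using sub by auto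
    show "Re (ip u u) \<ge> 0" by (rule ip_nonneg[OF u'])
    assume v: "v \<in> W"
    then have v': "v \<in> V" using sub by auto
    show "comb \<alpha> u \<beta> v \<in> W" by (rule Wcomb[OF u v])
    show "ip v u = cnj (ip u v)" by (rule ip_sym[OF u' v'])
    assume "w \<in> W"
    then have "w \<in> V" using sub by auto
    then show "ip (comb \<alpha> u \<beta> v) w = \<alpha> * ip u w + \<beta> * ip v w" by (rule ip_comb[OF u' v'])
  qed
  show ?thesis unfolding W_def[symmetric]
  proof
    show "D \<subseteq> W"
    proof
      fix d assume d: "d \<in> D"
      then have dV: "d \<in> V" using D(1) by auto
      have "nrm (dif d d) = 0" using nrm_comb_sq[OF dV dV, of 1 "-1"] by (simp add: ip_self[OF dV])
      with d dV show "d \<in> W" by (auto simp: W_def intro!: bexI[of _ d])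
    qed
    show "D \<noteq> {}" by (rule D(2))
    show "\<exists>d\<in>D. nrm (dif u d) < e" if "u \<in> W" "e > 0" for u e
      using that by (simp add: W_def)
    show "\<exists>u\<in>W. (\<lambda>n. nrm (dif (X n) u)) \<longlonglongrightarrow> 0"
      if X: "\<And>n. X n \<in> W" and C: "\<And>e. e > 0 \<Longrightarrow> \<exists>N. \<forall>m\<ge>N. \<forall>n\<ge>N. nrm (dif (X m) (X n)) < e" for X
    proof -
      have XV: "X n \<in> V" for n using X sub by blast
      obtain u where u: "u \<in> V" "(\<lambda>n. nrm (dif (X n) u)) \<longlonglongrightarrow> 0"
        using complete[OF XV C] by blast
      have "\<exists>d\<in>D. nrm (dif u d) < e" if e: "e > 0" for e
      proof -
        have "\<forall>\<^sub>F n in sequentially. nrm (dif (X n) u) < e / 2"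
          using u(2) e by (intro order_tendstoD) auto
        then obtain n where n: "nrm (dif (X n) u) < e / 2" by (auto simp: eventually_sequentially)
        have "e / 2 > 0" using e by simp
        then obtain d where d: "d \<in> D" "nrm (dif (X n) d) < e / 2"
          using X[of n] unfolding W_def by blast
        have dV: "d \<in> V" using d D by auto
        have "nrm (dif u d) < e"
          using nrm_dif_triangle[OF u(1) XV[of n] dV] nrm_dif_sym[OF u(1) XV[of n]] n d by simp
        with d show ?thesis by blast
      qed
      then have "u \<in> W" using u(1) by (simp add: W_def)
      with u(2) show ?thesis by blast
    qed
  qed (rule D(3))
qed

subsection \<open>Square-integrable functions\<close>

lemma L2_measurable: "u \<in> L2 S \<Longrightarrow> u \<in> borel_measurable (lebesgue_on S)"
  and L2_integrable: "u \<in> L2 S \<Longrightarrow> integrable (lebesgue_on S) (\<lambda>x. (cmod (u x))\<^sup>2)"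
  by (auto simp: L2_def)

lemma L2_I:
  assumes [measurable]: "u \<in> borel_measurable (lebesgue_on S)"
    and "integrable (lebesgue_on S) f" "\<And>x. x \<in> S \<Longrightarrow> (cmod (u x))\<^sup>2 \<le> f x"
  shows "u \<in> L2 S"
proof -
  have "integrable (lebesgue_on S) (\<lambda>x. (cmod (u x))\<^sup>2)"
  proof (rule Bochner_Integration.integrable_bound[OF assms(2)])
    show "AE x in lebesgue_on S. norm ((cmod (u x))\<^sup>2) \<le> norm (f x)"
      using assms(3) by (intro AE_I2) (fastforce intro: order_trans[OF _ abs_ge_self])
  qed measurable
  then show ?thesis by (simp add: L2_def)
qed

lemma L2_mult_integrable:
  assumes u: "u \<in> L2 S" and v: "v \<in> L2 S"
  shows "integrable (lebesgue_on S) (\<lambda>x. u x * v x)"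
proof (rule Bochner_Integration.integrable_bound)
  note [measurable] = L2_measurable[OF u] L2_measurable[OF v]
  show "integrable (lebesgue_on S) (\<lambda>x. (cmod (u x))\<^sup>2 + (cmod (v x))\<^sup>2)"
    using u v by (simp add: L2_def)
  show "(\<lambda>x. u x * v x) \<in> borel_measurable (lebesgue_on S)" by measurable
  show "AE x in lebesgue_on S. norm (u x * v x) \<le> norm ((cmod (u x))\<^sup>2 + (cmod (v x))\<^sup>2)"
  proof (rule AE_I2)
    fix x
    have "2 * (cmod (u x) * cmod (v x)) \<le> (cmod (u x))\<^sup>2 + (cmod (v x))\<^sup>2"
      using sum_squares_bound[of "cmod (u x)" "cmod (v x)"] by simp
    moreover have "0 \<le> cmod (u x) * cmod (v x)" by simp
    ultimately show "norm (u x * v x) \<le> norm ((cmod (u x))\<^sup>2 + (cmod (v x))\<^sup>2)"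
      unfolding norm_mult real_norm_def by linarith
  qed
qed

lemma cnj_borel[measurable]: "cnj \<in> borel_measurable borel"
  by (intro borel_measurable_continuous_onI continuous_intros)

lemma L2_cnj: "u \<in> L2 S \<Longrightarrow> (\<lambda>x. cnj (u x)) \<in> L2 S"
  by (auto simp: L2_def)

lemma L2_mult_cnj_integrable: "u \<in> L2 S \<Longrightarrow> v \<in> L2 S \<Longrightarrow> integrable (lebesgue_on S) (\<lambda>x. u x * cnj (v x))"
  by (rule L2_mult_integrable[OF _ L2_cnj])

lemma L2_bounded_mult:
  assumes [measurable]: "m \<in> borel_measurable (lebesgue_on S)" and m: "\<And>x. x \<in> S \<Longrightarrow> cmod (m x) \<le> B"
    and u: "u \<in> L2 S"
  shows "(\<lambda>x. m x * u x) \<in> L2 S"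
proof (rule L2_I)
  note [measurable] = L2_measurable[OF u]
  show "(\<lambda>x. m x * u x) \<in> borel_measurable (lebesgue_on S)" by measurable
  show "integrable (lebesgue_on S) (\<lambda>x. B\<^sup>2 * (cmod (u x))\<^sup>2)" using u by (simp add: L2_def)
  show "(cmod (m x * u x))\<^sup>2 \<le> B\<^sup>2 * (cmod (u x))\<^sup>2" if "x \<in> S" for x
    using m[OF that] unfolding norm_mult power_mult_distrib by (intro mult_right_mono power_mono) auto
qed

lemma L2_comb:
  assumes u: "u \<in> L2 S" and v: "v \<in> L2 S"
  shows "(\<lambda>x. \<alpha> * u x + \<beta> * v x) \<in> L2 S"
proof (rule L2_I)
  note [measurable] = L2_measurable[OF u] L2_measurable[OF v]
  show "(\<lambda>x. \<alpha> * u x + \<beta> * v x) \<in> borel_measurable (lebesgue_on S)" by measurable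
  show "integrable (lebesgue_on S) (\<lambda>x. 2 * ((cmod \<alpha>)\<^sup>2 * (cmod (u x))\<^sup>2) + 2 * ((cmod \<beta>)\<^sup>2 * (cmod (v x))\<^sup>2))"
    using u v by (simp add: L2_def)
  show "(cmod (\<alpha> * u x + \<beta> * v x))\<^sup>2 \<le> 2 * ((cmod \<alpha>)\<^sup>2 * (cmod (u x))\<^sup>2) + 2 * ((cmod \<beta>)\<^sup>2 * (cmod (v x))\<^sup>2)" for x
  proof -
    have "(cmod (\<alpha> * u x + \<beta> * v x))\<^sup>2 \<le> (cmod (\<alpha> * u x) + cmod (\<beta> * v x))\<^sup>2"
      by (intro power_mono norm_triangle_ineq) simp
    also have "\<dots> \<le> 2 * (cmod (\<alpha> * u x))\<^sup>2 + 2 * (cmod (\<beta> * v x))\<^sup>2"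
      using sum_squares_bound[of "cmod (\<alpha> * u x)" "cmod (\<beta> * v x)"] by (simp add: power2_sum)
    finally show ?thesis by (simp add: norm_mult power_mult_distrib)
  qed
qed

lemma L2_subset:
  assumes "S \<subseteq> T" "S \<in> sets lebesgue" "T \<in> sets lebesgue" "u \<in> L2 T"
  shows "u \<in> L2 S"
proof -
  have "integrable lebesgue (\<lambda>x. indicator T x *\<^sub>R (cmod (u x))\<^sup>2)"
    using assms by (simp add: L2_def integrable_restrict_space)
  then have "integrable lebesgue (\<lambda>x. indicator S x *\<^sub>R (indicator T x *\<^sub>R (cmod (u x))\<^sup>2))"
    by (rule integrable_mult_indicator[OF assms(2)])
  also have "(\<lambda>x. indicator S x *\<^sub>R (indicator T x *\<^sub>R (cmod (u x))\<^sup>2)) = (\<lambda>x. indicator S x *\<^sub>R (cmod (u x))\<^sup>2)"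
    using assms(1) by (auto simp: indicator_def fun_eq_iff)
  finally have "integrable (lebesgue_on S) (\<lambda>x. (cmod (u x))\<^sup>2)"
    using assms(2) by (simp add: integrable_restrict_space)
  moreover have "u \<in> borel_measurable (lebesgue_on S)"
    using measurable_restrict_mono[OF L2_measurable[OF assms(4)] assms(1)] .
  ultimately show ?thesis by (simp add: L2_def)
qed

lemma L2_bounded:
  assumes "S \<in> sets lebesgue" "bounded S" "u \<in> borel_measurable (lebesgue_on S)" "\<And>x. x \<in> S \<Longrightarrow> cmod (u x) \<le> B"
  shows "u \<in> L2 S"
proof (rule L2_I[where f="\<lambda>_. B\<^sup>2"])
  show "integrable (lebesgue_on S) (\<lambda>_. B\<^sup>2)"
    by (rule integrable_bounded_lebesgue_on[where B="B\<^sup>2"]) (use assms in auto)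
  show "(cmod (u x))\<^sup>2 \<le> B\<^sup>2" if "x \<in> S" for x using assms(4)[OF that] by (intro power_mono) auto
qed (use assms in auto)

lemma L2_imp_integrable:
  assumes "K \<in> sets lebesgue" "bounded K" "u \<in> L2 K"
  shows "integrable (lebesgue_on K) u"
  using L2_mult_integrable[OF assms(3) L2_bounded[OF assms(1,2), of "\<lambda>_. 1" 1]] by simp

lemma L2_loc_imp_L1_loc: "u \<in> L2_loc \<Omega> \<Longrightarrow> u \<in> L1_loc \<Omega>"
  by (auto simp: L2_loc_def L1_loc_def compact_imp_bounded lmeasurable_compact fmeasurableD intro!: L2_imp_integrable)

lemma L2_imp_L2_loc: "\<Omega> \<in> sets lebesgue \<Longrightarrow> u \<in> L2 \<Omega> \<Longrightarrow> u \<in> L2_loc \<Omega>"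
  by (simp add: L2_loc_def lmeasurable_compact fmeasurableD L2_subset[of _ \<Omega> u])

lemma test_L2: "v \<in> test_functions \<Omega> \<Longrightarrow> \<Omega> \<in> sets lebesgue \<Longrightarrow> v \<in> L2 \<Omega>"
proof -
  assume v: "v \<in> test_functions \<Omega>" "\<Omega> \<in> sets lebesgue"
  have "integrable (lebesgue_on \<Omega>) (\<lambda>x. Re (cnj (v x) * v x))"
    by (rule integrable_bounded_linear[OF bounded_linear_Re
          test_integrable[OF v(2) test_mult_smooth[OF smooth_cnj[OF test_smooth[OF v(1)]] v(1)]]])
  moreover have "Re (cnj (v x) * v x) = (cmod (v x))\<^sup>2" for x
    by (simp add: cmod_power2) (simp add: power2_eq_square)
  ultimately show ?thesis using v by (simp only: L2_def mem_Collect_eq smooth_measurable_lebesgue test_smooth)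
qed

text \<open>Local integrability gives measurability on compact sets; \<open>\<Omega>\<close> is a
  countable union of closed boxes.\<close>

lemma L1_loc_measurable:
  assumes "open \<Omega>" "u \<in> L1_loc \<Omega>"
  shows "u \<in> borel_measurable (lebesgue_on \<Omega>)"
proof -
  obtain C where C: "countable C" "C \<subseteq> Pow \<Omega>" "\<And>X. X \<in> C \<Longrightarrow> \<exists>a b. X = cbox a b" "\<Union>C = \<Omega>"
    using open_countable_Union_open_cbox[OF assms(1)] by metis
  show ?thesis
  proof (rule measurable_piecewise_restrict[OF C(1)])
    show "space (lebesgue_on \<Omega>) \<subseteq> \<Union>C" using C by simp
    fix X assume X: "X \<in> C"
    then obtain a b where ab: "X = cbox a b" using C by blast
    have X': "X \<subseteq> \<Omega>" using C X by auto
    show "X \<inter> space (lebesgue_on \<Omega>) \<in> sets (lebesgue_on \<Omega>)"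
      using ab X' assms(1) by (auto simp: sets_restrict_space_iff)
    have "restrict_space (lebesgue_on \<Omega>) X = lebesgue_on X"
      using X' ab assms(1) by (subst restrict_restrict_space) (auto simp: Int_absorb1)
    moreover have "u \<in> borel_measurable (lebesgue_on X)"
      using assms(2) X' ab by (auto simp: L1_loc_def intro!: borel_measurable_integrable)
    ultimately show "u \<in> restrict_space (lebesgue_on \<Omega>) X \<rightarrow>\<^sub>M borel" by simp
  qed
qed

abbreviation lcomb :: "complex \<Rightarrow> 'n::finite cfun \<Rightarrow> complex \<Rightarrow> 'n cfun \<Rightarrow> 'n cfun" where
  "lcomb \<alpha> u \<beta> v \<equiv> (\<lambda>x. \<alpha> * u x + \<beta> * v x)"

definition lip :: "(real^'n::finite) set \<Rightarrow> 'n cfun \<Rightarrow> 'n cfun \<Rightarrow> complex" where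
  "lip S u v = (LINT x|lebesgue_on S. u x * cnj (v x))"

lemma lip_self: "lip S u u = of_real (LINT x|lebesgue_on S. (cmod (u x))\<^sup>2)"
  unfolding lip_def
  by (simp only: complex_norm_square[symmetric] integral_complex_of_real)

lemma semi_inner_L2: "semi_inner (L2 S) lcomb (lip S)"
proof
  fix u v w :: "'a cfun" and \<alpha> \<beta>
  assume u: "u \<in> L2 S" 
  show "Re (lip S u u) \<ge> 0" unfolding lip_self by simp
  assume v: "v \<in> L2 S"
  show "lcomb \<alpha> u \<beta> v \<in> L2 S" by (rule L2_comb[OF u v])
  show "lip S v u = cnj (lip S u v)"
    unfolding lip_def Bochner_Integration.integral_cnj[symmetric] by (simp add: mult.commute)
  assume w: "w \<in> L2 S"
  show "lip S (lcomb \<alpha> u \<beta> v) w = \<alpha> * lip S u w + \<beta> * lip S v w"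
    using L2_mult_cnj_integrable[OF u w] L2_mult_cnj_integrable[OF v w]
    by (simp add: lip_def distrib_right mult.assoc)
qed

definition lnrm :: "(real^'n::finite) set \<Rightarrow> 'n cfun \<Rightarrow> real" where
  "lnrm S u = sqrt (LINT x|lebesgue_on S. (cmod (u x))\<^sup>2)"

interpretation L2: semi_inner "L2 S" lcomb "lip S"
  rewrites "semi_inner.nrm (lip S) = lnrm S"
  for S :: "(real^'n::finite) set"
proof -
  show "semi_inner (L2 S) lcomb (lip S)" by (rule semi_inner_L2)
  then show "semi_inner.nrm (lip S) = lnrm S"
    by (auto simp: fun_eq_iff semi_inner.nrm_def lnrm_def lip_self)
qed

lemma lnrm_sq: "(lnrm S u)\<^sup>2 = (LINT x|lebesgue_on S. (cmod (u x))\<^sup>2)"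
  by (simp add: lnrm_def)

lemma lnrm_nonneg[simp]: "lnrm S u \<ge> 0"
  by (simp add: lnrm_def)

lemma lnrm_le_iff: "B \<ge> 0 \<Longrightarrow> lnrm S u \<le> B \<longleftrightarrow> (LINT x|lebesgue_on S. (cmod (u x))\<^sup>2) \<le> B\<^sup>2"
  by (metis lnrm_nonneg lnrm_sq power2_le_imp_le power_mono)

lemma lnrm_eq_0_iff: "u \<in> L2 S \<Longrightarrow> lnrm S u = 0 \<longleftrightarrow> (AE x in lebesgue_on S. u x = 0)"
proof -
  assume u: "u \<in> L2 S"
  have "lnrm S u = 0 \<longleftrightarrow> (LINT x|lebesgue_on S. (cmod (u x))\<^sup>2) = 0"
    using lnrm_sq[of S u] by (metis power_zero_numeral zero_eq_power2)
  also have "\<dots> \<longleftrightarrow> (AE x in lebesgue_on S. (cmod (u x))\<^sup>2 = 0)"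
    by (rule integral_nonneg_eq_0_iff_AE[OF L2_integrable[OF u]]) simp
  finally show ?thesis by simp
qed

lemma lnrm_cong_AE:
  assumes "u \<in> L2 S" "v \<in> L2 S" "AE x in lebesgue_on S. u x = v x"
  shows "lnrm S u = lnrm S v"
proof -
  have "(LINT x|lebesgue_on S. (cmod (u x))\<^sup>2) = (LINT x|lebesgue_on S. (cmod (v x))\<^sup>2)"
    using assms by (intro integral_cong_AE) (auto simp: L2_def)
  then show ?thesis using lnrm_sq[of S] by (metis lnrm_nonneg power2_eq_imp_eq)
qed

lemma lnrm_bound:
  assumes "S \<in> sets lebesgue" "bounded S" "\<And>x. x \<in> S \<Longrightarrow> cmod (u x) \<le> B" "B \<ge> 0" "u \<in> L2 S"
  shows "lnrm S u \<le> B * sqrt (measure lebesgue S)"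
proof -
  have S: "S \<in> lmeasurable" using assms by (simp add: bounded_set_imp_lmeasurable)
  interpret finite_measure "lebesgue_on S" using assms by (intro finite_measure_lebesgue_on)
  have "(LINT x|lebesgue_on S. (cmod (u x))\<^sup>2) \<le> (LINT x|lebesgue_on S. B\<^sup>2)"
    using assms by (intro integral_mono) (auto simp: L2_def intro!: power_mono)
  also have "\<dots> = B\<^sup>2 * measure lebesgue S"
    using assms by (simp add: measure_restrict_space)
  also have "\<dots> = (B * sqrt (measure lebesgue S))\<^sup>2" by (simp add: power_mult_distrib)
  finally show ?thesis using assms by (subst lnrm_le_iff) auto
qed

lemma lnrm_mono_set:
  assumes "S \<subseteq> T" "S \<in> sets lebesgue" "T \<in> sets lebesgue" "u \<in> L2 T"
  shows "lnrm S u \<le> lnrm T u"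
proof -
  have "(LINT x|lebesgue_on S. (cmod (u x))\<^sup>2) \<le> (LINT x|lebesgue_on T. (cmod (u x))\<^sup>2)"
    using assms L2_integrable[OF L2_subset[OF assms]] L2_integrable[OF assms(4)]
    by (auto simp: integral_restrict_space integrable_restrict_space indicator_def intro!: integral_mono)
  then show ?thesis by (subst lnrm_le_iff) (auto simp: lnrm_sq)
qed

text \<open>The squares of the increments, weighted by \<open>2 ^ k\<close>, still have summable
  integrals, so their series is finite almost everywhere. Where it is finite,
  \<open>d \<le> (1/2) ^ k + 2 ^ k * d\<^sup>2\<close> makes the increments themselves
  summable.\<close>

lemma L2_AE_convergent:
  assumes X: "\<And>n. X n \<in> L2 S"
    and step: "\<And>k. lnrm S (\<lambda>x. X (Suc k) x - X k x) \<le> C * (1/2) ^ k"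
  shows "AE x in lebesgue_on S. convergent (\<lambda>k. X k x)"
proof -
  let ?M = "lebesgue_on S"
  have meas[measurable]: "X n \<in> borel_measurable ?M" for n by (rule L2_measurable[OF X])
  define d where "d k x = cmod (X (Suc k) x - X k x)" for k x
  have [measurable]: "d k \<in> borel_measurable ?M" for k unfolding d_def by measurable
  have XX: "(\<lambda>x. X m x - X n x) \<in> L2 S" for m n using L2_comb[OF X X, of 1 m "-1" n] by simp
  have nn: "(\<integral>\<^sup>+x. ennreal ((d k x)\<^sup>2) \<partial>?M) = ennreal ((lnrm S (\<lambda>x. X (Suc k) x - X k x))\<^sup>2)" for k
    unfolding lnrm_sq d_def using L2_integrable[OF XX] by (intro nn_integral_eq_integral) auto
  have dint: "(\<integral>\<^sup>+x. ennreal (2 ^ k * (d k x)\<^sup>2) \<partial>?M) \<le> ennreal (C\<^sup>2 * (1/2) ^ k)" for k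
  proof -
    have "(\<integral>\<^sup>+x. ennreal (2 ^ k * (d k x)\<^sup>2) \<partial>?M) = ennreal (2 ^ k) * (\<integral>\<^sup>+x. ennreal ((d k x)\<^sup>2) \<partial>?M)"
      by (subst nn_integral_cmult[symmetric]) (auto simp: ennreal_mult)
    also have "\<dots> = ennreal (2 ^ k * (lnrm S (\<lambda>x. X (Suc k) x - X k x))\<^sup>2)"
      unfolding nn by (simp add: ennreal_mult)
    also have "\<dots> \<le> ennreal (2 ^ k * (C * (1/2) ^ k)\<^sup>2)"
      by (intro ennreal_leI mult_left_mono power_mono step) auto
    also have "2 ^ k * (C * (1/2) ^ k)\<^sup>2 = C\<^sup>2 * (1/2 :: real) ^ k"
      by (simp add: power2_eq_square power_divide)
    finally show ?thesis .
  qed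
  have "(\<integral>\<^sup>+x. (\<Sum>k. ennreal (2 ^ k * (d k x)\<^sup>2)) \<partial>?M) = (\<Sum>k. \<integral>\<^sup>+x. ennreal (2 ^ k * (d k x)\<^sup>2) \<partial>?M)"
    by (rule nn_integral_suminf) measurable
  also have "\<dots> \<le> (\<Sum>k. ennreal (C\<^sup>2 * (1/2) ^ k))" by (intro suminf_le dint) auto
  also have "\<dots> = ennreal (\<Sum>k. C\<^sup>2 * (1/2) ^ k)" by (intro suminf_ennreal2 summable_mult) auto
  finally have "(\<integral>\<^sup>+x. (\<Sum>k. ennreal (2 ^ k * (d k x)\<^sup>2)) \<partial>?M) \<noteq> \<infinity>"
    unfolding infinity_ennreal_def by (rule neq_top_trans[OF ennreal_neq_top])
  then have "AE x in ?M. (\<Sum>k. ennreal (2 ^ k * (d k x)\<^sup>2)) \<noteq> \<infinity>"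
    by (intro nn_integral_PInf_AE) measurable
  then show ?thesis
  proof eventually_elim
    case (elim x)
    have s1: "summable (\<lambda>k. 2 ^ k * (d k x)\<^sup>2)"
      by (rule summable_suminf_not_top) (use elim in auto)
    have "summable (\<lambda>k. d k x)"
    proof (rule summable_comparison_test')
      show "summable (\<lambda>k. (1/2)^k + 2 ^ k * (d k x)\<^sup>2)" by (intro summable_add s1 summable_geometric) auto
      fix k
      have "(d k x)\<^sup>2 = ((1/2)^k) * (2 ^ k * (d k x)\<^sup>2)" by (simp add: power_divide)
      also have "\<dots> \<le> ((1/2)^k + 2 ^ k * (d k x)\<^sup>2)\<^sup>2"
      proof -
        have "a * b \<le> (a + b)\<^sup>2" if "a \<ge> 0" "b \<ge> 0" for a b :: real
          using mult_nonneg_nonneg[OF that] zero_le_power2[of a] zero_le_power2[of b]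
          unfolding power2_sum by linarith
        then show ?thesis by simp
      qed
      finally have "d k x \<le> (1/2)^k + 2 ^ k * (d k x)\<^sup>2" by (rule power2_le_imp_le) auto
      then show "norm (d k x) \<le> (1/2)^k + 2 ^ k * (d k x)\<^sup>2" by (simp add: d_def)
    qed
    then have "summable (\<lambda>k. X (Suc k) x - X k x)" unfolding d_def by (rule summable_norm_cancel)
    then have "convergent (\<lambda>k. \<Sum>i<k. X (Suc i) x - X i x)" by (simp add: summable_iff_convergent)
    then have "convergent (\<lambda>k. (\<Sum>i<k. X (Suc i) x - X i x) + X 0 x)"
      by (intro convergent_add convergent_const)
    also have "(\<lambda>k. (\<Sum>i<k. X (Suc i) x - X i x) + X 0 x) = (\<lambda>k. X k x)"
      using sum_lessThan_telescope[of "\<lambda>k. X k x"] by simp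
    finally show ?case .
  qed
qed

text \<open>Fatou's lemma along the indices \<open>r k\<close> bounds the distance from the limit
  function to \<open>X n\<close>. Taking the limit function as given allows it to be a prescribed
  representative.\<close>

lemma L2_limit_AE:
  assumes X: "\<And>n. X n \<in> L2 S"
    and Cauchy: "\<And>e. e > 0 \<Longrightarrow> \<exists>N. \<forall>m\<ge>N. \<forall>n\<ge>N. lnrm S (\<lambda>x. X m x - X n x) < e"
    and r: "\<And>k. r k \<ge> (k::nat)" and u_meas[measurable]: "u \<in> borel_measurable (lebesgue_on S)"
    and conv: "AE x in lebesgue_on S. (\<lambda>k. X (r k) x) \<longlonglongrightarrow> u x"
  shows "u \<in> L2 S" and "(\<lambda>n. lnrm S (\<lambda>x. X n x - u x)) \<longlonglongrightarrow> 0"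
proof -
  let ?M = "lebesgue_on S"
  have meas[measurable]: "X n \<in> borel_measurable ?M" for n by (rule L2_measurable[OF X])
  have XX: "(\<lambda>x. X m x - X n x) \<in> L2 S" for m n using L2_comb[OF X X, of 1 m "-1" n] by simp
  have nn: "(\<integral>\<^sup>+x. ennreal ((cmod (X m x - X n x))\<^sup>2) \<partial>?M) = ennreal ((lnrm S (\<lambda>x. X m x - X n x))\<^sup>2)" for m n
    unfolding lnrm_sq using L2_integrable[OF XX] by (intro nn_integral_eq_integral) auto
  have fatou: "(\<integral>\<^sup>+x. ennreal ((cmod (u x - X n x))\<^sup>2) \<partial>?M) \<le> ennreal (e\<^sup>2)"
    if n: "\<And>m. m \<ge> n0 \<Longrightarrow> lnrm S (\<lambda>x. X m x - X n x) < e" and e: "e > 0" for n n0 e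
  proof -
    have "(\<integral>\<^sup>+x. ennreal ((cmod (u x - X n x))\<^sup>2) \<partial>?M) = (\<integral>\<^sup>+x. liminf (\<lambda>k. ennreal ((cmod (X (r k) x - X n x))\<^sup>2)) \<partial>?M)"
    proof (rule nn_integral_cong_AE)
      show "AE x in ?M. ennreal ((cmod (u x - X n x))\<^sup>2) = liminf (\<lambda>k. ennreal ((cmod (X (r k) x - X n x))\<^sup>2))"
        using conv
      proof eventually_elim
        case (elim x)
        then have "(\<lambda>k. ennreal ((cmod (X (r k) x - X n x))\<^sup>2)) \<longlonglongrightarrow> ennreal ((cmod (u x - X n x))\<^sup>2)"
          by (intro tendsto_intros)
        then show ?case by (rule lim_imp_Liminf[OF sequentially_bot, symmetric])
      qed
    qed
    also have "\<dots> \<le> liminf (\<lambda>k. \<integral>\<^sup>+x. ennreal ((cmod (X (r k) x - X n x))\<^sup>2) \<partial>?M)"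
      by (rule nn_integral_liminf) measurable
    also have "\<dots> \<le> ennreal (e\<^sup>2)"
    proof (rule Liminf_le)
      show "\<forall>\<^sub>F k in sequentially. (\<integral>\<^sup>+x. ennreal ((cmod (X (r k) x - X n x))\<^sup>2) \<partial>?M) \<le> ennreal (e\<^sup>2)"
        unfolding nn eventually_sequentially
      proof (intro exI allI impI ennreal_leI power_mono)
        fix k assume "k \<ge> n0"
        then show "lnrm S (\<lambda>x. X (r k) x - X n x) \<le> e" using n[of "r k"] r[of k] by simp
      qed simp
    qed simp
    finally show ?thesis .
  qed
  have diff: "(\<lambda>x. u x - X n x) \<in> L2 S \<and> lnrm S (\<lambda>x. u x - X n x) \<le> e"
    if n: "\<And>m. m \<ge> n0 \<Longrightarrow> lnrm S (\<lambda>x. X m x - X n x) < e" and e: "e > 0" for n n0 e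
  proof
    have "integrable ?M (\<lambda>x. (cmod (u x - X n x))\<^sup>2)"
      using le_less_trans[OF fatou[OF n e] ennreal_less_top] by (intro integrableI_bounded) auto
    then show L: "(\<lambda>x. u x - X n x) \<in> L2 S" by (simp add: L2_def)
    have "ennreal (LINT x|?M. (cmod (u x - X n x))\<^sup>2) \<le> ennreal (e\<^sup>2)"
      using fatou[OF n e] nn_integral_eq_integral[OF L2_integrable[OF L]] by simp
    then show "lnrm S (\<lambda>x. u x - X n x) \<le> e"
      using e by (subst lnrm_le_iff) auto
  qed
  obtain n1 where n1: "\<And>m n. m \<ge> n1 \<Longrightarrow> n \<ge> n1 \<Longrightarrow> lnrm S (\<lambda>x. X m x - X n x) < 1" using Cauchy[of 1] by auto
  have "(\<lambda>x. u x - X n1 x) \<in> L2 S" using diff[of n1 n1 1] n1 by auto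
  from L2_comb[OF this X, of 1 1 n1] have uL2: "u \<in> L2 S" by simp
  then show "u \<in> L2 S" .
  show "(\<lambda>n. lnrm S (\<lambda>x. X n x - u x)) \<longlonglongrightarrow> 0"
  proof (rule LIMSEQ_I)
    fix e :: real assume e: "e > 0"
    obtain n2 where n2: "\<And>m n. m \<ge> n2 \<Longrightarrow> n \<ge> n2 \<Longrightarrow> lnrm S (\<lambda>x. X m x - X n x) < e/2" using Cauchy[of "e/2"] e by auto
    show "\<exists>no. \<forall>n\<ge>no. norm (lnrm S (\<lambda>x. X n x - u x) - 0) < e"
    proof (intro exI allI impI)
      fix n assume "n \<ge> n2"
      then have "lnrm S (\<lambda>x. u x - X n x) \<le> e/2" using diff[of n2 n "e/2"] n2 e by auto
      moreover have "lnrm S (\<lambda>x. X n x - u x) = lnrm S (\<lambda>x. u x - X n x)"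
        using L2.nrm_dif_sym[OF X uL2, of n] by simp
      ultimately show "norm (lnrm S (\<lambda>x. X n x - u x) - 0) < e" using e by simp
    qed
  qed
qed

lemma L2_complete:
  assumes X: "\<And>n. X n \<in> L2 S"
    and Cauchy: "\<And>e. e > 0 \<Longrightarrow> \<exists>N. \<forall>m\<ge>N. \<forall>n\<ge>N. lnrm S (\<lambda>x. X m x - X n x) < e"
  shows "\<exists>u\<in>L2 S. (\<lambda>n. lnrm S (\<lambda>x. X n x - u x)) \<longlonglongrightarrow> 0"
proof -
  have meas[measurable]: "X n \<in> borel_measurable (lebesgue_on S)" for n by (rule L2_measurable[OF X])
  have "\<exists>N. \<forall>m\<ge>N. \<forall>n\<ge>N. lnrm S (\<lambda>x. X m x - X n x) < (1/2) ^ k" for k by (rule Cauchy) simp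
  then obtain N where N: "\<And>k m n. m \<ge> N k \<Longrightarrow> n \<ge> N k \<Longrightarrow> lnrm S (\<lambda>x. X m x - X n x) < (1/2) ^ k" by metis
  \<comment> \<open>Summing the thresholds makes both \<open>r k\<close> and
    \<open>r (Suc k)\<close> at least \<open>N k\<close> without monotonicity of \<open>N\<close>;
    the summand \<open>k\<close> makes the indices tend to infinity.\<close>
  define r where "r k = (\<Sum>i\<le>k. N i) + k" for k
  have rN: "r k \<ge> N k" "r (Suc k) \<ge> N k" "r k \<ge> k" for k
    unfolding r_def using member_le_sum[of k "{..k}" N] by (auto)
  have "AE x in lebesgue_on S. convergent (\<lambda>k. X (r k) x)"
    using N[OF rN(2,1)] by (intro L2_AE_convergent[where C=1] X) (simp add: less_imp_le)
  define u where "u x = lim (\<lambda>k. X (r k) x)" for x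
  from \<open>AE x in lebesgue_on S. convergent (\<lambda>k. X (r k) x)\<close>
  have conv: "AE x in lebesgue_on S. (\<lambda>k. X (r k) x) \<longlonglongrightarrow> u x"
    unfolding u_def by eventually_elim (simp add: convergent_LIMSEQ_iff)
  have m: "u \<in> borel_measurable (lebesgue_on S)"
    unfolding u_def by (rule borel_measurable_lim_metric) measurable
  have "u \<in> L2 S" by (rule L2_limit_AE(1)[OF X _ rN(3) m conv]) (rule Cauchy)
  moreover have "(\<lambda>n. lnrm S (\<lambda>x. X n x - u x)) \<longlonglongrightarrow> 0"
    by (rule L2_limit_AE(2)[OF X _ rN(3) m conv]) (rule Cauchy)
  ultimately show ?thesis by (intro bexI[of _ u])
qed

subsection \<open>Jets and the space \<open>H\<^sup>1\<^sub>0\<close>\<close>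

text \<open>A function is handled together with its weak gradient: the index \<open>None\<close> stands for the
  function, \<open>Some k\<close> for the derivative in direction \<open>k\<close>.\<close>

type_synonym 'n jet = "'n option \<Rightarrow> 'n cfun"

text \<open>The components need not be derivatives of one another: in this way completeness is
  inherited from \<open>L2\<close>, and the differential relation is recovered later for limits of
  test jets.\<close>

definition jets :: "(real^'n::finite) set \<Rightarrow> 'n jet set" where
  "jets S = {p. \<forall>i. p i \<in> L2 S}"

abbreviation jcomb :: "complex \<Rightarrow> 'n::finite jet \<Rightarrow> complex \<Rightarrow> 'n jet \<Rightarrow> 'n jet" where
  "jcomb \<alpha> p \<beta> q \<equiv> (\<lambda>i x. \<alpha> * p i x + \<beta> * q i x)"

definition jip :: "(real^'n::finite) set \<Rightarrow> 'n jet \<Rightarrow> 'n jet \<Rightarrow> complex" where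
  "jip S p q = (\<Sum>i\<in>UNIV. lip S (p i) (q i))"

definition jnrm :: "(real^'n::finite) set \<Rightarrow> 'n jet \<Rightarrow> real" where
  "jnrm S p = sqrt (\<Sum>i\<in>UNIV. (lnrm S (p i))\<^sup>2)"

lemma jetsD: "p \<in> jets S \<Longrightarrow> p i \<in> L2 S"
  by (simp add: jets_def)

lemma jip_self: "jip S p p = of_real (\<Sum>i\<in>UNIV. (lnrm S (p i))\<^sup>2)"
  by (simp add: jip_def lip_self lnrm_sq del: of_real_power)

lemma semi_inner_jets: "semi_inner (jets S) jcomb (jip S)"
proof
  fix p q r :: "'a jet" and \<alpha> \<beta>
  assume p: "p \<in> jets S"
  show "Re (jip S p p) \<ge> 0" unfolding jip_self by (simp add: sum_nonneg)
  assume q: "q \<in> jets S"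
  show "jcomb \<alpha> p \<beta> q \<in> jets S" using p q by (simp add: jets_def L2_comb)
  show "jip S q p = cnj (jip S p q)"
    unfolding jip_def cnj_sum by (intro sum.cong refl L2.ip_sym jetsD p q)
  assume r: "r \<in> jets S"
  have "lip S (lcomb \<alpha> (p i) \<beta> (q i)) (r i) = \<alpha> * lip S (p i) (r i) + \<beta> * lip S (q i) (r i)" for i
    by (intro L2.ip_comb jetsD p q r)
  then show "jip S (jcomb \<alpha> p \<beta> q) r = \<alpha> * jip S p r + \<beta> * jip S q r"
    by (simp add: jip_def sum.distrib sum_distrib_left)
qed

lemma nrm_jip: "semi_inner.nrm (jip S) = jnrm S"
  using semi_inner_jets[of S] by (auto simp: fun_eq_iff semi_inner.nrm_def jnrm_def jip_self)

interpretation jets: semi_inner "jets S" jcomb "jip S"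
  rewrites "semi_inner.nrm (jip S) = jnrm S"
  for S :: "(real^'n::finite) set"
  by (rule semi_inner_jets) (rule nrm_jip)

lemma jnrm_sq: "(jnrm S p)\<^sup>2 = (\<Sum>i\<in>UNIV. (lnrm S (p i))\<^sup>2)"
  by (simp add: jnrm_def sum_nonneg)

lemma jnrm_nonneg[simp]: "jnrm S p \<ge> 0"
  by (simp add: jnrm_def sum_nonneg)

lemma lnrm_le_jnrm: "lnrm S (p i) \<le> jnrm S p"
proof (rule power2_le_imp_le)
  show "(lnrm S (p i))\<^sup>2 \<le> (jnrm S p)\<^sup>2"
    unfolding jnrm_sq by (rule member_le_sum) auto
qed simp

lemma jnrm_le_sum: "jnrm S p \<le> (\<Sum>i\<in>UNIV. lnrm S (p i))"
  unfolding jnrm_def by (rule order_trans[OF L2_set_le_sum[unfolded L2_set_def]]) auto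

lemma jnrm_cong_AE:
  assumes "p \<in> jets S" "q \<in> jets S" "\<And>i. AE x in lebesgue_on S. p i x = q i x"
  shows "jnrm S p = jnrm S q"
  unfolding jnrm_def using lnrm_cong_AE[OF jetsD[OF assms(1)] jetsD[OF assms(2)] assms(3)] by simp

lemma jnrm_eq_0_iff: "p \<in> jets S \<Longrightarrow> jnrm S p = 0 \<longleftrightarrow> (\<forall>i. AE x in lebesgue_on S. p i x = 0)"
proof -
  assume p: "p \<in> jets S"
  have "jnrm S p = 0 \<longleftrightarrow> (\<Sum>i\<in>UNIV. (lnrm S (p i))\<^sup>2) = 0" by (simp add: jnrm_def)
  also have "\<dots> \<longleftrightarrow> (\<forall>i. lnrm S (p i) = 0)" by (subst sum_nonneg_eq_0_iff) auto
  finally show ?thesis using lnrm_eq_0_iff[OF jetsD[OF p]] by simp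
qed

lemma jets_complete:
  assumes X: "\<And>n. X n \<in> jets S"
    and C: "\<And>e. e > 0 \<Longrightarrow> \<exists>N. \<forall>m\<ge>N. \<forall>n\<ge>N. jnrm S (jcomb 1 (X m) (-1) (X n)) < e"
  shows "\<exists>u\<in>jets S. (\<lambda>n. jnrm S (jcomb 1 (X n) (-1) u)) \<longlonglongrightarrow> 0"
proof -
  have "\<exists>u\<in>L2 S. (\<lambda>n. lnrm S (\<lambda>x. X n i x - u x)) \<longlonglongrightarrow> 0" for i
  proof (rule L2_complete)
    show "X n i \<in> L2 S" for n using X by (rule jetsD)
    fix e :: real assume "e > 0"
    from C[OF this] obtain N where N: "\<forall>m\<ge>N. \<forall>n\<ge>N. jnrm S (jcomb 1 (X m) (-1) (X n)) < e" by blast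
    show "\<exists>N. \<forall>m\<ge>N. \<forall>n\<ge>N. lnrm S (\<lambda>x. X m i x - X n i x) < e"
    proof (intro exI[of _ N] allI impI)
      fix m n assume mn: "N \<le> m" "N \<le> n"
      have "jnrm S (jcomb 1 (X m) (-1) (X n)) < e" using N mn by blast
      then show "lnrm S (\<lambda>x. X m i x - X n i x) < e"
        using lnrm_le_jnrm[of S "jcomb 1 (X m) (-1) (X n)" i] by simp
    qed
  qed
  then have ex: "\<exists>u. u \<in> L2 S \<and> (\<lambda>n. lnrm S (\<lambda>x. X n i x - u x)) \<longlonglongrightarrow> 0" for i by blast
  define u where "u i = (SOME u. u \<in> L2 S \<and> (\<lambda>n. lnrm S (\<lambda>x. X n i x - u x)) \<longlonglongrightarrow> 0)" for i
  have "u i \<in> L2 S \<and> (\<lambda>n. lnrm S (\<lambda>x. X n i x - u i x)) \<longlonglongrightarrow> 0" for i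
    unfolding u_def by (rule someI_ex[OF ex])
  then have u: "\<And>i. u i \<in> L2 S" "\<And>i. (\<lambda>n. lnrm S (\<lambda>x. X n i x - u i x)) \<longlonglongrightarrow> 0" by blast+
  have "(\<lambda>n. \<Sum>i\<in>UNIV. lnrm S (jcomb 1 (X n) (-1) u i)) \<longlonglongrightarrow> (\<Sum>i\<in>(UNIV::'a option set). 0)"
    using u(2) by (intro tendsto_sum) simp
  have "(\<lambda>n. jnrm S (jcomb 1 (X n) (-1) u)) \<longlonglongrightarrow> 0"
  proof (rule Lim_null_comparison[rotated])
    show "(\<lambda>n. \<Sum>i\<in>UNIV. lnrm S (jcomb 1 (X n) (-1) u i)) \<longlonglongrightarrow> 0"
      using \<open>(\<lambda>n. \<Sum>i\<in>UNIV. lnrm S (jcomb 1 (X n) (-1) u i)) \<longlonglongrightarrow> (\<Sum>i\<in>(UNIV::'a option set). 0)\<close> by simp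
    show "\<forall>\<^sub>F n in sequentially. norm (jnrm S (jcomb 1 (X n) (-1) u)) \<le> (\<Sum>i\<in>UNIV. lnrm S (jcomb 1 (X n) (-1) u i))"
    proof (intro always_eventually allI)
      show "norm (jnrm S (jcomb 1 (X n) (-1) u)) \<le> (\<Sum>i\<in>UNIV. lnrm S (jcomb 1 (X n) (-1) u i))" for n
        using jnrm_le_sum[of S "jcomb 1 (X n) (-1) u"] by simp
    qed
  qed
  with u show ?thesis by (auto simp: jets_def)
qed

definition jet :: "'n::finite cfun \<Rightarrow> 'n jet" where
  "jet v = (\<lambda>i. case i of None \<Rightarrow> v | Some k \<Rightarrow> partial k v)"

definition weak_jet :: "(real^'n::finite) set \<Rightarrow> 'n cfun \<Rightarrow> 'n jet" where
  "weak_jet \<Omega> u = (\<lambda>i. case i of None \<Rightarrow> u | Some k \<Rightarrow> weak_partial \<Omega> k u)"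

lemma jet_simps[simp]: "jet v None = v" "jet v (Some k) = partial k v"
  and weak_jet_simps[simp]: "weak_jet \<Omega> u None = u" "weak_jet \<Omega> u (Some k) = weak_partial \<Omega> k u"
  by (simp_all add: jet_def weak_jet_def)

lemma all_option: "(\<forall>i. P i) \<longleftrightarrow> P None \<and> (\<forall>k. P (Some k))"
  by (metis option.exhaust)

lemma sum_option: "(\<Sum>i\<in>(UNIV::'n::finite option set). f i) = f None + (\<Sum>k\<in>UNIV. f (Some k))"
  by (simp add: UNIV_option_conv sum.reindex)

lemma jet_comb:
  "smooth v \<Longrightarrow> smooth w \<Longrightarrow> jet (\<lambda>x. \<alpha> * v x + \<beta> * w x) = jcomb \<alpha> (jet v) \<beta> (jet w)"
proof (rule ext)
  fix i assume vw: "smooth v" "smooth w"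
  then have "smooth (\<lambda>x. \<alpha> * v x)" "smooth (\<lambda>x. \<beta> * w x)" by (simp_all add: smooth_mult)
  with vw show "jet (\<lambda>x. \<alpha> * v x + \<beta> * w x) i = jcomb \<alpha> (jet v) \<beta> (jet w) i"
    by (cases i) (simp_all add: fun_eq_iff partial_add partial_mult smoothD)
qed

lemma jet_diff: "smooth v \<Longrightarrow> smooth w \<Longrightarrow> jet (\<lambda>x. v x - w x) = jcomb 1 (jet v) (-1) (jet w)"
  using jet_comb[of v w 1 "-1"] by simp

lemma jet_test_in_jets: "v \<in> test_functions \<Omega> \<Longrightarrow> \<Omega> \<in> sets lebesgue \<Longrightarrow> jet v \<in> jets \<Omega>"
  by (auto simp: jets_def all_option test_L2 test_partial)

lemma jet_smooth_in_jets: "smooth v \<Longrightarrow> S \<in> sets lebesgue \<Longrightarrow> bounded S \<Longrightarrow> jet v \<in> jets S"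
proof -
  assume S: "S \<in> sets lebesgue" "bounded S" and v: "smooth v"
  have "f \<in> L2 S" if f: "smooth f" for f
  proof -
    obtain B where "\<And>x. x \<in> S \<Longrightarrow> cmod (f x) \<le> B" using smooth_bounded_on[OF f S(2)] by metis
    then show ?thesis by (rule L2_bounded[OF S smooth_measurable_lebesgue[OF f]])
  qed
  with v show ?thesis by (simp add: jets_def all_option smooth_partial)
qed

definition test_jets :: "(real^'n::finite) set \<Rightarrow> 'n jet set" where
  "test_jets \<Omega> = jet ` test_functions \<Omega>"

text \<open>The model of \<open>H1_0\<close> used throughout: approximation is measured in all
  components at once, with no reference to the derivative selected by
  \<open>weak_partial\<close>.\<close>

definition jets0 :: "(real^'n::finite) set \<Rightarrow> 'n jet set" where
  "jets0 \<Omega> = {p \<in> jets \<Omega>. \<forall>e>0. \<exists>d\<in>test_jets \<Omega>. jnrm \<Omega> (jcomb 1 p (-1) d) < e}"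

lemma semi_hilbert_jets0:
  assumes \<Omega>: "\<Omega> \<in> sets lebesgue"
  shows "semi_hilbert (jets0 \<Omega>) jcomb (jip \<Omega>) (test_jets \<Omega>)"
  unfolding jets0_def
proof (rule jets.closure_semi_hilbert)
  show "\<exists>u\<in>jets \<Omega>. (\<lambda>n. jnrm \<Omega> (jcomb 1 (X n) (-1) u)) \<longlonglongrightarrow> 0"
    if "\<And>n. X n \<in> jets \<Omega>" "\<And>e. e > 0 \<Longrightarrow> \<exists>N. \<forall>m\<ge>N. \<forall>n\<ge>N. jnrm \<Omega> (jcomb 1 (X m) (-1) (X n)) < e" for X
    using that by (rule jets_complete)
  show "test_jets \<Omega> \<subseteq> jets \<Omega>" using \<Omega> by (auto simp: test_jets_def jet_test_in_jets)
  show "test_jets \<Omega> \<noteq> {}" unfolding test_jets_def image_is_empty using test_zero[of \<Omega>] by (metis empty_iff)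
  show "jcomb \<alpha> p \<beta> q \<in> test_jets \<Omega>" if "p \<in> test_jets \<Omega>" "q \<in> test_jets \<Omega>" for p q \<alpha> \<beta>
    using that by (auto simp: test_jets_def jet_comb[symmetric] test_smooth intro!: imageI test_comb)
qed

lemma jets0_approx:
  assumes "p \<in> jets0 \<Omega>" "e > 0"
  obtains v where "v \<in> test_functions \<Omega>" "jnrm \<Omega> (jcomb 1 p (-1) (jet v)) < e"
proof -
  have "\<exists>d\<in>jet ` test_functions \<Omega>. jnrm \<Omega> (jcomb 1 p (-1) d) < e"
    using assms by (simp only: jets0_def test_jets_def mem_Collect_eq)
  then show thesis using that by blast
qed

lemma jets0_subset: "p \<in> jets0 \<Omega> \<Longrightarrow> p \<in> jets \<Omega>"
  by (simp add: jets0_def)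

text \<open>The chosen derivative agrees almost everywhere with a square-integrable one; its
  measurability on \<open>\<Omega>\<close> comes from local integrability.\<close>

lemma H1_weak_jet:
  assumes \<Omega>: "open \<Omega>" and u: "u \<in> H1 \<Omega>"
  shows "weak_jet \<Omega> u \<in> jets \<Omega>" "has_weak_partial \<Omega> k u (weak_partial \<Omega> k u)"
proof -
  have g: "\<exists>g\<in>L2 \<Omega>. has_weak_partial \<Omega> k u g" for k using u by (auto simp: H1_def)
  then have hw: "has_weak_partial \<Omega> k u (weak_partial \<Omega> k u)" for k using weak_partial_works by blast
  then show "has_weak_partial \<Omega> k u (weak_partial \<Omega> k u)" .
  have "weak_partial \<Omega> k u \<in> L2 \<Omega>" for k
  proof -
    obtain g where g: "g \<in> L2 \<Omega>" "has_weak_partial \<Omega> k u g" using g[of k] by blast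
    have ae: "AE x in lebesgue_on \<Omega>. (cmod (g x))\<^sup>2 = (cmod (weak_partial \<Omega> k u x))\<^sup>2"
      using weak_partial_AE[OF \<Omega> g(2)] by eventually_elim simp
    have m[measurable]: "weak_partial \<Omega> k u \<in> borel_measurable (lebesgue_on \<Omega>)"
      using hw[of k] L1_loc_measurable[OF \<Omega>] by (auto simp: has_weak_partial_def)
    have "integrable (lebesgue_on \<Omega>) (\<lambda>x. (cmod (weak_partial \<Omega> k u x))\<^sup>2)"
      by (rule integrable_cong_AE_imp[OF L2_integrable[OF g(1)] _ ae]) measurable
    with m show ?thesis by (simp add: L2_def)
  qed
  then show "weak_jet \<Omega> u \<in> jets \<Omega>" using u by (auto simp: jets_def all_option H1_def)
qed

lemma H1I_jet:
  assumes \<Omega>: "open \<Omega>" and p: "p \<in> jets \<Omega>" and w: "\<And>k. has_weak_partial \<Omega> k (p None) (p (Some k))"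
  shows "p None \<in> H1 \<Omega>" "AE x in lebesgue_on \<Omega>. weak_jet \<Omega> (p None) i x = p i x"
proof -
  show "p None \<in> H1 \<Omega>" using p w by (auto simp: H1_def jets_def)
  show "AE x in lebesgue_on \<Omega>. weak_jet \<Omega> (p None) i x = p i x"
    using weak_partial_AE[OF \<Omega> w] by (cases i) auto
qed

lemma H1_norm_eq_jnrm: "H1_norm \<Omega> u = jnrm \<Omega> (weak_jet \<Omega> u)"
  unfolding H1_norm_def jnrm_def sum_option by (simp add: lnrm_sq)

lemma H1_norm_jet:
  assumes \<Omega>: "open \<Omega>" and p: "p \<in> jets \<Omega>" and w: "\<And>k. has_weak_partial \<Omega> k (p None) (p (Some k))"
  shows "H1_norm \<Omega> (p None) = jnrm \<Omega> p"
  unfolding H1_norm_eq_jnrm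
  by (rule jnrm_cong_AE[OF H1_weak_jet(1)[OF \<Omega> H1I_jet(1)[OF \<Omega> p w]] p H1I_jet(2)[OF \<Omega> p w]])

lemma H1_norm_test: "open \<Omega> \<Longrightarrow> v \<in> test_functions \<Omega> \<Longrightarrow> H1_norm \<Omega> v = jnrm \<Omega> (jet v)"
  using H1_norm_jet[of \<Omega> "jet v"] by (simp add: jet_test_in_jets smooth_has_weak_partial test_smooth)

text \<open>Both sides of the integration by parts formula are continuous in the jet norm, and the
  formula holds for test functions; the defect \<open>e\<close> is therefore at most every positive
  \<open>\<epsilon>\<close>.\<close>

lemma jets0_has_weak_partial:
  assumes \<Omega>: "open \<Omega>" and p: "p \<in> jets0 \<Omega>"
  shows "has_weak_partial \<Omega> k (p None) (p (Some k))"
  unfolding has_weak_partial_def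
proof (intro conjI ballI)
  have \<Omega>': "\<Omega> \<in> sets lebesgue" using \<Omega> by auto
  have pj: "p i \<in> L2 \<Omega>" for i using p jetsD jets0_subset by blast
  then show "p None \<in> L1_loc \<Omega>" "p (Some k) \<in> L1_loc \<Omega>"
    using L2_loc_imp_L1_loc L2_imp_L2_loc[OF \<Omega>'] by auto
  fix w assume w: "w \<in> test_functions \<Omega>"
  let ?c = "\<lambda>x. cnj (w x)"
  have c: "?c \<in> test_functions \<Omega>" "partial k ?c = (\<lambda>x. cnj (partial k w x))"
    using w by (auto simp: test_cnj fun_eq_iff partial_cnj smoothD test_smooth)
  have wL: "?c \<in> L2 \<Omega>" "(\<lambda>x. cnj (partial k w x)) \<in> L2 \<Omega>"
    using test_L2[OF c(1) \<Omega>'] test_L2[OF test_partial[OF c(1), of k] \<Omega>'] c(2) by auto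
  define e where "e = lip \<Omega> (p None) (\<lambda>x. cnj (partial k w x)) + lip \<Omega> (p (Some k)) ?c"
  have e_le: "cmod e \<le> \<epsilon>" if \<epsilon>: "\<epsilon> > 0" for \<epsilon>
  proof -
    define B where "B = lnrm \<Omega> (\<lambda>x. cnj (partial k w x)) + lnrm \<Omega> ?c + 1"
    have B: "B > 0" by (simp add: B_def add_nonneg_pos)
    obtain v where v: "v \<in> test_functions \<Omega>" "jnrm \<Omega> (jcomb 1 p (-1) (jet v)) < \<epsilon> / B"
      using jets0_approx[OF p, of "\<epsilon> / B"] \<epsilon> B by auto
    have vL: "jet v i \<in> L2 \<Omega>" for i using jet_test_in_jets[OF v(1) \<Omega>'] jetsD by blast
    have "lip \<Omega> v (\<lambda>x. cnj (partial k w x)) + lip \<Omega> (partial k v) ?c = 0"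
      using smooth_has_weak_partial[OF \<Omega>' test_smooth[OF v(1)], of k] w
      by (simp add: has_weak_partial_def lip_def)
    moreover have "lip \<Omega> (p i) W = lip \<Omega> (jet v i) W + lip \<Omega> (lcomb 1 (p i) (-1) (jet v i)) W"
      if "W \<in> L2 \<Omega>" for i W
      using L2.ip_comb[OF pj vL that, of 1 i "-1" i] by simp
    from this[OF wL(2), of None] this[OF wL(1), of "Some k"]
    have "e = (lip \<Omega> v (\<lambda>x. cnj (partial k w x)) + lip \<Omega> (partial k v) ?c) +
        (lip \<Omega> (lcomb 1 (p None) (-1) (jet v None)) (\<lambda>x. cnj (partial k w x)) +
        lip \<Omega> (lcomb 1 (p (Some k)) (-1) (jet v (Some k))) ?c)"
      unfolding e_def by (simp only: ac_simps jet_simps)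
    ultimately have e_eq: "e = lip \<Omega> (lcomb 1 (p None) (-1) (jet v None)) (\<lambda>x. cnj (partial k w x)) +
        lip \<Omega> (lcomb 1 (p (Some k)) (-1) (jet v (Some k))) ?c"
      by (simp only: add_0)
    have "cmod e \<le> lnrm \<Omega> (lcomb 1 (p None) (-1) (jet v None)) * lnrm \<Omega> (\<lambda>x. cnj (partial k w x)) +
        lnrm \<Omega> (lcomb 1 (p (Some k)) (-1) (jet v (Some k))) * lnrm \<Omega> ?c"
      unfolding e_eq by (intro norm_triangle_le add_mono L2.cauchy_schwarz L2_comb pj vL wL)
    also have "\<dots> \<le> \<epsilon> / B * lnrm \<Omega> (\<lambda>x. cnj (partial k w x)) + \<epsilon> / B * lnrm \<Omega> ?c"
    proof (intro add_mono mult_right_mono)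
      have *: "lnrm \<Omega> (lcomb 1 (p i) (-1) (jet v i)) \<le> \<epsilon> / B" for i
        using lnrm_le_jnrm[of \<Omega> "jcomb 1 p (-1) (jet v)" i] v(2) by linarith
      show "lnrm \<Omega> (lcomb 1 (p None) (-1) (jet v None)) \<le> \<epsilon> / B"
        "lnrm \<Omega> (lcomb 1 (p (Some k)) (-1) (jet v (Some k))) \<le> \<epsilon> / B" by (fact *)+
    qed auto
    also have "\<dots> = \<epsilon> / B * (B - 1)" by (simp add: B_def algebra_simps add_divide_distrib)
    also have "\<dots> \<le> \<epsilon>" using \<epsilon> B by (simp add: field_simps)
    finally show ?thesis .
  qed
  have "e = 0"
  proof (rule ccontr)
    assume "e \<noteq> 0"
    then show False using e_le[of "cmod e / 2"] by simp
  qed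
  then show "(LINT x|lebesgue_on \<Omega>. p None x * partial k w x) = - (LINT x|lebesgue_on \<Omega>. p (Some k) x * w x)"
    by (simp add: e_def lip_def eq_neg_iff_add_eq_0)
qed

lemma H1_norm_diff_test:
  assumes \<Omega>: "open \<Omega>" and p: "p \<in> jets \<Omega>" "\<And>k. has_weak_partial \<Omega> k (p None) (p (Some k))"
    and v: "v \<in> test_functions \<Omega>"
  shows "H1_norm \<Omega> (\<lambda>x. p None x - v x) = jnrm \<Omega> (jcomb 1 p (-1) (jet v))"
proof -
  have \<Omega>': "\<Omega> \<in> sets lebesgue" using \<Omega> by auto
  have vj: "jet v \<in> jets \<Omega>" using jet_test_in_jets[OF v \<Omega>'] .
  have "H1_norm \<Omega> (jcomb 1 p (-1) (jet v) None) = jnrm \<Omega> (jcomb 1 p (-1) (jet v))"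
  proof (rule H1_norm_jet[OF \<Omega> jets.comb_closed[OF p(1) vj]])
    show "has_weak_partial \<Omega> k (jcomb 1 p (-1) (jet v) None) (jcomb 1 p (-1) (jet v) (Some k))" for k
      using has_weak_partial_comb[OF \<Omega>' p(2) smooth_has_weak_partial[OF \<Omega>' test_smooth[OF v]], of k 1 "-1"] by simp
  qed
  then show ?thesis by simp
qed

lemma H1_0_weak_jet:
  assumes \<Omega>: "open \<Omega>" and u: "u \<in> H1_0 \<Omega>"
  shows "weak_jet \<Omega> u \<in> jets0 \<Omega>"
proof -
  have H: "u \<in> H1 \<Omega>" using u by (simp add: H1_0_def)
  note wj = H1_weak_jet[OF \<Omega> H]
  have "\<exists>d\<in>test_jets \<Omega>. jnrm \<Omega> (jcomb 1 (weak_jet \<Omega> u) (-1) d) < e" if "e > 0" for e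
  proof -
    have "\<exists>v\<in>test_functions \<Omega>. H1_norm \<Omega> (\<lambda>x. u x - v x) < e"
      using u that by (simp add: H1_0_def)
    then obtain v where v: "v \<in> test_functions \<Omega>" "H1_norm \<Omega> (\<lambda>x. u x - v x) < e" by blast
    then have "jnrm \<Omega> (jcomb 1 (weak_jet \<Omega> u) (-1) (jet v)) < e"
      using H1_norm_diff_test[OF \<Omega> wj(1) _ v(1)] wj(2) by simp
    with v show ?thesis by (auto simp: test_jets_def)
  qed
  with wj show ?thesis by (simp add: jets0_def)
qed

text \<open>Together with \<open>H1_0_weak_jet\<close> this identifies the model with
  \<open>H1_0\<close>. The weak jet and the given jet agree only almost everywhere, which suffices
  because the forms do not see null sets.\<close>

lemma jets0_H1_0:
  assumes \<Omega>: "open \<Omega>" and p: "p \<in> jets0 \<Omega>"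
  shows "p None \<in> H1_0 \<Omega>" "AE x in lebesgue_on \<Omega>. weak_jet \<Omega> (p None) i x = p i x"
proof -
  note w = jets0_has_weak_partial[OF \<Omega> p] and pj = jets0_subset[OF p]
  note H = H1I_jet[OF \<Omega> pj w]
  show "AE x in lebesgue_on \<Omega>. weak_jet \<Omega> (p None) i x = p i x" by (rule H(2))
  show "p None \<in> H1_0 \<Omega>"
    unfolding H1_0_def
  proof (intro CollectI conjI allI impI H(1))
    fix e :: real assume "e > 0"
    with p obtain v where "v \<in> test_functions \<Omega>" "jnrm \<Omega> (jcomb 1 p (-1) (jet v)) < e"
      using jets0_approx by blast
    then show "\<exists>v\<in>test_functions \<Omega>. H1_norm \<Omega> (\<lambda>x. p None x - v x) < e"
      using H1_norm_diff_test[OF \<Omega> pj w] by auto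
  qed
qed

subsection \<open>A quantitative compactness estimate\<close>

text \<open>Jensen's inequality on the unit interval, by expanding the integral of
  \<open>|f t - c|\<^sup>2\<close>.\<close>

lemma has_integral_norm_square_ge:
  fixes f :: "real \<Rightarrow> complex"
  assumes f: "(f has_integral c) {0..1}" and I: "((\<lambda>t. (cmod (f t))\<^sup>2) has_integral I) {0..1}"
  shows "(cmod c)\<^sup>2 \<le> I"
proof -
  have "((\<lambda>t. Re (cnj c * f t)) has_integral Re (cnj c * c)) {0..1}"
    using has_integral_linear[OF has_integral_mult_right[OF f, of "cnj c"] bounded_linear_Re] by (simp add: o_def)
  then have "((\<lambda>t. (cmod (f t))\<^sup>2 - 2 * Re (cnj c * f t) + (cmod c)\<^sup>2) has_integral
      (I - 2 * Re (cnj c * c) + (cmod c)\<^sup>2 * (1 - 0))) {0..1}"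
    using has_integral_const_real[of "(cmod c)\<^sup>2" 0 1]
    by (intro has_integral_add has_integral_diff I has_integral_mult_right) simp_all
  moreover have "0 \<le> (cmod (f t))\<^sup>2 - 2 * Re (cnj c * f t) + (cmod c)\<^sup>2" for t
  proof -
    have "(cmod (f t))\<^sup>2 - 2 * Re (cnj c * f t) + (cmod c)\<^sup>2 = (Re (f t) - Re c)\<^sup>2 + (Im (f t) - Im c)\<^sup>2"
      unfolding cmod_power2 by (simp add: power2_eq_square algebra_simps)
    then show ?thesis by simp
  qed
  ultimately have "0 \<le> I - 2 * Re (cnj c * c) + (cmod c)\<^sup>2 * (1 - 0)"
    by (rule has_integral_nonneg)
  moreover have "Re (cnj c * c) = (cmod c)\<^sup>2"
    unfolding cmod_power2 by (simp add: power2_eq_square)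
  ultimately show ?thesis by simp
qed

definition grad_sq :: "'n::finite cfun \<Rightarrow> real^'n \<Rightarrow> real" where
  "grad_sq v x = (\<Sum>k\<in>UNIV. (cmod (partial k v x))\<^sup>2)"

lemma grad_sq_nonneg: "grad_sq v x \<ge> 0"
  by (simp add: grad_sq_def sum_nonneg)

lemma continuous_grad_sq: "smooth v \<Longrightarrow> continuous_on S (grad_sq v)"
  unfolding grad_sq_def by (intro continuous_intros smooth_continuous smooth_partial)

lemma grad_sq_borel[measurable]: "smooth v \<Longrightarrow> grad_sq v \<in> borel_measurable borel"
  by (rule borel_measurable_continuous_onI[OF continuous_grad_sq])

lemma norm_sum_partial_le:
  "(cmod (\<Sum>k\<in>UNIV. of_real (h $ k) * partial k v x))\<^sup>2 \<le> (norm h)\<^sup>2 * grad_sq v x"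
proof -
  have "cmod (\<Sum>k\<in>UNIV. of_real (h $ k) * partial k v x) \<le> (\<Sum>k\<in>UNIV. \<bar>h $ k\<bar> * cmod (partial k v x))"
    by (intro sum_norm_le) (simp add: norm_mult)
  also have "\<dots> \<le> L2_set (\<lambda>k. h $ k) UNIV * L2_set (\<lambda>k. cmod (partial k v x)) UNIV"
    using L2_set_mult_ineq[of "\<lambda>k. h $ k" "\<lambda>k. cmod (partial k v x)" UNIV] by simp
  finally have "(cmod (\<Sum>k\<in>UNIV. of_real (h $ k) * partial k v x))\<^sup>2 \<le>
      (L2_set (\<lambda>k. h $ k) UNIV * L2_set (\<lambda>k. cmod (partial k v x)) UNIV)\<^sup>2"
    by (rule power_mono) simp
  then show ?thesis
    by (simp add: power_mult_distrib norm_vec_def L2_set_def grad_sq_def sum_nonneg)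
qed

text \<open>The fundamental theorem of calculus along the segment, followed by Jensen and
  Cauchy--Schwarz. The extended nonnegative integral is used so that the order of integration can be
  exchanged without integrability conditions.\<close>

lemma translate_pointwise:
  assumes v: "smooth v"
  shows "ennreal ((cmod (v (x + z) - v x))\<^sup>2) \<le>
    (\<integral>\<^sup>+t. indicator {0..1} t * ennreal ((norm z)\<^sup>2 * grad_sq v (x + t *\<^sub>R z)) \<partial>lborel)"
proof -
  let ?d = "\<lambda>t. \<Sum>k\<in>UNIV. of_real (z $ k) * partial k v (x + t *\<^sub>R z)"
  have FTC: "(?d has_integral (v (x + 1 *\<^sub>R z) - v (x + 0 *\<^sub>R z))) {0..1}"
  proof (rule fundamental_theorem_of_calculus)
    fix t :: real
    have "((\<lambda>t. x + t *\<^sub>R z) has_derivative (\<lambda>t. t *\<^sub>R z)) (at t within {0..1})"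
      by (auto intro!: derivative_eq_intros)
    from has_derivative_compose[OF this has_derivative_sum_partial[OF smoothD[OF v]]]
    show "((\<lambda>t. v (x + t *\<^sub>R z)) has_vector_derivative ?d t) (at t within {0..1})"
      by (simp add: has_vector_derivative_def scaleR_sum_right scaleR_conv_of_real[where 'a=complex] sum_distrib_left mult.assoc)
  qed simp
  have cont: "continuous_on {0..1} ?d"
    by (intro continuous_intros continuous_on_compose2[OF smooth_continuous[OF smooth_partial[OF v], of UNIV]]) auto
  have contg: "continuous_on {0..1} (\<lambda>t. (norm z)\<^sup>2 * grad_sq v (x + t *\<^sub>R z))"
    by (intro continuous_intros continuous_on_compose2[OF continuous_grad_sq[OF v, of UNIV]]) auto
  have I1: "((\<lambda>t. (cmod (?d t))\<^sup>2) has_integral integral {0..1} (\<lambda>t. (cmod (?d t))\<^sup>2)) {0..1}"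
    by (intro integrable_integral integrable_continuous_real continuous_intros cont)
  have I2: "((\<lambda>t. (norm z)\<^sup>2 * grad_sq v (x + t *\<^sub>R z)) has_integral
      integral {0..1} (\<lambda>t. (norm z)\<^sup>2 * grad_sq v (x + t *\<^sub>R z))) {0..1}"
    by (intro integrable_integral integrable_continuous_real contg)
  have "(cmod (v (x + z) - v x))\<^sup>2 \<le> integral {0..1} (\<lambda>t. (cmod (?d t))\<^sup>2)"
    using has_integral_norm_square_ge[OF FTC I1] by simp
  also have "\<dots> \<le> integral {0..1} (\<lambda>t. (norm z)\<^sup>2 * grad_sq v (x + t *\<^sub>R z))"
    by (rule has_integral_le[OF I1 I2]) (rule norm_sum_partial_le)
  finally have "ennreal ((cmod (v (x + z) - v x))\<^sup>2) \<le>
      ennreal (integral {0..1} (\<lambda>t. (norm z)\<^sup>2 * grad_sq v (x + t *\<^sub>R z)))"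
    by (rule ennreal_leI)
  also have "\<dots> = (\<integral>\<^sup>+t. ennreal (indicator {0..1} t * ((norm z)\<^sup>2 * grad_sq v (x + t *\<^sub>R z))) \<partial>lborel)"
    using nn_integral_has_integral_lebesgue[OF _ I2] by (simp add: grad_sq_nonneg)
  also have "\<dots> = (\<integral>\<^sup>+t. indicator {0..1} t * ennreal ((norm z)\<^sup>2 * grad_sq v (x + t *\<^sub>R z)) \<partial>lborel)"
    by (intro nn_integral_cong) (auto simp: indicator_def)
  finally show ?thesis .
qed

lemma nn_integral_lborel_translate:
  fixes f :: "'a::euclidean_space \<Rightarrow> ennreal"
  assumes "f \<in> borel_measurable borel"
  shows "(\<integral>\<^sup>+x. f (x + c) \<partial>lborel) = integral\<^sup>N lborel f"
proof -
  have "integral\<^sup>N lborel f = integral\<^sup>N (distr lborel borel ((+) c)) f" by (simp add: lborel_distr_plus)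
  also have "\<dots> = (\<integral>\<^sup>+x. f (c + x) \<partial>lborel)" by (rule nn_integral_distr) (use assms in auto)
  finally show ?thesis by (simp add: add.commute)
qed

text \<open>Tonelli's theorem exchanges the integrals, and translation invariance removes the
  dependence on \<open>t\<close>.\<close>

lemma translate_estimate:
  assumes v: "smooth v"
  shows "(\<integral>\<^sup>+x. ennreal ((cmod (v (x + z) - v x))\<^sup>2) \<partial>lborel) \<le>
    ennreal ((norm z)\<^sup>2) * (\<integral>\<^sup>+x. ennreal (grad_sq v x) \<partial>lborel)"
proof -
  have [measurable]: "grad_sq v \<in> borel_measurable borel" using v by (rule grad_sq_borel)
  have "(\<integral>\<^sup>+x. ennreal ((cmod (v (x + z) - v x))\<^sup>2) \<partial>lborel) \<le>
      (\<integral>\<^sup>+x. (\<integral>\<^sup>+t. indicator {0..1} t * ennreal ((norm z)\<^sup>2 * grad_sq v (x + t *\<^sub>R z)) \<partial>lborel) \<partial>lborel)"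
    by (intro nn_integral_mono translate_pointwise v)
  also have "\<dots> = (\<integral>\<^sup>+t. (\<integral>\<^sup>+x. indicator {0..1} t * ennreal ((norm z)\<^sup>2 * grad_sq v (x + t *\<^sub>R z)) \<partial>lborel) \<partial>lborel)"
    by (rule lborel_pair.Fubini'[symmetric]) measurable
  also have "\<dots> = (\<integral>\<^sup>+t. indicator {0..1::real} t * (ennreal ((norm z)\<^sup>2) * (\<integral>\<^sup>+x. ennreal (grad_sq v x) \<partial>lborel)) \<partial>lborel)"
  proof (rule nn_integral_cong)
    fix t :: real
    have "(\<integral>\<^sup>+x. indicator {0..1} t * ennreal ((norm z)\<^sup>2 * grad_sq v (x + t *\<^sub>R z)) \<partial>lborel) =
        (\<integral>\<^sup>+x. (indicator {0..1} t * ennreal ((norm z)\<^sup>2)) * ennreal (grad_sq v (x + t *\<^sub>R z)) \<partial>lborel)"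
      by (simp add: ennreal_mult grad_sq_nonneg mult.assoc)
    also have "\<dots> = (indicator {0..1} t * ennreal ((norm z)\<^sup>2)) * (\<integral>\<^sup>+x. ennreal (grad_sq v (x + t *\<^sub>R z)) \<partial>lborel)"
      by (rule nn_integral_cmult) measurable
    also have "(\<integral>\<^sup>+x. ennreal (grad_sq v (x + t *\<^sub>R z)) \<partial>lborel) = (\<integral>\<^sup>+x. ennreal (grad_sq v x) \<partial>lborel)"
      by (rule nn_integral_lborel_translate) measurable
    finally show "(\<integral>\<^sup>+x. indicator {0..1} t * ennreal ((norm z)\<^sup>2 * grad_sq v (x + t *\<^sub>R z)) \<partial>lborel) =
        indicator {0..1} t * (ennreal ((norm z)\<^sup>2) * (\<integral>\<^sup>+x. ennreal (grad_sq v x) \<partial>lborel))"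
      by (simp add: mult.assoc)
  qed
  also have "\<dots> = ennreal ((norm z)\<^sup>2) * (\<integral>\<^sup>+x. ennreal (grad_sq v x) \<partial>lborel)"
    by (subst nn_integral_multc) simp_all
  finally show ?thesis .
qed

lemma lnrm_test_nn_integral:
  assumes \<Omega>: "\<Omega> \<in> sets lebesgue" and v: "v \<in> test_functions \<Omega>"
  shows "(\<integral>\<^sup>+x. ennreal ((cmod (v x))\<^sup>2) \<partial>lborel) = ennreal ((lnrm \<Omega> v)\<^sup>2)"
proof -
  have w: "(\<lambda>x. cnj (v x) * v x) \<in> test_functions \<Omega>"
    using v by (intro test_mult_smooth smooth_cnj test_smooth)
  have eq: "cnj (v x) * v x = of_real ((cmod (v x))\<^sup>2)" for x
    by (simp add: complex_norm_square mult.commute del: of_real_power)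
  have "complex_of_real (LINT x|lborel. (cmod (v x))\<^sup>2) = complex_of_real (LINT x|lebesgue_on \<Omega>. (cmod (v x))\<^sup>2)"
    using integral_test_lebesgue_on[OF \<Omega> w] unfolding eq integral_complex_of_real by simp
  then have "(LINT x|lborel. (cmod (v x))\<^sup>2) = (lnrm \<Omega> v)\<^sup>2" by (simp add: lnrm_sq)
  moreover have "integrable lborel (\<lambda>x. (cmod (v x))\<^sup>2)"
    using integrable_bounded_linear[OF bounded_linear_Re test_lborel_integrable[OF w]] unfolding eq by simp
  ultimately show ?thesis by (subst nn_integral_eq_integral) auto
qed

lemma lnrm_grad_sq_nn_integral:
  assumes \<Omega>: "\<Omega> \<in> sets lebesgue" and v: "v \<in> test_functions \<Omega>"
  shows "(\<integral>\<^sup>+x. ennreal (grad_sq v x) \<partial>lborel) = ennreal (\<Sum>k\<in>UNIV. (lnrm \<Omega> (partial k v))\<^sup>2)"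
proof -
  have m: "partial k v \<in> borel_measurable borel" for k
    using v by (intro smooth_borel smooth_partial test_smooth)
  have "(\<integral>\<^sup>+x. ennreal (grad_sq v x) \<partial>lborel) = (\<integral>\<^sup>+x. (\<Sum>k\<in>UNIV. ennreal ((cmod (partial k v x))\<^sup>2)) \<partial>lborel)"
    unfolding grad_sq_def by (subst sum_ennreal) auto
  also have "\<dots> = (\<Sum>k\<in>UNIV. \<integral>\<^sup>+x. ennreal ((cmod (partial k v x))\<^sup>2) \<partial>lborel)"
    using m by (intro nn_integral_sum) measurable
  also have "\<dots> = (\<Sum>k\<in>UNIV. ennreal ((lnrm \<Omega> (partial k v))\<^sup>2))"
    by (intro sum.cong refl lnrm_test_nn_integral[OF \<Omega> test_partial[OF v]])
  finally show ?thesis by (simp add: sum_ennreal)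
qed

lemma norm_integral_square_le:
  assumes "S \<in> sets lebesgue" "bounded S" "f \<in> L2 S"
  shows "(cmod (integral\<^sup>L (lebesgue_on S) f))\<^sup>2 \<le> measure lebesgue S * (lnrm S f)\<^sup>2"
proof -
  have one: "(\<lambda>_. 1) \<in> L2 S" by (rule L2_bounded[OF assms(1,2), of _ 1]) auto
  have "cmod (lip S f (\<lambda>_. 1)) \<le> lnrm S f * lnrm S (\<lambda>_. 1)" by (rule L2.cauchy_schwarz[OF assms(3) one])
  moreover have "lnrm S (\<lambda>_. 1) \<le> 1 * sqrt (measure lebesgue S)"
    by (rule lnrm_bound[OF assms(1,2) _ _ one]) auto
  ultimately have "cmod (integral\<^sup>L (lebesgue_on S) f) \<le> lnrm S f * sqrt (measure lebesgue S)"
    using mult_left_mono[of "lnrm S (\<lambda>_. 1)" "sqrt (measure lebesgue S)" "lnrm S f"] by (simp add: lip_def)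
  then have "(cmod (integral\<^sup>L (lebesgue_on S) f))\<^sup>2 \<le> (lnrm S f * sqrt (measure lebesgue S))\<^sup>2"
    by (rule power_mono) simp
  then show ?thesis by (simp add: power_mult_distrib mult.commute)
qed

text \<open>Writes \<open>v x\<close> as the mean over the ball plus the mean of
  \<open>v x - v u\<close>; for \<open>u\<close> in the same ball \<open>u - x\<close> has length
  below \<open>2 * \<delta>\<close>, and the factor 2 in the bound comes from squaring a sum of two
  terms.\<close>

lemma average_pointwise:
  fixes v :: "'n::finite cfun"
  assumes v: "smooth v" and \<delta>: "\<delta> > 0" and x: "x \<in> ball y \<delta>"
  defines "b \<equiv> measure lebesgue (ball (0::real^'n) \<delta>)"
  shows "ennreal ((cmod (v x))\<^sup>2) \<le> ennreal (2 / b\<^sup>2 * (cmod (integral\<^sup>L (lebesgue_on (ball y \<delta>)) v))\<^sup>2) +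
    ennreal (2 / b) * (\<integral>\<^sup>+z. indicator (ball 0 (2 * \<delta>)) z * ennreal ((cmod (v (x + z) - v x))\<^sup>2) \<partial>lborel)"
proof -
  let ?B = "ball y \<delta>"
  have b: "b > 0" "measure lebesgue ?B = b"
    using \<delta> content_ball_pos[of \<delta> "0::real^'n"] content_ball[of \<delta> y] content_ball[of \<delta> "0::real^'n"]
    by (auto simp: b_def measure_completion)
  have B: "?B \<in> sets lebesgue" "bounded ?B" by auto
  have [measurable]: "v \<in> borel_measurable borel" using v by (rule smooth_borel)
  have L2: "(\<lambda>u. v x - v u) \<in> L2 ?B" "v \<in> L2 ?B"
  proof -
    obtain C where C: "\<And>x. x \<in> ?B \<Longrightarrow> cmod (v x) \<le> C" using smooth_bounded_on[OF v B(2)] by metis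
    show "v \<in> L2 ?B" by (rule L2_bounded[OF B smooth_measurable_lebesgue[OF v] C])
    show "(\<lambda>u. v x - v u) \<in> L2 ?B"
      using order_trans[OF norm_triangle_ineq4 add_left_mono[OF C]]
      by (intro L2_bounded[OF B, of _ "cmod (v x) + C"] borel_measurable_diff smooth_measurable_lebesgue v) auto
  qed
  define J where "J = integral\<^sup>L (lebesgue_on ?B) v"
  interpret finite_measure "lebesgue_on ?B" using B by (intro finite_measure_lebesgue_on) auto
  have intv: "integrable (lebesgue_on ?B) v" by (rule L2_imp_integrable[OF B L2(2)])
  have "(LINT u|lebesgue_on ?B. v x - v u) = of_real b * v x - J"
    using intv b by (simp add: J_def measure_restrict_space scaleR_conv_of_real)
  then have "v x = (1 / of_real b) * (LINT u|lebesgue_on ?B. v x - v u) + J / of_real b"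
    using b by (simp add: field_simps)
  then have "cmod (v x) \<le> (1 / b) * cmod (LINT u|lebesgue_on ?B. v x - v u) + cmod J / b"
    using norm_triangle_ineq[of "(1 / of_real b) * (LINT u|lebesgue_on ?B. v x - v u)" "J / of_real b"] b
    by (simp add: norm_mult norm_divide)
  then have "(cmod (v x))\<^sup>2 \<le> ((1 / b) * cmod (LINT u|lebesgue_on ?B. v x - v u) + cmod J / b)\<^sup>2"
    by (rule power_mono) simp
  also have "\<dots> \<le> 2 * ((1 / b) * cmod (LINT u|lebesgue_on ?B. v x - v u))\<^sup>2 + 2 * (cmod J / b)\<^sup>2"
    using sum_squares_bound[of "(1 / b) * cmod (LINT u|lebesgue_on ?B. v x - v u)" "cmod J / b"]
    by (simp add: power2_sum)
  also have "\<dots> = 2 / b\<^sup>2 * (cmod J)\<^sup>2 + 2 / b\<^sup>2 * (cmod (LINT u|lebesgue_on ?B. v x - v u))\<^sup>2"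
    by (simp add: power_mult_distrib power_divide)
  also have "\<dots> \<le> 2 / b\<^sup>2 * (cmod J)\<^sup>2 + 2 / b\<^sup>2 * (b * (lnrm ?B (\<lambda>u. v x - v u))\<^sup>2)"
    using norm_integral_square_le[OF B L2(1)] b by (intro add_left_mono mult_left_mono) auto
  also have "\<dots> = 2 / b\<^sup>2 * (cmod J)\<^sup>2 + 2 / b * (lnrm ?B (\<lambda>u. v x - v u))\<^sup>2"
    using b by (simp add: power2_eq_square)
  finally have "ennreal ((cmod (v x))\<^sup>2) \<le> ennreal (2 / b\<^sup>2 * (cmod J)\<^sup>2) + ennreal (2 / b) * ennreal ((lnrm ?B (\<lambda>u. v x - v u))\<^sup>2)"
    using b by (simp add: ennreal_leI flip: ennreal_plus ennreal_mult)
  moreover have "ennreal ((lnrm ?B (\<lambda>u. v x - v u))\<^sup>2) \<le>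
      (\<integral>\<^sup>+z. indicator (ball 0 (2 * \<delta>)) z * ennreal ((cmod (v (x + z) - v x))\<^sup>2) \<partial>lborel)"
  proof -
    have "ennreal ((lnrm ?B (\<lambda>u. v x - v u))\<^sup>2) = (\<integral>\<^sup>+u. ennreal ((cmod (v x - v u))\<^sup>2) \<partial>lebesgue_on ?B)"
      unfolding lnrm_sq using L2_integrable[OF L2(1)] by (intro nn_integral_eq_integral[symmetric]) auto
    also have "\<dots> = (\<integral>\<^sup>+u. ennreal ((cmod (v x - v u))\<^sup>2) * indicator ?B u \<partial>lebesgue)"
      by (rule nn_integral_restrict_space) auto
    also have "\<dots> = (\<integral>\<^sup>+u. ennreal ((cmod (v x - v u))\<^sup>2) * indicator ?B u \<partial>lborel)"
      by (rule nn_integral_completion)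
    also have "\<dots> \<le> (\<integral>\<^sup>+u. indicator (ball 0 (2 * \<delta>)) (u - x) * ennreal ((cmod (v u - v x))\<^sup>2) \<partial>lborel)"
    proof (rule nn_integral_mono)
      fix u
      have "u - x \<in> ball 0 (2 * \<delta>)" if "u \<in> ?B"
        using x that dist_triangle[of u x y] by (simp add: dist_norm norm_minus_commute)
      then show "ennreal ((cmod (v x - v u))\<^sup>2) * indicator ?B u \<le>
          indicator (ball 0 (2 * \<delta>)) (u - x) * ennreal ((cmod (v u - v x))\<^sup>2)"
        by (auto simp: indicator_def norm_minus_commute)
    qed
    also have "\<dots> = (\<integral>\<^sup>+z. indicator (ball 0 (2 * \<delta>)) (z + x - x) * ennreal ((cmod (v (z + x) - v x))\<^sup>2) \<partial>lborel)"
    proof (rule nn_integral_lborel_translate[symmetric])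
      have [measurable]: "ball (0::real^'n) (2 * \<delta>) \<in> sets borel" by simp
      show "(\<lambda>u. indicator (ball 0 (2 * \<delta>)) (u - x) * ennreal ((cmod (v u - v x))\<^sup>2)) \<in> borel_measurable borel"
        by measurable
    qed
    finally show ?thesis by (simp add: add.commute)
  qed
  ultimately show ?thesis
    unfolding J_def by (meson add_left_mono mult_left_mono order_trans zero_le)
qed

text \<open>A quantitative form of Rellich's theorem. The closure of \<open>\<Omega>\<close> is
  covered by finitely many balls of radius \<open>\<delta>\<close>; the integrals over these balls
  are the finitely many functionals, and the oscillation at scale \<open>2 * \<delta>\<close> is
  paid for by the gradient.\<close>

theorem finite_rank_estimate:
  fixes \<Omega> :: "(real^'n::finite) set"
  assumes \<Omega>: "open \<Omega>" "bounded \<Omega>" and \<eta>: "\<eta> > 0"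
  obtains C and N :: "(real^'n) set" and \<delta> where "C \<ge> 0" "finite N"
    "\<And>v. v \<in> test_functions \<Omega> \<Longrightarrow> (lnrm \<Omega> v)\<^sup>2 \<le> \<eta> * (\<Sum>k\<in>UNIV. (lnrm \<Omega> (partial k v))\<^sup>2) +
       C * (\<Sum>y\<in>N. (cmod (LINT x|lebesgue_on \<Omega>. indicator (ball y \<delta>) x * v x))\<^sup>2)"
proof -
  have \<Omega>': "\<Omega> \<in> sets lebesgue" "\<Omega> \<in> sets borel" using \<Omega> by auto
  \<comment> \<open>The factor in front of the gradient works out as
    \<open>2 / b * (2 * \<delta>)\<^sup>2 * (2 ^ CARD('n) * b)\<close>, where \<open>b\<close> is
    the volume of the ball of radius \<open>\<delta>\<close>.\<close>
  let ?c = "8 * 2 ^ CARD('n) :: real"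
  define \<delta> where "\<delta> = sqrt (\<eta> / ?c)"
  have \<delta>: "\<delta> > 0" "?c * \<delta>\<^sup>2 = \<eta>" using \<eta> by (auto simp: \<delta>_def)
  obtain N where N: "finite N" "closure \<Omega> \<subseteq> (\<Union>y\<in>N. ball y \<delta>)"
  proof (rule compactE_image[of "closure \<Omega>" UNIV "\<lambda>y. ball y \<delta>"])
    show "compact (closure \<Omega>)" using \<Omega> by (simp add: compact_closure)
    show "closure \<Omega> \<subseteq> (\<Union>y. ball y \<delta>)" using \<delta>(1) centre_in_ball by blast
  qed auto
  define b where "b = measure lebesgue (ball (0::real^'n) \<delta>)"
  have b: "b > 0" "measure lebesgue (ball (0::real^'n) (2 * \<delta>)) = 2 ^ CARD('n) * b"
    using \<delta> content_ball_pos[of \<delta> "0::real^'n"] content_ball[of "2 * \<delta>" "0::real^'n"] content_ball[of \<delta> "0::real^'n"]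
    by (auto simp: b_def measure_completion power_mult_distrib)
  define C where "C = 2 / b\<^sup>2 * measure lebesgue \<Omega>"
  show thesis
  proof (rule that)
    show "C \<ge> 0" using b by (simp add: C_def)
    show "finite N" by fact
    fix v assume v: "v \<in> test_functions \<Omega>"
    have sm: "smooth v" using v by (rule test_smooth)
    have [measurable]: "v \<in> borel_measurable borel" using sm by (rule smooth_borel)
    have [measurable]: "ball (0::real^'n) (2 * \<delta>) \<in> sets borel" by simp
    let ?J = "\<lambda>y. LINT x|lebesgue_on \<Omega>. indicator (ball y \<delta>) x * v x"
    have J: "?J y = integral\<^sup>L (lebesgue_on (ball y \<delta>)) v" for y
    proof -
      have "?J y = (LINT x|lebesgue. indicator \<Omega> x *\<^sub>R (indicator (ball y \<delta>) x * v x))"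
        using \<Omega>' by (subst integral_restrict_space) auto
      also have "\<dots> = (LINT x|lebesgue. indicator (ball y \<delta>) x *\<^sub>R v x)"
        using test_outside[OF v] by (intro Bochner_Integration.integral_cong) (auto simp: indicator_def)
      also have "\<dots> = integral\<^sup>L (lebesgue_on (ball y \<delta>)) v" by (subst integral_restrict_space) auto
      finally show ?thesis .
    qed
    let ?S = "\<Sum>y\<in>N. (cmod (?J y))\<^sup>2"
    let ?W = "\<lambda>x. \<integral>\<^sup>+z. indicator (ball 0 (2 * \<delta>)) z * ennreal ((cmod (v (x + z) - v x))\<^sup>2) \<partial>lborel"
    let ?G = "\<integral>\<^sup>+x. ennreal (grad_sq v x) \<partial>lborel"
    have point: "ennreal ((cmod (v x))\<^sup>2) \<le> ennreal (2 / b\<^sup>2 * ?S) * indicator \<Omega> x + ennreal (2 / b) * ?W x" for x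
    proof (cases "x \<in> \<Omega>")
      case True
      then obtain y where y: "y \<in> N" "x \<in> ball y \<delta>" using N closure_subset by blast
      have "(cmod (?J y))\<^sup>2 \<le> ?S" using y N by (intro member_le_sum) auto
      then have le: "ennreal (2 / b\<^sup>2 * (cmod (?J y))\<^sup>2) \<le> ennreal (2 / b\<^sup>2 * ?S)"
        by (intro ennreal_leI mult_left_mono) auto
      have "ennreal ((cmod (v x))\<^sup>2) \<le> ennreal (2 / b\<^sup>2 * (cmod (?J y))\<^sup>2) + ennreal (2 / b) * ?W x"
        using average_pointwise[OF sm \<delta>(1) y(2)] unfolding b_def[symmetric] J .
      from order_trans[OF this add_right_mono[OF le]] show ?thesis
        using True by (simp only: indicator_simps mult_1_right)
    next
      case False
      then show ?thesis using test_outside[OF v] by simp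
    qed
    have "ennreal ((lnrm \<Omega> v)\<^sup>2) = (\<integral>\<^sup>+x. ennreal ((cmod (v x))\<^sup>2) \<partial>lborel)"
      using lnrm_test_nn_integral[OF \<Omega>'(1) v] by simp
    also have "\<dots> \<le> (\<integral>\<^sup>+x. ennreal (2 / b\<^sup>2 * ?S) * indicator \<Omega> x + ennreal (2 / b) * ?W x \<partial>lborel)"
      by (intro nn_integral_mono point)
    also have "\<dots> = ennreal (2 / b\<^sup>2 * ?S) * emeasure lborel \<Omega> + ennreal (2 / b) * (\<integral>\<^sup>+x. ?W x \<partial>lborel)"
    proof -
      have W: "?W \<in> borel_measurable lborel"
        by (rule lborel.borel_measurable_nn_integral) measurable
      have \<Omega>m: "\<Omega> \<in> sets lborel" using \<Omega>' by simp
      have "(\<lambda>x. ennreal (2 / b\<^sup>2 * ?S) * indicator \<Omega> x) \<in> borel_measurable lborel"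
        by (intro borel_measurable_times_ennreal borel_measurable_const borel_measurable_indicator \<Omega>m)
      moreover have "(\<lambda>x. ennreal (2 / b) * ?W x) \<in> borel_measurable lborel"
        by (intro borel_measurable_times_ennreal borel_measurable_const W)
      ultimately have "(\<integral>\<^sup>+x. ennreal (2 / b\<^sup>2 * ?S) * indicator \<Omega> x + ennreal (2 / b) * ?W x \<partial>lborel) =
          (\<integral>\<^sup>+x. ennreal (2 / b\<^sup>2 * ?S) * indicator \<Omega> x \<partial>lborel) + (\<integral>\<^sup>+x. ennreal (2 / b) * ?W x \<partial>lborel)"
        by (rule nn_integral_add)
      then show ?thesis
        unfolding nn_integral_cmult[OF W] nn_integral_cmult_indicator[OF \<Omega>m] .
    qed
    also have "(\<integral>\<^sup>+x. ?W x \<partial>lborel) \<le> ennreal ((2 * \<delta>)\<^sup>2) * ?G * ennreal (2 ^ CARD('n) * b)"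
    proof -
      have "(\<integral>\<^sup>+x. ?W x \<partial>lborel) = (\<integral>\<^sup>+z. (\<integral>\<^sup>+x. indicator (ball 0 (2 * \<delta>)) z * ennreal ((cmod (v (x + z) - v x))\<^sup>2) \<partial>lborel) \<partial>lborel)"
        by (rule lborel_pair.Fubini'[symmetric]) measurable
      also have "\<dots> \<le> (\<integral>\<^sup>+z. (ennreal ((2 * \<delta>)\<^sup>2) * ?G) * indicator (ball (0::real^'n) (2 * \<delta>)) z \<partial>lborel)"
      proof (rule nn_integral_mono)
        fix z :: "real^'n"
        show "(\<integral>\<^sup>+x. indicator (ball 0 (2 * \<delta>)) z * ennreal ((cmod (v (x + z) - v x))\<^sup>2) \<partial>lborel) \<le>
            (ennreal ((2 * \<delta>)\<^sup>2) * ?G) * indicator (ball 0 (2 * \<delta>)) z"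
        proof (cases "z \<in> ball 0 (2 * \<delta>)")
          case True
          then have "ennreal ((norm z)\<^sup>2) \<le> ennreal ((2 * \<delta>)\<^sup>2)" by (intro ennreal_leI power_mono) auto
          then have "ennreal ((norm z)\<^sup>2) * ?G \<le> ennreal ((2 * \<delta>)\<^sup>2) * ?G" by (rule mult_right_mono) simp
          from order_trans[OF translate_estimate[OF sm, of z] this] show ?thesis
            using True by (simp only: indicator_simps mult_1_left mult_1_right)
        qed simp
      qed
      also have "\<dots> = ennreal ((2 * \<delta>)\<^sup>2) * ?G * emeasure lborel (ball (0::real^'n) (2 * \<delta>))"
        by (rule nn_integral_cmult_indicator) simp
      also have "emeasure lborel (ball (0::real^'n) (2 * \<delta>)) = ennreal (2 ^ CARD('n) * b)"
        using b(2) emeasure_bounded_finite[of "ball (0::real^'n) (2 * \<delta>)"]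
        by (simp add: emeasure_eq_ennreal_measure measure_completion)
      finally show ?thesis .
    qed
    also have "emeasure lborel \<Omega> = ennreal (measure lebesgue \<Omega>)"
      using \<Omega> \<Omega>' emeasure_bounded_finite[of \<Omega>] by (simp add: emeasure_eq_ennreal_measure measure_completion)
    finally have "ennreal ((lnrm \<Omega> v)\<^sup>2) \<le> ennreal (2 / b\<^sup>2 * ?S) * ennreal (measure lebesgue \<Omega>) +
        ennreal (2 / b) * (ennreal ((2 * \<delta>)\<^sup>2) * ?G * ennreal (2 ^ CARD('n) * b))"
      by (simp add: add_left_mono mult_left_mono)
    also have "\<dots> = ennreal (C * ?S + 2 / b * ((2 * \<delta>)\<^sup>2 * (\<Sum>k\<in>UNIV. (lnrm \<Omega> (partial k v))\<^sup>2) * (2 ^ CARD('n) * b)))"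
      unfolding lnrm_grad_sq_nn_integral[OF \<Omega>'(1) v] C_def using b
      by (simp add: sum_nonneg flip: ennreal_mult ennreal_plus)
    also have "C * ?S + 2 / b * ((2 * \<delta>)\<^sup>2 * (\<Sum>k\<in>UNIV. (lnrm \<Omega> (partial k v))\<^sup>2) * (2 ^ CARD('n) * b)) =
        C * ?S + (?c * \<delta>\<^sup>2) * (\<Sum>k\<in>UNIV. (lnrm \<Omega> (partial k v))\<^sup>2)"
      using b by (simp add: power_mult_distrib)
    finally show "(lnrm \<Omega> v)\<^sup>2 \<le> \<eta> * (\<Sum>k\<in>UNIV. (lnrm \<Omega> (partial k v))\<^sup>2) + C * ?S"
      unfolding \<delta>(2) using \<open>C \<ge> 0\<close> \<eta> by (subst (asm) ennreal_le_iff) (auto simp: sum_nonneg add_nonneg_nonneg)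
  qed
qed

subsection \<open>Sesquilinear forms with bounded coefficients\<close>

text \<open>The coefficients as a matrix indexed like jets: the row belongs to the derivative
  falling on the test function, the column to the one falling on the solution, so that
  \<open>b\<close> lies in the column and \<open>c\<close> in the row of
  \<open>None\<close>.\<close>

definition coef :: "('n \<Rightarrow> 'n \<Rightarrow> real^'n \<Rightarrow> real) \<Rightarrow> ('n \<Rightarrow> real^'n \<Rightarrow> complex) \<Rightarrow> ('n \<Rightarrow> real^'n \<Rightarrow> real) \<Rightarrow>
    (real^'n \<Rightarrow> complex) \<Rightarrow> 'n::finite option \<Rightarrow> 'n option \<Rightarrow> 'n cfun" where
  "coef a b c c0 i j x = (case i of
     None \<Rightarrow> (case j of None \<Rightarrow> c0 x | Some l \<Rightarrow> of_real (c l x))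
   | Some k \<Rightarrow> (case j of None \<Rightarrow> b k x | Some l \<Rightarrow> of_real (a k l x)))"

lemma coef_simps[simp]:
  "coef a b c c0 None None = c0" "coef a b c c0 None (Some l) = (\<lambda>x. of_real (c l x))"
  "coef a b c c0 (Some k) None = b k" "coef a b c c0 (Some k) (Some l) = (\<lambda>x. of_real (a k l x))"
  by (simp_all add: coef_def fun_eq_iff)

definition form :: "(real^'n::finite) set \<Rightarrow> ('n option \<Rightarrow> 'n option \<Rightarrow> 'n cfun) \<Rightarrow> 'n jet \<Rightarrow> 'n jet \<Rightarrow> complex" where
  "form S m p q = (\<Sum>i\<in>UNIV. \<Sum>j\<in>UNIV. LINT x|lebesgue_on S. m i j x * p j x * cnj (q i x))"

lemma ell_op_eq_form:
  "v \<in> test_functions \<Omega> \<Longrightarrow> ell_op \<Omega> a b c c0 u v = form \<Omega> (coef a b c c0) (weak_jet \<Omega> u) (jet v)"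
  by (simp add: ell_op_def form_def sum_option sum.distrib)

definition bounded_coef :: "(real^'n::finite) set \<Rightarrow> real \<Rightarrow> ('n option \<Rightarrow> 'n option \<Rightarrow> 'n cfun) \<Rightarrow> bool" where
  "bounded_coef S B m \<longleftrightarrow> (\<forall>i j. m i j \<in> borel_measurable (lebesgue_on S) \<and> (\<forall>x\<in>S. cmod (m i j x) \<le> B))"

lemma bounded_coef_subset: "bounded_coef T B m \<Longrightarrow> S \<subseteq> T \<Longrightarrow> bounded_coef S B m"
  unfolding bounded_coef_def using measurable_restrict_mono[of _ lebesgue T borel S] by blast

lemma lnrm_bounded_mult:
  assumes "m \<in> borel_measurable (lebesgue_on S)" "\<And>x. x \<in> S \<Longrightarrow> cmod (m x) \<le> B" "B \<ge> 0" "u \<in> L2 S"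
  shows "lnrm S (\<lambda>x. m x * u x) \<le> B * lnrm S u"
proof -
  have "(LINT x|lebesgue_on S. (cmod (m x * u x))\<^sup>2) \<le> (LINT x|lebesgue_on S. B\<^sup>2 * (cmod (u x))\<^sup>2)"
    using L2_integrable[OF L2_bounded_mult[OF assms(1,2,4)]] L2_integrable[OF assms(4)] assms(2)
    by (intro integral_mono) (auto simp: norm_mult power_mult_distrib intro!: mult_right_mono power_mono)
  also have "\<dots> = (B * lnrm S u)\<^sup>2" by (simp add: lnrm_sq power_mult_distrib)
  finally show ?thesis using assms(3) by (subst lnrm_le_iff) auto
qed

lemma
  assumes m: "bounded_coef S B m" and p: "p j \<in> L2 S" and q: "q i \<in> L2 S"
  shows form_entry_integrable: "integrable (lebesgue_on S) (\<lambda>x. m i j x * p j x * cnj (q i x))"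
    and form_entry_bound: "B \<ge> 0 \<Longrightarrow> cmod (LINT x|lebesgue_on S. m i j x * p j x * cnj (q i x)) \<le> B * lnrm S (p j) * lnrm S (q i)"
proof -
  have mm: "m i j \<in> borel_measurable (lebesgue_on S)" "\<And>x. x \<in> S \<Longrightarrow> cmod (m i j x) \<le> B"
    using m by (auto simp: bounded_coef_def)
  have mp: "(\<lambda>x. m i j x * p j x) \<in> L2 S" by (rule L2_bounded_mult[OF mm p])
  show "integrable (lebesgue_on S) (\<lambda>x. m i j x * p j x * cnj (q i x))"
    using L2_mult_cnj_integrable[OF mp q] .
  assume B: "B \<ge> 0"
  have "cmod (lip S (\<lambda>x. m i j x * p j x) (q i)) \<le> lnrm S (\<lambda>x. m i j x * p j x) * lnrm S (q i)"
    by (rule L2.cauchy_schwarz[OF mp q])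
  also have "\<dots> \<le> B * lnrm S (p j) * lnrm S (q i)"
    using lnrm_bounded_mult[OF mm B p] by (intro mult_right_mono) auto
  finally show "cmod (LINT x|lebesgue_on S. m i j x * p j x * cnj (q i x)) \<le> B * lnrm S (p j) * lnrm S (q i)"
    by (simp add: lip_def)
qed

lemma form_bound:
  assumes m: "bounded_coef S B m" "B \<ge> 0" and p: "p \<in> jets S" and q: "q \<in> jets S"
  shows "cmod (form S m p q) \<le> real (CARD('n::finite option) * CARD('n option)) * B * jnrm S p * jnrm S (q :: 'n jet)"
proof -
  have "cmod (form S m p q) \<le> (\<Sum>i\<in>(UNIV::'n option set). \<Sum>j\<in>(UNIV::'n option set). B * jnrm S p * jnrm S q)"
    unfolding form_def
  proof (intro sum_norm_le order_trans[OF form_entry_bound[OF m(1) jetsD[OF p] jetsD[OF q] m(2)]])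
    show "B * lnrm S (p j) * lnrm S (q i) \<le> B * jnrm S p * jnrm S q" for i j
      using m(2) by (intro mult_mono mult_left_mono lnrm_le_jnrm) auto
  qed
  then show ?thesis by (simp add: algebra_simps)
qed

lemma form_comb_left:
  assumes m: "bounded_coef S B m" and "p \<in> jets S" "p' \<in> jets S" "q \<in> jets S"
  shows "form S m (jcomb \<alpha> p \<beta> p') q = \<alpha> * form S m p q + \<beta> * form S m p' q"
proof -
  have "(LINT x|lebesgue_on S. m i j x * (\<alpha> * p j x + \<beta> * p' j x) * cnj (q i x)) =
      \<alpha> * (LINT x|lebesgue_on S. m i j x * p j x * cnj (q i x)) + \<beta> * (LINT x|lebesgue_on S. m i j x * p' j x * cnj (q i x))" for i j
  proof -
    have "(LINT x|lebesgue_on S. m i j x * (\<alpha> * p j x + \<beta> * p' j x) * cnj (q i x)) =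
        (LINT x|lebesgue_on S. \<alpha> * (m i j x * p j x * cnj (q i x)) + \<beta> * (m i j x * p' j x * cnj (q i x)))"
      by (intro Bochner_Integration.integral_cong refl) (simp add: algebra_simps)
    then show ?thesis using assms by (simp add: form_entry_integrable[OF m] jetsD)
  qed
  then show ?thesis by (simp add: form_def sum.distrib sum_distrib_left)
qed

lemma form_comb_right:
  assumes m: "bounded_coef S B m" and "p \<in> jets S" "q \<in> jets S" "q' \<in> jets S"
  shows "form S m p (jcomb \<alpha> q \<beta> q') = cnj \<alpha> * form S m p q + cnj \<beta> * form S m p q'"
proof -
  have "(LINT x|lebesgue_on S. m i j x * p j x * cnj (\<alpha> * q i x + \<beta> * q' i x)) =
      cnj \<alpha> * (LINT x|lebesgue_on S. m i j x * p j x * cnj (q i x)) + cnj \<beta> * (LINT x|lebesgue_on S. m i j x * p j x * cnj (q' i x))" for i j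
  proof -
    have "(LINT x|lebesgue_on S. m i j x * p j x * cnj (\<alpha> * q i x + \<beta> * q' i x)) =
        (LINT x|lebesgue_on S. cnj \<alpha> * (m i j x * p j x * cnj (q i x)) + cnj \<beta> * (m i j x * p j x * cnj (q' i x)))"
      by (intro Bochner_Integration.integral_cong refl) (simp add: algebra_simps)
    then show ?thesis using assms by (simp add: form_entry_integrable[OF m] jetsD)
  qed
  then show ?thesis by (simp add: form_def sum.distrib sum_distrib_left)
qed

lemma form_cong_AE:
  assumes m: "bounded_coef S B m" and "p \<in> jets S" "p' \<in> jets S" "q \<in> jets S"
    and eq: "\<And>j. AE x in lebesgue_on S. p j x = p' j x"
  shows "form S m p q = form S m p' q"
  unfolding form_def
proof (intro sum.cong refl integral_cong_AE)
  fix i j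
  show "AE x in lebesgue_on S. m i j x * p j x * cnj (q i x) = m i j x * p' j x * cnj (q i x)"
    using eq[of j] by eventually_elim simp
  show "(\<lambda>x. m i j x * p j x * cnj (q i x)) \<in> borel_measurable (lebesgue_on S)"
    "(\<lambda>x. m i j x * p' j x * cnj (q i x)) \<in> borel_measurable (lebesgue_on S)"
    by (rule borel_measurable_integrable[OF form_entry_integrable[OF m jetsD[OF assms(2)] jetsD[OF assms(4)]]])
      (rule borel_measurable_integrable[OF form_entry_integrable[OF m jetsD[OF assms(3)] jetsD[OF assms(4)]]])
qed

lemma form_sesquilinear_jets0:
  assumes \<Omega>: "\<Omega> \<in> sets lebesgue" and m: "bounded_coef \<Omega> B m" "B \<ge> 0"
  shows "semi_inner.sesquilinear (jets0 \<Omega>) jcomb (jip \<Omega>) (form \<Omega> (m :: 'n::finite option \<Rightarrow> _))"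
proof -
  interpret V: semi_hilbert "jets0 \<Omega>" jcomb "jip \<Omega>" "test_jets \<Omega>" by (rule semi_hilbert_jets0[OF \<Omega>])
  note J = jets0_subset
  show ?thesis
    unfolding V.sesquilinear_def V.antilinear_on_def V.bounded_on_def nrm_jip
  proof (intro conjI ballI allI exI)
    fix p q r :: "'n jet" and \<alpha> \<beta> :: complex assume "p \<in> jets0 \<Omega>" "q \<in> jets0 \<Omega>" "r \<in> jets0 \<Omega>"
    then show "form \<Omega> m p (jcomb \<alpha> q \<beta> r) = cnj \<alpha> * form \<Omega> m p q + cnj \<beta> * form \<Omega> m p r"
      "form \<Omega> m (jcomb \<alpha> p \<beta> q) r = \<alpha> * form \<Omega> m p r + \<beta> * form \<Omega> m q r"
      by (auto intro!: form_comb_right[OF m(1)] form_comb_left[OF m(1)] J)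
  next
    fix p q :: "'n jet" assume "p \<in> jets0 \<Omega>" "q \<in> jets0 \<Omega>"
    then show "cmod (form \<Omega> m p q) \<le> (real (CARD('n option) * CARD('n option)) * B) * jnrm \<Omega> p * jnrm \<Omega> q"
      by (intro form_bound[OF m] J)
  qed
qed

section \<open>Jets that are square-integrable on compact subsets\<close>

definition jets_loc :: "(real^'n::finite) set \<Rightarrow> 'n jet set" where
  "jets_loc \<Omega> = {p. \<forall>i. p i \<in> L2_loc \<Omega>}"

lemma jets_loc_jets: "p \<in> jets_loc \<Omega> \<Longrightarrow> compact K \<Longrightarrow> K \<subseteq> \<Omega> \<Longrightarrow> p \<in> jets K"
  by (auto simp: jets_loc_def L2_loc_def jets_def)

lemma jets_imp_jets_loc: "\<Omega> \<in> sets lebesgue \<Longrightarrow> p \<in> jets \<Omega> \<Longrightarrow> p \<in> jets_loc \<Omega>"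
  by (auto simp: jets_loc_def jets_def L2_imp_L2_loc)

lemma jets_loc_comb: "p \<in> jets_loc \<Omega> \<Longrightarrow> q \<in> jets_loc \<Omega> \<Longrightarrow> jcomb \<alpha> p \<beta> q \<in> jets_loc \<Omega>"
  by (auto simp: jets_loc_def L2_loc_def L2_comb)

lemma jet_smooth_in_jets_loc: "smooth v \<Longrightarrow> jet v \<in> jets_loc \<Omega>"
  using jet_smooth_in_jets[of v]
  by (auto simp: jets_loc_def L2_loc_def jets_def compact_imp_bounded lmeasurable_compact fmeasurableD)

lemma jet_outside_supp: "x \<notin> supp v \<Longrightarrow> jet v i x = 0"
  by (cases i) (auto simp: not_in_supp partial_eq_0_outside_supp)

lemma form_restrict:
  assumes "\<Omega> \<in> sets lebesgue" "compact K" "K \<subseteq> \<Omega>" "supp v \<subseteq> K"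
  shows "form \<Omega> m p (jet v) = form K m p (jet v)"
  unfolding form_def using assms jet_outside_supp[of _ v]
  by (intro sum.cong refl integral_lebesgue_on_mono_set) (auto simp: lmeasurable_compact fmeasurableD)

lemma jnrm_restrict:
  assumes "\<Omega> \<in> sets lebesgue" "compact K" "K \<subseteq> \<Omega>" "supp v \<subseteq> K"
  shows "jnrm \<Omega> (jet v) = jnrm K (jet v)"
proof -
  have "lnrm \<Omega> (jet v i) = lnrm K (jet v i)" for i
    unfolding lnrm_def using assms jet_outside_supp[of _ v i]
    by (subst integral_lebesgue_on_mono_set[of K \<Omega>]) (auto simp: lmeasurable_compact fmeasurableD)
  then show ?thesis by (simp add: jnrm_def)
qed

text \<open>A local jet can be paired with test jets only; the computation is moved to the compact
  support, where the form is bounded.\<close>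

lemma form_comb_left_loc:
  assumes \<Omega>: "\<Omega> \<in> sets lebesgue" and m: "bounded_coef \<Omega> B m"
    and p: "p \<in> jets_loc \<Omega>" "p' \<in> jets_loc \<Omega>" and v: "v \<in> test_functions \<Omega>"
  shows "form \<Omega> m (jcomb \<alpha> p \<beta> p') (jet v) = \<alpha> * form \<Omega> m p (jet v) + \<beta> * form \<Omega> m p' (jet v)"
proof -
  note K = test_compact[OF v] test_supp[OF v]
  note fr = form_restrict[OF \<Omega> K subset_refl]
  show ?thesis unfolding fr
    by (intro form_comb_left[OF bounded_coef_subset[OF m K(2)]] jets_loc_jets[OF _ K] p
        jet_smooth_in_jets_loc test_smooth[OF v])
qed

lemma form_comb_right_loc:
  assumes \<Omega>: "\<Omega> \<in> sets lebesgue" and m: "bounded_coef \<Omega> B m"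
    and p: "p \<in> jets_loc \<Omega>" and v: "v \<in> test_functions \<Omega>" "w \<in> test_functions \<Omega>"
  shows "form \<Omega> m p (jet (\<lambda>x. \<alpha> * v x + \<beta> * w x)) = cnj \<alpha> * form \<Omega> m p (jet v) + cnj \<beta> * form \<Omega> m p (jet w)"
proof -
  let ?K = "supp v \<union> supp w"
  have K: "compact ?K" "?K \<subseteq> \<Omega>" using v by (auto simp: test_functions_def)
  have "supp (\<lambda>x. \<alpha> * v x + \<beta> * w x) \<subseteq> ?K" by (rule supp_subset) (auto simp: not_in_supp)
  note fr = form_restrict[OF \<Omega> K this] form_restrict[OF \<Omega> K, of v] form_restrict[OF \<Omega> K, of w]
  show ?thesis unfolding fr(1) fr(2)[OF Un_upper1] fr(3)[OF Un_upper2]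
    unfolding jet_comb[OF test_smooth[OF v(1)] test_smooth[OF v(2)]]
    by (intro form_comb_right[OF bounded_coef_subset[OF m K(2)]] jets_loc_jets[OF _ K] p
        jet_smooth_in_jets_loc test_smooth[OF v(1)] test_smooth[OF v(2)])
qed

lemma L2_cong_AE:
  assumes "f \<in> L2 S" "g \<in> borel_measurable (lebesgue_on S)" "AE x in lebesgue_on S. g x = f x"
  shows "g \<in> L2 S"
proof -
  have ae: "AE x in lebesgue_on S. (cmod (f x))\<^sup>2 = (cmod (g x))\<^sup>2"
    using assms(3) by eventually_elim simp
  have "integrable (lebesgue_on S) (\<lambda>x. (cmod (g x))\<^sup>2)"
    by (rule integrable_cong_AE_imp[OF L2_integrable[OF assms(1)] _ ae]) (use assms(2) in measurable)
  then show ?thesis using assms(2) by (simp add: L2_def)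
qed

lemma AE_lebesgue_on_subset:
  assumes "AE x in lebesgue_on T. P x" "S \<subseteq> T" "S \<in> sets lebesgue" "T \<in> sets lebesgue"
  shows "AE x in lebesgue_on S. P x"
proof -
  have "AE x in lebesgue. x \<in> T \<longrightarrow> P x" using assms by (simp add: AE_restrict_space_iff)
  then have "AE x in lebesgue. x \<in> S \<longrightarrow> P x" by eventually_elim (use assms(2) in auto)
  then show ?thesis using assms by (simp add: AE_restrict_space_iff)
qed

lemma H1_loc_weak_jet:
  assumes \<Omega>: "open \<Omega>" and u: "u \<in> H1_loc \<Omega>"
  shows "weak_jet \<Omega> u \<in> jets_loc \<Omega>" and "has_weak_partial \<Omega> k u (weak_partial \<Omega> k u)"
proof -
  have g: "\<exists>g\<in>L2_loc \<Omega>. has_weak_partial \<Omega> k u g" for k using u by (auto simp: H1_loc_def)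
  then have hw: "has_weak_partial \<Omega> k u (weak_partial \<Omega> k u)" for k using weak_partial_works by blast
  then show "has_weak_partial \<Omega> k u (weak_partial \<Omega> k u)" .
  have "weak_partial \<Omega> k u \<in> L2 K" if K: "compact K" "K \<subseteq> \<Omega>" for k K
  proof -
    have K': "K \<in> sets lebesgue" using K by (simp add: lmeasurable_compact fmeasurableD)
    obtain g where g: "g \<in> L2_loc \<Omega>" "has_weak_partial \<Omega> k u g" using g[of k] by blast
    show ?thesis
    proof (rule L2_cong_AE)
      show "g \<in> L2 K" using g K by (auto simp: L2_loc_def)
      show "AE x in lebesgue_on K. weak_partial \<Omega> k u x = g x"
        using \<Omega> by (intro AE_lebesgue_on_subset[OF weak_partial_AE[OF \<Omega> g(2)] K(2) K']) auto
      show "weak_partial \<Omega> k u \<in> borel_measurable (lebesgue_on K)"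
        using hw[of k] K by (auto simp: has_weak_partial_def L1_loc_def intro: borel_measurable_integrable)
    qed
  qed
  then show "weak_jet \<Omega> u \<in> jets_loc \<Omega>" using u by (auto simp: jets_loc_def all_option H1_loc_def L2_loc_def)
qed

subsection \<open>Ellipticity\<close>

text \<open>Young's inequality, weighted so that the first square costs half of the ellipticity
  constant.\<close>

lemma two_mult_le_squares:
  fixes s t \<mu> R :: real
  assumes "\<mu> > 0"
  shows "R * s * t \<le> \<mu> / 2 * s\<^sup>2 + R\<^sup>2 / (2 * \<mu>) * t\<^sup>2"
proof -
  have "0 \<le> (\<mu> * s - R * t)\<^sup>2 / (2 * \<mu>)" using assms by simp
  also have "(\<mu> * s - R * t)\<^sup>2 / (2 * \<mu>) = \<mu> / 2 * s\<^sup>2 + R\<^sup>2 / (2 * \<mu>) * t\<^sup>2 - R * s * t"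
    using assms by (simp add: power2_diff field_simps power2_eq_square)
  finally show ?thesis by simp
qed

text \<open>Garding's inequality at a point: each of the \<open>CARD('n)\<close> mixed terms is
  split by Young's inequality, which consumes half of the leading part and adds
  \<open>R\<^sup>2 / (2 * \<mu>)\<close> to the loss of order zero.\<close>

lemma garding_pointwise:
  fixes M :: "'n::finite option \<Rightarrow> 'n option \<Rightarrow> complex" and p :: "'n option \<Rightarrow> complex"
  assumes ell: "\<mu> * (\<Sum>k\<in>UNIV. (cmod (p (Some k)))\<^sup>2) \<le>
      Re (\<Sum>k\<in>UNIV. \<Sum>l\<in>UNIV. M (Some k) (Some l) * p (Some l) * cnj (p (Some k)))"
    and \<mu>: "\<mu> > 0" and R: "\<And>k. cmod (M (Some k) None) + cmod (M None (Some k)) \<le> R"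
  shows "\<mu> / 2 * (\<Sum>k\<in>UNIV. (cmod (p (Some k)))\<^sup>2) + (Re (M None None) - real CARD('n) * R\<^sup>2 / (2 * \<mu>)) * (cmod (p None))\<^sup>2 \<le>
    Re (\<Sum>i\<in>UNIV. \<Sum>j\<in>UNIV. M i j * p j * cnj (p i))"
proof -
  have cross: "- (\<mu> / 2 * (cmod (p (Some k)))\<^sup>2 + R\<^sup>2 / (2 * \<mu>) * (cmod (p None))\<^sup>2) \<le>
      Re (M (Some k) None * p None * cnj (p (Some k)) + M None (Some k) * p (Some k) * cnj (p None))" for k
  proof -
    have "cmod (M (Some k) None * p None * cnj (p (Some k)) + M None (Some k) * p (Some k) * cnj (p None)) \<le>
        (cmod (M (Some k) None) + cmod (M None (Some k))) * (cmod (p (Some k)) * cmod (p None))"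
      by (rule order_trans[OF norm_triangle_ineq]) (simp add: norm_mult algebra_simps)
    also have "\<dots> \<le> R * (cmod (p (Some k)) * cmod (p None))" by (intro mult_right_mono R) simp
    also have "\<dots> \<le> \<mu> / 2 * (cmod (p (Some k)))\<^sup>2 + R\<^sup>2 / (2 * \<mu>) * (cmod (p None))\<^sup>2"
      using two_mult_le_squares[OF \<mu>, of R] by (simp add: mult.assoc)
    finally show ?thesis
      using abs_Re_le_cmod[of "M (Some k) None * p None * cnj (p (Some k)) + M None (Some k) * p (Some k) * cnj (p None)"]
      by linarith
  qed
  have "(\<Sum>i\<in>UNIV. \<Sum>j\<in>UNIV. M i j * p j * cnj (p i)) = M None None * p None * cnj (p None) +
      (\<Sum>k\<in>UNIV. M (Some k) None * p None * cnj (p (Some k)) + M None (Some k) * p (Some k) * cnj (p None)) +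
      (\<Sum>k\<in>UNIV. \<Sum>l\<in>UNIV. M (Some k) (Some l) * p (Some l) * cnj (p (Some k)))"
    by (simp add: sum_option sum.distrib)
  then have "Re (\<Sum>i\<in>UNIV. \<Sum>j\<in>UNIV. M i j * p j * cnj (p i)) = Re (M None None * p None * cnj (p None)) +
      (\<Sum>k\<in>UNIV. Re (M (Some k) None * p None * cnj (p (Some k)) + M None (Some k) * p (Some k) * cnj (p None))) +
      Re (\<Sum>k\<in>UNIV. \<Sum>l\<in>UNIV. M (Some k) (Some l) * p (Some l) * cnj (p (Some k)))"
    by (simp only: plus_complex.sel Re_sum)
  moreover have "Re (M None None * p None * cnj (p None)) = Re (M None None) * (cmod (p None))\<^sup>2"
    unfolding mult.assoc complex_norm_square[symmetric] by simp
  moreover have "(\<Sum>k\<in>UNIV. - (\<mu> / 2 * (cmod (p (Some k)))\<^sup>2 + R\<^sup>2 / (2 * \<mu>) * (cmod (p None))\<^sup>2)) \<le>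
      (\<Sum>k\<in>UNIV. Re (M (Some k) None * p None * cnj (p (Some k)) + M None (Some k) * p (Some k) * cnj (p None)))"
    by (intro sum_mono cross)
  moreover have "(\<Sum>k\<in>(UNIV::'n set). - (\<mu> / 2 * (cmod (p (Some k)))\<^sup>2 + R\<^sup>2 / (2 * \<mu>) * (cmod (p None))\<^sup>2)) =
      - (\<mu> / 2 * (\<Sum>k\<in>UNIV. (cmod (p (Some k)))\<^sup>2)) - real CARD('n) * R\<^sup>2 / (2 * \<mu>) * (cmod (p None))\<^sup>2"
    by (simp add: sum_negf sum.distrib sum_distrib_left sum_subtractf)
  moreover have "\<mu> * (\<Sum>k\<in>UNIV. (cmod (p (Some k)))\<^sup>2) = \<mu> / 2 * (\<Sum>k\<in>UNIV. (cmod (p (Some k)))\<^sup>2) + \<mu> / 2 * (\<Sum>k\<in>UNIV. (cmod (p (Some k)))\<^sup>2)"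
    by simp
  ultimately show ?thesis using ell unfolding left_diff_distrib by linarith
qed

lemma Re_form_integral:
  assumes m: "bounded_coef S B m" and p: "p \<in> jets S" and q: "q \<in> jets S"
  shows "Re (form S m p q) = (LINT x|lebesgue_on S. Re (\<Sum>i\<in>UNIV. \<Sum>j\<in>UNIV. m i j x * p j x * cnj (q i x)))"
    and "integrable (lebesgue_on S) (\<lambda>x. Re (\<Sum>i\<in>UNIV. \<Sum>j\<in>UNIV. m i j x * p j x * cnj (q i x)))"
proof -
  have int: "integrable (lebesgue_on S) (\<lambda>x. m i j x * p j x * cnj (q i x))" for i j
    by (rule form_entry_integrable[OF m jetsD[OF p] jetsD[OF q]])
  have I: "integrable (lebesgue_on S) (\<lambda>x. \<Sum>i\<in>UNIV. \<Sum>j\<in>UNIV. m i j x * p j x * cnj (q i x))"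
    by (intro Bochner_Integration.integrable_sum int)
  show "integrable (lebesgue_on S) (\<lambda>x. Re (\<Sum>i\<in>UNIV. \<Sum>j\<in>UNIV. m i j x * p j x * cnj (q i x)))"
    by (rule integrable_bounded_linear[OF bounded_linear_Re I])
  have "form S m p q = (LINT x|lebesgue_on S. (\<Sum>i\<in>UNIV. \<Sum>j\<in>UNIV. m i j x * p j x * cnj (q i x)))"
  proof -
    have "(LINT x|lebesgue_on S. (\<Sum>i\<in>UNIV. \<Sum>j\<in>UNIV. m i j x * p j x * cnj (q i x))) =
        (\<Sum>i\<in>UNIV. (LINT x|lebesgue_on S. (\<Sum>j\<in>UNIV. m i j x * p j x * cnj (q i x))))"
      by (intro Bochner_Integration.integral_sum Bochner_Integration.integrable_sum int)
    also have "\<dots> = form S m p q"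
      unfolding form_def by (intro sum.cong refl Bochner_Integration.integral_sum int)
    finally show ?thesis by simp
  qed
  then show "Re (form S m p q) = (LINT x|lebesgue_on S. Re (\<Sum>i\<in>UNIV. \<Sum>j\<in>UNIV. m i j x * p j x * cnj (q i x)))"
    using integral_bounded_linear[OF bounded_linear_Re I] by simp
qed

lemma jnrm_sq_split: "(jnrm S p)\<^sup>2 = (lnrm S (p None))\<^sup>2 + (\<Sum>k\<in>UNIV. (lnrm S (p (Some k)))\<^sup>2)"
  by (simp add: jnrm_sq sum_option)

lemma
  assumes "p \<in> jets S"
  shows jnrm_weighted_integral: "(LINT x|lebesgue_on S. s * (\<Sum>k\<in>UNIV. (cmod (p (Some k) x))\<^sup>2) + t * (cmod (p None x))\<^sup>2) =
      s * (\<Sum>k\<in>UNIV. (lnrm S (p (Some k)))\<^sup>2) + t * (lnrm S (p None))\<^sup>2"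
    and jnrm_weighted_integrable: "integrable (lebesgue_on S) (\<lambda>x. s * (\<Sum>k\<in>UNIV. (cmod (p (Some k) x))\<^sup>2) + t * (cmod (p None x))\<^sup>2)"
  using L2_integrable[OF jetsD[OF assms]] by (simp_all add: lnrm_sq)

locale elliptic =
  fixes \<Omega> :: "(real^'n::finite) set" and a :: "'n \<Rightarrow> 'n \<Rightarrow> real^'n \<Rightarrow> real"
    and b :: "'n \<Rightarrow> real^'n \<Rightarrow> complex" and c :: "'n \<Rightarrow> real^'n \<Rightarrow> real" and c0 :: "real^'n \<Rightarrow> complex"
    and \<mu> B :: real
  assumes \<Omega>: "open \<Omega>" "bounded \<Omega>"
    and meas: "\<And>k l. a k l \<in> borel_measurable (lebesgue_on \<Omega>)" "\<And>k. b k \<in> borel_measurable (lebesgue_on \<Omega>)"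
      "\<And>k. c k \<in> borel_measurable (lebesgue_on \<Omega>)" "c0 \<in> borel_measurable (lebesgue_on \<Omega>)"
    and bound: "\<And>k l x. x \<in> \<Omega> \<Longrightarrow> \<bar>a k l x\<bar> \<le> B" "\<And>k x. x \<in> \<Omega> \<Longrightarrow> cmod (b k x) \<le> B"
      "\<And>k x. x \<in> \<Omega> \<Longrightarrow> \<bar>c k x\<bar> \<le> B" "\<And>x. x \<in> \<Omega> \<Longrightarrow> cmod (c0 x) \<le> B" and B: "B \<ge> 0"
    and \<mu>: "\<mu> > 0" "\<mu> \<le> 1"
    and ell: "\<And>x (\<xi> :: complex^'n). x \<in> \<Omega> \<Longrightarrow>
           Re (\<Sum>k\<in>UNIV. \<Sum>l\<in>UNIV. of_real (a k l x) * \<xi> $ k * cnj (\<xi> $ l)) \<ge> \<mu> * (norm \<xi>)\<^sup>2"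
begin

lemma \<Omega>_sets[simp]: "\<Omega> \<in> sets lebesgue"
  using \<Omega> by auto

text \<open>The ellipticity hypothesis conjugates the entry with the column index, the form the one
  with the row index; inserting the conjugate vector passes from one to the other.\<close>

lemma ell': "x \<in> \<Omega> \<Longrightarrow> \<mu> * (\<Sum>k\<in>UNIV. (cmod (\<xi> k))\<^sup>2) \<le> Re (\<Sum>k\<in>UNIV. \<Sum>l\<in>UNIV. of_real (a k l x) * \<xi> l * cnj (\<xi> k))"
  using ell[of x "\<chi> k. cnj (\<xi> k)"] by (simp add: norm_vec_def L2_set_def sum_nonneg mult_ac)

text \<open>The operator with the same leading part but with zero-order coefficient so large that the
  form is coercive and a maximum principle holds.\<close>

definition \<kappa> :: real where "\<kappa> = real CARD('n) * B\<^sup>2 / (2 * \<mu>) + 1"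

abbreviation m where "m \<equiv> coef a b c c0"
abbreviation m1 where "m1 \<equiv> coef a (\<lambda>_ _. 0) c (\<lambda>_. of_real \<kappa>)"

lemma \<kappa>: "\<kappa> \<ge> 1"
  using \<mu> by (simp add: \<kappa>_def)

lemma bounded_m: "bounded_coef \<Omega> B m"
  unfolding bounded_coef_def all_option using meas bound by auto

lemma bounded_m1: "bounded_coef \<Omega> (B + \<kappa>) m1"
proof -
  have "coef a (\<lambda>_ _. 0) c (\<lambda>_. of_real \<kappa>) i j \<in> borel_measurable (lebesgue_on \<Omega>)" for i j
    using meas by (cases i; cases j) auto
  moreover have "cmod (m1 i j x) \<le> B + \<kappa>" if "x \<in> \<Omega>" for i j x
    using bound(1,3)[OF that] \<kappa> B by (cases i; cases j) (auto intro: order_trans[of _ B])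
  ultimately show ?thesis by (simp add: bounded_coef_def)
qed

text \<open>With \<open>b = 0\<close> the mixed terms are bounded by \<open>B\<close> alone, and
  \<open>\<kappa>\<close> exceeds the resulting loss by 1; since \<open>\<mu> \<le> 1\<close>, this
  remainder covers the zeroth component.\<close>

lemma coercive1:
  assumes p: "p \<in> jets \<Omega>"
  shows "\<mu> / 2 * (jnrm \<Omega> p)\<^sup>2 \<le> Re (form \<Omega> m1 p p)"
proof -
  have "\<mu> / 2 * (\<Sum>k\<in>UNIV. (lnrm \<Omega> (p (Some k)))\<^sup>2) + 1 * (lnrm \<Omega> (p None))\<^sup>2 \<le> Re (form \<Omega> m1 p p)"
    unfolding Re_form_integral[OF bounded_m1 p p] jnrm_weighted_integral[OF p, symmetric]
  proof (rule integral_mono)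
    fix x assume "x \<in> space (lebesgue_on \<Omega>)"
    then have x: "x \<in> \<Omega>" by simp
    have "\<mu> / 2 * (\<Sum>k\<in>UNIV. (cmod (p (Some k) x))\<^sup>2) + (Re (m1 None None x) - real CARD('n) * B\<^sup>2 / (2 * \<mu>)) * (cmod (p None x))\<^sup>2
        \<le> Re (\<Sum>i\<in>UNIV. \<Sum>j\<in>UNIV. m1 i j x * p j x * cnj (p i x))"
      by (rule garding_pointwise[where p="\<lambda>i. p i x" and M="\<lambda>i j. m1 i j x"])
        (use ell'[OF x, of "\<lambda>k. p (Some k) x"] \<mu> bound(3)[OF x] in auto)
    then show "\<mu> / 2 * (\<Sum>k\<in>UNIV. (cmod (p (Some k) x))\<^sup>2) + 1 * (cmod (p None x))\<^sup>2
        \<le> Re (\<Sum>i\<in>UNIV. \<Sum>j\<in>UNIV. m1 i j x * p j x * cnj (p i x))"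
      by (simp add: \<kappa>_def)
  qed (rule jnrm_weighted_integrable[OF p], rule Re_form_integral(2)[OF bounded_m1 p p])
  moreover have "\<mu> / 2 * (lnrm \<Omega> (p None))\<^sup>2 \<le> 1 * (lnrm \<Omega> (p None))\<^sup>2" using \<mu> by (intro mult_right_mono) auto
  ultimately show ?thesis unfolding jnrm_sq_split distrib_left by linarith
qed

text \<open>Both families of first-order coefficients now contribute, hence \<open>2 * B\<close>,
  and the real part of \<open>c0\<close> may be as low as \<open>- B\<close>.\<close>

lemma garding:
  assumes p: "p \<in> jets \<Omega>"
  shows "\<mu> / 2 * (\<Sum>k\<in>UNIV. (lnrm \<Omega> (p (Some k)))\<^sup>2) - (B + real CARD('n) * (2 * B)\<^sup>2 / (2 * \<mu>)) * (lnrm \<Omega> (p None))\<^sup>2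
    \<le> Re (form \<Omega> m p p)"
proof -
  let ?\<beta> = "B + real CARD('n) * (2 * B)\<^sup>2 / (2 * \<mu>)"
  have "\<mu> / 2 * (\<Sum>k\<in>UNIV. (lnrm \<Omega> (p (Some k)))\<^sup>2) + (- ?\<beta>) * (lnrm \<Omega> (p None))\<^sup>2 \<le> Re (form \<Omega> m p p)"
    unfolding Re_form_integral[OF bounded_m p p] jnrm_weighted_integral[OF p, symmetric]
  proof (rule integral_mono)
    fix x assume "x \<in> space (lebesgue_on \<Omega>)"
    then have x: "x \<in> \<Omega>" by simp
    have R: "cmod (m (Some k) None x) + cmod (m None (Some k) x) \<le> 2 * B" for k
      using bound(2,3)[OF x, of k] by simp
    have "- ?\<beta> \<le> Re (m None None x) - real CARD('n) * (2 * B)\<^sup>2 / (2 * \<mu>)"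
      using bound(4)[OF x] abs_Re_le_cmod[of "c0 x"] by simp
    then have "(- ?\<beta>) * (cmod (p None x))\<^sup>2 \<le> (Re (m None None x) - real CARD('n) * (2 * B)\<^sup>2 / (2 * \<mu>)) * (cmod (p None x))\<^sup>2"
      by (rule mult_right_mono) simp
    moreover have "\<mu> / 2 * (\<Sum>k\<in>UNIV. (cmod (p (Some k) x))\<^sup>2) + (Re (m None None x) - real CARD('n) * (2 * B)\<^sup>2 / (2 * \<mu>)) * (cmod (p None x))\<^sup>2
        \<le> Re (\<Sum>i\<in>UNIV. \<Sum>j\<in>UNIV. m i j x * p j x * cnj (p i x))"
      by (rule garding_pointwise[where p="\<lambda>i. p i x" and M="\<lambda>i j. m i j x"])
        (use ell'[OF x, of "\<lambda>k. p (Some k) x"] \<mu> R in auto)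
    ultimately show "\<mu> / 2 * (\<Sum>k\<in>UNIV. (cmod (p (Some k) x))\<^sup>2) + (- ?\<beta>) * (cmod (p None x))\<^sup>2
        \<le> Re (\<Sum>i\<in>UNIV. \<Sum>j\<in>UNIV. m i j x * p j x * cnj (p i x))"
      by linarith
  qed (rule jnrm_weighted_integrable[OF p], rule Re_form_integral(2)[OF bounded_m p p])
  then show ?thesis by (simp only: mult_minus_left add_uminus_conv_diff)
qed

section \<open>Solvability of the two equations in \<open>jets0\<close>\<close>

sublocale V: semi_hilbert "jets0 \<Omega>" jcomb "jip \<Omega>" "test_jets \<Omega>"
  rewrites "semi_inner.nrm (jip \<Omega>) = jnrm \<Omega>"
  by (rule semi_hilbert_jets0[OF \<Omega>_sets]) (rule nrm_jip)

definition antidual :: "real \<Rightarrow> ('n cfun \<Rightarrow> complex) \<Rightarrow> bool" where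
  "antidual K G \<longleftrightarrow> (\<forall>v\<in>test_functions \<Omega>. \<forall>w\<in>test_functions \<Omega>. \<forall>\<alpha> \<beta>.
      G (\<lambda>x. \<alpha> * v x + \<beta> * w x) = cnj \<alpha> * G v + cnj \<beta> * G w) \<and>
    (\<forall>v\<in>test_functions \<Omega>. cmod (G v) \<le> K * jnrm \<Omega> (jet v))"

lemma antidual_jets:
  assumes "antidual K G"
  shows "V.antilinear_on (test_jets \<Omega>) (\<lambda>q. G (q None))" "V.bounded_on (test_jets \<Omega>) K (\<lambda>q. G (q None))"
  using assms by (auto simp: antidual_def V.antilinear_on_def V.bounded_on_def test_jets_def)

theorem solve1:
  assumes G: "antidual K G" and K: "K \<ge> 0"
  obtains p where "p \<in> jets0 \<Omega>" "\<mu> / 2 * jnrm \<Omega> p \<le> K" "\<And>v. v \<in> test_functions \<Omega> \<Longrightarrow> form \<Omega> m1 p (jet v) = G v"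
proof -
  have pos: "0 \<le> B + \<kappa>" "0 < \<mu> / 2" using B \<kappa> \<mu> by auto
  have "\<exists>p\<in>jets0 \<Omega>. \<mu> / 2 * jnrm \<Omega> p \<le> K \<and> (\<forall>d\<in>test_jets \<Omega>. form \<Omega> m1 p d = G (d None))"
    by (rule V.lax_milgram[OF form_sesquilinear_jets0[OF \<Omega>_sets bounded_m1 pos(1)] pos(2)
          coercive1[OF jets0_subset] antidual_jets[OF G] K])
  then show thesis using that by (auto simp: test_jets_def)
qed

text \<open>Each term is continuous along test jets converging in the jet norm, so the estimate for
  test functions extends to their closure.\<close>

lemma lnrm_estimate_jets0:
  assumes \<eta>: "\<eta> > 0"
  obtains C and N :: "(real^'n) set" and \<delta> where "C \<ge> 0" "finite N"
    "\<And>p. p \<in> jets0 \<Omega> \<Longrightarrow> (lnrm \<Omega> (p None))\<^sup>2 \<le> \<eta> * (\<Sum>k\<in>UNIV. (lnrm \<Omega> (p (Some k)))\<^sup>2) +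
       C * (\<Sum>y\<in>N. (cmod (LINT x|lebesgue_on \<Omega>. indicator (ball y \<delta>) x * p None x))\<^sup>2)"
proof -
  obtain C and N :: "(real^'n) set" and \<delta> where CN: "C \<ge> 0" "finite N" and
    est: "\<And>v. v \<in> test_functions \<Omega> \<Longrightarrow> (lnrm \<Omega> v)\<^sup>2 \<le> \<eta> * (\<Sum>k\<in>UNIV. (lnrm \<Omega> (partial k v))\<^sup>2) +
       C * (\<Sum>y\<in>N. (cmod (LINT x|lebesgue_on \<Omega>. indicator (ball y \<delta>) x * v x))\<^sup>2)"
    by (rule finite_rank_estimate[OF \<Omega> \<eta>]) blast
  show thesis
  proof (rule that[OF CN])
    fix p assume p: "p \<in> jets0 \<Omega>"
    obtain X where X: "\<And>n. X n \<in> test_jets \<Omega>" "(\<lambda>n. jnrm \<Omega> (jcomb 1 (X n) (-1) p)) \<longlonglongrightarrow> 0"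
      using V.D_approx[OF p] by blast
    have w: "X n None \<in> test_functions \<Omega>" "partial k (X n None) = X n (Some k)" for n k
      using X(1)[of n] by (auto simp: test_jets_def)
    have XL: "X n i \<in> L2 \<Omega>" "p i \<in> L2 \<Omega>" for n i
      using X(1) p V.D_in_V jets0_subset jetsD by blast+
    have conv: "(\<lambda>n. lnrm \<Omega> (lcomb 1 (X n i) (-1) (p i))) \<longlonglongrightarrow> 0" for i
      by (rule Lim_null_comparison[OF always_eventually X(2)]) (use lnrm_le_jnrm in fastforce)
    have nlim: "(\<lambda>n. lnrm \<Omega> (X n i)) \<longlonglongrightarrow> lnrm \<Omega> (p i)" for i
      by (rule L2.nrm_tendsto[OF XL conv])
    have llim: "(\<lambda>n. LINT x|lebesgue_on \<Omega>. indicator (ball y \<delta>) x * X n None x) \<longlonglongrightarrow>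
        (LINT x|lebesgue_on \<Omega>. indicator (ball y \<delta>) x * p None x)" for y
    proof -
      let ?I = "\<lambda>x. indicator (ball y \<delta>) x :: complex"
      have I: "?I \<in> L2 \<Omega>"
      proof (rule L2_bounded[OF \<Omega>_sets \<Omega>(2), of _ 1])
        show "?I \<in> borel_measurable (lebesgue_on \<Omega>)"
          by (intro measurable_restrict_space1 borel_measurable_indicator) simp
      qed (auto simp: indicator_def)
      have eq: "(LINT x|lebesgue_on \<Omega>. indicator (ball y \<delta>) x * u x) = lip \<Omega> u ?I" for u :: "'n cfun"
        unfolding lip_def by (intro Bochner_Integration.integral_cong) (auto simp: indicator_def)
      show ?thesis unfolding eq
        by (rule L2.linear_tendsto[where G="\<lambda>u. lip \<Omega> u ?I" and K="lnrm \<Omega> ?I", OF _ _ XL conv])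
          (use L2.ip_comb[OF _ _ I] L2.cauchy_schwarz[OF _ I] in \<open>auto simp: mult.commute\<close>)
    qed
    show "(lnrm \<Omega> (p None))\<^sup>2 \<le> \<eta> * (\<Sum>k\<in>UNIV. (lnrm \<Omega> (p (Some k)))\<^sup>2) +
       C * (\<Sum>y\<in>N. (cmod (LINT x|lebesgue_on \<Omega>. indicator (ball y \<delta>) x * p None x))\<^sup>2)"
    proof (rule LIMSEQ_le)
      show "(\<lambda>n. (lnrm \<Omega> (X n None))\<^sup>2) \<longlonglongrightarrow> (lnrm \<Omega> (p None))\<^sup>2" by (intro tendsto_intros nlim)
      show "(\<lambda>n. \<eta> * (\<Sum>k\<in>UNIV. (lnrm \<Omega> (X n (Some k)))\<^sup>2) +
          C * (\<Sum>y\<in>N. (cmod (LINT x|lebesgue_on \<Omega>. indicator (ball y \<delta>) x * X n None x))\<^sup>2)) \<longlonglongrightarrow>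
          \<eta> * (\<Sum>k\<in>UNIV. (lnrm \<Omega> (p (Some k)))\<^sup>2) +
          C * (\<Sum>y\<in>N. (cmod (LINT x|lebesgue_on \<Omega>. indicator (ball y \<delta>) x * p None x))\<^sup>2)"
        by (intro tendsto_intros nlim llim)
      show "\<exists>N'. \<forall>n\<ge>N'. (lnrm \<Omega> (X n None))\<^sup>2 \<le> \<eta> * (\<Sum>k\<in>UNIV. (lnrm \<Omega> (X n (Some k)))\<^sup>2) +
          C * (\<Sum>y\<in>N. (cmod (LINT x|lebesgue_on \<Omega>. indicator (ball y \<delta>) x * X n None x))\<^sup>2)"
        using est[OF w(1)] unfolding w(2) by blast
    qed
  qed
qed

text \<open>The compactness estimate with small \<open>\<eta>\<close> trades the negative
  \<open>L\<^sup>2\<close> term of Garding's inequality for a part of the gradient term and finitely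
  many integrals over balls, so the form is coercive up to finite rank.\<close>

theorem solve:
  assumes inj: "\<And>u. u \<in> H1_0 \<Omega> \<Longrightarrow> ell_op \<Omega> a b c c0 u = (\<lambda>_. 0) \<Longrightarrow> AE x in lebesgue_on \<Omega>. u x = 0"
  obtains C where "C \<ge> 0"
    "\<And>G K. antidual K G \<Longrightarrow> K \<ge> 0 \<Longrightarrow>
      \<exists>p\<in>jets0 \<Omega>. jnrm \<Omega> p \<le> C * K \<and> (\<forall>v\<in>test_functions \<Omega>. form \<Omega> m p (jet v) = G v)"
proof -
  \<comment> \<open>The final \<open>\<mu> / 2\<close> is added so that, after absorption, a
    positive multiple of the zeroth component remains.\<close>
  define \<beta> where "\<beta> = B + real CARD('n) * (2 * B)\<^sup>2 / (2 * \<mu>) + \<mu> / 2"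
  have \<beta>: "\<beta> > 0" using \<mu> B by (auto simp: \<beta>_def intro!: add_nonneg_pos)
  define \<eta> where "\<eta> = \<mu> / (4 * \<beta>)"
  have \<eta>: "\<eta> > 0" "\<beta> * \<eta> = \<mu> / 4" using \<mu> \<beta> by (auto simp: \<eta>_def)
  obtain C and N :: "(real^'n) set" and \<delta> where CN: "C \<ge> 0" "finite N" and
    est: "\<And>p. p \<in> jets0 \<Omega> \<Longrightarrow> (lnrm \<Omega> (p None))\<^sup>2 \<le> \<eta> * (\<Sum>k\<in>UNIV. (lnrm \<Omega> (p (Some k)))\<^sup>2) +
       C * (\<Sum>y\<in>N. (cmod (LINT x|lebesgue_on \<Omega>. indicator (ball y \<delta>) x * p None x))\<^sup>2)"
    by (rule lnrm_estimate_jets0[OF \<eta>(1)]) blast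
  define l where "l y p = (LINT x|lebesgue_on \<Omega>. indicator (ball y \<delta>) x * p None x)" for y and p :: "'n jet"
  have I: "(\<lambda>x. indicator (ball y \<delta>) x :: complex) \<in> L2 \<Omega>" for y
  proof (rule L2_bounded[OF \<Omega>_sets \<Omega>(2), of _ 1])
    show "(\<lambda>x. indicator (ball y \<delta>) x :: complex) \<in> borel_measurable (lebesgue_on \<Omega>)"
      by (intro measurable_restrict_space1 borel_measurable_indicator) simp
  qed (auto simp: indicator_def)
  have l_eq: "l y p = lip \<Omega> (p None) (\<lambda>x. indicator (ball y \<delta>) x)" for y p
    unfolding lip_def l_def by (intro Bochner_Integration.integral_cong) (auto simp: indicator_def)
  have PL: "p i \<in> L2 \<Omega>" if "p \<in> jets0 \<Omega>" for p i using that jets0_subset jetsD by blast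
  define L where "L = (\<Sum>y\<in>N. lnrm \<Omega> (\<lambda>x. indicator (ball y \<delta>) x :: complex))"
  have lL: "cmod (l y p) \<le> L * jnrm \<Omega> p" if "y \<in> N" "p \<in> jets0 \<Omega>" for y p
  proof -
    have "cmod (l y p) \<le> lnrm \<Omega> (p None) * lnrm \<Omega> (\<lambda>x. indicator (ball y \<delta>) x :: complex)"
      unfolding l_eq by (rule L2.cauchy_schwarz[OF PL[OF that(2)] I])
    also have "\<dots> \<le> jnrm \<Omega> p * L"
      unfolding L_def using that CN by (intro mult_mono lnrm_le_jnrm member_le_sum) auto
    finally show ?thesis by (simp add: mult.commute)
  qed
  have coercive: "\<mu> / 4 * (jnrm \<Omega> p)\<^sup>2 \<le> Re (form \<Omega> m p p) + (\<beta> * C) * (\<Sum>y\<in>N. (cmod (l y p))\<^sup>2)"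
    if p: "p \<in> jets0 \<Omega>" for p
  proof -
    let ?S = "\<Sum>k\<in>UNIV. (lnrm \<Omega> (p (Some k)))\<^sup>2"
    have "\<beta> * (lnrm \<Omega> (p None))\<^sup>2 \<le> \<beta> * (\<eta> * ?S + C * (\<Sum>y\<in>N. (cmod (l y p))\<^sup>2))"
      using est[OF p] \<beta> unfolding l_def by (intro mult_left_mono) auto
    also have "\<dots> = \<mu> / 4 * ?S + (\<beta> * C) * (\<Sum>y\<in>N. (cmod (l y p))\<^sup>2)"
      using \<eta>(2) by (simp add: distrib_left flip: mult.assoc)
    finally have 1: "\<beta> * (lnrm \<Omega> (p None))\<^sup>2 \<le> \<mu> / 4 * ?S + (\<beta> * C) * (\<Sum>y\<in>N. (cmod (l y p))\<^sup>2)" .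
    have 2: "\<mu> / 2 * ?S - (\<beta> - \<mu> / 2) * (lnrm \<Omega> (p None))\<^sup>2 \<le> Re (form \<Omega> m p p)"
      using garding[OF jets0_subset[OF p]] by (simp add: \<beta>_def)
    have 3: "\<mu> / 4 * (lnrm \<Omega> (p None))\<^sup>2 \<le> \<mu> / 2 * (lnrm \<Omega> (p None))\<^sup>2" using \<mu> by (intro mult_right_mono) auto
    have 4: "\<mu> / 2 * ?S = \<mu> / 4 * ?S + \<mu> / 4 * ?S" by simp
    show ?thesis
      using 1 2 3 4 unfolding jnrm_sq_split distrib_left left_diff_distrib by linarith
  qed
  \<comment> \<open>The hypothesis speaks of \<open>ell_op\<close> and hence of the chosen weak
    derivatives; these agree with the components of \<open>p\<close> almost everywhere. It yields
    only that \<open>p None\<close> vanishes, and uniqueness of weak derivatives gives the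
    rest.\<close>
  have inj': "jnrm \<Omega> p = 0" if p: "p \<in> jets0 \<Omega>" and z: "\<And>d. d \<in> test_jets \<Omega> \<Longrightarrow> form \<Omega> m p d = 0" for p
  proof -
    note H = jets0_H1_0[OF \<Omega>(1) p]
    have wj: "weak_jet \<Omega> (p None) \<in> jets \<Omega>" using H1_0_weak_jet[OF \<Omega>(1) H(1)] jets0_subset by blast
    have "ell_op \<Omega> a b c c0 (p None) v = 0" for v
    proof (cases "v \<in> test_functions \<Omega>")
      case True
      have "form \<Omega> m (weak_jet \<Omega> (p None)) (jet v) = form \<Omega> m p (jet v)"
        by (rule form_cong_AE[OF bounded_m wj jets0_subset[OF p] jet_test_in_jets[OF True \<Omega>_sets] H(2)])
      then show ?thesis using z True by (simp add: ell_op_eq_form test_jets_def)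
    qed (simp add: ell_op_def)
    then have ae: "AE x in lebesgue_on \<Omega>. p None x = 0" by (intro inj H(1)) auto
    have "AE x in lebesgue_on \<Omega>. p i x = 0" for i
    proof (cases i)
      case None
      then show ?thesis using ae by simp
    next
      case (Some k)
      have "has_weak_partial \<Omega> k (\<lambda>_. 0) (\<lambda>_. 0)"
        using smooth_has_weak_partial[OF \<Omega>_sets, of "\<lambda>_. 0" k] by simp
      from has_weak_partial_unique_AE[OF \<Omega>(1) jets0_has_weak_partial[OF \<Omega>(1) p] this ae]
      show ?thesis using Some by simp
    qed
    then show ?thesis using jnrm_eq_0_iff[OF jets0_subset[OF p]] by blast
  qed
  have lcomb: "l y (jcomb \<alpha> p \<beta>' q) = \<alpha> * l y p + \<beta>' * l y q" if "p \<in> jets0 \<Omega>" "q \<in> jets0 \<Omega>" for y p q \<alpha> \<beta>'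
    unfolding l_eq by (rule L2.ip_comb[OF PL[OF that(1)] PL[OF that(2)] I])
  have \<mu>4: "\<mu> / 4 > 0" using \<mu> by simp
  obtain C' where C': "C' \<ge> 0" "\<And>G K. V.antilinear_on (test_jets \<Omega>) G \<Longrightarrow> V.bounded_on (test_jets \<Omega>) K G \<Longrightarrow> K \<ge> 0 \<Longrightarrow>
        \<exists>u\<in>jets0 \<Omega>. jnrm \<Omega> u \<le> C' * K \<and> (\<forall>d\<in>test_jets \<Omega>. form \<Omega> m u d = G d)"
    using V.finite_rank_fredholm[OF form_sesquilinear_jets0[OF \<Omega>_sets bounded_m B] CN(2) lcomb lL \<mu>4 coercive inj']
    by blast
  show thesis
  proof (rule that[OF C'(1)])
    fix G K assume "antidual K G" "K \<ge> 0"
    from C'(2)[OF antidual_jets[OF this(1)] this(2)]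
    show "\<exists>p\<in>jets0 \<Omega>. jnrm \<Omega> p \<le> C' * K \<and> (\<forall>v\<in>test_functions \<Omega>. form \<Omega> m p (jet v) = G v)"
      by (auto simp: test_jets_def)
  qed
qed

end

subsection \<open>Truncation\<close>

text \<open>The derivative of \<open>bump1\<close>, equal to
  \<open>exp (- (1 / t)) / t\<^sup>2\<close> for positive \<open>t\<close>.\<close>

definition bump1' :: "real \<Rightarrow> real" where "bump1' = expinv (expinv_deriv 1)"

lemma bump1'_nonneg: "bump1' t \<ge> 0"
  by (simp add: bump1'_def expinv_def expinv_deriv_def poly_monom)

text \<open>For positive \<open>t\<close> and \<open>x = 1 / t\<close> the product is
  \<open>(x + x\<^sup>2) / exp x\<close>, bounded by means of the quadratic Taylor polynomial of
  \<open>exp\<close>. With \<open>t + 1 = |g|\<^sup>2 / M\<^sup>2\<close> this bounds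
  \<open>|g|\<^sup>2\<close> times the derivative of the cutoff factor, uniformly in
  \<open>g\<close>.\<close>

lemma bump1'_bound: "(t + 1) * bump1' t \<le> 2"
proof (cases "t > 0")
  case True
  define x where "x = 1 / t"
  have x: "x > 0" "t = 1 / x" using True by (auto simp: x_def)
  have "(t + 1) * bump1' t = (x + x\<^sup>2) / exp x"
    using True by (simp add: bump1'_def expinv_def expinv_deriv_def poly_monom x_def exp_minus field_simps power2_eq_square)
  also have "\<dots> \<le> 2"
  proof -
    have "1 + x + x\<^sup>2 / 2 \<le> exp x" using exp_lower_Taylor_quadratic[of x] x by simp
    then have "x + x\<^sup>2 \<le> 2 * exp x" using x by simp
    then show ?thesis by (simp add: divide_le_eq)
  qed
  finally show ?thesis .
qed (simp add: bump1'_def expinv_def)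

text \<open>A smooth substitute for the part of \<open>g\<close> exceeding the modulus
  \<open>M\<close>: \<open>g\<close> times a nondecreasing function of its squared modulus, so that
  the phase of \<open>g\<close> is kept.\<close>

definition cut :: "real \<Rightarrow> 'n::finite cfun \<Rightarrow> 'n cfun" where
  "cut M g x = g x * of_real (bump1 ((cmod (g x))\<^sup>2 / M\<^sup>2 - 1))"

text \<open>The argument of the cutoff factor as a polynomial in \<open>g\<close> and its conjugate,
  which brings it under the closure rules for smooth functions.\<close>

definition cut_arg :: "real \<Rightarrow> 'n::finite cfun \<Rightarrow> 'n cfun" where
  "cut_arg M g x = of_real (1 / M\<^sup>2) * (cnj (g x) * g x) - 1"

lemma Re_cut_arg: "Re (cut_arg M g x) = (cmod (g x))\<^sup>2 / M\<^sup>2 - 1"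
proof -
  have "cut_arg M g x = of_real ((cmod (g x))\<^sup>2 / M\<^sup>2 - 1)"
    unfolding cut_arg_def mult.commute[of "cnj (g x)"] complex_norm_square[symmetric] by simp
  then show ?thesis by simp
qed

lemma cut_eq: "cut M g = (\<lambda>x. g x * of_real (bump1 (Re (cut_arg M g x))))"
  by (simp add: cut_def Re_cut_arg fun_eq_iff)

lemma smooth_cut_arg: "smooth g \<Longrightarrow> smooth (cut_arg M g)"
  unfolding cut_arg_def by (intro smooth_diff smooth_mult smooth_const smooth_cnj)

lemma smooth_cut: "smooth g \<Longrightarrow> smooth (cut M g)"
  unfolding cut_eq by (intro smooth_mult smooth_bump1_Re smooth_cut_arg)

lemma partial_cut:
  assumes g: "smooth g"
  shows "partial k (cut M g) x = partial k g x * of_real (bump1 ((cmod (g x))\<^sup>2 / M\<^sup>2 - 1)) +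
    g x * of_real (2 / M\<^sup>2 * bump1' ((cmod (g x))\<^sup>2 / M\<^sup>2 - 1)) * of_real (Re (cnj (g x) * partial k g x))"
proof -
  have d: "f differentiable (at x)" if "smooth f" for f :: "'a cfun" using that by (rule smoothD)
  have "partial k (\<lambda>x. c * (cnj (g x) * g x) - 1) x = c * (cnj (g x) * partial k g x + cnj (partial k g x) * g x)" for c
    using g by (simp add: partial_diff partial_mult partial_cnj d smooth_mult smooth_cnj smooth_diff)
  from this[of "of_real (1 / M\<^sup>2)"]
  have "partial k (cut_arg M g) x = of_real (1 / M\<^sup>2) * (cnj (g x) * partial k g x + cnj (partial k g x) * g x)"
    unfolding cut_arg_def .
  also have "cnj (g x) * partial k g x + cnj (partial k g x) * g x = of_real (2 * Re (cnj (g x) * partial k g x))"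
    using complex_add_cnj[of "cnj (g x) * partial k g x"] by (simp add: mult.commute)
  finally have "Re (partial k (cut_arg M g) x) = 2 / M\<^sup>2 * Re (cnj (g x) * partial k g x)"
    by (simp del: of_real_mult of_real_divide add: of_real_mult[symmetric])
  then have P: "partial k (\<lambda>x. of_real (bump1 (Re (cut_arg M g x)))) x =
      of_real (bump1' (Re (cut_arg M g x))) * of_real (2 / M\<^sup>2 * Re (cnj (g x) * partial k g x))"
    unfolding bump1_def bump1'_def by (simp add: partial_expinv d smooth_cut_arg g)
  show ?thesis
    unfolding cut_eq partial_mult[OF d[OF g] d[OF smooth_bump1_Re[OF smooth_cut_arg[OF g]]]] P
    unfolding Re_cut_arg by (simp only: of_real_mult mult_ac add_ac)
qed

lemma cut_eq_0: "cmod (g x) \<le> M \<Longrightarrow> cut M g x = 0"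
proof -
  assume le: "cmod (g x) \<le> M"
  have "(cmod (g x))\<^sup>2 / M\<^sup>2 \<le> 1"
    using power_mono[OF le, of 2] by (cases "M = 0") (auto simp: divide_le_eq)
  then have "bump1 ((cmod (g x))\<^sup>2 / M\<^sup>2 - 1) = 0" by (simp add: bump1_eq_0_iff)
  then show ?thesis by (simp add: cut_def)
qed

text \<open>Up to modulus \<open>2 * M\<close> the cutoff factor may be anything in the unit
  interval. Beyond it, \<open>1 - bump1 t \<le> 1 / t\<close> with \<open>t\<close> at least
  \<open>|g|\<^sup>2 / (2 * M\<^sup>2)\<close> leaves at most
  \<open>2 * M\<^sup>2 / |g|\<close>.\<close>

lemma cut_remainder:
  assumes M: "M > 0"
  shows "cmod (g x - cut M g x) \<le> 2 * M"
proof -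
  define s where "s = cmod (g x)"
  define t where "t = s\<^sup>2 / M\<^sup>2 - 1"
  have "g x - cut M g x = g x * of_real (1 - bump1 t)"
    by (simp add: cut_def t_def s_def right_diff_distrib)
  then have eq: "cmod (g x - cut M g x) = s * (1 - bump1 t)"
    using bump1_le_1[of t] by (simp add: norm_mult s_def del: of_real_diff)
  show ?thesis
  proof (cases "s \<le> 2 * M")
    case True
    have "s * (1 - bump1 t) \<le> s * 1"
      using bump1_nonneg[of t] by (intro mult_left_mono) (auto simp: s_def)
    then show ?thesis using True eq by simp
  next
    case False
    then have "(2 * M)\<^sup>2 \<le> s\<^sup>2" using M by (intro power_mono) auto
    then have "4 \<le> s\<^sup>2 / M\<^sup>2" using M by (simp add: le_divide_eq power_mult_distrib)
    moreover have "s\<^sup>2 / (2 * M\<^sup>2) = s\<^sup>2 / M\<^sup>2 / 2" by simp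
    ultimately have t1: "t \<ge> s\<^sup>2 / (2 * M\<^sup>2)" and t0: "t > 0" unfolding t_def by linarith+
    have "1 - bump1 t \<le> 1 / t"
      using t0 exp_ge_add_one_self[of "- (1 / t)"] by (simp add: bump1_def expinv_def)
    also have "\<dots> \<le> 2 * M\<^sup>2 / s\<^sup>2"
      using t1 t0 False M by (simp add: field_simps)
    finally have "s * (1 - bump1 t) \<le> s * (2 * M\<^sup>2 / s\<^sup>2)"
      using False M by (intro mult_left_mono) auto
    also have "\<dots> = 2 * M * (M / s)" using False M by (simp add: power2_eq_square)
    also have "\<dots> \<le> 2 * M * 1" using False M by (intro mult_left_mono) auto
    finally show ?thesis using eq by simp
  qed
qed

lemma smooth_truncation:
  assumes "smooth g" "M > 0"
  obtains f where "smooth f" "\<And>x. cmod (f x) \<le> 2 * M" "\<And>x. cmod (g x) \<le> M \<Longrightarrow> f x = g x"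
proof (rule that)
  show "smooth (\<lambda>x. g x - cut M g x)" using assms by (intro smooth_diff smooth_cut)
qed (use cut_remainder[OF assms(2)] cut_eq_0 in auto)

lemma norm_sq_add_le: "(cmod (u + v))\<^sup>2 \<le> 2 * (cmod u)\<^sup>2 + 2 * (cmod v)\<^sup>2"
proof -
  have "(cmod (u + v))\<^sup>2 \<le> (cmod u + cmod v)\<^sup>2" by (intro power_mono norm_triangle_ineq) simp
  also have "\<dots> \<le> 2 * (cmod u)\<^sup>2 + 2 * (cmod v)\<^sup>2"
    using sum_squares_bound[of "cmod u" "cmod v"] by (simp add: power2_sum)
  finally show ?thesis .
qed

context elliptic
begin

text \<open>The pointwise form of the maximum principle: since the \<open>a k l\<close> are real, testing with
  \<open>g h(|g|\<^sup>2)\<close>, \<open>h\<close> increasing, produces only nonnegative leading terms.\<close>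

lemma cut_pointwise:
  fixes \<xi> :: "'n \<Rightarrow> complex"
  assumes x: "x \<in> \<Omega>" and h: "0 \<le> h" "h \<le> 1" and d: "0 \<le> d" "(cmod g)\<^sup>2 * d \<le> 4"
  defines "p \<equiv> (\<lambda>i. case i of None \<Rightarrow> g | Some k \<Rightarrow> \<xi> k)"
    and "q \<equiv> (\<lambda>i. case i of None \<Rightarrow> g * of_real h | Some k \<Rightarrow> \<xi> k * of_real h + g * of_real d * of_real (Re (cnj g * \<xi> k)))"
  shows "\<mu> / 8 * (\<Sum>k\<in>UNIV. (cmod (q (Some k)))\<^sup>2) + \<mu> / 8 * (cmod (q None))\<^sup>2 \<le>
    Re (\<Sum>i\<in>UNIV. \<Sum>j\<in>UNIV. m1 i j x * p j * cnj (q i))"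
proof -
  define r where "r k = Re (cnj g * \<xi> k)" for k
  define X where "X = (\<Sum>k\<in>UNIV. (cmod (\<xi> k))\<^sup>2)"
  define Y where "Y = (\<Sum>k\<in>UNIV. (r k)\<^sup>2)"
  define G where "G = (cmod g)\<^sup>2"
  have nn: "X \<ge> 0" "Y \<ge> 0" "G \<ge> 0" by (auto simp: X_def Y_def G_def sum_nonneg)
  have q_le: "(\<Sum>k\<in>UNIV. (cmod (q (Some k)))\<^sup>2) \<le> 2 * h * X + 8 * d * Y"
  proof -
    have "(cmod (q (Some k)))\<^sup>2 \<le> 2 * h * (cmod (\<xi> k))\<^sup>2 + 8 * d * (r k)\<^sup>2" for k
    proof -
      have "(cmod (q (Some k)))\<^sup>2 \<le> 2 * (cmod (\<xi> k * of_real h))\<^sup>2 + 2 * (cmod (g * of_real d * of_real (r k)))\<^sup>2"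
        unfolding q_def r_def option.case by (rule norm_sq_add_le)
      also have "\<dots> = 2 * ((cmod (\<xi> k))\<^sup>2 * (h * h)) + 2 * ((G * d) * (d * (r k)\<^sup>2))"
        by (simp add: norm_mult power_mult_distrib G_def power2_eq_square[of h] power2_eq_square[of d])
      also have "\<dots> \<le> 2 * ((cmod (\<xi> k))\<^sup>2 * (h * 1)) + 2 * (4 * (d * (r k)\<^sup>2))"
        using h d by (intro add_mono mult_left_mono mult_right_mono) (auto simp: G_def)
      finally show ?thesis by (simp add: mult_ac)
    qed
    then have "(\<Sum>k\<in>UNIV. (cmod (q (Some k)))\<^sup>2) \<le> (\<Sum>k\<in>UNIV. 2 * h * (cmod (\<xi> k))\<^sup>2 + 8 * d * (r k)\<^sup>2)"
      by (intro sum_mono)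
    then show ?thesis by (simp add: sum.distrib X_def Y_def sum_distrib_left)
  qed
  have q0_le: "(cmod (q None))\<^sup>2 \<le> h * G"
  proof -
    have "(cmod (q None))\<^sup>2 = (h * G) * h" using h by (simp add: q_def norm_mult G_def power_mult_distrib power2_eq_square)
    also have "\<dots> \<le> (h * G) * 1" using h nn by (intro mult_left_mono) auto
    finally show ?thesis by simp
  qed
  \<comment> \<open>Differentiating the factor \<open>h\<close> contributes a quadratic form in the
    real vector \<open>r\<close>; as the \<open>a k l\<close> are real, ellipticity bounds it below
    by \<open>\<mu>\<close> times the squared length of \<open>r\<close>.\<close>
  have lead: "Re (of_real (a k l x) * \<xi> l * cnj (q (Some k))) =
      h * Re (of_real (a k l x) * \<xi> l * cnj (\<xi> k)) + d * (a k l x * r l * r k)" for k l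
    by (simp add: q_def r_def algebra_simps)
  have A1: "h * (\<mu> * X) \<le> h * Re (\<Sum>k\<in>UNIV. \<Sum>l\<in>UNIV. of_real (a k l x) * \<xi> l * cnj (\<xi> k))"
    unfolding X_def using h by (intro mult_left_mono ell'[OF x]) auto
  have "\<mu> * Y \<le> (\<Sum>k\<in>UNIV. \<Sum>l\<in>UNIV. a k l x * r l * r k)"
    using ell'[OF x, of "\<lambda>k. of_real (r k)"] by (simp add: Y_def)
  then have A2: "d * (\<mu> * Y) \<le> d * (\<Sum>k\<in>UNIV. \<Sum>l\<in>UNIV. a k l x * r l * r k)"
    using d by (intro mult_left_mono) auto
  have A: "Re (\<Sum>k\<in>UNIV. \<Sum>l\<in>UNIV. of_real (a k l x) * \<xi> l * cnj (q (Some k))) =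
      h * Re (\<Sum>k\<in>UNIV. \<Sum>l\<in>UNIV. of_real (a k l x) * \<xi> l * cnj (\<xi> k)) +
      d * (\<Sum>k\<in>UNIV. \<Sum>l\<in>UNIV. a k l x * r l * r k)"
    unfolding Re_sum lead by (simp only: sum.distrib sum_distrib_left)
  have cl: "- (h * (\<mu> / 2 * (cmod (\<xi> l))\<^sup>2 + B\<^sup>2 / (2 * \<mu>) * G)) \<le> Re (of_real (c l x) * \<xi> l * cnj (q None))" for l
  proof -
    have "cmod (of_real (c l x) * \<xi> l * cnj (q None)) = \<bar>c l x\<bar> * (h * (cmod (\<xi> l) * cmod g))"
      using h by (simp add: q_def norm_mult)
    also have "\<dots> \<le> B * (h * (cmod (\<xi> l) * cmod g))"
      using h bound(3)[OF x] by (intro mult_right_mono) auto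
    also have "\<dots> = h * (B * cmod (\<xi> l) * cmod g)" by simp
    also have "\<dots> \<le> h * (\<mu> / 2 * (cmod (\<xi> l))\<^sup>2 + B\<^sup>2 / (2 * \<mu>) * (cmod g)\<^sup>2)"
      using h by (intro mult_left_mono two_mult_le_squares[OF \<mu>(1)])
    finally show ?thesis using abs_Re_le_cmod[of "of_real (c l x) * \<xi> l * cnj (q None)"] by (simp add: G_def)
  qed
  have C: "- (h * (\<mu> / 2 * X)) - h * (real CARD('n) * B\<^sup>2 / (2 * \<mu>) * G) \<le> (\<Sum>l\<in>UNIV. Re (of_real (c l x) * \<xi> l * cnj (q None)))"
  proof -
    have "(\<Sum>l\<in>(UNIV::'n set). - (h * (\<mu> / 2 * (cmod (\<xi> l))\<^sup>2 + B\<^sup>2 / (2 * \<mu>) * G))) =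
        - (h * (\<mu> / 2 * X)) - h * (real CARD('n) * B\<^sup>2 / (2 * \<mu>) * G)"
      by (simp add: X_def sum_negf sum.distrib distrib_left sum_distrib_left sum_subtractf)
    then show ?thesis using sum_mono[of UNIV "\<lambda>l. - (h * (\<mu> / 2 * (cmod (\<xi> l))\<^sup>2 + B\<^sup>2 / (2 * \<mu>) * G))", OF cl] by simp
  qed
  have zero: "Re (of_real \<kappa> * g * cnj (q None)) = h * (\<kappa> * G)"
  proof -
    have "of_real \<kappa> * g * cnj (q None) = of_real (\<kappa> * h * (cmod g)\<^sup>2)"
      unfolding of_real_mult complex_norm_square by (simp add: q_def)
    then show ?thesis by (simp only: Re_complex_of_real G_def mult_ac)
  qed
  have "Re (\<Sum>i\<in>UNIV. \<Sum>j\<in>UNIV. m1 i j x * p j * cnj (q i)) =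
      Re (of_real \<kappa> * g * cnj (q None)) + (\<Sum>l\<in>UNIV. Re (of_real (c l x) * \<xi> l * cnj (q None))) +
      Re (\<Sum>k\<in>UNIV. \<Sum>l\<in>UNIV. of_real (a k l x) * \<xi> l * cnj (q (Some k)))"
    by (simp add: sum_option p_def)
  also have "\<dots> \<ge> h * (\<kappa> * G) + (- (h * (\<mu> / 2 * X)) - h * (real CARD('n) * B\<^sup>2 / (2 * \<mu>) * G)) + (h * (\<mu> * X) + d * (\<mu> * Y))"
    unfolding zero A using A1 A2 C by linarith
  \<comment> \<open>The loss from the first-order terms is exactly the part of
    \<open>\<kappa>\<close> beyond 1, so \<open>h * G\<close> survives.\<close>
  also have "h * (\<kappa> * G) + (- (h * (\<mu> / 2 * X)) - h * (real CARD('n) * B\<^sup>2 / (2 * \<mu>) * G)) + (h * (\<mu> * X) + d * (\<mu> * Y)) =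
      h * G + \<mu> / 2 * (h * X) + \<mu> * (d * Y)"
    by (simp add: \<kappa>_def algebra_simps)
  finally have lower: "h * G + \<mu> / 2 * (h * X) + \<mu> * (d * Y) \<le> Re (\<Sum>i\<in>UNIV. \<Sum>j\<in>UNIV. m1 i j x * p j * cnj (q i))" .
  \<comment> \<open>The factor \<open>\<mu> / 8\<close> is dictated by the term
    \<open>8 * d * Y\<close> in the bound for the gradient of the truncated function.\<close>
  have "\<mu> / 8 * (\<Sum>k\<in>UNIV. (cmod (q (Some k)))\<^sup>2) + \<mu> / 8 * (cmod (q None))\<^sup>2 \<le>
      \<mu> / 8 * (2 * h * X + 8 * d * Y) + \<mu> / 8 * (h * G)"
    using \<mu> q_le q0_le by (intro add_mono mult_left_mono) auto
  also have "\<dots> = \<mu> / 4 * (h * X) + \<mu> * (d * Y) + \<mu> / 8 * (h * G)" by (simp add: algebra_simps)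
  also have "\<dots> \<le> \<mu> / 2 * (h * X) + \<mu> * (d * Y) + 1 * (h * G)"
    using \<mu> h nn d by (intro add_mono mult_right_mono) auto
  finally show ?thesis using lower by linarith
qed

lemma cut_test:
  assumes g: "smooth g" and K: "compact K" "K \<subseteq> \<Omega>" "\<And>x. x \<notin> K \<Longrightarrow> cmod (g x) \<le> M"
  shows "cut M g \<in> test_functions \<Omega>"
  by (rule test_functionI[OF smooth_cut[OF g] K(1,2)]) (rule cut_eq_0[OF K(3)])

text \<open>Integrates the pointwise inequality, with \<open>h\<close> the cutoff factor and
  \<open>d\<close> twice its derivative with respect to \<open>|g|\<^sup>2\<close>. Off
  \<open>K\<close> the truncation vanishes, so it is admissible as a test function although
  \<open>g\<close> need not vanish at the boundary.\<close>

lemma cut_estimate: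
  assumes g: "smooth g" and K: "compact K" "K \<subseteq> \<Omega>" "\<And>x. x \<notin> K \<Longrightarrow> cmod (g x) \<le> M" and M: "M > 0"
  shows "\<mu> / 8 * (jnrm \<Omega> (jet (cut M g)))\<^sup>2 \<le> Re (form \<Omega> m1 (jet g) (jet (cut M g)))"
proof -
  let ?q = "jet (cut M g)"
  have q: "?q \<in> jets \<Omega>" by (rule jet_test_in_jets[OF cut_test[OF g K] \<Omega>_sets])
  have p: "jet g \<in> jets \<Omega>" by (rule jet_smooth_in_jets[OF g \<Omega>_sets \<Omega>(2)])
  have "\<mu> / 8 * (\<Sum>k\<in>UNIV. (lnrm \<Omega> (?q (Some k)))\<^sup>2) + \<mu> / 8 * (lnrm \<Omega> (?q None))\<^sup>2 \<le> Re (form \<Omega> m1 (jet g) ?q)"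
    unfolding Re_form_integral[OF bounded_m1 p q] jnrm_weighted_integral[OF q, symmetric]
  proof (rule integral_mono)
    fix x assume "x \<in> space (lebesgue_on \<Omega>)"
    then have x: "x \<in> \<Omega>" by simp
    let ?t = "(cmod (g x))\<^sup>2 / M\<^sup>2 - 1"
    have d: "(cmod (g x))\<^sup>2 * (2 / M\<^sup>2 * bump1' ?t) \<le> 4"
      using bump1'_bound[of ?t] by (simp add: mult_ac)
    have eq: "(\<lambda>i. case i of None \<Rightarrow> g x | Some k \<Rightarrow> partial k g x) = (\<lambda>i. jet g i x)"
      "(\<lambda>i. case i of None \<Rightarrow> g x * of_real (bump1 ?t) | Some k \<Rightarrow> partial k g x * of_real (bump1 ?t) +
        g x * of_real (2 / M\<^sup>2 * bump1' ?t) * of_real (Re (cnj (g x) * partial k g x))) = (\<lambda>i. ?q i x)"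
      by (auto simp: fun_eq_iff partial_cut[OF g] cut_def split: option.split)
    have "0 \<le> 2 / M\<^sup>2 * bump1' ?t" using bump1'_nonneg[of ?t] by simp
    from cut_pointwise[OF x bump1_nonneg bump1_le_1 this d, of ?t "\<lambda>k. partial k g x", unfolded eq]
    have *: "\<mu> / 8 * (\<Sum>k\<in>UNIV. (cmod ((\<lambda>i. ?q i x) (Some k)))\<^sup>2) + \<mu> / 8 * (cmod ((\<lambda>i. ?q i x) None))\<^sup>2 \<le>
        Re (\<Sum>i\<in>UNIV. \<Sum>j\<in>UNIV. m1 i j x * (\<lambda>i. jet g i x) j * cnj ((\<lambda>i. ?q i x) i))"
      unfolding eq[symmetric] by simp
    then show "\<mu> / 8 * (\<Sum>k\<in>UNIV. (cmod (?q (Some k) x))\<^sup>2) + \<mu> / 8 * (cmod (?q None x))\<^sup>2 \<le>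
        Re (\<Sum>i\<in>UNIV. \<Sum>j\<in>UNIV. m1 i j x * jet g j x * cnj (?q i x))"
      by blast
  qed (rule jnrm_weighted_integrable[OF q], rule Re_form_integral(2)[OF bounded_m1 p q])
  then show ?thesis unfolding jnrm_sq_split distrib_left by linarith
qed

lemma form_bound_const:
  obtains C where "C > 0" "\<And>S p q. S \<subseteq> \<Omega> \<Longrightarrow> p \<in> jets S \<Longrightarrow> q \<in> jets S \<Longrightarrow> cmod (form S m1 p q) \<le> C * jnrm S p * jnrm S q"
    "\<And>S p q. S \<subseteq> \<Omega> \<Longrightarrow> p \<in> jets S \<Longrightarrow> q \<in> jets S \<Longrightarrow> cmod (form S m p q) \<le> C * jnrm S p * jnrm S q"
proof (rule that)
  let ?N = "real (CARD('n option) * CARD('n option))"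
  let ?C = "?N * (B + \<kappa>)"
  show "?C > 0" using B \<kappa> by (simp add: add_nonneg_pos)
  fix S p q assume S: "S \<subseteq> \<Omega>" "p \<in> jets S" "q \<in> jets S"
  have pos: "0 \<le> B + \<kappa>" using B \<kappa> by simp
  show "cmod (form S m1 p q) \<le> ?C * jnrm S p * jnrm S q"
    by (rule form_bound[OF bounded_coef_subset[OF bounded_m1 S(1)] pos S(2,3)])
  have "cmod (form S m p q) \<le> ?N * B * jnrm S p * jnrm S q"
    by (rule form_bound[OF bounded_coef_subset[OF bounded_m S(1)] B S(2,3)])
  also have "\<dots> \<le> ?C * jnrm S p * jnrm S q"
    using \<kappa> by (intro mult_right_mono mult_left_mono) auto
  finally show "cmod (form S m p q) \<le> ?C * jnrm S p * jnrm S q" .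
qed

text \<open>The solution \<open>p\<close> in \<open>H\<^sup>1\<^sub>0\<close> with the same image as
  \<open>f\<close> would leave the image 0 for \<open>f - p\<close>, but need be neither smooth nor
  bounded. A test function \<open>z\<close> near \<open>p\<close> keeps the image small but not the
  values. Since \<open>f - z\<close> exceeds \<open>M\<close> only on the support of
  \<open>z\<close>, its truncation is a test function, of small norm by \<open>cut_estimate\<close>,
  and subtracting it restores the bound \<open>2 * M\<close>.\<close>

lemma small_antidual_correction:
  assumes f: "smooth f" "\<And>x. cmod (f x) \<le> M" and M: "M > 0" and e: "e > 0"
  obtains w where "w \<in> test_functions \<Omega>" "\<And>x. cmod (f x - w x) \<le> 2 * M"
    "\<And>v. v \<in> test_functions \<Omega> \<Longrightarrow> cmod (form \<Omega> m1 (jet (\<lambda>x. f x - w x)) (jet v)) \<le> e * jnrm \<Omega> (jet v)"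
proof -
  obtain C where C: "C > 0" "\<And>S p q. S \<subseteq> \<Omega> \<Longrightarrow> p \<in> jets S \<Longrightarrow> q \<in> jets S \<Longrightarrow> cmod (form S m1 p q) \<le> C * jnrm S p * jnrm S q"
    using form_bound_const by metis
  have F: "jet f \<in> jets \<Omega>" by (rule jet_smooth_in_jets[OF f(1) \<Omega>_sets \<Omega>(2)])
  have tj: "jet v \<in> jets \<Omega>" if "v \<in> test_functions \<Omega>" for v by (rule jet_test_in_jets[OF that \<Omega>_sets])
  have "antidual (C * jnrm \<Omega> (jet f)) (\<lambda>v. form \<Omega> m1 (jet f) (jet v))"
    unfolding antidual_def using C(2)[OF subset_refl F tj]
    by (auto simp: jet_comb[OF test_smooth test_smooth] form_comb_right[OF bounded_m1 F tj tj])
  then obtain p where p: "p \<in> jets0 \<Omega>" "\<And>v. v \<in> test_functions \<Omega> \<Longrightarrow> form \<Omega> m1 p (jet v) = form \<Omega> m1 (jet f) (jet v)"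
    using solve1[of "C * jnrm \<Omega> (jet f)" "\<lambda>v. form \<Omega> m1 (jet f) (jet v)"] C(1) by (metis jnrm_nonneg less_imp_le mult_nonneg_nonneg)
  have pj: "p \<in> jets \<Omega>" using p jets0_subset by blast
  \<comment> \<open>Accounts for both errors: replacing \<open>p\<close> by \<open>z\<close>, and
    subtracting the truncation, whose norm is at most \<open>8 * C / \<mu>\<close> times
    \<open>e'\<close>.\<close>
  define e' where "e' = e / (C + C * (8 * C / \<mu>))"
  have den: "C + C * (8 * C / \<mu>) > 0" using C(1) \<mu> by (intro add_pos_pos mult_pos_pos divide_pos_pos) auto
  have e': "e' > 0" using den e by (simp add: e'_def)
  obtain z where z: "z \<in> test_functions \<Omega>" "jnrm \<Omega> (jcomb 1 p (-1) (jet z)) < e'" using jets0_approx[OF p(1) e'] by blast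
  define r where "r = jcomb 1 p (-1) (jet z)"
  have r: "r \<in> jets \<Omega>" "jnrm \<Omega> r < e'" unfolding r_def by (rule jets.comb_closed[OF pj tj[OF z(1)]], rule z(2))
  define g where "g = (\<lambda>x. f x - z x)"
  have g: "smooth g" unfolding g_def by (intro smooth_diff f(1) test_smooth[OF z(1)])
  have out: "cmod (g x) \<le> M" if "x \<notin> supp z" for x using f(2)[of x] not_in_supp[OF that] by (simp add: g_def)
  note K = test_compact[OF z(1)] test_supp[OF z(1)] out
  define q where "q = cut M g"
  have q: "q \<in> test_functions \<Omega>" unfolding q_def by (rule cut_test[OF g K])
  have fg: "form \<Omega> m1 (jet g) (jet v) = form \<Omega> m1 r (jet v)" if v: "v \<in> test_functions \<Omega>" for v
    unfolding g_def jet_diff[OF f(1) test_smooth[OF z(1)]] r_def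
      form_comb_left[OF bounded_m1 F tj[OF z(1)] tj[OF v]] form_comb_left[OF bounded_m1 pj tj[OF z(1)] tj[OF v]]
    using p(2)[OF v] by simp
  have fr: "cmod (form \<Omega> m1 r (jet v)) \<le> C * e' * jnrm \<Omega> (jet v)" if v: "v \<in> test_functions \<Omega>" for v
  proof -
    have "cmod (form \<Omega> m1 r (jet v)) \<le> C * jnrm \<Omega> r * jnrm \<Omega> (jet v)" by (rule C(2)[OF subset_refl r(1) tj[OF v]])
    also have "\<dots> \<le> C * e' * jnrm \<Omega> (jet v)" using C(1) r(2) by (intro mult_right_mono mult_left_mono) auto
    finally show ?thesis .
  qed
  have qn: "jnrm \<Omega> (jet q) \<le> 8 * C / \<mu> * e'"
  proof (cases "jnrm \<Omega> (jet q) = 0")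
    case False
    have "\<mu> / 8 * (jnrm \<Omega> (jet q))\<^sup>2 \<le> Re (form \<Omega> m1 (jet g) (jet q))"
      unfolding q_def by (rule cut_estimate[OF g K M])
    also have "\<dots> \<le> C * e' * jnrm \<Omega> (jet q)"
      using fr[OF q] complex_Re_le_cmod[of "form \<Omega> m1 r (jet q)"] unfolding fg[OF q] by linarith
    finally have "\<mu> / 8 * jnrm \<Omega> (jet q) * jnrm \<Omega> (jet q) \<le> C * e' * jnrm \<Omega> (jet q)" by (simp add: power2_eq_square)
    then have "\<mu> / 8 * jnrm \<Omega> (jet q) \<le> C * e'" using False by (simp add: less_le)
    then show ?thesis using \<mu> by (simp add: field_simps)
  qed (use C(1) e' \<mu> in simp)
  show thesis
  proof (rule that[of "\<lambda>x. z x + q x"])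
    show "(\<lambda>x. z x + q x) \<in> test_functions \<Omega>" by (rule test_add[OF z(1) q])
    show "cmod (f x - (z x + q x)) \<le> 2 * M" for x
      using cut_remainder[OF M, of g x] by (simp add: g_def q_def diff_diff_eq)
    fix v assume v: "v \<in> test_functions \<Omega>"
    have gq: "jet (\<lambda>x. f x - (z x + q x)) = jcomb 1 (jet g) (-1) (jet q)"
      using jet_diff[OF g test_smooth[OF q]] by (simp add: g_def diff_diff_eq)
    have gj: "jet g \<in> jets \<Omega>" by (rule jet_smooth_in_jets[OF g \<Omega>_sets \<Omega>(2)])
    have "form \<Omega> m1 (jet (\<lambda>x. f x - (z x + q x))) (jet v) = form \<Omega> m1 r (jet v) - form \<Omega> m1 (jet q) (jet v)"
      unfolding gq form_comb_left[OF bounded_m1 gj tj[OF q] tj[OF v]] fg[OF v] by simp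
    then have "cmod (form \<Omega> m1 (jet (\<lambda>x. f x - (z x + q x))) (jet v)) \<le>
        C * e' * jnrm \<Omega> (jet v) + C * jnrm \<Omega> (jet q) * jnrm \<Omega> (jet v)"
      using norm_triangle_ineq4[of "form \<Omega> m1 r (jet v)" "form \<Omega> m1 (jet q) (jet v)"] fr[OF v]
        C(2)[OF subset_refl tj[OF q] tj[OF v]] by simp
    also have "\<dots> \<le> C * e' * jnrm \<Omega> (jet v) + C * (8 * C / \<mu> * e') * jnrm \<Omega> (jet v)"
      using C(1) qn by (intro add_left_mono mult_right_mono mult_left_mono) auto
    also have "\<dots> = (C + C * (8 * C / \<mu>)) * e' * jnrm \<Omega> (jet v)" by (simp add: algebra_simps)
    also have "\<dots> = e * jnrm \<Omega> (jet v)" using den by (simp add: e'_def)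
    finally show "cmod (form \<Omega> m1 (jet (\<lambda>x. f x - (z x + q x))) (jet v)) \<le> e * jnrm \<Omega> (jet v)" .
  qed
qed

end

subsection \<open>Interior gradient estimates\<close>

lemma lnrm_mono:
  assumes "u \<in> L2 S" "v \<in> L2 S" "\<And>x. x \<in> S \<Longrightarrow> cmod (u x) \<le> cmod (v x)"
  shows "lnrm S u \<le> lnrm S v"
proof -
  have "(LINT x|lebesgue_on S. (cmod (u x))\<^sup>2) \<le> (LINT x|lebesgue_on S. (cmod (v x))\<^sup>2)"
    using assms L2_integrable by (intro integral_mono) (auto intro!: power_mono)
  then show ?thesis by (simp add: lnrm_def)
qed

lemma test_sum: "(\<And>i. i \<in> I \<Longrightarrow> f i \<in> test_functions \<Omega>) \<Longrightarrow> (\<lambda>x. \<Sum>i\<in>I. f i x) \<in> test_functions \<Omega>"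
  by (induction I rule: infinite_finite_induct) (auto simp: test_add)

text \<open>A finite sum of box bumps is positive on \<open>K\<close> and so bounded below there. It
  is not normalised to 1; the bound \<open>t\<close> is divided out where the cutoff is
  used.\<close>

lemma cutoff_exists:
  fixes K :: "(real^'n::finite) set"
  assumes K: "compact K" "K \<subseteq> \<Omega>" and \<Omega>: "open \<Omega>"
  obtains w t where "w \<in> test_functions \<Omega>" "\<And>x. cnj (w x) = w x" "t > 0" "\<And>x. x \<in> K \<Longrightarrow> t \<le> cmod (w x)"
proof -
  let ?I = "{(a, b). cbox a b \<subseteq> \<Omega>} :: ((real^'n) \<times> (real^'n)) set"
  obtain F where F: "F \<subseteq> ?I" "finite F" "K \<subseteq> (\<Union>(a,b)\<in>F. box a b)"
  proof (rule compactE_image[OF K(1), of ?I "\<lambda>(a, b). box a b"])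
    show "K \<subseteq> (\<Union>(a,b)\<in>?I. box a b)"
    proof
      fix x assume "x \<in> K"
      then obtain a b where "cbox a b \<subseteq> \<Omega>" "x \<in> box a b" using open_contains_cbox[OF \<Omega>] K by (metis subsetD)
      then show "x \<in> (\<Union>(a,b)\<in>?I. box a b)" by auto
    qed
  qed auto
  define w where "w x = (\<Sum>i\<in>F. box_bump (fst i) (snd i) 1 x)" for x
  define r where "r i x = Re (box_bump (fst i) (snd i) 1 x)" for i :: "(real^'n) \<times> (real^'n)" and x
  have r: "r i x \<ge> 0" "box_bump (fst i) (snd i) 1 x = of_real (r i x)" "x \<in> box (fst i) (snd i) \<Longrightarrow> r i x > 0" for i x
    using box_bump_nonneg[of "fst i" "snd i" 1 x] by (auto simp: r_def)
  have w_eq: "w x = of_real (\<Sum>i\<in>F. r i x)" for x by (simp add: w_def r)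
  have "cbox (fst i) (snd i) \<subseteq> \<Omega>" if "i \<in> F" for i using subsetD[OF F(1) that] by (cases i) simp
  then have w: "w \<in> test_functions \<Omega>" unfolding w_def by (intro test_sum box_bump_test) auto
  have pos: "(\<Sum>i\<in>F. r i x) > 0" if "x \<in> K" for x
  proof -
    obtain i where i: "i \<in> F" "x \<in> box (fst i) (snd i)" using F(3) \<open>x \<in> K\<close> by auto
    then show ?thesis using F(2) r by (intro sum_pos2[of F i]) auto
  qed
  have "\<exists>t>0. \<forall>x\<in>K. t \<le> cmod (w x)"
  proof (cases "K = {}")
    case False
    have "continuous_on K (\<lambda>x. cmod (w x))" by (intro continuous_intros smooth_continuous test_smooth[OF w])
    then obtain y where y: "y \<in> K" "\<And>x. x \<in> K \<Longrightarrow> cmod (w y) \<le> cmod (w x)"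
      using continuous_attains_inf[OF K(1) False] by blast
    then show ?thesis using pos[OF y(1)] by (intro exI[of _ "cmod (w y)"]) (auto simp: w_eq simp del: of_real_sum)
  qed (auto intro: exI[of _ 1])
  then show thesis using w w_eq by (metis that complex_cnj_complex_of_real)
qed

context elliptic
begin

text \<open>Here \<open>e\<close> and \<open>\<epsilon> k\<close> are the values of a real cutoff
  and of its partial derivatives, and \<open>q\<close> is the jet of the squared cutoff times
  \<open>g\<close>. In \<open>R\<close> the summand \<open>2 * real CARD('n)\<close> comes from the
  leading part and 1 from the terms with \<open>c\<close>; half of the leading part absorbs
  them.\<close>

lemma caccioppoli_pointwise:
  fixes g :: complex and \<xi> :: "'n \<Rightarrow> complex" and e :: real and \<epsilon> :: "'n \<Rightarrow> real"
  assumes x: "x \<in> \<Omega>" and E: "\<bar>e\<bar> \<le> E" "\<And>k. \<bar>\<epsilon> k\<bar> \<le> E"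
  defines "p \<equiv> (\<lambda>i. case i of None \<Rightarrow> g | Some k \<Rightarrow> \<xi> k)"
    and "q \<equiv> (\<lambda>i. case i of None \<Rightarrow> of_real (e\<^sup>2) * g | Some k \<Rightarrow> of_real (e\<^sup>2) * \<xi> k + of_real (2 * e * \<epsilon> k) * g)"
    and "R \<equiv> (2 * real CARD('n) + 1) * B * E"
  shows "\<mu> / 2 * (\<Sum>k\<in>UNIV. (cmod (of_real e * \<xi> k))\<^sup>2) + (- (real CARD('n) * R\<^sup>2 / (2 * \<mu>))) * (cmod g)\<^sup>2 \<le>
    Re (\<Sum>i\<in>UNIV. \<Sum>j\<in>UNIV. m1 i j x * p j * cnj (q i))"
proof -
  have E0: "E \<ge> 0" using E(1) by simp
  define n where "n = real CARD('n)"
  define X where "X = (\<Sum>k\<in>UNIV. (cmod (\<xi> k))\<^sup>2)"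
  have XX: "(\<Sum>k\<in>UNIV. (cmod (of_real e * \<xi> k))\<^sup>2) = e\<^sup>2 * X"
    by (simp add: X_def norm_mult power_mult_distrib sum_distrib_left)
  define T where "T l = \<bar>e\<bar> * cmod (\<xi> l)" for l
  have T0: "T l \<ge> 0" for l by (simp add: T_def)
  have lead: "Re (of_real (a k l x) * \<xi> l * cnj (q (Some k))) =
      e\<^sup>2 * Re (of_real (a k l x) * \<xi> l * cnj (\<xi> k)) + 2 * e * \<epsilon> k * a k l x * Re (\<xi> l * cnj g)" for k l
    by (simp add: q_def algebra_simps)
  have A1: "e\<^sup>2 * (\<mu> * X) \<le> e\<^sup>2 * Re (\<Sum>k\<in>UNIV. \<Sum>l\<in>UNIV. of_real (a k l x) * \<xi> l * cnj (\<xi> k))"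
    unfolding X_def by (intro mult_left_mono ell'[OF x]) auto
  have A2: "- (2 * B * E * (T l * cmod g)) \<le> 2 * e * \<epsilon> k * a k l x * Re (\<xi> l * cnj g)" for k l
  proof -
    have "\<bar>2 * e * \<epsilon> k * a k l x * Re (\<xi> l * cnj g)\<bar> = 2 * (\<bar>\<epsilon> k\<bar> * \<bar>a k l x\<bar>) * (\<bar>e\<bar> * \<bar>Re (\<xi> l * cnj g)\<bar>)"
      by (simp add: abs_mult)
    also have "\<dots> \<le> 2 * (E * B) * (\<bar>e\<bar> * cmod (\<xi> l * cnj g))"
      using E E0 bound(1)[OF x] B by (intro mult_mono mult_left_mono abs_Re_le_cmod) auto
    also have "\<dots> = 2 * B * E * (T l * cmod g)" by (simp add: T_def norm_mult)
    finally show ?thesis by linarith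
  qed
  have cl: "- (B * E * (T l * cmod g)) \<le> Re (of_real (c l x) * \<xi> l * cnj (q None))" for l
  proof -
    have "cmod (of_real (c l x) * \<xi> l * cnj (q None)) = \<bar>c l x\<bar> * \<bar>e\<bar> * (\<bar>e\<bar> * cmod (\<xi> l) * cmod g)"
      by (simp add: q_def norm_mult norm_power power2_eq_square)
    also have "\<dots> \<le> B * E * (T l * cmod g)"
      unfolding T_def using E E0 bound(3)[OF x] B by (intro mult_mono) auto
    finally show ?thesis using abs_Re_le_cmod[of "of_real (c l x) * \<xi> l * cnj (q None)"] by linarith
  qed
  have zero: "0 \<le> Re (of_real \<kappa> * g * cnj (q None))"
  proof -
    have "of_real \<kappa> * g * cnj (q None) = of_real (\<kappa> * e\<^sup>2 * (cmod g)\<^sup>2)"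
      unfolding of_real_mult complex_norm_square by (simp add: q_def)
    then show ?thesis using \<kappa> by (simp only: Re_complex_of_real) simp
  qed
  have "Re (\<Sum>i\<in>UNIV. \<Sum>j\<in>UNIV. m1 i j x * p j * cnj (q i)) =
      Re (of_real \<kappa> * g * cnj (q None)) + (\<Sum>l\<in>UNIV. Re (of_real (c l x) * \<xi> l * cnj (q None))) +
      (\<Sum>k\<in>UNIV. \<Sum>l\<in>UNIV. Re (of_real (a k l x) * \<xi> l * cnj (q (Some k))))"
    by (simp add: sum_option p_def)
  also have "(\<Sum>k\<in>UNIV. \<Sum>l\<in>UNIV. Re (of_real (a k l x) * \<xi> l * cnj (q (Some k)))) =
      e\<^sup>2 * Re (\<Sum>k\<in>UNIV. \<Sum>l\<in>UNIV. of_real (a k l x) * \<xi> l * cnj (\<xi> k)) +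
      (\<Sum>k\<in>UNIV. \<Sum>l\<in>UNIV. 2 * e * \<epsilon> k * a k l x * Re (\<xi> l * cnj g))"
    unfolding lead Re_sum by (simp only: sum.distrib sum_distrib_left)
  finally have eq: "Re (\<Sum>i\<in>UNIV. \<Sum>j\<in>UNIV. m1 i j x * p j * cnj (q i)) = Re (of_real \<kappa> * g * cnj (q None)) +
      (\<Sum>l\<in>UNIV. Re (of_real (c l x) * \<xi> l * cnj (q None))) +
      (e\<^sup>2 * Re (\<Sum>k\<in>UNIV. \<Sum>l\<in>UNIV. of_real (a k l x) * \<xi> l * cnj (\<xi> k)) +
      (\<Sum>k\<in>UNIV. \<Sum>l\<in>UNIV. 2 * e * \<epsilon> k * a k l x * Re (\<xi> l * cnj g)))" .
  have S1: "(\<Sum>l\<in>(UNIV::'n set). - (B * E * (T l * cmod g))) \<le> (\<Sum>l\<in>UNIV. Re (of_real (c l x) * \<xi> l * cnj (q None)))"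
    by (intro sum_mono cl)
  have S2: "(\<Sum>k\<in>(UNIV::'n set). \<Sum>l\<in>(UNIV::'n set). - (2 * B * E * (T l * cmod g))) \<le>
      (\<Sum>k\<in>UNIV. \<Sum>l\<in>UNIV. 2 * e * \<epsilon> k * a k l x * Re (\<xi> l * cnj g))"
    by (intro sum_mono A2)
  have S3: "(\<Sum>l\<in>(UNIV::'n set). - (B * E * (T l * cmod g))) + (\<Sum>k\<in>(UNIV::'n set). \<Sum>l\<in>(UNIV::'n set). - (2 * B * E * (T l * cmod g))) =
      - (\<Sum>l\<in>UNIV. R * T l * cmod g)"
    by (simp add: R_def sum_negf sum_distrib_left sum.distrib[symmetric] algebra_simps)
  \<comment> \<open>Young's inequality is applied once for each direction, which costs half of the
    leading part and produces the factor \<open>n\<close>.\<close>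
  have "(\<Sum>l\<in>(UNIV::'n set). R * T l * cmod g) \<le> (\<Sum>l\<in>(UNIV::'n set). \<mu> / 2 * (T l)\<^sup>2 + R\<^sup>2 / (2 * \<mu>) * (cmod g)\<^sup>2)"
    by (intro sum_mono two_mult_le_squares[OF \<mu>(1)])
  also have "\<dots> = \<mu> / 2 * (e\<^sup>2 * X) + n * R\<^sup>2 / (2 * \<mu>) * (cmod g)\<^sup>2"
    by (simp add: T_def X_def n_def sum.distrib power_mult_distrib sum_distrib_left)
  finally have S4: "(\<Sum>l\<in>(UNIV::'n set). R * T l * cmod g) \<le> \<mu> / 2 * (e\<^sup>2 * X) + n * R\<^sup>2 / (2 * \<mu>) * (cmod g)\<^sup>2" .
  have half: "e\<^sup>2 * (\<mu> * X) = \<mu> / 2 * (e\<^sup>2 * X) + \<mu> / 2 * (e\<^sup>2 * X)" by simp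
  show ?thesis
    unfolding XX eq n_def[symmetric] mult_minus_left using zero S1 S2 S3 S4 A1 half by linarith
qed

text \<open>Caccioppoli's inequality for functions whose image is small instead of zero; a common
  \<open>\<delta>\<close> bounds the values and the image. Testing with \<open>w\<^sup>2 * g\<close>
  bounds the weighted energy \<open>X\<^sup>2\<close> by \<open>\<delta>\<close> times the norm of
  the test function, apart from a multiple of \<open>\<delta>\<^sup>2\<close>, and that norm
  contains \<open>X\<close> only linearly.\<close>

lemma caccioppoli:
  assumes w: "w \<in> test_functions \<Omega>" "\<And>x. cnj (w x) = w x"
  obtains C where "C \<ge> 0"
    "\<And>g \<delta> k. smooth g \<Longrightarrow> \<delta> \<ge> 0 \<Longrightarrow> (\<And>x. x \<in> \<Omega> \<Longrightarrow> cmod (g x) \<le> \<delta>) \<Longrightarrow>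
      (\<And>v. v \<in> test_functions \<Omega> \<Longrightarrow> cmod (form \<Omega> m1 (jet g) (jet v)) \<le> \<delta> * jnrm \<Omega> (jet v)) \<Longrightarrow>
      lnrm \<Omega> (\<lambda>x. w x * partial k g x) \<le> C * \<delta>"
proof -
  have sw: "smooth w" using w(1) by (rule test_smooth)
  have re: "w x = of_real (Re (w x))" for x using w(2)[of x] by (simp add: complex_eq_iff)
  have rep: "partial k w x = of_real (Re (partial k w x))" for k x
  proof -
    have "cnj (partial k w x) = partial k (\<lambda>x. cnj (w x)) x" by (simp add: partial_cnj smoothD[OF sw])
    also have "\<dots> = partial k w x" by (simp add: w(2))
    finally show ?thesis by (simp add: complex_eq_iff)
  qed
  have "\<exists>E. \<forall>x. cmod (jet w i x) \<le> E" for i :: "'n option"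
  proof (cases i)
    case None
    then show ?thesis using test_bounded[OF w(1)] by (metis jet_simps(1))
  next
    case (Some k)
    then show ?thesis using test_bounded[OF test_partial[OF w(1), of k]] by (metis jet_simps(2))
  qed
  then obtain E0 where E0: "\<And>i x. cmod (jet w i x) \<le> E0 i" by metis
  define E where "E = (\<Sum>i\<in>UNIV. \<bar>E0 i\<bar>)"
  have E: "cmod (jet w i x) \<le> E" for i x
  proof -
    have "\<bar>E0 i\<bar> \<le> E" unfolding E_def by (rule member_le_sum) auto
    then show ?thesis using E0[of i x] by linarith
  qed
  have Epos: "E \<ge> 0" unfolding E_def by (simp add: sum_nonneg)
  define n where "n = real CARD('n)"
  define R where "R = (2 * n + 1) * B * E"
  define s where "s = sqrt (measure lebesgue \<Omega>)"
  \<comment> \<open>\<open>c1\<close> comes from the norm of the test function, \<open>c2\<close>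
    from the zero-order loss in the pointwise estimate.\<close>
  define c1 where "c1 = (2 * n + 1) * E\<^sup>2 * s"
  define c2 where "c2 = n * R\<^sup>2 / (2 * \<mu>) * s\<^sup>2"
  define C2 where "C2 = 4 / \<mu> * (c1 + c2 + (n * E)\<^sup>2 / \<mu>)"
  have nn: "n \<ge> 0" "s \<ge> 0" "c1 \<ge> 0" "c2 \<ge> 0" using \<mu> by (auto simp: n_def s_def c1_def c2_def)
  have C2: "C2 \<ge> 0" using \<mu> nn by (simp add: C2_def)
  show thesis
  proof (rule that[of "sqrt C2"])
    show "sqrt C2 \<ge> 0" using C2 by simp
    fix g \<delta> k0
    assume g: "smooth g" and \<delta>: "\<delta> \<ge> 0" and gb: "\<And>x. x \<in> \<Omega> \<Longrightarrow> cmod (g x) \<le> \<delta>"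
      and fb: "\<And>v. v \<in> test_functions \<Omega> \<Longrightarrow> cmod (form \<Omega> m1 (jet g) (jet v)) \<le> \<delta> * jnrm \<Omega> (jet v)"
    have dg: "f differentiable (at x)" if "smooth f" for f :: "'n cfun" and x using that by (rule smoothD)
    define v where "v x = (g x * w x) * w x" for x
    have v: "v \<in> test_functions \<Omega>" unfolding v_def by (intro test_mult_smooth smooth_mult g sw w(1))
    have pv: "partial k v x = of_real ((Re (w x))\<^sup>2) * partial k g x + of_real (2 * Re (w x) * Re (partial k w x)) * g x" for k x
    proof -
      have "partial k v x = g x * w x * partial k w x + (g x * partial k w x + partial k g x * w x) * w x"
        unfolding v_def using g sw by (simp add: partial_mult dg smooth_mult)
      also have "\<dots> = (w x)\<^sup>2 * partial k g x + 2 * w x * partial k w x * g x" by (simp add: algebra_simps power2_eq_square)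
      finally show ?thesis using re[of x] rep[of k x] by (metis of_real_mult of_real_numeral of_real_power)
    qed
    have gj: "jet g \<in> jets \<Omega>" by (rule jet_smooth_in_jets[OF g \<Omega>_sets \<Omega>(2)])
    have vj: "jet v \<in> jets \<Omega>" by (rule jet_test_in_jets[OF v \<Omega>_sets])
    define d where "d i = (case i of None \<Rightarrow> g | Some k \<Rightarrow> (\<lambda>x. w x * partial k g x))" for i
    have wm: "w \<in> borel_measurable (lebesgue_on \<Omega>)" by (rule smooth_measurable_lebesgue[OF sw])
    have wb: "cmod (w x) \<le> E" for x using E[of None x] by simp
    have gL: "g \<in> L2 \<Omega>" "partial k g \<in> L2 \<Omega>" for k using jetsD[OF gj, of None] jetsD[OF gj, of "Some k"] by auto
    have wgL: "(\<lambda>x. w x * partial k g x) \<in> L2 \<Omega>" for k by (rule L2_bounded_mult[OF wm wb gL(2)])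
    have dj: "d \<in> jets \<Omega>" using gL(1) wgL by (simp add: jets_def all_option d_def)
    have sumd: "(\<Sum>k\<in>UNIV. (lnrm \<Omega> (d (Some k)))\<^sup>2) \<ge> 0" by (simp add: sum_nonneg)
    define X where "X = sqrt (\<Sum>k\<in>UNIV. (lnrm \<Omega> (d (Some k)))\<^sup>2)"
    have X: "X \<ge> 0" "X\<^sup>2 = (\<Sum>k\<in>UNIV. (lnrm \<Omega> (d (Some k)))\<^sup>2)" using sumd by (auto simp: X_def)
    have lX: "lnrm \<Omega> (\<lambda>x. w x * partial k g x) \<le> X" for k
    proof (rule power2_le_imp_le)
      have "(lnrm \<Omega> (d (Some k)))\<^sup>2 \<le> X\<^sup>2" unfolding X(2) by (rule member_le_sum) auto
      then show "(lnrm \<Omega> (\<lambda>x. w x * partial k g x))\<^sup>2 \<le> X\<^sup>2" by (simp add: d_def)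
    qed (rule X(1))
    have gn: "lnrm \<Omega> g \<le> \<delta> * s" unfolding s_def by (rule lnrm_bound[OF \<Omega>_sets \<Omega>(2) gb \<delta> gL(1)])
    have "\<mu> / 2 * X\<^sup>2 + (- (n * R\<^sup>2 / (2 * \<mu>))) * (lnrm \<Omega> (d None))\<^sup>2 \<le> Re (form \<Omega> m1 (jet g) (jet v))"
      unfolding Re_form_integral[OF bounded_m1 gj vj] X(2) jnrm_weighted_integral[OF dj, symmetric]
    proof (rule integral_mono)
      fix x assume "x \<in> space (lebesgue_on \<Omega>)"
      then have x: "x \<in> \<Omega>" by simp
      have e1: "\<bar>Re (w x)\<bar> \<le> E" using abs_Re_le_cmod[of "w x"] wb[of x] by linarith
      have e2: "\<bar>Re (partial k w x)\<bar> \<le> E" for k using abs_Re_le_cmod[of "partial k w x"] E[of "Some k" x] by simp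
      have vx: "v x = of_real ((Re (w x))\<^sup>2) * g x" unfolding v_def using re[of x]
        by (metis (no_types, lifting) mult.assoc mult.commute of_real_power power2_eq_square)
      have eq: "(\<lambda>i. case i of None \<Rightarrow> g x | Some k \<Rightarrow> partial k g x) = (\<lambda>i. jet g i x)"
        "(\<lambda>i. case i of None \<Rightarrow> of_real ((Re (w x))\<^sup>2) * g x | Some k \<Rightarrow> of_real ((Re (w x))\<^sup>2) * partial k g x +
          of_real (2 * Re (w x) * Re (partial k w x)) * g x) = (\<lambda>i. jet v i x)"
        by (auto simp: fun_eq_iff pv vx split: option.split)
      have dk: "of_real (Re (w x)) * partial k g x = d (Some k) x" for k using re[of x] by (simp add: d_def)
      show "\<mu> / 2 * (\<Sum>k\<in>UNIV. (cmod (d (Some k) x))\<^sup>2) + - (n * R\<^sup>2 / (2 * \<mu>)) * (cmod (d None x))\<^sup>2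
          \<le> Re (\<Sum>i\<in>UNIV. \<Sum>j\<in>UNIV. m1 i j x * jet g j x * cnj (jet v i x))"
        using caccioppoli_pointwise[where e="Re (w x)" and g="g x" and \<xi>="\<lambda>k. partial k g x" and \<epsilon>="\<lambda>k. Re (partial k w x)", OF x e1 e2]
        unfolding eq dk n_def[symmetric] R_def[symmetric] by (simp add: d_def)
    qed (rule jnrm_weighted_integrable[OF dj], rule Re_form_integral(2)[OF bounded_m1 gj vj])
    also have "\<dots> \<le> \<delta> * jnrm \<Omega> (jet v)"
      using fb[OF v] complex_Re_le_cmod[of "form \<Omega> m1 (jet g) (jet v)"] by linarith
    also have "\<dots> \<le> \<delta> * (n * E * X + c1 * \<delta>)"
    proof (rule mult_left_mono[OF _ \<delta>])
      have v0: "lnrm \<Omega> v \<le> E\<^sup>2 * (\<delta> * s)"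
      proof -
        have eq: "v = (\<lambda>x. (w x * w x) * g x)" by (simp add: v_def fun_eq_iff mult_ac)
        have "cmod (w x * w x) \<le> E\<^sup>2" for x
          unfolding norm_mult power2_eq_square by (intro mult_mono wb Epos norm_ge_zero)
        then have "lnrm \<Omega> (\<lambda>x. (w x * w x) * g x) \<le> E\<^sup>2 * lnrm \<Omega> g"
          using wm gL by (intro lnrm_bounded_mult) auto
        also have "\<dots> \<le> E\<^sup>2 * (\<delta> * s)" using gn by (intro mult_left_mono) auto
        finally show ?thesis unfolding eq .
      qed
      have vk: "lnrm \<Omega> (partial k v) \<le> E * X + 2 * E\<^sup>2 * (\<delta> * s)" for k
      proof -
        have pm: "partial k w \<in> borel_measurable (lebesgue_on \<Omega>)" by (rule smooth_measurable_lebesgue[OF smooth_partial[OF sw]])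
        have m: "(\<lambda>x. 2 * w x * partial k w x) \<in> borel_measurable (lebesgue_on \<Omega>)"
          using wm pm by measurable
        have mb: "cmod (2 * w x * partial k w x) \<le> 2 * E\<^sup>2" for x
          unfolding norm_mult power2_eq_square using E[of "Some k" x] wb[of x] Epos
          by (simp add: mult_mono)
        have eq: "partial k v = lcomb 1 (\<lambda>x. w x * (w x * partial k g x)) 1 (\<lambda>x. (2 * w x * partial k w x) * g x)"
        proof
          fix x
          have "of_real ((Re (w x))\<^sup>2) = w x * w x" "of_real (2 * Re (w x) * Re (partial k w x)) = 2 * w x * partial k w x"
            using re[of x] rep[of k x] by (metis of_real_mult power2_eq_square, metis of_real_mult of_real_numeral)
          then show "partial k v x = 1 * (w x * (w x * partial k g x)) + 1 * ((2 * w x * partial k w x) * g x)"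
            unfolding pv by simp
        qed
        have "lnrm \<Omega> (partial k v) \<le> cmod 1 * lnrm \<Omega> (\<lambda>x. w x * (w x * partial k g x)) + cmod 1 * lnrm \<Omega> (\<lambda>x. (2 * w x * partial k w x) * g x)"
          unfolding eq by (rule L2.nrm_comb_le[OF L2_bounded_mult[OF wm wb wgL] L2_bounded_mult[OF m mb gL(1)]])
        moreover have "lnrm \<Omega> (\<lambda>x. w x * (w x * partial k g x)) \<le> E * lnrm \<Omega> (\<lambda>x. w x * partial k g x)"
          by (rule lnrm_bounded_mult[OF wm wb Epos wgL])
        moreover have "E * lnrm \<Omega> (\<lambda>x. w x * partial k g x) \<le> E * X" by (intro mult_left_mono lX Epos)
        moreover have "lnrm \<Omega> (\<lambda>x. (2 * w x * partial k w x) * g x) \<le> 2 * E\<^sup>2 * lnrm \<Omega> g"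
          by (rule lnrm_bounded_mult[OF m mb _ gL(1)]) simp
        moreover have "2 * E\<^sup>2 * lnrm \<Omega> g \<le> 2 * E\<^sup>2 * (\<delta> * s)" using gn by (intro mult_left_mono) auto
        ultimately show ?thesis by simp
      qed
      have "jnrm \<Omega> (jet v) \<le> lnrm \<Omega> v + (\<Sum>k\<in>UNIV. lnrm \<Omega> (partial k v))"
        using jnrm_le_sum[of \<Omega> "jet v"] by (simp add: sum_option)
      also have "\<dots> \<le> E\<^sup>2 * (\<delta> * s) + (\<Sum>k\<in>(UNIV::'n set). E * X + 2 * E\<^sup>2 * (\<delta> * s))"
        by (intro add_mono sum_mono v0 vk)
      also have "\<dots> = n * E * X + c1 * \<delta>" by (simp add: n_def c1_def algebra_simps)
      finally show "jnrm \<Omega> (jet v) \<le> n * E * X + c1 * \<delta>" .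
    qed
    finally have main: "\<mu> / 2 * X\<^sup>2 + (- (n * R\<^sup>2 / (2 * \<mu>))) * (lnrm \<Omega> (d None))\<^sup>2 \<le> \<delta> * (n * E * X + c1 * \<delta>)" .
    have "(lnrm \<Omega> (d None))\<^sup>2 \<le> (\<delta> * s)\<^sup>2" using gn by (intro power_mono) (auto simp: d_def)
    then have "n * R\<^sup>2 / (2 * \<mu>) * (lnrm \<Omega> (d None))\<^sup>2 \<le> n * R\<^sup>2 / (2 * \<mu>) * (\<delta> * s)\<^sup>2"
      using \<mu> nn by (intro mult_left_mono) auto
    also have "\<dots> = c2 * \<delta>\<^sup>2" by (simp add: c2_def power_mult_distrib)
    finally have low: "n * R\<^sup>2 / (2 * \<mu>) * (lnrm \<Omega> (d None))\<^sup>2 \<le> c2 * \<delta>\<^sup>2" .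
    \<comment> \<open>Absorbs the term linear in \<open>X\<close>: half of the available
      \<open>\<mu> / 2\<close> is spent on it.\<close>
    have mid: "(n * E) * X * \<delta> \<le> (\<mu> / 2) / 2 * X\<^sup>2 + (n * E)\<^sup>2 / (2 * (\<mu> / 2)) * \<delta>\<^sup>2"
      using \<mu> by (intro two_mult_le_squares) simp
    have "\<mu> / 4 * X\<^sup>2 \<le> c1 * \<delta>\<^sup>2 + c2 * \<delta>\<^sup>2 + (n * E)\<^sup>2 / \<mu> * \<delta>\<^sup>2"
    proof -
      have e1: "\<delta> * (n * E * X + c1 * \<delta>) = (n * E) * X * \<delta> + c1 * \<delta>\<^sup>2" by (simp add: algebra_simps power2_eq_square)
      have e2: "(\<mu> / 2) / 2 * X\<^sup>2 + (n * E)\<^sup>2 / (2 * (\<mu> / 2)) * \<delta>\<^sup>2 = \<mu> / 4 * X\<^sup>2 + (n * E)\<^sup>2 / \<mu> * \<delta>\<^sup>2" by simp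
      have e3: "\<mu> / 2 * X\<^sup>2 = \<mu> / 4 * X\<^sup>2 + \<mu> / 4 * X\<^sup>2" by simp
      show ?thesis using main low mid unfolding e1 e2 e3 mult_minus_left by linarith
    qed
    also have "\<dots> = \<mu> / 4 * (C2 * \<delta>\<^sup>2)"
    proof -
      have "\<mu> / 4 * C2 = c1 + c2 + (n * E)\<^sup>2 / \<mu>" unfolding C2_def using \<mu> by simp
      then show ?thesis unfolding mult.assoc[symmetric] by (simp only: distrib_right)
    qed
    finally have "X\<^sup>2 \<le> C2 * \<delta>\<^sup>2" using \<mu> by simp
    then have "X\<^sup>2 \<le> (sqrt C2 * \<delta>)\<^sup>2" using C2 by (simp add: power_mult_distrib)
    then have "X \<le> sqrt C2 * \<delta>" using \<delta> C2 by (auto elim: power2_le_imp_le)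
    then show "lnrm \<Omega> (\<lambda>x. w x * partial k0 g x) \<le> sqrt C2 * \<delta>" using lX[of k0] by linarith
  qed
qed

text \<open>On \<open>K\<close> the cutoff is at least \<open>t\<close>, so the weighted gradient
  bound becomes unweighted after division by \<open>t\<close>; the zeroth component is controlled by
  the supremum bound.\<close>

lemma interior_gradient_estimate:
  assumes K: "compact K" "K \<subseteq> \<Omega>"
  obtains C where "C \<ge> 0"
    "\<And>g \<delta> i. smooth g \<Longrightarrow> \<delta> \<ge> 0 \<Longrightarrow> (\<And>x. x \<in> \<Omega> \<Longrightarrow> cmod (g x) \<le> \<delta>) \<Longrightarrow>
      (\<And>v. v \<in> test_functions \<Omega> \<Longrightarrow> cmod (form \<Omega> m1 (jet g) (jet v)) \<le> \<delta> * jnrm \<Omega> (jet v)) \<Longrightarrow>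
      lnrm K (jet g i) \<le> C * \<delta>"
proof -
  obtain w t where w: "w \<in> test_functions \<Omega>" "\<And>x. cnj (w x) = w x" "t > 0" "\<And>x. x \<in> K \<Longrightarrow> t \<le> cmod (w x)"
    by (rule cutoff_exists[OF K \<Omega>(1)]) blast
  obtain C where C: "C \<ge> 0"
    "\<And>g \<delta> k. smooth g \<Longrightarrow> \<delta> \<ge> 0 \<Longrightarrow> (\<And>x. x \<in> \<Omega> \<Longrightarrow> cmod (g x) \<le> \<delta>) \<Longrightarrow>
      (\<And>v. v \<in> test_functions \<Omega> \<Longrightarrow> cmod (form \<Omega> m1 (jet g) (jet v)) \<le> \<delta> * jnrm \<Omega> (jet v)) \<Longrightarrow>
      lnrm \<Omega> (\<lambda>x. w x * partial k g x) \<le> C * \<delta>"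
    by (rule caccioppoli[OF w(1,2)]) blast
  have K': "K \<in> sets lebesgue" "bounded K" using K by (auto simp: lmeasurable_compact fmeasurableD compact_imp_bounded)
  show thesis
  proof (rule that[of "sqrt (measure lebesgue K) + C / t"])
    show "sqrt (measure lebesgue K) + C / t \<ge> 0" using C(1) w(3) by simp
    fix g \<delta> i
    assume g: "smooth g" "\<delta> \<ge> 0" "\<And>x. x \<in> \<Omega> \<Longrightarrow> cmod (g x) \<le> \<delta>"
      "\<And>v. v \<in> test_functions \<Omega> \<Longrightarrow> cmod (form \<Omega> m1 (jet g) (jet v)) \<le> \<delta> * jnrm \<Omega> (jet v)"
    have gK: "jet g \<in> jets K" by (rule jet_smooth_in_jets[OF g(1) K'])
    show "lnrm K (jet g i) \<le> (sqrt (measure lebesgue K) + C / t) * \<delta>"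
    proof (cases i)
      case None
      have "lnrm K g \<le> \<delta> * sqrt (measure lebesgue K)"
        using g(3) K(2) jetsD[OF gK, of None] by (intro lnrm_bound[OF K' _ g(2)]) auto
      moreover have "0 \<le> C / t * \<delta>" using C(1) w(3) g(2) by simp
      ultimately show ?thesis using None by (simp add: algebra_simps)
    next
      case (Some k)
      have pg: "partial k g \<in> L2 K" using jetsD[OF gK, of "Some k"] by simp
      have wm: "w \<in> borel_measurable (lebesgue_on S)" for S by (rule smooth_measurable_lebesgue[OF test_smooth[OF w(1)]])
      obtain E where E: "\<And>x. cmod (w x) \<le> E" using test_bounded[OF w(1)] by metis
      have wgK: "(\<lambda>x. w x * partial k g x) \<in> L2 K" by (rule L2_bounded_mult[OF wm E pg])
      have pg\<Omega>: "partial k g \<in> L2 \<Omega>" using jetsD[OF jet_smooth_in_jets[OF g(1) \<Omega>_sets \<Omega>(2)], of "Some k"] by simp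
      have wg\<Omega>: "(\<lambda>x. w x * partial k g x) \<in> L2 \<Omega>" by (rule L2_bounded_mult[OF wm E pg\<Omega>])
      have "lnrm K (partial k g) \<le> lnrm K (\<lambda>x. of_real (1 / t) * (w x * partial k g x))"
      proof (rule lnrm_mono[OF pg])
        show "(\<lambda>x. of_real (1 / t) * (w x * partial k g x)) \<in> L2 K" using L2_comb[OF wgK wgK, of "of_real (1/t)" 0] by simp
        fix x assume "x \<in> K"
        then have "1 * cmod (partial k g x) \<le> (cmod (w x) / t) * cmod (partial k g x)"
          using w(3,4) by (intro mult_right_mono) (auto simp: le_divide_eq)
        then show "cmod (partial k g x) \<le> cmod (of_real (1 / t) * (w x * partial k g x))"
          using w(3) by (simp add: norm_mult norm_divide)
      qed
      also have "\<dots> \<le> 1 / t * lnrm K (\<lambda>x. w x * partial k g x)"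
        using w(3) by (intro lnrm_bounded_mult wgK) (auto simp: norm_divide)
      also have "\<dots> \<le> 1 / t * lnrm \<Omega> (\<lambda>x. w x * partial k g x)"
        using w(3) by (intro mult_left_mono lnrm_mono_set[OF K(2) K'(1) \<Omega>_sets wg\<Omega>]) auto
      also have "\<dots> \<le> 1 / t * (C * \<delta>)" using w(3) C(2)[OF g] by (intro mult_left_mono) auto
      also have "\<dots> \<le> (sqrt (measure lebesgue K) + C / t) * \<delta>" using g(2) by (simp add: distrib_right)
      finally show ?thesis using Some by simp
    qed
  qed
qed

end

subsection \<open>Existence of an extension with image in the antidual\<close>

lemma jet_zero: "jet (\<lambda>_. 0) = ((\<lambda>_ _. 0) :: 'n::finite jet)"
proof
  show "jet (\<lambda>_. 0) i = (\<lambda>_. 0)" for i :: "'n option" by (cases i) auto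
qed

lemma jet_sum:
  assumes "\<And>n. smooth (g n)"
  shows "jet (\<lambda>x. \<Sum>n<N. g n x) = (\<lambda>i x. \<Sum>n<(N::nat). jet (g n) i x)"
proof (induction N)
  case 0
  then show ?case by (simp add: jet_zero)
next
  case (Suc N)
  have "jet (\<lambda>x. 1 * (\<Sum>n<N. g n x) + 1 * g N x) = jcomb 1 (jet (\<lambda>x. \<Sum>n<N. g n x)) 1 (jet (g N))"
    by (intro jet_comb smooth_sum assms)
  then show ?case using Suc by simp
qed

text \<open>The sum is taken pointwise, so that the zeroth component of the limiting jet is the
  uniformly convergent series itself and not just a representative of its class.\<close>

lemma L2_geometric_series:
  assumes g: "\<And>n. g n \<in> L2 S" and C: "\<And>n. lnrm S (g n) \<le> C * (1/2) ^ n"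
  defines "s \<equiv> (\<lambda>x. \<Sum>n. g n x)"
  shows "s \<in> L2 S" and "(\<lambda>N. lnrm S (\<lambda>x. (\<Sum>n<N. g n x) - s x)) \<longlonglongrightarrow> 0"
proof -
  define X where "X N x = (\<Sum>n<N. g n x)" for N x
  have X: "X N \<in> L2 S" for N
  proof (induction N)
    case 0
    show ?case using L2_comb[OF g g, of 0 0 0 0] by (simp add: X_def)
  next
    case (Suc N)
    then show ?case using L2_comb[OF Suc g, of 1 1 N] by (simp add: X_def)
  qed
  have step: "lnrm S (\<lambda>x. X (Suc N) x - X N x) \<le> C * (1/2) ^ N" for N
    using C[of N] by (simp add: X_def)
  have Cauchy: "\<exists>N. \<forall>m\<ge>N. \<forall>n\<ge>N. lnrm S (\<lambda>x. X m x - X n x) < e" if "e > 0" for e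
    using L2.geometric_Cauchy[where X=X and q="1/2" and A=C and e=e, OF X] step that by simp
  have lim: "s x = lim (\<lambda>N. X N x)" for x by (simp add: s_def X_def suminf_eq_lim)
  have conv: "AE x in lebesgue_on S. (\<lambda>N. X N x) \<longlonglongrightarrow> s x"
    using L2_AE_convergent[OF X step] unfolding lim by eventually_elim (simp add: convergent_LIMSEQ_iff)
  have m: "s \<in> borel_measurable (lebesgue_on S)"
    unfolding lim[abs_def] by (rule borel_measurable_lim_metric) (rule L2_measurable[OF X])
  show "s \<in> L2 S"
    by (rule L2_limit_AE(1)[OF X _ _ m, where r="\<lambda>k. k"]) (use Cauchy conv in auto)
  have "(\<lambda>N. lnrm S (\<lambda>x. X N x - s x)) \<longlonglongrightarrow> 0"
    by (rule L2_limit_AE(2)[OF X _ _ m, where r="\<lambda>k. k"]) (use Cauchy conv in auto)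
  then show "(\<lambda>N. lnrm S (\<lambda>x. (\<Sum>n<N. g n x) - s x)) \<longlonglongrightarrow> 0" by (simp add: X_def)
qed

lemma smooth_real_polynomial:
  fixes q :: "real^'n::finite \<Rightarrow> real"
  shows "real_polynomial_function q \<Longrightarrow> smooth (\<lambda>x. of_real (q x))"
proof (induction rule: real_polynomial_function.induct)
  case (linear f)
  then interpret bounded_linear f .
  have fx: "f x = (\<Sum>k\<in>UNIV. x $ k * f (axis k 1))" for x
  proof -
    have "x = (\<Sum>k\<in>UNIV. (x $ k) *\<^sub>R axis k 1)"
      by (simp add: vec_eq_iff axis_def if_distrib[of "\<lambda>x. _ * x"] cong: if_cong)
    then have "f x = f (\<Sum>k\<in>UNIV. (x $ k) *\<^sub>R axis k 1)" by simp
    then show ?thesis by (simp add: sum scaleR)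
  qed
  have eq: "(\<lambda>x. complex_of_real (f x)) = (\<lambda>x. \<Sum>k\<in>UNIV. of_real (x $ k) * of_real (f (axis k 1)))"
  proof (rule ext)
    fix x
    have "complex_of_real (\<Sum>k\<in>UNIV. x $ k * f (axis k 1)) = (\<Sum>k\<in>UNIV. of_real (x $ k) * of_real (f (axis k 1)))"
      by (simp only: of_real_sum of_real_mult)
    then show "complex_of_real (f x) = (\<Sum>k\<in>UNIV. of_real (x $ k) * of_real (f (axis k 1)))"
      unfolding fx[symmetric] .
  qed
  show ?case unfolding eq by (intro smooth_sum smooth_mult smooth_coord smooth_const)
next
  case (const c)
  show ?case by (rule smooth_const)
qed (simp_all add: smooth_add smooth_mult)

lemma smooth_polynomial:
  fixes q :: "'n::finite cfun"
  assumes "polynomial_function q"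
  shows "smooth q"
proof -
  have "real_polynomial_function (Re \<circ> q)" "real_polynomial_function (Im \<circ> q)"
    using assms bounded_linear_Re bounded_linear_Im by (auto simp: polynomial_function_def)
  from this[THEN smooth_real_polynomial]
  have "smooth (\<lambda>x. of_real (Re (q x)) + \<i> * of_real (Im (q x)))" by (simp add: smooth_add smooth_mult)
  then show ?thesis by (simp add: complex_eq[symmetric])
qed

text \<open>Against a fixed test function everything happens on its compact support, where both
  sides of the integration by parts formula converge.\<close>

lemma has_weak_partial_limit:
  assumes \<Omega>: "open \<Omega>" and g: "\<And>N. smooth (g N)" and p: "p \<in> jets_loc \<Omega>"
    and lim: "\<And>K i. compact K \<Longrightarrow> K \<subseteq> \<Omega> \<Longrightarrow> (\<lambda>N. lnrm K (\<lambda>x. jet (g N) i x - p i x)) \<longlonglongrightarrow> 0"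
  shows "has_weak_partial \<Omega> k (p None) (p (Some k))"
  unfolding has_weak_partial_def
proof (intro conjI ballI)
  have \<Omega>': "\<Omega> \<in> sets lebesgue" using \<Omega> by auto
  show "p None \<in> L1_loc \<Omega>" "p (Some k) \<in> L1_loc \<Omega>"
    using p by (auto simp: jets_loc_def intro: L2_loc_imp_L1_loc)
  fix v assume v: "v \<in> test_functions \<Omega>"
  let ?K = "supp v"
  have K: "compact ?K" "?K \<subseteq> \<Omega>" "?K \<in> sets lebesgue" "bounded ?K"
    using v by (auto simp: test_functions_def lmeasurable_compact fmeasurableD compact_imp_bounded)
  have restr: "(LINT x|lebesgue_on \<Omega>. f x * jet v i x) = lip ?K f (\<lambda>x. cnj (jet v i x))" for f i
    unfolding lip_def complex_cnj_cnj
    by (rule integral_lebesgue_on_mono_set) (use K \<Omega>' jet_outside_supp[of _ v i] in auto)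
  have vK: "(\<lambda>x. cnj (jet v i x)) \<in> L2 ?K" for i
    by (rule L2_cnj[OF jetsD[OF jet_smooth_in_jets[OF test_smooth[OF v] K(3,4)]]])
  have gK: "jet (g N) i \<in> L2 ?K" "p i \<in> L2 ?K" for N i
    using jetsD[OF jet_smooth_in_jets[OF g K(3,4)]] jetsD[OF jets_loc_jets[OF p K(1,2)]] by auto
  have conv: "(\<lambda>N. lip ?K (jet (g N) i) (\<lambda>x. cnj (jet v j x))) \<longlonglongrightarrow> lip ?K (p i) (\<lambda>x. cnj (jet v j x))" for i j
  proof (rule L2.linear_tendsto[where G="\<lambda>u. lip ?K u (\<lambda>x. cnj (jet v j x))" and K="lnrm ?K (\<lambda>x. cnj (jet v j x))", OF _ _ gK])
    show "(\<lambda>n. lnrm ?K (\<lambda>x. 1 * jet (g n) i x + (-1) * p i x)) \<longlonglongrightarrow> 0" using lim[OF K(1,2), of i] by simp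
  qed (use L2.ip_comb[OF _ _ vK] L2.cauchy_schwarz[OF _ vK] in \<open>auto simp: mult.commute\<close>)
  have "lip ?K (jet (g N) None) (\<lambda>x. cnj (jet v (Some k) x)) = - lip ?K (jet (g N) (Some k)) (\<lambda>x. cnj (jet v None x))" for N
    using smooth_has_weak_partial[OF \<Omega>' g, of k N] v restr[of "g N" "Some k"] restr[of "partial k (g N)" None]
    by (simp add: has_weak_partial_def)
  then have "(\<lambda>N. - lip ?K (jet (g N) (Some k)) (\<lambda>x. cnj (jet v None x))) \<longlonglongrightarrow> lip ?K (p None) (\<lambda>x. cnj (jet v (Some k) x))"
    using conv[of None "Some k"] by simp
  with tendsto_minus[OF conv[of "Some k" None]]
  have "lip ?K (p None) (\<lambda>x. cnj (jet v (Some k) x)) = - lip ?K (p (Some k)) (\<lambda>x. cnj (jet v None x))"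
    by (metis LIMSEQ_unique)
  then show "(LINT x|lebesgue_on \<Omega>. p None x * partial k v x) = - (LINT x|lebesgue_on \<Omega>. p (Some k) x * v x)"
    using restr[of "p None" "Some k"] restr[of "p (Some k)" None] by simp
qed

section \<open>Assembling the extension from a series of corrected functions\<close>

context elliptic
begin

text \<open>Lets the form be computed with any weak gradient at hand instead of the one picked by
  \<open>weak_partial\<close>.\<close>

lemma form_weak_jet:
  assumes p: "p \<in> jets_loc \<Omega>" "\<And>k. has_weak_partial \<Omega> k (p None) (p (Some k))" and m': "bounded_coef \<Omega> B' m'"
    and v: "v \<in> test_functions \<Omega>"
  shows "p None \<in> H1_loc \<Omega>" "form \<Omega> m' (weak_jet \<Omega> (p None)) (jet v) = form \<Omega> m' p (jet v)"
proof -
  show H: "p None \<in> H1_loc \<Omega>" using p by (auto simp: H1_loc_def jets_loc_def)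
  note K = test_compact[OF v] test_supp[OF v]
  have K': "supp v \<in> sets lebesgue" using K by (simp add: lmeasurable_compact fmeasurableD)
  show "form \<Omega> m' (weak_jet \<Omega> (p None)) (jet v) = form \<Omega> m' p (jet v)"
    unfolding form_restrict[OF \<Omega>_sets K subset_refl]
  proof (rule form_cong_AE[OF bounded_coef_subset[OF m' K(2)]])
    show "weak_jet \<Omega> (p None) \<in> jets (supp v)" by (rule jets_loc_jets[OF H1_loc_weak_jet(1)[OF \<Omega>(1) H] K])
    show "p \<in> jets (supp v)" by (rule jets_loc_jets[OF p(1) K])
    show "jet v \<in> jets (supp v)" by (rule jets_loc_jets[OF jet_smooth_in_jets_loc[OF test_smooth[OF v]] K])
    show "AE x in lebesgue_on (supp v). weak_jet \<Omega> (p None) j x = p j x" for j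
    proof (rule AE_lebesgue_on_subset[OF _ K(2) K' \<Omega>_sets])
      show "AE x in lebesgue_on \<Omega>. weak_jet \<Omega> (p None) j x = p j x"
        using weak_partial_AE[OF \<Omega>(1) p(2)] by (cases j) auto
    qed
  qed
qed

text \<open>The two operators differ only in coefficients multiplying the undifferentiated function,
  so no gradient enters the bound. This makes the passage from the auxiliary operator to the given
  one possible for functions without global energy.\<close>

lemma form_difference:
  obtains C where "C \<ge> 0" "\<And>p v. p None \<in> L2 \<Omega> \<Longrightarrow> v \<in> test_functions \<Omega> \<Longrightarrow>
    cmod (form \<Omega> m p (jet v) - form \<Omega> m1 p (jet v)) \<le> C * lnrm \<Omega> (p None) * jnrm \<Omega> (jet v)"
proof (rule that)
  define n where "n = real CARD('n)"
  let ?C = "B + (B + \<kappa>) + n * B"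
  show "?C \<ge> 0" using B \<kappa> by (simp add: n_def)
  fix p :: "'n jet" and v assume p: "p None \<in> L2 \<Omega>" and v: "v \<in> test_functions \<Omega>"
  let ?I = "\<lambda>M i j. LINT x|lebesgue_on \<Omega>. M i j x * p j x * cnj (jet v i x)"
  have vL: "jet v i \<in> L2 \<Omega>" for i by (rule jetsD[OF jet_test_in_jets[OF v \<Omega>_sets]])
  have pos: "0 \<le> B + \<kappa>" using B \<kappa> by simp
  have bnd: "cmod (?I m i None) \<le> B * (lnrm \<Omega> (p None) * jnrm \<Omega> (jet v))" for i
  proof -
    have "cmod (?I m i None) \<le> B * lnrm \<Omega> (p None) * lnrm \<Omega> (jet v i)"
      by (rule form_entry_bound[where p=p and q="jet v" and i=i and j=None, OF bounded_m p vL B])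
    also have "\<dots> \<le> B * lnrm \<Omega> (p None) * jnrm \<Omega> (jet v)" using B by (intro mult_left_mono lnrm_le_jnrm) auto
    finally show ?thesis by (simp add: mult.assoc)
  qed
  have bnd1: "cmod (?I m1 None None) \<le> (B + \<kappa>) * (lnrm \<Omega> (p None) * jnrm \<Omega> (jet v))"
  proof -
    have "cmod (?I m1 None None) \<le> (B + \<kappa>) * lnrm \<Omega> (p None) * lnrm \<Omega> (jet v None)"
      by (rule form_entry_bound[where p=p and q="jet v" and i=None and j=None, OF bounded_m1 p vL pos])
    also have "\<dots> \<le> (B + \<kappa>) * lnrm \<Omega> (p None) * jnrm \<Omega> (jet v)" using pos by (intro mult_left_mono lnrm_le_jnrm) auto
    finally show ?thesis by (simp add: mult.assoc)
  qed
  define I0 I1 where "I0 = ?I m None None" and "I1 = ?I m1 None None"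
  define J where "J k = ?I m (Some k) None" for k
  define L where "L = lnrm \<Omega> (p None) * jnrm \<Omega> (jet v)"
  have eq: "form \<Omega> m p (jet v) - form \<Omega> m1 p (jet v) = I0 - I1 + (\<Sum>k\<in>UNIV. J k)"
    by (simp add: form_def sum_option sum.distrib I0_def I1_def J_def)
  have "cmod (I0 - I1 + (\<Sum>k\<in>UNIV. J k)) \<le> cmod I0 + cmod I1 + (\<Sum>k\<in>UNIV. cmod (J k))"
    using norm_triangle_ineq[of "I0 - I1" "\<Sum>k\<in>UNIV. J k"] norm_triangle_ineq4[of I0 I1] norm_sum[of J UNIV] by linarith
  also have "\<dots> \<le> B * L + (B + \<kappa>) * L + (\<Sum>k\<in>(UNIV::'n set). B * L)"
    unfolding I0_def I1_def J_def L_def by (rule add_mono[OF add_mono[OF bnd bnd1] sum_mono[OF bnd]])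
  also have "\<dots> = ?C * lnrm \<Omega> (p None) * jnrm \<Omega> (jet v)" by (simp add: n_def L_def algebra_simps)
  finally have "cmod (I0 - I1 + (\<Sum>k\<in>UNIV. J k)) \<le> ?C * lnrm \<Omega> (p None) * jnrm \<Omega> (jet v)" .
  then show "cmod (form \<Omega> m p (jet v) - form \<Omega> m1 p (jet v)) \<le> ?C * lnrm \<Omega> (p None) * jnrm \<Omega> (jet v)"
    unfolding eq .
qed

text \<open>The pairing with a test function supported in \<open>K\<close> is bounded by its jet
  norm on \<open>K\<close>, hence by suprema of derivatives of order at most one.\<close>

lemma ell_op_distribution:
  assumes u: "u \<in> H1_loc \<Omega>"
  shows "ell_op \<Omega> a b c c0 u \<in> distributions \<Omega>"
  unfolding distributions_def
proof (intro CollectI conjI allI impI ballI)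
  note wj = H1_loc_weak_jet(1)[OF \<Omega>(1) u]
  show "ell_op \<Omega> a b c c0 u v = 0" if "v \<notin> test_functions \<Omega>" for v using that by (simp add: ell_op_def)
  show "ell_op \<Omega> a b c c0 u (\<lambda>x. \<alpha> * v x + \<beta> * w x) = cnj \<alpha> * ell_op \<Omega> a b c c0 u v + cnj \<beta> * ell_op \<Omega> a b c c0 u w"
    if "v \<in> test_functions \<Omega>" "w \<in> test_functions \<Omega>" for v w \<alpha> \<beta>
    using that by (simp add: ell_op_eq_form test_comb form_comb_right_loc[OF \<Omega>_sets bounded_m wj])
  fix K assume "compact K \<and> K \<subseteq> \<Omega>"
  then have K: "compact K" "K \<subseteq> \<Omega>" by auto
  have K': "K \<in> sets lebesgue" "bounded K" using K by (auto simp: lmeasurable_compact fmeasurableD compact_imp_bounded)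
  obtain C where C: "C > 0" "\<And>S p q. S \<subseteq> \<Omega> \<Longrightarrow> p \<in> jets S \<Longrightarrow> q \<in> jets S \<Longrightarrow> cmod (form S m p q) \<le> C * jnrm S p * jnrm S q"
    by (rule form_bound_const) blast
  let ?C = "C * jnrm K (weak_jet \<Omega> u) * sqrt (measure lebesgue K)"
  show "\<exists>C m. \<forall>v\<in>test_functions \<Omega>. supp v \<subseteq> K \<longrightarrow>
      cmod (ell_op \<Omega> a b c c0 u v) \<le> C * (\<Sum>ks | length ks \<le> m. SUP x. cmod (partials ks v x))"
  proof (intro exI[of _ ?C] exI[of _ 1] ballI impI)
    fix v assume v: "v \<in> test_functions \<Omega>" "supp v \<subseteq> K"
    define \<sigma> where "\<sigma> ks = (SUP x. cmod (partials ks v x))" for ks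
    have \<sigma>: "cmod (partials ks v x) \<le> \<sigma> ks" for ks x
    proof -
      obtain B' where "\<And>x. cmod (partials ks v x) \<le> B'" using test_bounded[OF test_partials[OF v(1)]] by metis
      then have "bdd_above (range (\<lambda>x. cmod (partials ks v x)))" by (auto intro!: bdd_aboveI2)
      then show ?thesis unfolding \<sigma>_def by (rule cSUP_upper2) auto
    qed
    have \<sigma>0: "\<sigma> ks \<ge> 0" for ks using \<sigma>[of ks 0] norm_ge_zero order_trans by blast
    \<comment> \<open>Translates jet indices into lists of directions; injectivity makes the sum
      over jet indices part of the sum over lists of length at most 1.\<close>
    define f where "f i = (case i of None \<Rightarrow> [] | Some k \<Rightarrow> [k])" for i :: "'n option"
    have jf: "jet v i x = partials (f i) v x" for i x by (cases i) (auto simp: f_def)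
    have inj: "inj f" unfolding inj_def f_def by (auto split: option.splits)
    have vK: "jet v \<in> jets K" by (rule jet_smooth_in_jets[OF test_smooth[OF v(1)] K'])
    have "jnrm K (jet v) \<le> (\<Sum>i\<in>UNIV. lnrm K (jet v i))" by (rule jnrm_le_sum)
    also have "\<dots> \<le> (\<Sum>i\<in>UNIV. \<sigma> (f i) * sqrt (measure lebesgue K))"
      by (intro sum_mono lnrm_bound[OF K' _ \<sigma>0 jetsD[OF vK]]) (simp add: jf \<sigma>)
    also have "\<dots> = (\<Sum>ks\<in>range f. \<sigma> ks) * sqrt (measure lebesgue K)"
      by (simp add: sum.reindex[OF inj] sum_distrib_right)
    also have "\<dots> \<le> (\<Sum>ks | length ks \<le> 1. \<sigma> ks) * sqrt (measure lebesgue K)"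
    proof (intro mult_right_mono sum_mono2 \<sigma>0)
      show "finite {ks :: 'n list. length ks \<le> 1}" using finite_lists_length_le[of "UNIV :: 'n set" 1] by simp
      show "range f \<subseteq> {ks. length ks \<le> 1}" by (auto simp: f_def split: option.splits)
    qed auto
    finally have jv: "jnrm K (jet v) \<le> (\<Sum>ks | length ks \<le> 1. \<sigma> ks) * sqrt (measure lebesgue K)" .
    have "cmod (ell_op \<Omega> a b c c0 u v) = cmod (form K m (weak_jet \<Omega> u) (jet v))"
      using v by (simp add: ell_op_eq_form form_restrict[OF \<Omega>_sets K])
    also have "\<dots> \<le> C * jnrm K (weak_jet \<Omega> u) * jnrm K (jet v)"
      by (rule C(2)[OF K(2) jets_loc_jets[OF wj K] vK])
    also have "\<dots> \<le> C * jnrm K (weak_jet \<Omega> u) * ((\<Sum>ks | length ks \<le> 1. \<sigma> ks) * sqrt (measure lebesgue K))"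
      using C(1) by (intro mult_left_mono jv) auto
    finally show "cmod (ell_op \<Omega> a b c c0 u v) \<le> ?C * (\<Sum>ks | length ks \<le> 1. SUP x. cmod (partials ks v x))"
      unfolding \<sigma>_def by (simp add: mult_ac)
  qed
qed

lemma H_minus_1_I:
  assumes u: "u \<in> H1_loc \<Omega>" and bnd: "\<And>v. v \<in> test_functions \<Omega> \<Longrightarrow> cmod (form \<Omega> m (weak_jet \<Omega> u) (jet v)) \<le> C * jnrm \<Omega> (jet v)"
  shows "ell_op \<Omega> a b c c0 u \<in> H_minus_1 \<Omega>"
proof -
  have "cmod (ell_op \<Omega> a b c c0 u v) \<le> (\<bar>C\<bar> + 1) * H1_norm \<Omega> v" if v: "v \<in> test_functions \<Omega>" for v
  proof -
    have "cmod (ell_op \<Omega> a b c c0 u v) \<le> C * jnrm \<Omega> (jet v)" using bnd[OF v] by (simp add: ell_op_eq_form[OF v])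
    also have "\<dots> \<le> (\<bar>C\<bar> + 1) * jnrm \<Omega> (jet v)" by (intro mult_right_mono) auto
    finally show ?thesis by (simp add: H1_norm_test[OF \<Omega>(1) v])
  qed
  then show ?thesis using ell_op_distribution[OF u] unfolding H_minus_1_def by (auto intro!: exI[of _ "\<bar>C\<bar> + 1"])
qed

text \<open>Truncation doubles the bound and correction doubles it again. Since \<open>f\<close> is
  bounded by \<open>M\<close> on the closure, truncation leaves the boundary values unchanged, and
  the correction vanishes outside \<open>\<Omega>\<close>.\<close>

lemma corrected_function:
  assumes f: "smooth f" "\<And>x. x \<in> closure \<Omega> \<Longrightarrow> cmod (f x) \<le> M" and M: "M > 0"
  shows "\<exists>g. smooth g \<and> (\<forall>x. cmod (g x) \<le> 4 * M) \<and> (\<forall>x\<in>frontier \<Omega>. g x = f x) \<and>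
    (\<forall>v\<in>test_functions \<Omega>. cmod (form \<Omega> m1 (jet g) (jet v)) \<le> 4 * M * jnrm \<Omega> (jet v))"
proof -
  obtain F where F: "smooth F" "\<And>x. cmod (F x) \<le> 2 * M" "\<And>x. cmod (f x) \<le> M \<Longrightarrow> F x = f x"
    by (rule smooth_truncation[OF f(1) M]) blast
  have M2: "2 * M > 0" "4 * M > 0" using M by auto
  obtain w where w: "w \<in> test_functions \<Omega>" "\<And>x. cmod (F x - w x) \<le> 2 * (2 * M)"
    "\<And>v. v \<in> test_functions \<Omega> \<Longrightarrow> cmod (form \<Omega> m1 (jet (\<lambda>x. F x - w x)) (jet v)) \<le> 4 * M * jnrm \<Omega> (jet v)"
    by (rule small_antidual_correction[OF F(1,2) M2]) blast
  have "F x - w x = f x" if "x \<in> frontier \<Omega>" for x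
  proof -
    have "x \<notin> \<Omega>" "x \<in> closure \<Omega>" using that \<Omega>(1) by (auto simp: frontier_def interior_open)
    then show ?thesis using F(3) f(2) test_outside[OF w(1)] by simp
  qed
  moreover have "smooth (\<lambda>x. F x - w x)" by (intro smooth_diff F(1) test_smooth[OF w(1)])
  ultimately show ?thesis using w(2,3) by (intro exI[of _ "\<lambda>x. F x - w x"]) auto
qed

text \<open>The geometric decay acts three times: it gives uniform convergence of the values,
  through the interior estimate convergence of the gradients in \<open>L\<^sup>2\<close> on compact
  sets, and summability of the images in the antidual.\<close>

lemma series_extension:
  assumes g: "\<And>n. smooth (g n)" "\<And>n x. cmod (g n x) \<le> A * (1/2) ^ n"
    "\<And>n v. v \<in> test_functions \<Omega> \<Longrightarrow> cmod (form \<Omega> m1 (jet (g n)) (jet v)) \<le> A * (1/2) ^ n * jnrm \<Omega> (jet v)"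
  defines "\<Phi> \<equiv> (\<lambda>x. \<Sum>n. g n x)"
  shows "continuous_on UNIV \<Phi>" "\<Phi> \<in> H1_loc \<Omega>" "ell_op \<Omega> a b c c0 \<Phi> \<in> H_minus_1 \<Omega>"
proof -
  have A: "A \<ge> 0" using order_trans[OF norm_ge_zero g(2)[of 0 0]] by simp
  have An: "A * (1/2) ^ n \<ge> 0" for n using A by simp
  have sumA: "summable (\<lambda>n. A * (1/2::real) ^ n)" by (intro summable_mult summable_geometric) simp
  have sumA2: "(\<Sum>n. A * (1/2::real) ^ n) = 2 * A" using suminf_mult[of "\<lambda>n. (1/2::real)^n" A] by (simp add: suminf_geometric)
  define G where "G N x = (\<Sum>n<N. g n x)" for N x
  have G: "smooth (G N)" for N unfolding G_def by (intro smooth_sum g(1))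
  have unif: "uniform_limit UNIV G \<Phi> sequentially"
    unfolding G_def[abs_def] \<Phi>_def by (rule Weierstrass_m_test[OF g(2) sumA]) 
  show cont: "continuous_on UNIV \<Phi>"
    by (rule uniform_limit_theorem[OF _ unif]) (auto intro!: always_eventually smooth_continuous G)
  define p where "p i x = (\<Sum>n. jet (g n) i x)" for i x
  have pN: "p None = \<Phi>" by (simp add: p_def \<Phi>_def fun_eq_iff)
  have jG: "jet (G N) i x = (\<Sum>n<N. jet (g n) i x)" for N i x
    using jet_sum[where g=g and N=N, OF g(1)] by (simp add: G_def[abs_def])
  have loc: "p i \<in> L2 K \<and> (\<lambda>N. lnrm K (\<lambda>x. jet (G N) i x - p i x)) \<longlonglongrightarrow> 0" if K: "compact K" "K \<subseteq> \<Omega>" for K i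
  proof -
    have K': "K \<in> sets lebesgue" "bounded K" using K by (auto simp: lmeasurable_compact fmeasurableD compact_imp_bounded)
    obtain C where C: "C \<ge> 0"
      "\<And>g \<delta> i. smooth g \<Longrightarrow> \<delta> \<ge> 0 \<Longrightarrow> (\<And>x. x \<in> \<Omega> \<Longrightarrow> cmod (g x) \<le> \<delta>) \<Longrightarrow>
        (\<And>v. v \<in> test_functions \<Omega> \<Longrightarrow> cmod (form \<Omega> m1 (jet g) (jet v)) \<le> \<delta> * jnrm \<Omega> (jet v)) \<Longrightarrow>
        lnrm K (jet g i) \<le> C * \<delta>"
      by (rule interior_gradient_estimate[OF K]) blast
    have b: "lnrm K (jet (g n) i) \<le> (C * A) * (1/2) ^ n" for n
      using C(2)[OF g(1) An g(2) g(3), of n] by (simp add: mult.assoc)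
    note s = L2_geometric_series[OF jetsD[OF jet_smooth_in_jets[OF g(1) K']] b]
    show ?thesis using s unfolding jG p_def[abs_def] by blast
  qed
  have pl: "p \<in> jets_loc \<Omega>" using loc by (simp add: jets_loc_def L2_loc_def)
  have wp: "has_weak_partial \<Omega> k (p None) (p (Some k))" for k
    by (rule has_weak_partial_limit[where g=G, OF \<Omega>(1) G pl]) (use loc in blast)
  show H: "\<Phi> \<in> H1_loc \<Omega>" using form_weak_jet(1)[OF pl wp bounded_m test_zero] by (simp add: pN)
  have Gj: "jet (G N) \<in> jets \<Omega>" for N by (rule jet_smooth_in_jets[OF G \<Omega>_sets \<Omega>(2)])
  have gj: "jet (g n) \<in> jets \<Omega>" for n by (rule jet_smooth_in_jets[OF g(1) \<Omega>_sets \<Omega>(2)])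
  have G_bound: "cmod (form \<Omega> m1 (jet (G N)) (jet v)) \<le> 2 * A * jnrm \<Omega> (jet v)" if v: "v \<in> test_functions \<Omega>" for v N
  proof -
    have vj: "jet v \<in> jets \<Omega>" by (rule jet_test_in_jets[OF v \<Omega>_sets])
    have "form \<Omega> m1 (jet (G N)) (jet v) = (\<Sum>n<N. form \<Omega> m1 (jet (g n)) (jet v))"
    proof (induction N)
      case 0
      have "jet (G 0) = jcomb 0 (jet (G 0)) 0 (jet (G 0))" by (simp add: G_def[abs_def] jet_zero)
      then show ?case using form_comb_left[OF bounded_m1 Gj Gj vj, of 0 0 0 0] by simp
    next
      case (Suc N)
      have "jet (G (Suc N)) = jcomb 1 (jet (G N)) 1 (jet (g N))" by (simp add: jG fun_eq_iff)
      then show ?case using form_comb_left[OF bounded_m1 Gj gj vj, of 1 N 1 N] Suc by simp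
    qed
    also have "cmod \<dots> \<le> (\<Sum>n<N. A * (1/2) ^ n * jnrm \<Omega> (jet v))" by (intro sum_norm_le g(3) v)
    also have "\<dots> \<le> (\<Sum>n. A * (1/2) ^ n) * jnrm \<Omega> (jet v)"
      unfolding sum_distrib_right[symmetric] by (intro mult_right_mono sum_le_suminf sumA) (auto simp: A)
    finally show ?thesis by (simp add: sumA2)
  qed
  \<comment> \<open>The bound for the partial sums passes to the limit because the form against a
    fixed \<open>v\<close> only sees the support of \<open>v\<close>.\<close>
  have p_bound: "cmod (form \<Omega> m1 p (jet v)) \<le> 2 * A * jnrm \<Omega> (jet v)" if v: "v \<in> test_functions \<Omega>" for v
  proof -
    note K = test_compact[OF v] test_supp[OF v]
    have K': "supp v \<in> sets lebesgue" "bounded (supp v)" using K by (auto simp: lmeasurable_compact fmeasurableD compact_imp_bounded)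
    obtain C where C: "C > 0" "\<And>S p q. S \<subseteq> \<Omega> \<Longrightarrow> p \<in> jets S \<Longrightarrow> q \<in> jets S \<Longrightarrow> cmod (form S m1 p q) \<le> C * jnrm S p * jnrm S q"
      by (rule form_bound_const) blast
    have vK: "jet v \<in> jets (supp v)" by (rule jet_smooth_in_jets[OF test_smooth[OF v] K'])
    have GK: "jet (G N) \<in> jets (supp v)" for N by (rule jet_smooth_in_jets[OF G K'])
    have pK: "p \<in> jets (supp v)" by (rule jets_loc_jets[OF pl K])
    have "(\<lambda>N. \<Sum>i\<in>UNIV. lnrm (supp v) (\<lambda>x. jet (G N) i x - p i x)) \<longlonglongrightarrow> (\<Sum>i\<in>(UNIV::'n option set). 0)"
      using loc[OF K] by (intro tendsto_sum) blast
    then have z: "(\<lambda>N. \<Sum>i\<in>UNIV. lnrm (supp v) (jcomb 1 (jet (G N)) (-1) p i)) \<longlonglongrightarrow> 0" by simp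
    have jlim: "(\<lambda>N. jnrm (supp v) (jcomb 1 (jet (G N)) (-1) p)) \<longlonglongrightarrow> 0"
    proof (rule Lim_null_comparison[OF _ z], intro always_eventually allI)
      show "norm (jnrm (supp v) (jcomb 1 (jet (G N)) (-1) p)) \<le> (\<Sum>i\<in>UNIV. lnrm (supp v) (jcomb 1 (jet (G N)) (-1) p i))" for N
        using jnrm_le_sum[of "supp v" "jcomb 1 (jet (G N)) (-1) p"] by simp
    qed
    note fr = form_restrict[OF \<Omega>_sets K subset_refl]
    have "(\<lambda>N. form (supp v) m1 (jet (G N)) (jet v)) \<longlonglongrightarrow> form (supp v) m1 p (jet v)"
    proof (rule jets.linear_tendsto[where G="\<lambda>q. form (supp v) m1 q (jet v)" and K="C * jnrm (supp v) (jet v)", OF _ _ GK pK jlim])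
      show "form (supp v) m1 (jcomb \<alpha> q \<beta> q') (jet v) = \<alpha> * form (supp v) m1 q (jet v) + \<beta> * form (supp v) m1 q' (jet v)"
        if "q \<in> jets (supp v)" "q' \<in> jets (supp v)" for q q' \<alpha> \<beta>
        by (rule form_comb_left[OF bounded_coef_subset[OF bounded_m1 K(2)] that vK])
      show "cmod (form (supp v) m1 q (jet v)) \<le> C * jnrm (supp v) (jet v) * jnrm (supp v) q" if "q \<in> jets (supp v)" for q
        using C(2)[OF K(2) that vK] by (simp add: mult_ac)
    qed
    then have "(\<lambda>N. cmod (form \<Omega> m1 (jet (G N)) (jet v))) \<longlonglongrightarrow> cmod (form \<Omega> m1 p (jet v))"
      unfolding fr by (rule tendsto_norm)
    then show ?thesis by (rule LIMSEQ_le_const2) (use G_bound[OF v] in blast)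
  qed
  have \<Phi>b: "cmod (\<Phi> x) \<le> 2 * A" for x
  proof -
    have "summable (\<lambda>n. norm (g n x))" by (rule summable_comparison_test'[OF sumA]) (simp add: g(2))
    then have "cmod (\<Phi> x) \<le> (\<Sum>n. cmod (g n x))" unfolding \<Phi>_def by (rule summable_norm)
    also have "\<dots> \<le> (\<Sum>n. A * (1/2) ^ n)" by (intro suminf_le g(2) sumA \<open>summable (\<lambda>n. norm (g n x))\<close>)
    finally show ?thesis by (simp add: sumA2)
  qed
  \<comment> \<open>Boundedness of \<open>\<Phi>\<close> puts its values in \<open>L2\<close>, which
    is what the comparison with the full operator asks for.\<close>
  have \<Phi>L: "p None \<in> L2 \<Omega>" unfolding pN
    by (rule L2_bounded[OF \<Omega>_sets \<Omega>(2) _ \<Phi>b]) (intro continuous_imp_measurable_on_sets_lebesgue continuous_on_subset[OF cont] \<Omega>_sets subset_UNIV)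
  obtain C where C: "C \<ge> 0" "\<And>p v. p None \<in> L2 \<Omega> \<Longrightarrow> v \<in> test_functions \<Omega> \<Longrightarrow>
    cmod (form \<Omega> m p (jet v) - form \<Omega> m1 p (jet v)) \<le> C * lnrm \<Omega> (p None) * jnrm \<Omega> (jet v)"
    by (rule form_difference) blast
  show "ell_op \<Omega> a b c c0 \<Phi> \<in> H_minus_1 \<Omega>"
  proof (rule H_minus_1_I[OF H, where C="C * lnrm \<Omega> (p None) + 2 * A"])
    fix v assume v: "v \<in> test_functions \<Omega>"
    have "cmod (form \<Omega> m p (jet v)) \<le> C * lnrm \<Omega> (p None) * jnrm \<Omega> (jet v) + 2 * A * jnrm \<Omega> (jet v)"
      using C(2)[of p, OF \<Phi>L v] p_bound[OF v] norm_triangle_sub[of "form \<Omega> m p (jet v)" "form \<Omega> m1 p (jet v)"] by linarith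
    then show "cmod (form \<Omega> m (weak_jet \<Omega> \<Phi>) (jet v)) \<le> (C * lnrm \<Omega> (p None) + 2 * A) * jnrm \<Omega> (jet v)"
      using form_weak_jet(2)[OF pl wp bounded_m v] by (simp add: pN distrib_right)
  qed
qed

text \<open>Tietze's theorem extends \<open>\<phi>\<close>, and polynomials approximating the
  extension at the rate \<open>(1/2) ^ n\<close> form a telescoping series. Each difference is
  altered inside \<open>\<Omega>\<close> only, so the boundary values of the sum are kept.\<close>

theorem exists_extension:
  assumes \<phi>: "continuous_on (frontier \<Omega>) \<phi>"
  shows "\<exists>\<Phi>. continuous_on (closure \<Omega>) \<Phi> \<and> \<Phi> \<in> H1_loc \<Omega> \<and> (\<forall>x\<in>frontier \<Omega>. \<Phi> x = \<phi> x) \<and>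
    ell_op \<Omega> a b c c0 \<Phi> \<in> H_minus_1 \<Omega>"
proof -
  obtain f where f: "continuous_on UNIV f" "\<And>x. x \<in> frontier \<Omega> \<Longrightarrow> f x = \<phi> x"
    using Tietze_unbounded[OF \<phi>, of UNIV] by (auto simp: closedin_closed)
  have cl: "compact (closure \<Omega>)" using \<Omega>(2) by (simp add: compact_closure)
  have "\<exists>q. polynomial_function q \<and> (\<forall>x\<in>closure \<Omega>. norm (f x - q x) < (1/2) ^ n)" for n
    by (rule Stone_Weierstrass_polynomial_function[OF cl continuous_on_subset[OF f(1)]]) auto
  then obtain P where P: "\<And>n. polynomial_function (P n)" "\<And>n x. x \<in> closure \<Omega> \<Longrightarrow> cmod (f x - P n x) < (1/2) ^ n"
    by metis
  have sP: "smooth (P n)" for n by (rule smooth_polynomial[OF P(1)])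
  define \<Delta> where "\<Delta> n = (case n of 0 \<Rightarrow> P 0 | Suc k \<Rightarrow> (\<lambda>x. P (Suc k) x - P k x))" for n
  have s\<Delta>: "smooth (\<Delta> n)" for n by (cases n) (auto simp: \<Delta>_def sP smooth_diff)
  obtain L where L: "L > 0" "\<And>x. x \<in> closure \<Omega> \<Longrightarrow> cmod (P 0 x) \<le> L"
    using smooth_bounded_on[OF sP compact_imp_bounded[OF cl]] by metis
  \<comment> \<open>\<open>L\<close> bounds the initial polynomial; 3 arises from
    \<open>(1/2) ^ k + (1/2) ^ Suc k = 3 * (1/2) ^ Suc k\<close>.\<close>
  define A where "A = L + 3"
  have A: "A * (1/2) ^ n > 0" for n using L by (simp add: A_def)
  have \<Delta>b: "cmod (\<Delta> n x) \<le> A * (1/2) ^ n" if x: "x \<in> closure \<Omega>" for n x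
  proof (cases n)
    case 0
    then show ?thesis using L(2)[OF x] by (simp add: \<Delta>_def A_def)
  next
    case (Suc k)
    have "cmod (P (Suc k) x - P k x) \<le> cmod (f x - P k x) + cmod (f x - P (Suc k) x)"
      using norm_triangle_ineq4[of "f x - P k x" "f x - P (Suc k) x"] by simp
    also have "\<dots> \<le> (1/2) ^ k + (1/2) ^ Suc k" using P(2)[OF x, of k] P(2)[OF x, of "Suc k"] by linarith
    also have "\<dots> = 3 * (1/2) ^ Suc k" by simp
    also have "\<dots> \<le> A * (1/2) ^ Suc k" using L by (intro mult_right_mono) (auto simp: A_def)
    finally show ?thesis using Suc by (simp add: \<Delta>_def)
  qed
  have "\<exists>g. smooth g \<and> (\<forall>x. cmod (g x) \<le> 4 * (A * (1/2) ^ n)) \<and> (\<forall>x\<in>frontier \<Omega>. g x = \<Delta> n x) \<and>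
    (\<forall>v\<in>test_functions \<Omega>. cmod (form \<Omega> m1 (jet g) (jet v)) \<le> 4 * (A * (1/2) ^ n) * jnrm \<Omega> (jet v))" for n
    by (rule corrected_function[OF s\<Delta> \<Delta>b A])
  then obtain g where g: "\<And>n. smooth (g n) \<and> (\<forall>x. cmod (g n x) \<le> 4 * (A * (1/2) ^ n)) \<and> (\<forall>x\<in>frontier \<Omega>. g n x = \<Delta> n x) \<and>
    (\<forall>v\<in>test_functions \<Omega>. cmod (form \<Omega> m1 (jet (g n)) (jet v)) \<le> 4 * (A * (1/2) ^ n) * jnrm \<Omega> (jet v))"
    by metis
  have g1: "smooth (g n)" "cmod (g n x) \<le> (4 * A) * (1/2) ^ n" for n x using g[of n] by (auto simp: mult.assoc)
  have g2: "cmod (form \<Omega> m1 (jet (g n)) (jet v)) \<le> (4 * A) * (1/2) ^ n * jnrm \<Omega> (jet v)" if "v \<in> test_functions \<Omega>" for n v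
    using g[of n] that by (auto simp: mult.assoc)
  have g3: "g n x = \<Delta> n x" if "x \<in> frontier \<Omega>" for n x using g[of n] that by blast
  note ext = series_extension[of g "4 * A", OF g1 g2]
  have "(\<Sum>n. g n x) = \<phi> x" if x: "x \<in> frontier \<Omega>" for x
  proof -
    have xc: "x \<in> closure \<Omega>" using x by (simp add: frontier_def)
    have part: "(\<Sum>n<Suc N. \<Delta> n x) = P N x" for N by (induction N) (auto simp: \<Delta>_def)
    have "(\<lambda>N. P N x) \<longlonglongrightarrow> f x"
    proof (rule LIM_zero_cancel, rule Lim_null_comparison)
      show "\<forall>\<^sub>F n in sequentially. norm (P n x - f x) \<le> (1/2) ^ n"
        using P(2)[OF xc] by (intro always_eventually allI) (simp add: norm_minus_commute less_imp_le)
      show "(\<lambda>n. (1/2::real) ^ n) \<longlonglongrightarrow> 0" by (rule LIMSEQ_realpow_zero) auto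
    qed
    then have "(\<lambda>N. \<Sum>n<Suc N. \<Delta> n x) \<longlonglongrightarrow> f x" unfolding part .
    then have "(\<lambda>N. \<Sum>n<N. \<Delta> n x) \<longlonglongrightarrow> f x" by (rule LIMSEQ_imp_Suc)
    then have "(\<lambda>n. \<Delta> n x) sums f x" by (simp add: sums_def)
    then show ?thesis using g3[OF x] f(2)[OF x] by (simp add: sums_iff)
  qed
  then show ?thesis using ext continuous_on_subset[OF ext(1)] by (intro exI[of _ "\<lambda>x. \<Sum>n. g n x"]) auto
qed

end

subsection \<open>Mollification\<close>

text \<open>The Riesz theorem projects \<open>f\<close> onto the closure of the test functions. The
  difference is orthogonal to every test function and vanishes by the fundamental lemma.\<close>

lemma test_dense_L2:
  fixes \<Omega> :: "(real^'n::finite) set"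
  assumes \<Omega>: "open \<Omega>" and f: "f \<in> L2 \<Omega>" and e: "e > 0"
  obtains v where "v \<in> test_functions \<Omega>" "lnrm \<Omega> (\<lambda>x. f x - v x) < e"
proof -
  have \<Omega>': "\<Omega> \<in> sets lebesgue" using \<Omega> by auto
  let ?D = "test_functions \<Omega>"
  define W where "W = {u \<in> L2 \<Omega>. \<forall>e>0. \<exists>d\<in>?D. lnrm \<Omega> (lcomb 1 u (-1) d) < e}"
  have DL: "?D \<subseteq> L2 \<Omega>" using \<Omega>' by (auto simp: test_L2)
  have "semi_hilbert W lcomb (lip \<Omega>) ?D"
    unfolding W_def
  proof (rule L2.closure_semi_hilbert[OF _ DL])
    show "\<exists>u\<in>L2 \<Omega>. (\<lambda>n. lnrm \<Omega> (lcomb 1 (X n) (-1) u)) \<longlonglongrightarrow> 0"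
      if "\<And>n. X n \<in> L2 \<Omega>" "\<And>e. e > 0 \<Longrightarrow> \<exists>N. \<forall>m\<ge>N. \<forall>n\<ge>N. lnrm \<Omega> (lcomb 1 (X m) (-1) (X n)) < e" for X
      using L2_complete[of X \<Omega>] that by simp
    show "?D \<noteq> {}" using test_zero by blast
  qed (rule test_comb)
  then interpret W: semi_hilbert W lcomb "lip \<Omega>" ?D .
  have nrm: "W.nrm = lnrm \<Omega>" by (simp add: fun_eq_iff W.nrm_def lnrm_def lip_self)
  have "\<exists>u\<in>W. W.nrm u \<le> lnrm \<Omega> f \<and> (\<forall>d\<in>?D. lip \<Omega> u d = lip \<Omega> f d)"
  proof (rule W.riesz)
    show "W.antilinear_on ?D (lip \<Omega> f)"
      unfolding W.antilinear_on_def using L2.ip_comb_right[OF _ _ f] DL by blast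
    show "W.bounded_on ?D (lnrm \<Omega> f) (lip \<Omega> f)"
      unfolding W.bounded_on_def nrm using L2.cauchy_schwarz[OF f] DL by blast
  qed simp
  then obtain u where u: "u \<in> W" "\<And>d. d \<in> ?D \<Longrightarrow> lip \<Omega> u d = lip \<Omega> f d" by blast
  have uL: "u \<in> L2 \<Omega>" using u(1) by (simp add: W_def)
  have fu: "(\<lambda>x. 1 * f x + (-1) * u x) \<in> L2 \<Omega>" by (rule L2_comb[OF f uL])
  have "AE x in lebesgue_on \<Omega>. 1 * f x + (-1) * u x = 0"
  proof (rule fundamental_lemma[OF \<Omega> L2_loc_imp_L1_loc[OF L2_imp_L2_loc[OF \<Omega>' fu]]])
    fix v assume "v \<in> ?D"
    then have cv: "(\<lambda>x. cnj (v x)) \<in> ?D" by (rule test_cnj)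
    have "lip \<Omega> (lcomb 1 f (-1) u) (\<lambda>x. cnj (v x)) = 0"
      using L2.ip_comb[OF f uL, of "\<lambda>x. cnj (v x)" 1 "-1"] cv DL u(2)[OF cv] by auto
    then show "(LINT x|lebesgue_on \<Omega>. (1 * f x + (-1) * u x) * v x) = 0"
      by (simp only: lip_def complex_cnj_cnj)
  qed
  then have fu0: "AE x in lebesgue_on \<Omega>. f x = u x" by simp
  have "\<exists>d\<in>?D. lnrm \<Omega> (lcomb 1 u (-1) d) < e" using u(1) e by (simp only: W_def mem_Collect_eq)
  then obtain v where v: "v \<in> ?D" "lnrm \<Omega> (lcomb 1 u (-1) v) < e" by blast
  have vL: "v \<in> L2 \<Omega>" using v DL by blast
  have "lnrm \<Omega> (lcomb 1 f (-1) v) = lnrm \<Omega> (lcomb 1 u (-1) v)"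
    by (rule lnrm_cong_AE[OF L2_comb[OF f vL] L2_comb[OF uL vL]]) (use fu0 in eventually_elim, simp)
  with v show thesis using that[of v] by simp
qed

section \<open>Correlation with a test function and its derivatives\<close>

lemma differentiable_translate:
  fixes v :: "'n::finite cfun"
  assumes "smooth v"
  shows "((\<lambda>y. v (y - x)) has_derivative frechet_derivative v (at (y - x))) (at y)"
proof -
  have "((\<lambda>y. y - x) has_derivative (\<lambda>h. h)) (at y)" by (auto intro!: derivative_eq_intros)
  from has_derivative_compose[OF this differentiable_frechet[OF smoothD[OF assms]]]
  show ?thesis .
qed

lemma partial_translate: "smooth v \<Longrightarrow> partial k (\<lambda>y. v (y - x)) = (\<lambda>y. partial k v (y - x))"
  using has_derivative_partial[OF differentiable_translate] by (auto simp: fun_eq_iff partial_def)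

lemma smooth_translate:
  assumes "smooth v"
  shows "smooth (\<lambda>y. v (y - x))"
proof (rule smooth_coinduct[where P="\<lambda>f. \<exists>v. smooth v \<and> f = (\<lambda>y. v (y - x))"])
  show "\<exists>v'. smooth v' \<and> (\<lambda>y. v (y - x)) = (\<lambda>y. v' (y - x))" using assms by blast
  show "f differentiable (at y)" if "\<exists>v. smooth v \<and> f = (\<lambda>y. v (y - x))" for f y
    using that differentiable_translate by (auto simp: differentiable_def)
  show "\<exists>v. smooth v \<and> partial k f = (\<lambda>y. v (y - x))" if "\<exists>v. smooth v \<and> f = (\<lambda>y. v (y - x))" for f k
    using that smooth_partial partial_translate by blast
qed

lemma test_translate:
  assumes v: "v \<in> test_functions (ball 0 \<delta>)" and x: "ball x \<delta> \<subseteq> \<Omega>"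
  shows "(\<lambda>y. v (y - x)) \<in> test_functions \<Omega>"
proof (rule test_functionI[OF smooth_translate[OF test_smooth[OF v]]])
  show "compact ((+) x ` supp v)" by (rule compact_translation[OF test_compact[OF v]])
  show "(+) x ` supp v \<subseteq> \<Omega>"
  proof
    fix y assume "y \<in> (+) x ` supp v"
    then obtain z where "z \<in> supp v" "y = x + z" by auto
    then have "y \<in> ball x \<delta>" using test_supp[OF v] by (auto simp: dist_norm)
    then show "y \<in> \<Omega>" using x by blast
  qed
  show "v (y - x) = 0" if "y \<notin> (+) x ` supp v" for y
  proof (rule ccontr)
    assume "v (y - x) \<noteq> 0"
    then have "y - x \<in> supp v" using not_in_supp by blast
    then have "x + (y - x) \<in> (+) x ` supp v" by (rule imageI)
    with that show False by simp
  qed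
qed

text \<open>Subtracting the linear part at \<open>x\<close> leaves a function whose derivative on
  the segment is at most \<open>norm z\<close> times the Lipschitz constants of the partial
  derivatives.\<close>

lemma test_taylor:
  fixes v :: "'n::finite cfun"
  assumes v: "v \<in> test_functions \<Omega>"
  obtains B where "B > 0" "\<And>x z. cmod (v (x + z) - v x - (\<Sum>k\<in>UNIV. of_real (z $ k) * partial k v x)) \<le> B * (norm z)\<^sup>2"
proof -
  have "\<exists>B>0. \<forall>x y. cmod (partial k v x - partial k v y) \<le> B * norm (x - y)" for k
    using test_lipschitz[OF test_partial[OF v]] by metis
  then obtain B where B: "\<And>k. B k > 0" "\<And>k x y. cmod (partial k v x - partial k v y) \<le> B k * norm (x - y)" by metis
  let ?B = "\<Sum>k\<in>UNIV. B k"
  have B0: "?B > 0" using B(1) by (intro sum_pos) auto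
  have "cmod (v (x + z) - v x - (\<Sum>k\<in>UNIV. of_real (z $ k) * partial k v x)) \<le> ?B * (norm z)\<^sup>2" for x z
  proof -
    define g where "g y = v y - (\<Sum>k\<in>UNIV. of_real (y $ k) * partial k v x)" for y
    have gd: "(g has_derivative (\<lambda>h. \<Sum>k\<in>UNIV. of_real (h $ k) * (partial k v y - partial k v x))) (at y within S)" for y S
    proof -
      have "(v has_derivative (\<lambda>h. \<Sum>k\<in>UNIV. of_real (h $ k) * partial k v y)) (at y within S)"
        by (rule has_derivative_at_withinI[OF has_derivative_sum_partial[OF smoothD[OF test_smooth[OF v]]]])
      moreover have "((\<lambda>y. \<Sum>k\<in>UNIV. of_real (y $ k) * partial k v x) has_derivative
          (\<lambda>h. \<Sum>k\<in>UNIV. of_real (h $ k) * partial k v x)) (at y within S)"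
        by (intro has_derivative_sum has_derivative_mult_left has_derivative_of_real
            bounded_linear_imp_has_derivative bounded_linear_vec_nth)
      ultimately show ?thesis
        unfolding g_def using has_derivative_diff by (force simp: right_diff_distrib sum_subtractf)
    qed
    have "cmod (g (x + z) - g x) \<le> (?B * norm z) * norm ((x + z) - x)"
    proof (rule differentiable_bound[of "closed_segment x (x + z)"])
      fix y assume y: "y \<in> closed_segment x (x + z)"
      then have yz: "norm (y - x) \<le> norm z" using segment_bound1[OF y] by simp
      show "(g has_derivative (\<lambda>h. \<Sum>k\<in>UNIV. of_real (h $ k) * (partial k v y - partial k v x))) (at y within closed_segment x (x + z))"
        by (rule gd)
      show "onorm (\<lambda>h. \<Sum>k\<in>UNIV. of_real (h $ k) * (partial k v y - partial k v x)) \<le> ?B * norm z"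
      proof (rule onorm_bound)
        show "?B * norm z \<ge> 0" using B0 by simp
        fix h :: "real^'n"
        have "cmod (\<Sum>k\<in>UNIV. of_real (h $ k) * (partial k v y - partial k v x)) \<le> (\<Sum>k\<in>UNIV. norm h * (B k * norm z))"
        proof (rule sum_norm_le)
          fix k
          have "cmod (partial k v y - partial k v x) \<le> B k * norm z"
            by (rule order_trans[OF B(2) mult_left_mono[OF yz less_imp_le[OF B(1)]]])
          then show "cmod (of_real (h $ k) * (partial k v y - partial k v x)) \<le> norm h * (B k * norm z)"
            unfolding norm_mult by (intro mult_mono) (auto simp: component_le_norm_cart)
        qed
        also have "\<dots> = ?B * norm z * norm h" by (simp add: sum_distrib_left sum_distrib_right mult_ac)
        finally show "cmod (\<Sum>k\<in>UNIV. of_real (h $ k) * (partial k v y - partial k v x)) \<le> ?B * norm z * norm h" .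
      qed
    qed auto
    moreover have "g (x + z) - g x = v (x + z) - v x - (\<Sum>k\<in>UNIV. of_real (z $ k) * partial k v x)"
      by (simp add: g_def distrib_right sum.distrib)
    ultimately show ?thesis by (simp add: power2_eq_square mult.assoc)
  qed
  with B0 show thesis using that by blast
qed

text \<open>Convolution with the reflected kernel. In this form the kernel, as a function of
  \<open>y\<close>, is a translate and so itself a test function; differentiation in
  \<open>x\<close> produces a minus sign.\<close>

definition correlation :: "'n::finite cfun \<Rightarrow> 'n cfun \<Rightarrow> 'n cfun" where
  "correlation f v x = (LINT y|lebesgue_on UNIV. f y * v (y - x))"

lemma correlation_restrict:
  assumes "S \<in> sets lebesgue" "\<And>y. y \<notin> S \<Longrightarrow> v (y - x) = 0"
  shows "correlation f v x = (LINT y|lebesgue_on S. f y * v (y - x))"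
  unfolding correlation_def
  by (rule integral_lebesgue_on_mono_set) (use assms in auto)

text \<open>Differentiation under the integral by the second-order Taylor bound for the kernel: the
  bound is uniform in the integration variable, so the remainder is at most a multiple of
  \<open>(norm z)\<^sup>2\<close> times the integral of \<open>|f|\<close> over a fixed
  ball.\<close>

lemma correlation_has_derivative:
  fixes f v :: "'n::finite cfun"
  assumes f: "f \<in> L1_loc UNIV" and v: "v \<in> test_functions UNIV"
  shows "(correlation f v has_derivative
    (\<lambda>z. \<Sum>k\<in>UNIV. of_real (z $ k) * correlation f (\<lambda>y. - partial k v y) x)) (at x)"
    (is "(_ has_derivative ?D) _")
proof -
  obtain r where r: "r > 0" "\<And>y. y \<in> supp v \<Longrightarrow> norm y \<le> r"
    using compact_imp_bounded[OF test_compact[OF v]] by (auto simp: bounded_pos)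
  have v0: "v y = 0" "partial k v y = 0" if "norm y > r" for y k
  proof -
    have "y \<notin> supp v" using that r(2)[of y] by auto
    then show "v y = 0" "partial k v y = 0" by (auto intro: not_in_supp partial_eq_0_outside_supp)
  qed
  obtain B where B: "B > 0" "\<And>x z. cmod (v (x + z) - v x - (\<Sum>k\<in>UNIV. of_real (z $ k) * partial k v x)) \<le> B * (norm z)\<^sup>2"
    by (rule test_taylor[OF v]) blast
  \<comment> \<open>For shifts shorter than 1 this ball contains the supports of both translated
    kernels.\<close>
  define S where "S = cball x (r + 1)"
  have S: "S \<in> sets lebesgue" by (simp add: S_def)
  have fS: "integrable (lebesgue_on S) f" using f by (simp add: L1_loc_def S_def)
  have int: "integrable (lebesgue_on S) (\<lambda>y. f y * w (y - a))" if w: "w \<in> test_functions UNIV" for w a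
  proof -
    obtain C where C: "\<And>x. cmod (w x) \<le> C" using test_bounded[OF w] by metis
    have "(\<lambda>y. w (y - a)) \<in> borel_measurable (lebesgue_on S)"
      by (rule smooth_measurable_lebesgue[OF smooth_translate[OF test_smooth[OF w]]])
    then have m: "(\<lambda>y. f y * w (y - a)) \<in> borel_measurable (lebesgue_on S)"
      using fS by (intro borel_measurable_times) auto
    have "integrable (lebesgue_on S) (\<lambda>y. C * cmod (f y))" using fS by simp
    then show ?thesis
    proof (rule Bochner_Integration.integrable_bound[OF _ m], intro AE_I2)
      fix y
      have "cmod (f y) * cmod (w (y - a)) \<le> cmod (f y) * C" by (intro mult_left_mono C) simp
      then show "norm (f y * w (y - a)) \<le> norm (C * cmod (f y))" by (simp add: norm_mult mult.commute)
    qed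
  qed
  define A where "A = (LINT y|lebesgue_on S. cmod (f y))"
  have est: "norm (correlation f v y - correlation f v x - ?D (y - x)) \<le> A * B * (norm (y - x))\<^sup>2" if y: "norm (y - x) < 1" for y
  proof -
    define z where "z = y - x"
    have nz: "norm z < 1" using y by (simp add: z_def)
    have y': "y = x + z" by (simp add: z_def)
    have out: "norm (u - x) > r \<and> norm (u - (x + z)) > r" if "u \<notin> S" for u
      using that nz norm_triangle_ineq2[of "u - x" z] by (simp add: S_def dist_norm norm_minus_commute algebra_simps)
    have c1: "correlation f v (x + z) = (LINT u|lebesgue_on S. f u * v (u - (x + z)))"
      by (rule correlation_restrict[OF S]) (use out v0 in blast)
    have c2: "correlation f v x = (LINT u|lebesgue_on S. f u * v (u - x))"
      by (rule correlation_restrict[OF S]) (use out v0 in blast)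
    have pt: "(\<lambda>u. - partial k v u) \<in> test_functions UNIV" for k
      using test_cmult[OF test_partial[OF v], of "-1"] by simp
    have c3: "correlation f (\<lambda>y. - partial k v y) x = (LINT u|lebesgue_on S. f u * (- partial k v (u - x)))" for k
      by (rule correlation_restrict[OF S]) (use out v0 in auto)
    have i3: "integrable (lebesgue_on S) (\<lambda>u. of_real (z $ k) * (f u * (- partial k v (u - x))))" for k
      using int[OF pt, of k x] by (intro integrable_mult_right) simp
    define R where "R u = f u * v (u - (x + z)) - f u * v (u - x) - (\<Sum>k\<in>UNIV. of_real (z $ k) * (f u * (- partial k v (u - x))))" for u
    have iR: "integrable (lebesgue_on S) R"
      unfolding R_def by (intro Bochner_Integration.integrable_diff Bochner_Integration.integrable_sum int v i3)
    have eq: "correlation f v (x + z) - correlation f v x - ?D z = integral\<^sup>L (lebesgue_on S) R"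
    proof -
      have "integral\<^sup>L (lebesgue_on S) R = (LINT u|lebesgue_on S. f u * v (u - (x + z))) - (LINT u|lebesgue_on S. f u * v (u - x))
          - (\<Sum>k\<in>UNIV. LINT u|lebesgue_on S. of_real (z $ k) * (f u * (- partial k v (u - x))))"
        unfolding R_def
        by (simp only: Bochner_Integration.integral_diff Bochner_Integration.integral_sum
            Bochner_Integration.integrable_diff Bochner_Integration.integrable_sum int[OF v] i3)
      then show ?thesis unfolding c1 c2 c3 integral_mult_right_zero by simp
    qed
    have Rb: "norm (R u) \<le> (B * (norm z)\<^sup>2) * cmod (f u)" for u
    proof -
      have "R u = f u * (v ((u - x) + - z) - v (u - x) - (\<Sum>k\<in>UNIV. of_real ((- z) $ k) * partial k v (u - x)))"
        by (simp add: R_def distrib_left right_diff_distrib sum_distrib_left diff_diff_eq mult_ac sum_negf)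
      then have "norm (R u) = cmod (f u) * cmod (v ((u - x) + - z) - v (u - x) - (\<Sum>k\<in>UNIV. of_real ((- z) $ k) * partial k v (u - x)))"
        by (simp only: norm_mult)
      also have "\<dots> \<le> cmod (f u) * (B * (norm (- z))\<^sup>2)" by (intro mult_left_mono B(2)) simp
      finally show ?thesis by (simp add: mult_ac)
    qed
    have "norm (integral\<^sup>L (lebesgue_on S) R) \<le> (LINT u|lebesgue_on S. (B * (norm z)\<^sup>2) * cmod (f u))"
      by (rule Bochner_Integration.integral_norm_bound_integral[OF iR]) (use fS Rb in auto)
    also have "\<dots> = A * B * (norm z)\<^sup>2" by (simp add: A_def)
    finally show ?thesis unfolding eq[symmetric] y' by simp
  qed
  have A0: "A * B \<ge> 0" using B(1) by (simp add: A_def)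
  show ?thesis
    unfolding has_derivative_iff_norm
  proof
    show "bounded_linear ?D"
      by (intro bounded_linear_sum bounded_linear_mult_const bounded_linear_compose[OF bounded_linear_of_real] bounded_linear_vec_nth)
    show "((\<lambda>y. norm (correlation f v y - correlation f v x - ?D (y - x)) / norm (y - x)) \<longlongrightarrow> 0) (at x)"
    proof (rule Lim_null_comparison)
      have "((\<lambda>y. A * B * norm (y - x)) \<longlongrightarrow> A * B * norm (x - x)) (at x)" by (intro tendsto_intros)
      then show "((\<lambda>y. A * B * norm (y - x)) \<longlongrightarrow> 0) (at x)" by simp
      have "\<forall>\<^sub>F y in at x. norm (y - x) < 1"
        using eventually_at_ball'[of 1 x UNIV] by (auto simp: dist_norm norm_minus_commute elim: eventually_mono)
      then show "\<forall>\<^sub>F y in at x. norm (norm (correlation f v y - correlation f v x - ?D (y - x)) / norm (y - x)) \<le> A * B * norm (y - x)"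
      proof eventually_elim
        case (elim y)
        have "norm (correlation f v y - correlation f v x - ?D (y - x)) / norm (y - x) \<le> A * B * (norm (y - x))\<^sup>2 / norm (y - x)"
          by (rule divide_right_mono[OF est[OF elim]]) simp
        also have "\<dots> = A * B * norm (y - x)" by (simp add: power2_eq_square)
        finally show ?case by simp
      qed
    qed
  qed
qed

lemma correlation_partial:
  assumes "f \<in> L1_loc UNIV" "v \<in> test_functions UNIV"
  shows "partial k (correlation f v) = correlation f (\<lambda>y. - partial k v y)"
proof
  show "partial k (correlation f v) x = correlation f (\<lambda>y. - partial k v y) x" for x
    using has_derivative_partial[OF correlation_has_derivative[OF assms], of k x]
    by (simp add: axis_def if_distrib[of complex_of_real] if_distrib[of "\<lambda>y. y * _"] cong: if_cong)
qed

lemma correlation_smooth: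
  assumes f: "f \<in> L1_loc UNIV" and v: "v \<in> test_functions UNIV"
  shows "smooth (correlation f v)"
proof (rule smooth_coinduct[where P="\<lambda>F. \<exists>v\<in>test_functions UNIV. F = correlation f v"])
  show "\<exists>w\<in>test_functions UNIV. correlation f v = correlation f w" using v by blast
  show "F differentiable (at x)" if "\<exists>v\<in>test_functions UNIV. F = correlation f v" for F x
    using that correlation_has_derivative[OF f] unfolding differentiable_def by blast
  show "\<exists>v\<in>test_functions UNIV. partial k F = correlation f v" if F: "\<exists>v\<in>test_functions UNIV. F = correlation f v" for F k
  proof -
    obtain v where v: "v \<in> test_functions UNIV" "F = correlation f v" using F by blast
    have "(\<lambda>y. - partial k v y) \<in> test_functions UNIV"
      using test_cmult[OF test_partial[OF v(1)], of "-1"] by simp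
    then show ?thesis unfolding v(2) correlation_partial[OF f v(1)] by blast
  qed
qed

lemma lnrm_diff_triangle:
  "u \<in> L2 S \<Longrightarrow> v \<in> L2 S \<Longrightarrow> w \<in> L2 S \<Longrightarrow>
    lnrm S (\<lambda>x. u x - w x) \<le> lnrm S (\<lambda>x. u x - v x) + lnrm S (\<lambda>x. v x - w x)"
  using L2.nrm_dif_triangle[of u S v w] by simp

lemma lnrm_minus_commute: "lnrm S (\<lambda>x. u x - v x) = lnrm S (\<lambda>x. v x - u x)"
  by (simp add: lnrm_def norm_minus_commute)

lemma L2_diff: "u \<in> L2 S \<Longrightarrow> v \<in> L2 S \<Longrightarrow> (\<lambda>x. u x - v x) \<in> L2 S"
  using L2_comb[of u S v 1 "-1"] by simp

section \<open>Mollifiers and approximation in the mean\<close>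

definition mollifier :: "real \<Rightarrow> 'n::finite cfun \<Rightarrow> bool" where
  "mollifier \<delta> \<rho> \<longleftrightarrow> \<rho> \<in> test_functions (ball 0 \<delta>) \<and> (\<forall>x. \<rho> x = of_real (Re (\<rho> x)) \<and> Re (\<rho> x) \<ge> 0) \<and>
     (LINT x|lborel. Re (\<rho> x)) = 1"

lemma mollifier_exists:
  assumes \<delta>: "\<delta> > 0"
  obtains \<rho> :: "'n::finite cfun" where "mollifier \<delta> \<rho>"
proof -
  \<comment> \<open>The sum of the absolute coordinates bounds the norm, so this half-width keeps
    the box within radius \<open>\<delta> / 2\<close>.\<close>
  define s where "s = \<delta> / (2 * real CARD('n))"
  have s: "s > 0" using \<delta> by (simp add: s_def)
  define a b :: "real^'n" where "a = (\<chi> k. - s)" and "b = (\<chi> k. s)"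
  have sub: "cbox a b \<subseteq> ball 0 \<delta>"
  proof
    fix x assume "x \<in> cbox a b"
    then have "\<bar>x $ k\<bar> \<le> s" for k by (simp add: mem_box_cart a_def b_def abs_le_iff minus_le_iff)
    then have "(\<Sum>k\<in>UNIV. \<bar>x $ k\<bar>) \<le> (\<Sum>k\<in>(UNIV::'n set). s)" by (intro sum_mono)
    also have "\<dots> = \<delta> / 2" by (simp add: s_def)
    also have "\<dots> < \<delta>" using \<delta> by simp
    finally show "x \<in> ball 0 \<delta>" using norm_le_l1_cart[of x] by simp
  qed
  define v where "v = box_bump a b 1"
  have v: "v \<in> test_functions (ball 0 \<delta>)" unfolding v_def by (rule box_bump_test[OF _ sub]) simp
  have vr: "v x = of_real (Re (v x)) \<and> Re (v x) \<ge> 0" for x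
    using box_bump_nonneg[of a b 1 x] by (auto simp: v_def)
  have vp: "Re (v x) > 0" if "x \<in> box a b" for x
    using box_bump_nonneg[of a b 1 x] that by (auto simp: v_def)
  have int: "integrable lborel (\<lambda>x. Re (v x))"
    by (rule integrable_bounded_linear[OF bounded_linear_Re test_lborel_integrable[OF v]])
  define I where "I = (LINT x|lborel. Re (v x))"
  \<comment> \<open>The bump is positive on a nonempty open box, which is not negligible.\<close>
  have "I \<noteq> 0"
  proof
    assume "I = 0"
    then have "AE x in lborel. Re (v x) = 0"
      using integral_nonneg_eq_0_iff_AE[OF int] vr by (simp add: I_def)
    then have "AE x in lborel. x \<notin> box a b" by eventually_elim (use vp in force)
    then have "AE x in lebesgue. x \<notin> box a b" by (rule AE_completion)
    then have "negligible (box a b)" by (simp add: AE_iff_null_sets negligible_iff_null_sets)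
    moreover have "0 \<in> box a b" using s by (simp add: mem_box_cart a_def b_def)
    ultimately show False using open_not_negligible[OF open_box] by blast
  qed
  moreover have "I \<ge> 0" unfolding I_def by (rule Bochner_Integration.integral_nonneg) (use vr in auto)
  ultimately have I: "I > 0" by simp
  have Rv: "Re (of_real (1 / I) * v x) = 1 / I * Re (v x)" for x by simp
  have "mollifier \<delta> (\<lambda>x. of_real (1 / I) * v x)"
    unfolding mollifier_def Rv
  proof (intro conjI allI)
    show "(\<lambda>x. of_real (1 / I) * v x) \<in> test_functions (ball 0 \<delta>)" by (rule test_cmult[OF v])
    show "of_real (1 / I) * v x = of_real (1 / I * Re (v x))" for x unfolding of_real_mult using vr[of x] by simp
    show "0 \<le> 1 / I * Re (v x)" for x using vr[of x] I by simp
    have "(LINT x|lborel. 1 / I * Re (v x)) = 1 / I * I" unfolding I_def by (rule integral_mult_right_zero)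
    then show "(LINT x|lborel. 1 / I * Re (v x)) = 1" using I by simp
  qed
  then show thesis by (rule that)
qed

lemma mollifierD:
  assumes "mollifier \<delta> \<rho>"
  shows "\<rho> \<in> test_functions (ball 0 \<delta>)" "\<rho> \<in> test_functions UNIV" "of_real (Re (\<rho> x)) = \<rho> x" "Re (\<rho> x) \<ge> 0"
    "\<rho> \<in> borel_measurable borel"
  using assms by (auto simp: mollifier_def intro: test_mono smooth_borel[OF test_smooth])

text \<open>The first two facts concern the kernel as a function of the integration variable; the
  third integrates over the centre of the kernel, as Tonelli's theorem will require, and follows by
  reflection.\<close>

lemma mollifier_translate:
  fixes \<rho> :: "'n::finite cfun"
  assumes \<rho>: "mollifier \<delta> \<rho>"
  shows "integrable (lebesgue_on UNIV) (\<lambda>y. Re (\<rho> (y - x)))" "(LINT y|lebesgue_on UNIV. Re (\<rho> (y - x))) = 1"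
    "(\<integral>\<^sup>+z. ennreal (Re (\<rho> (x - z))) \<partial>lborel) = 1"
proof -
  note [measurable] = mollifierD(5)[OF \<rho>]
  have t: "(\<lambda>y. \<rho> (y - x)) \<in> test_functions UNIV" by (rule test_translate[OF mollifierD(1)[OF \<rho>]]) simp
  show "integrable (lebesgue_on UNIV) (\<lambda>y. Re (\<rho> (y - x)))"
    by (rule integrable_bounded_linear[OF bounded_linear_Re test_integrable[OF _ t]]) simp
  have "(LINT y|lborel. Re (\<rho> (y + - x))) = 1"
    using \<rho> by (subst integral_lborel_translate) (auto simp: mollifier_def)
  then show "(LINT y|lebesgue_on UNIV. Re (\<rho> (y - x))) = 1"
    by (simp add: lebesgue_on_UNIV_eq integral_completion)
  have int: "integrable lborel (\<lambda>x. Re (\<rho> x))"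
    by (rule integrable_bounded_linear[OF bounded_linear_Re test_lborel_integrable[OF mollifierD(1)[OF \<rho>]]])
  have "(\<integral>\<^sup>+z. ennreal (Re (\<rho> z)) \<partial>lborel) = 1"
    using \<rho> by (subst nn_integral_eq_integral[OF int]) (auto simp: mollifier_def)
  moreover have "(\<integral>\<^sup>+z. ennreal (Re (\<rho> z)) \<partial>lborel) =
      (\<integral>\<^sup>+z. ennreal (Re (\<rho> z)) \<partial>(density (distr lborel borel (\<lambda>z. x + (-1) *\<^sub>R z)) (\<lambda>_. ennreal (\<bar>- 1\<bar> ^ DIM(real^'n)))))"
    by (subst lborel_affine[of "-1" x]) simp_all
  moreover have "\<dots> = (\<integral>\<^sup>+z. ennreal (Re (\<rho> (x - z))) \<partial>lborel)"
    by (simp add: density_1 nn_integral_distr)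
  ultimately show "(\<integral>\<^sup>+z. ennreal (Re (\<rho> (x - z))) \<partial>lborel) = 1" by simp
qed

lemma correlation_bound:
  assumes \<rho>: "mollifier \<delta> \<rho>" and f: "f \<in> L1_loc UNIV" and b: "\<And>y. cmod (f y) \<le> \<epsilon>"
  shows "cmod (correlation f \<rho> x) \<le> \<epsilon>"
proof -
  have t: "(\<lambda>y. \<rho> (y - x)) \<in> test_functions UNIV" by (rule test_translate[OF mollifierD(1)[OF \<rho>]]) simp
  have "cmod (correlation f \<rho> x) \<le> (LINT y|lebesgue_on UNIV. \<epsilon> * Re (\<rho> (y - x)))"
    unfolding correlation_def
  proof (rule Bochner_Integration.integral_norm_bound_integral[OF L1_loc_mult_test[OF _ f t]])
    fix y
    have "cmod (\<rho> (y - x)) = Re (\<rho> (y - x))"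
      by (subst mollifierD(3)[OF \<rho>, symmetric]) (simp add: mollifierD(4)[OF \<rho>])
    then show "cmod (f y * \<rho> (y - x)) \<le> \<epsilon> * Re (\<rho> (y - x))"
      unfolding norm_mult using b[of y] mollifierD(4)[OF \<rho>, of "y - x"] by (simp add: mult_right_mono)
  qed (use mollifier_translate(1)[OF \<rho>] in auto)
  also have "\<dots> = \<epsilon> * (LINT y|lebesgue_on UNIV. Re (\<rho> (y - x)))" by (rule integral_mult_right_zero)
  also have "\<dots> = \<epsilon> * 1" unfolding mollifier_translate(2)[OF \<rho>] ..
  finally show ?thesis by simp
qed

text \<open>Cauchy--Schwarz for the factors \<open>sqrt \<rho> * v\<close> and
  \<open>sqrt \<rho>\<close>, the second of which has norm 1.\<close>

lemma correlation_square_le: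
  assumes \<rho>: "mollifier \<delta> \<rho>" and v: "v \<in> test_functions UNIV"
  shows "ennreal ((cmod (correlation v \<rho> x))\<^sup>2) \<le> (\<integral>\<^sup>+y. ennreal (Re (\<rho> (y - x)) * (cmod (v y))\<^sup>2) \<partial>lborel)"
proof -
  let ?U = "UNIV :: (real^'a) set"
  note [measurable] = mollifierD(5)[OF \<rho>] smooth_borel[OF test_smooth[OF v]]
  have t: "(\<lambda>y. \<rho> (y - x)) \<in> test_functions UNIV" by (rule test_translate[OF mollifierD(1)[OF \<rho>]]) simp
  have [measurable]: "(\<lambda>y. \<rho> (y - x)) \<in> borel_measurable (lebesgue_on ?U)" "v \<in> borel_measurable (lebesgue_on ?U)"
    by (rule smooth_measurable_lebesgue[OF test_smooth[OF t]], rule smooth_measurable_lebesgue[OF test_smooth[OF v]])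
  define s where "s y = complex_of_real (sqrt (Re (\<rho> (y - x))))" for y
  have ss: "s y * cnj (s y) = \<rho> (y - x)" "(cmod (s y))\<^sup>2 = Re (\<rho> (y - x))" for y
    using mollifierD(3,4)[OF \<rho>, of "y - x"] by (simp_all add: s_def flip: of_real_mult)
  have [measurable]: "s \<in> borel_measurable (lebesgue_on ?U)" unfolding s_def[abs_def] by measurable
  have sL: "s \<in> L2 UNIV" by (rule L2_I[OF _ mollifier_translate(1)[OF \<rho>, of x]]) (auto simp: ss)
  have "(\<lambda>y. (\<rho> (y - x) * cnj (v y)) * v y) \<in> test_functions UNIV"
    by (intro test_mult_smooth smooth_mult smooth_cnj v test_smooth[OF t] test_smooth[OF v])
  from integrable_bounded_linear[OF bounded_linear_Re test_integrable[OF _ this]]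
  have "integrable (lebesgue_on UNIV) (\<lambda>y. Re ((\<rho> (y - x) * cnj (v y)) * v y))" by simp
  moreover have eq: "Re ((\<rho> (y - x) * cnj (v y)) * v y) = Re (\<rho> (y - x)) * (cmod (v y))\<^sup>2" for y
  proof -
    have "(\<rho> (y - x) * cnj (v y)) * v y = of_real (Re (\<rho> (y - x))) * of_real ((cmod (v y))\<^sup>2)"
      unfolding complex_norm_square mollifierD(3)[OF \<rho>] by (simp add: mult_ac)
    then show ?thesis by (simp only: of_real_mult[symmetric] Re_complex_of_real)
  qed
  ultimately have int: "integrable (lebesgue_on UNIV) (\<lambda>y. Re (\<rho> (y - x)) * (cmod (v y))\<^sup>2)" by simp
  have uL: "(\<lambda>y. s y * v y) \<in> L2 UNIV"
    by (rule L2_I[OF _ int]) (auto simp: ss norm_mult power_mult_distrib)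
  have "correlation v \<rho> x = lip UNIV (\<lambda>y. s y * v y) s"
    unfolding correlation_def lip_def ss(1)[symmetric] by (simp add: mult_ac)
  then have "cmod (correlation v \<rho> x) \<le> lnrm UNIV (\<lambda>y. s y * v y) * lnrm UNIV s"
    using L2.cauchy_schwarz[OF uL sL] by simp
  also have "lnrm UNIV s = 1" unfolding lnrm_def ss mollifier_translate(2)[OF \<rho>] by simp
  finally have "(cmod (correlation v \<rho> x))\<^sup>2 \<le> (lnrm UNIV (\<lambda>y. s y * v y))\<^sup>2" by (intro power_mono) auto
  also have "\<dots> = (LINT y|lebesgue_on UNIV. Re (\<rho> (y - x)) * (cmod (v y))\<^sup>2)"
    by (simp add: lnrm_sq norm_mult power_mult_distrib ss)
  finally have "ennreal ((cmod (correlation v \<rho> x))\<^sup>2) \<le> ennreal (LINT y|lebesgue_on UNIV. Re (\<rho> (y - x)) * (cmod (v y))\<^sup>2)"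
    by (rule ennreal_leI)
  also have "\<dots> = (\<integral>\<^sup>+y. ennreal (Re (\<rho> (y - x)) * (cmod (v y))\<^sup>2) \<partial>lebesgue_on UNIV)"
    by (rule nn_integral_eq_integral[symmetric, OF int]) (simp add: mollifierD(4)[OF \<rho>])
  also have "\<dots> = (\<integral>\<^sup>+y. ennreal (Re (\<rho> (y - x)) * (cmod (v y))\<^sup>2) \<partial>lborel)"
    by (simp add: lebesgue_on_UNIV_eq nn_integral_completion)
  finally show ?thesis .
qed

text \<open>Young's inequality for convolution with a kernel of mass 1: after squaring, the kernel
  is integrated out first.\<close>

lemma correlation_young:
  fixes K :: "(real^'n::finite) set"
  assumes \<rho>: "mollifier \<delta> \<rho>" and v: "v \<in> test_functions \<Omega>" and \<Omega>: "\<Omega> \<in> sets lebesgue"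
    and K: "K \<in> sets lebesgue" "bounded K"
  shows "lnrm K (correlation v \<rho>) \<le> lnrm \<Omega> v"
proof -
  have v': "v \<in> test_functions UNIV" using v by (rule test_mono) simp
  note [measurable] = mollifierD(5)[OF \<rho>] smooth_borel[OF test_smooth[OF v]]
  have sm: "smooth (correlation v \<rho>)"
    by (rule correlation_smooth[OF smooth_L1_loc[OF test_smooth[OF v]] mollifierD(2)[OF \<rho>]])
  have cL: "correlation v \<rho> \<in> L2 K" using jetsD[OF jet_smooth_in_jets[OF sm K], of None] by simp
  have "ennreal ((lnrm K (correlation v \<rho>))\<^sup>2) = (\<integral>\<^sup>+x. ennreal ((cmod (correlation v \<rho> x))\<^sup>2) \<partial>lebesgue_on K)"
    unfolding lnrm_sq using L2_integrable[OF cL] by (intro nn_integral_eq_integral[symmetric]) auto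
  also have "\<dots> = (\<integral>\<^sup>+x. ennreal ((cmod (correlation v \<rho> x))\<^sup>2) * indicator K x \<partial>lebesgue)"
    using K by (intro nn_integral_restrict_space) auto
  also have "\<dots> \<le> (\<integral>\<^sup>+x. ennreal ((cmod (correlation v \<rho> x))\<^sup>2) \<partial>lebesgue)"
    by (intro nn_integral_mono) (auto simp: indicator_def)
  also have "\<dots> = (\<integral>\<^sup>+x. ennreal ((cmod (correlation v \<rho> x))\<^sup>2) \<partial>lborel)" by (rule nn_integral_completion)
  also have "\<dots> \<le> (\<integral>\<^sup>+x. (\<integral>\<^sup>+y. ennreal (Re (\<rho> (y - x)) * (cmod (v y))\<^sup>2) \<partial>lborel) \<partial>lborel)"
    by (intro nn_integral_mono correlation_square_le[OF \<rho> v'])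
  also have "\<dots> = (\<integral>\<^sup>+y. (\<integral>\<^sup>+x. ennreal (Re (\<rho> (y - x)) * (cmod (v y))\<^sup>2) \<partial>lborel) \<partial>lborel)"
    by (rule lborel_pair.Fubini') measurable
  also have "\<dots> = (\<integral>\<^sup>+y. ennreal ((cmod (v y))\<^sup>2) \<partial>lborel)"
  proof (rule nn_integral_cong)
    fix y
    have "(\<integral>\<^sup>+x. ennreal (Re (\<rho> (y - x)) * (cmod (v y))\<^sup>2) \<partial>lborel) =
        (\<integral>\<^sup>+x. ennreal (Re (\<rho> (y - x))) * ennreal ((cmod (v y))\<^sup>2) \<partial>lborel)"
      by (intro nn_integral_cong ennreal_mult) (auto simp: mollifierD(4)[OF \<rho>])
    also have "\<dots> = (\<integral>\<^sup>+x. ennreal (Re (\<rho> (y - x))) \<partial>lborel) * ennreal ((cmod (v y))\<^sup>2)"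
      by (rule nn_integral_multc) measurable
    finally show "(\<integral>\<^sup>+x. ennreal (Re (\<rho> (y - x)) * (cmod (v y))\<^sup>2) \<partial>lborel) = ennreal ((cmod (v y))\<^sup>2)"
      unfolding mollifier_translate(3)[OF \<rho>] by simp
  qed
  also have "\<dots> = ennreal ((lnrm \<Omega> v)\<^sup>2)" by (rule lnrm_test_nn_integral[OF \<Omega> v])
  finally have "(lnrm K (correlation v \<rho>))\<^sup>2 \<le> (lnrm \<Omega> v)\<^sup>2" by simp
  then show ?thesis by (rule power2_le_imp_le) simp
qed

lemma correlation_close:
  assumes \<rho>: "mollifier \<delta> \<rho>" and v: "v \<in> test_functions UNIV" and B: "B \<ge> 0" "\<And>x y. cmod (v x - v y) \<le> B * norm (x - y)"
  shows "cmod (correlation v \<rho> x - v x) \<le> B * \<delta>"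
proof -
  have t: "(\<lambda>y. \<rho> (y - x)) \<in> test_functions UNIV" by (rule test_translate[OF mollifierD(1)[OF \<rho>]]) simp
  note iv = L1_loc_mult_test[OF _ smooth_L1_loc t] 
  have i1: "integrable (lebesgue_on UNIV) (\<lambda>y. v y * \<rho> (y - x))" by (rule iv[OF _ test_smooth[OF v]]) simp
  have i2: "integrable (lebesgue_on UNIV) (\<lambda>y. v x * \<rho> (y - x))" by (rule iv[OF _ smooth_const]) simp
  have "(LINT y|lebesgue_on UNIV. \<rho> (y - x)) = (LINT y|lebesgue_on UNIV. of_real (Re (\<rho> (y - x))))"
    unfolding mollifierD(3)[OF \<rho>] ..
  also have "\<dots> = of_real (LINT y|lebesgue_on UNIV. Re (\<rho> (y - x)))" by (rule integral_complex_of_real)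
  finally have one: "(LINT y|lebesgue_on UNIV. \<rho> (y - x)) = 1" unfolding mollifier_translate(2)[OF \<rho>] by simp
  have "correlation v \<rho> x - v x = (LINT y|lebesgue_on UNIV. v y * \<rho> (y - x)) - (LINT y|lebesgue_on UNIV. v x * \<rho> (y - x))"
    by (simp add: correlation_def one)
  also have "\<dots> = (LINT y|lebesgue_on UNIV. v y * \<rho> (y - x) - v x * \<rho> (y - x))"
    by (rule Bochner_Integration.integral_diff[symmetric, OF i1 i2])
  finally have eq: "correlation v \<rho> x - v x = (LINT y|lebesgue_on UNIV. v y * \<rho> (y - x) - v x * \<rho> (y - x))" .
  have "cmod (correlation v \<rho> x - v x) \<le> (LINT y|lebesgue_on UNIV. (B * \<delta>) * Re (\<rho> (y - x)))"
    unfolding eq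
  proof (rule Bochner_Integration.integral_norm_bound_integral[OF Bochner_Integration.integrable_diff[OF i1 i2]])
    fix y
    have n: "cmod (\<rho> (y - x)) = Re (\<rho> (y - x))"
      by (subst mollifierD(3)[OF \<rho>, symmetric]) (simp add: mollifierD(4)[OF \<rho>])
    show "norm (v y * \<rho> (y - x) - v x * \<rho> (y - x)) \<le> B * \<delta> * Re (\<rho> (y - x))"
    proof (cases "y - x \<in> ball 0 \<delta>")
      case True
      then have "B * norm (y - x) \<le> B * \<delta>" using B(1) by (intro mult_left_mono) auto
      then have "cmod (v y - v x) \<le> B * \<delta>" using B(2)[of y x] by linarith
      then show ?thesis unfolding left_diff_distrib[symmetric] norm_mult n
        by (intro mult_right_mono mollifierD(4)[OF \<rho>])
    next
      case False
      then show ?thesis using test_outside[OF mollifierD(1)[OF \<rho>] False] by simp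
    qed
  qed (use mollifier_translate(1)[OF \<rho>, of x] in auto)
  also have "\<dots> = B * \<delta> * (LINT y|lebesgue_on UNIV. Re (\<rho> (y - x)))" by (rule integral_mult_right_zero)
  also have "\<dots> = B * \<delta> * 1" unfolding mollifier_translate(2)[OF \<rho>] ..
  finally show ?thesis by simp
qed

text \<open>\<open>J\<close> is the mollification of \<open>f\<close>, which need not be continuous,
  while \<open>correlation_young\<close> concerns test functions. One approximant \<open>v\<close>
  is fixed beforehand and determines \<open>\<delta>0\<close>; a second one, \<open>w\<close>, may
  depend on the kernel and is so close to \<open>f\<close> that its mollification is uniformly close
  to \<open>J\<close>.\<close>

lemma mollify_L2:
  fixes \<Omega> K :: "(real^'n::finite) set"
  assumes \<Omega>: "open \<Omega>" "bounded \<Omega>" and K: "K \<in> sets lebesgue" "K \<subseteq> \<Omega>" and f: "f \<in> L2 \<Omega>" and \<eta>: "\<eta> > 0"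
  shows "\<exists>\<delta>0>0. \<forall>\<delta> \<rho> J. \<delta> \<le> \<delta>0 \<longrightarrow> mollifier \<delta> \<rho> \<longrightarrow> J \<in> L2 K \<longrightarrow>
    (\<forall>x\<in>K. J x = (LINT y|lebesgue_on \<Omega>. f y * \<rho> (y - x))) \<longrightarrow> lnrm K (\<lambda>x. J x - f x) < \<eta>"
proof -
  have \<Omega>': "\<Omega> \<in> sets lebesgue" using \<Omega> by auto
  have Kb: "bounded K" using bounded_subset[OF \<Omega>(2) K(2)] .
  have e8: "\<eta> / 8 > 0" using \<eta> by simp
  obtain v where v: "v \<in> test_functions \<Omega>" "lnrm \<Omega> (\<lambda>x. f x - v x) < \<eta> / 8"
    by (rule test_dense_L2[OF \<Omega>(1) f e8]) blast
  have v': "v \<in> test_functions UNIV" using v(1) by (rule test_mono) simp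
  obtain B where B: "B > 0" "\<And>x y. cmod (v x - v y) \<le> B * norm (x - y)"
    by (rule test_lipschitz[OF v(1)]) blast
  define M where "M = sqrt (measure lebesgue K)"
  have M: "M \<ge> 0" by (simp add: M_def)
  define \<delta>0 where "\<delta>0 = \<eta> / (8 * (B * (M + 1)))"
  have d0: "\<delta>0 > 0" using \<eta> B M by (simp add: \<delta>0_def)
  have Bd: "B * \<delta>0 * M \<le> \<eta> / 8"
  proof -
    have "B * \<delta>0 * M \<le> B * \<delta>0 * (M + 1)" using B d0 by (intro mult_left_mono) auto
    also have "\<dots> = (B * (M + 1)) * \<delta>0" by simp
    also have "\<dots> = \<eta> / 8" using B M by (simp add: \<delta>0_def)
    finally show ?thesis .
  qed
  have fK: "f \<in> L2 K" by (rule L2_subset[OF K(2,1) \<Omega>' f])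
  have smK: "u \<in> L2 K" if "smooth u" for u using jetsD[OF jet_smooth_in_jets[OF that K(1) Kb], of None] by simp
  show ?thesis
  proof (intro exI[of _ \<delta>0] conjI d0 allI impI)
    fix \<delta> \<rho> J
    assume \<delta>: "\<delta> \<le> \<delta>0" and \<rho>: "mollifier \<delta> \<rho>" and J: "J \<in> L2 K" "\<forall>x\<in>K. J x = (LINT y|lebesgue_on \<Omega>. f y * \<rho> (y - x))"
    obtain P where P: "P > 0" "\<And>x. cmod (\<rho> x) \<le> P" by (rule test_bounded[OF mollifierD(1)[OF \<rho>]]) blast
    define R where "R = P * sqrt (measure lebesgue \<Omega>)"
    have R: "R \<ge> 0" using P by (simp add: R_def)
    define \<tau> where "\<tau> = min (\<eta> / 8) (\<eta> / (8 * (R * M + 1)))"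
    have RM: "R * M + 1 > 0" using R M by (simp add: add_nonneg_pos)
    have \<tau>: "\<tau> > 0" using \<eta> RM by (simp add: \<tau>_def)
    have \<tau>8: "\<tau> \<le> \<eta> / 8" unfolding \<tau>_def by (rule min.cobounded1)
    have tRM: "\<tau> * R * M \<le> \<eta> / 8"
    proof -
      have "\<tau> * (R * M) \<le> \<eta> / (8 * (R * M + 1)) * (R * M)" using R M by (intro mult_right_mono) (auto simp: \<tau>_def)
      also have "\<dots> \<le> \<eta> / (8 * (R * M + 1)) * (R * M + 1)" using \<eta> RM by (intro mult_left_mono) auto
      also have "\<dots> = \<eta> / 8"
      proof -
        have "\<eta> / (8 * s) * s = \<eta> / 8" if "s > 0" for s using that by simp
        from this[OF RM] show ?thesis .
      qed
      finally show ?thesis by (simp add: mult.assoc)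
    qed
    obtain w where w: "w \<in> test_functions \<Omega>" "lnrm \<Omega> (\<lambda>x. f x - w x) < \<tau>"
      by (rule test_dense_L2[OF \<Omega>(1) f \<tau>]) blast
    have w': "w \<in> test_functions UNIV" using w(1) by (rule test_mono) simp
    have L: "v \<in> L2 \<Omega>" "w \<in> L2 \<Omega>" using v w \<Omega>' by (auto intro: test_L2)
    have cs: "smooth (correlation u \<rho>)" if "u \<in> test_functions \<Omega>" for u
      by (rule correlation_smooth[OF smooth_L1_loc[OF test_smooth[OF that]] mollifierD(2)[OF \<rho>]])
    note cL = smK[OF cs[OF v(1)]] smK[OF cs[OF w(1)]] smK[OF test_smooth[OF v(1)]]
    have 1: "lnrm K (\<lambda>x. J x - correlation w \<rho> x) \<le> \<tau> * R * M"
      unfolding M_def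
    proof (rule lnrm_bound[OF K(1) Kb _ _ L2_diff[OF J(1) cL(2)]])
      fix x assume x: "x \<in> K"
      have t: "(\<lambda>y. \<rho> (y - x)) \<in> test_functions UNIV" by (rule test_translate[OF mollifierD(1)[OF \<rho>]]) simp
      have rL: "(\<lambda>y. cnj (\<rho> (y - x))) \<in> L2 \<Omega>"
        by (rule L2_bounded[where B=P, OF \<Omega>' \<Omega>(2) smooth_measurable_lebesgue[OF smooth_cnj[OF test_smooth[OF t]]]]) (simp add: P(2))
      have rn: "lnrm \<Omega> (\<lambda>y. cnj (\<rho> (y - x))) \<le> R"
        unfolding R_def by (rule lnrm_bound[OF \<Omega>' \<Omega>(2) _ _ rL]) (use P in \<open>auto intro: less_imp_le\<close>)
      have "correlation w \<rho> x = (LINT y|lebesgue_on \<Omega>. w y * \<rho> (y - x))"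
        unfolding correlation_def by (rule integral_lebesgue_on_mono_set) (use \<Omega>' test_outside[OF w(1)] in auto)
      then have "J x - correlation w \<rho> x = lip \<Omega> f (\<lambda>y. cnj (\<rho> (y - x))) - lip \<Omega> w (\<lambda>y. cnj (\<rho> (y - x)))"
        using J(2) x by (simp add: lip_def)
      also have "\<dots> = lip \<Omega> (lcomb 1 f (-1) w) (\<lambda>y. cnj (\<rho> (y - x)))"
        using L2.ip_comb[OF f L(2) rL, of 1 "-1"] by simp
      finally have "cmod (J x - correlation w \<rho> x) \<le> lnrm \<Omega> (lcomb 1 f (-1) w) * lnrm \<Omega> (\<lambda>y. cnj (\<rho> (y - x)))"
        using L2.cauchy_schwarz[OF L2_comb[OF f L(2), of 1 "-1"] rL] by simp
      also have "\<dots> \<le> \<tau> * R" using w(2) rn \<tau> by (intro mult_mono) auto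
      finally show "cmod (J x - correlation w \<rho> x) \<le> \<tau> * R" .
    qed (use \<tau> R in simp)
    have 2: "lnrm K (\<lambda>x. correlation w \<rho> x - correlation v \<rho> x) \<le> lnrm \<Omega> (\<lambda>x. w x - v x)"
    proof -
      have wv: "(\<lambda>x. w x - v x) \<in> test_functions \<Omega>" using test_comb[OF w(1) v(1), of 1 "-1"] by simp
      have "correlation (\<lambda>x. w x - v x) \<rho> x = correlation w \<rho> x - correlation v \<rho> x" for x
      proof -
        have t: "(\<lambda>y. \<rho> (y - x)) \<in> test_functions UNIV" by (rule test_translate[OF mollifierD(1)[OF \<rho>]]) simp
        have i: "integrable (lebesgue_on UNIV) (\<lambda>y. u y * \<rho> (y - x))" if "smooth u" for u
          by (rule L1_loc_mult_test[OF _ smooth_L1_loc[OF that] t]) simp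
        show ?thesis unfolding correlation_def left_diff_distrib
          by (rule Bochner_Integration.integral_diff[OF i i]) (use v w test_smooth in blast)+
      qed
      then have "correlation (\<lambda>x. w x - v x) \<rho> = (\<lambda>x. correlation w \<rho> x - correlation v \<rho> x)" by (rule ext)
      then show ?thesis using correlation_young[OF \<rho> wv \<Omega>' K(1) Kb] by simp
    qed
    have 3: "lnrm K (\<lambda>x. correlation v \<rho> x - v x) \<le> B * \<delta>0 * M"
      unfolding M_def
    proof (rule lnrm_bound[OF K(1) Kb _ _ L2_diff[OF cL(1,3)]])
      fix x
      have "cmod (correlation v \<rho> x - v x) \<le> B * \<delta>" by (rule correlation_close[OF \<rho> v' less_imp_le[OF B(1)] B(2)])
      also have "\<dots> \<le> B * \<delta>0" using B(1) \<delta> by (intro mult_left_mono) auto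
      finally show "cmod (correlation v \<rho> x - v x) \<le> B * \<delta>0" .
    qed (use B d0 in simp)
    have 4: "lnrm K (\<lambda>x. v x - f x) \<le> lnrm \<Omega> (\<lambda>x. v x - f x)"
      by (rule lnrm_mono_set[OF K(2,1) \<Omega>' L2_diff[OF L(1) f]])
    have 5: "lnrm \<Omega> (\<lambda>x. w x - v x) \<le> lnrm \<Omega> (\<lambda>x. w x - f x) + lnrm \<Omega> (\<lambda>x. f x - v x)"
      by (rule lnrm_diff_triangle[OF L(2) f L(1)])
    have "lnrm K (\<lambda>x. J x - f x) \<le> lnrm K (\<lambda>x. J x - correlation w \<rho> x) + (lnrm K (\<lambda>x. correlation w \<rho> x - correlation v \<rho> x)
        + (lnrm K (\<lambda>x. correlation v \<rho> x - v x) + lnrm K (\<lambda>x. v x - f x)))"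
      using lnrm_diff_triangle[OF J(1) cL(2) fK] lnrm_diff_triangle[OF cL(2,1) fK] lnrm_diff_triangle[OF cL(1,3) fK] by linarith
    also have "\<dots> < \<eta>"
      using 1 2 3 4 5 v(2) w(2) tRM Bd \<tau>8 \<eta> lnrm_minus_commute[of \<Omega> w f] lnrm_minus_commute[of \<Omega> v f] by linarith
    finally show "lnrm K (\<lambda>x. J x - f x) < \<eta>" .
  qed
qed

text \<open>On \<open>K\<close> a derivative of the mollified function is the mollification of the
  weak derivative, because the translated kernel is a test function in \<open>\<Omega>\<close>. A
  kernel of mass 1 preserves the supremum bound.\<close>

theorem smooth_approximation:
  fixes \<Omega> K :: "(real^'n::finite) set"
  assumes \<Omega>: "open \<Omega>" and \<Psi>: "\<Psi> \<in> H1_loc \<Omega>" "continuous_on UNIV \<Psi>" "\<And>x. cmod (\<Psi> x) \<le> \<epsilon>"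
    and K: "compact K" "K \<subseteq> \<Omega>" and \<eta>: "\<eta> > 0"
  obtains g where "smooth g" "\<And>x. cmod (g x) \<le> \<epsilon>" "jnrm K (jcomb 1 (weak_jet \<Omega> \<Psi>) (-1) (jet g)) < \<eta>"
proof -
  have K': "K \<in> sets lebesgue" "bounded K" using K by (auto simp: lmeasurable_compact fmeasurableD compact_imp_bounded)
  obtain e where e: "e > 0" "(\<Union>x\<in>K. cball x e) \<subseteq> \<Omega>"
    by (rule compact_subset_open_imp_cball_epsilon_subset[OF K(1) \<Omega> K(2)]) blast
  \<comment> \<open>A compact neighbourhood of \<open>K\<close> in \<open>\<Omega>\<close>: local
    square integrability becomes square integrability on the open set \<open>S\<close> between the
    two.\<close>
  define T where "T = {x + y |x y. x \<in> K \<and> y \<in> cball 0 e}"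
  have T: "compact T" unfolding T_def by (rule compact_sums[OF K(1) compact_cball])
  have T\<Omega>: "T \<subseteq> \<Omega>" using e(2) by (force simp: T_def dist_norm)
  define S where "S = (\<Union>x\<in>K. ball x e)"
  have ST: "S \<subseteq> T"
  proof
    fix z assume "z \<in> S"
    then obtain x where "x \<in> K" "z \<in> ball x e" by (auto simp: S_def)
    then have "z = x + (z - x)" "z - x \<in> cball 0 e" by (auto simp: dist_norm norm_minus_commute)
    with \<open>x \<in> K\<close> show "z \<in> T" unfolding T_def by blast
  qed
  have "open S" unfolding S_def by (intro open_UN ballI open_ball)
  then have S: "open S" "bounded S" "K \<subseteq> S" "S \<in> sets lebesgue"
    using e(1) bounded_subset[OF compact_imp_bounded[OF T] ST] by simp_all (force simp: S_def)
  have T': "T \<in> sets lebesgue" using T by (simp add: lmeasurable_compact fmeasurableD)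
  have \<Omega>': "\<Omega> \<in> sets lebesgue" using \<Omega> by auto
  let ?p = "weak_jet \<Omega> \<Psi>"
  have pS: "?p i \<in> L2 S" for i
    by (rule L2_subset[OF ST S(4) T' jetsD[OF jets_loc_jets[OF H1_loc_weak_jet(1)[OF \<Omega> \<Psi>(1)] T T\<Omega>]]])
  have wp: "has_weak_partial \<Omega> k \<Psi> (?p (Some k))" for k
    using H1_loc_weak_jet(2)[OF \<Omega> \<Psi>(1)] by simp
  define \<eta>' where "\<eta>' = \<eta> / real (CARD('n option))"
  have \<eta>': "\<eta>' > 0" using \<eta> by (simp add: \<eta>'_def)
  define Q where "Q i \<delta>0 \<longleftrightarrow> (\<forall>\<delta> \<rho> J. \<delta> \<le> \<delta>0 \<longrightarrow> mollifier \<delta> \<rho> \<longrightarrow> J \<in> L2 K \<longrightarrow>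
    (\<forall>x\<in>K. J x = (LINT y|lebesgue_on S. ?p i y * \<rho> (y - x))) \<longrightarrow> lnrm K (\<lambda>x. J x - ?p i x) < \<eta>')" for i \<delta>0
  have "\<exists>\<delta>0>0. Q i \<delta>0" for i
    unfolding Q_def by (rule mollify_L2[OF S(1,2) K'(1) S(3) pS \<eta>'])
  then obtain D where D: "\<And>i. D i > 0" "\<And>i. Q i (D i)" by metis
  define \<delta> where "\<delta> = min e (Min (range D))"
  have \<delta>: "\<delta> > 0" "\<delta> \<le> e" "\<delta> \<le> D i" for i using e(1) D(1) by (auto simp: \<delta>_def min_le_iff_disj)
  obtain \<rho> :: "'n cfun" where \<rho>: "mollifier \<delta> \<rho>" by (rule mollifier_exists[OF \<delta>(1)])
  have \<Psi>L: "\<Psi> \<in> L1_loc UNIV" by (rule continuous_L1_loc[OF \<Psi>(2)])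
  define g where "g = correlation \<Psi> \<rho>"
  have sg: "smooth g" unfolding g_def by (rule correlation_smooth[OF \<Psi>L mollifierD(2)[OF \<rho>]])
  have jg: "jet g i x = (LINT y|lebesgue_on S. ?p i y * \<rho> (y - x))" if x: "x \<in> K" for i x
  proof -
    have xS: "ball x \<delta> \<subseteq> S" using x \<delta>(2) by (force simp: S_def)
    have t: "(\<lambda>y. \<rho> (y - x)) \<in> test_functions S" by (rule test_translate[OF mollifierD(1)[OF \<rho>] xS])
    have S\<Omega>: "S \<subseteq> \<Omega>" using ST T\<Omega> by blast
    have t\<Omega>: "(\<lambda>y. \<rho> (y - x)) \<in> test_functions \<Omega>" using t test_supp[OF t] S\<Omega> by (intro test_mono[OF t]) auto
    show ?thesis
    proof (cases i)
      case None
      have "correlation \<Psi> \<rho> x = (LINT y|lebesgue_on S. \<Psi> y * \<rho> (y - x))"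
        by (rule correlation_restrict[OF S(4)]) (rule test_outside[OF t])
      then show ?thesis by (simp add: None g_def)
    next
      case (Some k)
      have pt: "partial k (\<lambda>y. \<rho> (y - x)) = (\<lambda>y. partial k \<rho> (y - x))"
        by (rule partial_translate[OF test_smooth[OF mollifierD(1)[OF \<rho>]]])
      have "partial k g x = correlation \<Psi> (\<lambda>y. - partial k \<rho> y) x"
        unfolding g_def by (simp only: correlation_partial[OF \<Psi>L mollifierD(2)[OF \<rho>]])
      also have "\<dots> = (LINT y|lebesgue_on \<Omega>. \<Psi> y * (- partial k \<rho> (y - x)))"
      proof (rule correlation_restrict[OF \<Omega>'])
        fix y assume "y \<notin> \<Omega>"
        then have "partial k (\<lambda>y. \<rho> (y - x)) y = 0" by (rule test_outside[OF test_partial[OF t\<Omega>]])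
        then show "- partial k \<rho> (y - x) = 0" by (simp add: pt)
      qed
      also have "\<dots> = - (LINT y|lebesgue_on \<Omega>. \<Psi> y * partial k (\<lambda>y. \<rho> (y - x)) y)" by (simp add: pt)
      also have "\<dots> = (LINT y|lebesgue_on \<Omega>. ?p (Some k) y * \<rho> (y - x))"
        using wp[of k] t\<Omega> unfolding has_weak_partial_def by simp
      also have "\<dots> = (LINT y|lebesgue_on S. ?p (Some k) y * \<rho> (y - x))"
        by (rule integral_lebesgue_on_mono_set) (use S\<Omega> S(4) \<Omega>' test_outside[OF t] in auto)
      finally show ?thesis by (simp add: Some)
    qed
  qed
  have gK: "jet g i \<in> L2 K" for i by (rule jetsD[OF jet_smooth_in_jets[OF sg K']])
  have lt: "lnrm K (\<lambda>x. jet g i x - ?p i x) < \<eta>'" for i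
    using D(2)[of i] \<delta>(3)[of i] \<rho> gK[of i] jg unfolding Q_def by blast
  have "jnrm K (jcomb 1 ?p (-1) (jet g)) \<le> (\<Sum>i\<in>UNIV. lnrm K (jcomb 1 ?p (-1) (jet g) i))" by (rule jnrm_le_sum)
  also have "\<dots> = (\<Sum>i\<in>UNIV. lnrm K (\<lambda>x. jet g i x - ?p i x))"
    by (intro sum.cong refl) (simp add: lnrm_minus_commute[of K "jet g _"])
  also have "\<dots> < (\<Sum>i\<in>(UNIV::'n option set). \<eta>')" by (intro sum_strict_mono lt) auto
  also have "\<dots> = \<eta>" by (simp add: \<eta>'_def)
  finally have "jnrm K (jcomb 1 ?p (-1) (jet g)) < \<eta>" .
  moreover have "cmod (g x) \<le> \<epsilon>" for x unfolding g_def by (rule correlation_bound[OF \<rho> \<Psi>L \<Psi>(3)])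
  ultimately show thesis using that[OF sg] by blast
qed

subsection \<open>Estimates in terms of the supremum norm\<close>

context elliptic
begin

lemma continuous_L2: "continuous_on \<Omega> f \<Longrightarrow> (\<And>x. x \<in> \<Omega> \<Longrightarrow> cmod (f x) \<le> C) \<Longrightarrow> f \<in> L2 \<Omega>"
  by (rule L2_bounded[OF \<Omega>_sets \<Omega>(2)]) (auto intro: continuous_imp_measurable_on_sets_lebesgue)

text \<open>Testing with \<open>cut \<epsilon> g\<close>, where \<open>g\<close> is a smooth approximation of \<open>\<Psi> - z\<close>, replaces
  the maximum principle.\<close>

lemma coercive_solution_estimate:
  assumes \<Psi>: "\<Psi> \<in> H1_loc \<Omega>" "continuous_on UNIV \<Psi>" "\<And>x. cmod (\<Psi> x) \<le> \<epsilon>" and \<epsilon>: "\<epsilon> > 0"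
    and z: "z \<in> jets0 \<Omega>" "\<And>v. v \<in> test_functions \<Omega> \<Longrightarrow> form \<Omega> m1 z (jet v) = form \<Omega> m1 (weak_jet \<Omega> \<Psi>) (jet v)"
  shows "lnrm \<Omega> (\<lambda>x. \<Psi> x - z None x) \<le> (4 * sqrt (measure lebesgue \<Omega>) + 2) * \<epsilon>"
proof -
  obtain C where C: "C > 0" "\<And>S p q. S \<subseteq> \<Omega> \<Longrightarrow> p \<in> jets S \<Longrightarrow> q \<in> jets S \<Longrightarrow> cmod (form S m1 p q) \<le> C * jnrm S p * jnrm S q"
    by (rule form_bound_const) blast
  \<comment> \<open>Makes the approximation errors in the form at most
    \<open>\<mu> / 8 * \<epsilon>\<close> times the norm of the test function, and the error in the
    values of \<open>z\<close> at most \<open>\<epsilon>\<close>.\<close>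
  define \<tau> where "\<tau> = min \<epsilon> (\<epsilon> * \<mu> / (16 * C))"
  have \<tau>: "\<tau> > 0" "\<tau> \<le> \<epsilon>" using \<epsilon> \<mu> C(1) by (auto simp: \<tau>_def)
  have \<tau>C: "2 * C * \<tau> \<le> \<mu> / 8 * \<epsilon>"
  proof -
    have "2 * C * \<tau> \<le> 2 * C * (\<epsilon> * \<mu> / (16 * C))" using C(1) by (intro mult_left_mono) (auto simp: \<tau>_def)
    also have "\<dots> = \<mu> / 8 * \<epsilon>" using C(1) by simp
    finally show ?thesis .
  qed
  obtain \<zeta> where \<zeta>: "\<zeta> \<in> test_functions \<Omega>" "jnrm \<Omega> (jcomb 1 z (-1) (jet \<zeta>)) < \<tau>"
    by (rule jets0_approx[OF z(1) \<tau>(1)]) blast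
  define K where "K = supp \<zeta>"
  have K: "compact K" "K \<subseteq> \<Omega>" "K \<in> sets lebesgue" "bounded K"
    using test_compact[OF \<zeta>(1)] test_supp[OF \<zeta>(1)]
    by (auto simp: K_def lmeasurable_compact fmeasurableD compact_imp_bounded)
  let ?p = "weak_jet \<Omega> \<Psi>"
  obtain g0 where g0: "smooth g0" "\<And>x. cmod (g0 x) \<le> \<epsilon>" "jnrm K (jcomb 1 ?p (-1) (jet g0)) < \<tau>"
    by (rule smooth_approximation[OF \<Omega>(1) \<Psi> K(1,2) \<tau>(1)]) blast
  note sm = g0(1) test_smooth[OF \<zeta>(1)]
  \<comment> \<open>Outside the support of \<open>\<zeta>\<close> this is \<open>g0\<close>, bounded
    by \<open>\<epsilon>\<close>; so the truncation at level \<open>\<epsilon>\<close> is a test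
    function carried by \<open>K\<close>, the set on which the gradient of \<open>g0\<close>
    approximates that of \<open>\<Psi>\<close>.\<close>
  define g where "g x = g0 x - \<zeta> x" for x
  have g: "smooth g" unfolding g_def by (rule smooth_diff[OF sm])
  have gK: "cmod (g x) \<le> \<epsilon>" if "x \<notin> K" for x
    using that not_in_supp[of x \<zeta>] g0(2)[of x] by (simp add: g_def K_def)
  define q where "q = cut \<epsilon> g"
  have q: "q \<in> test_functions \<Omega>" unfolding q_def by (rule cut_test[OF g K(1,2) gK])
  have qK: "supp q \<subseteq> K"
    unfolding q_def using K(1) by (intro supp_subset compact_imp_closed) (use cut_eq_0 gK in auto)
  define N where "N = jnrm \<Omega> (jet q)"
  have N: "N \<ge> 0" "N = jnrm K (jet q)" unfolding N_def using jnrm_restrict[OF \<Omega>_sets K(1,2) qK] by auto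
  have low: "\<mu> / 8 * N\<^sup>2 \<le> Re (form \<Omega> m1 (jet g) (jet q))"
    unfolding N_def q_def by (rule cut_estimate[OF g K(1,2) gK \<epsilon>])
  have pl: "?p \<in> jets_loc \<Omega>" by (rule H1_loc_weak_jet(1)[OF \<Omega>(1) \<Psi>(1)])
  have j: "jet q \<in> jets \<Omega>" "jet g0 \<in> jets \<Omega>" "jet \<zeta> \<in> jets \<Omega>" "z \<in> jets \<Omega>"
    using jet_smooth_in_jets[OF _ \<Omega>_sets \<Omega>(2)] sm test_smooth[OF q] jets0_subset[OF z(1)] by auto
  have jK: "jet q \<in> jets K" "jet g0 \<in> jets K" "?p \<in> jets K"
    using jet_smooth_in_jets[OF _ K(3,4)] sm test_smooth[OF q] jets_loc_jets[OF pl K(1,2)] by auto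
  \<comment> \<open>Both are approximation errors; the equation for \<open>z\<close> cancels
    everything else.\<close>
  define X Y where "X = form K m1 (jcomb 1 ?p (-1) (jet g0)) (jet q)" and "Y = form \<Omega> m1 (jcomb 1 z (-1) (jet \<zeta>)) (jet q)"
  have "form \<Omega> m1 (jet g) (jet q) = form \<Omega> m1 (jet g0) (jet q) - form \<Omega> m1 (jet \<zeta>) (jet q)"
    using form_comb_left[OF bounded_m1 j(2,3,1), of 1 "-1"] jet_diff[OF sm] by (simp add: g_def[abs_def])
  moreover have "X = form \<Omega> m1 ?p (jet q) - form \<Omega> m1 (jet g0) (jet q)"
    using form_comb_left[OF bounded_coef_subset[OF bounded_m1 K(2)] jK(3,2,1), of 1 "-1"]
    by (simp add: X_def form_restrict[OF \<Omega>_sets K(1,2) qK])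
  moreover have "Y = form \<Omega> m1 z (jet q) - form \<Omega> m1 (jet \<zeta>) (jet q)"
    using form_comb_left[OF bounded_m1 j(4,3,1), of 1 "-1"] by (simp add: Y_def)
  ultimately have "form \<Omega> m1 (jet g) (jet q) = Y - X" using z(2)[OF q] by simp
  moreover have "cmod (Y - X) \<le> 2 * C * \<tau> * N"
  proof -
    have "cmod X \<le> C * jnrm K (jcomb 1 ?p (-1) (jet g0)) * jnrm K (jet q)"
      unfolding X_def by (rule C(2)[OF K(2) jets.comb_closed[OF jK(3,2)] jK(1)])
    also have "\<dots> \<le> C * \<tau> * N" unfolding N(2) using g0(3) C(1) by (intro mult_right_mono mult_left_mono) auto
    finally have 1: "cmod X \<le> C * \<tau> * N" .
    have "cmod Y \<le> C * jnrm \<Omega> (jcomb 1 z (-1) (jet \<zeta>)) * jnrm \<Omega> (jet q)"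
      unfolding Y_def by (rule C(2)[OF subset_refl jets.comb_closed[OF j(4,3)] j(1)])
    also have "\<dots> \<le> C * \<tau> * N" unfolding N_def using \<zeta>(2) C(1) by (intro mult_right_mono mult_left_mono) auto
    finally have 2: "cmod Y \<le> C * \<tau> * N" .
    have "2 * C * \<tau> * N = C * \<tau> * N + C * \<tau> * N" by simp
    then show ?thesis using 1 2 norm_triangle_ineq4[of Y X] by linarith
  qed
  ultimately have "\<mu> / 8 * N\<^sup>2 \<le> 2 * C * \<tau> * N"
    using low complex_Re_le_cmod[of "Y - X"] by simp
  also have "\<dots> \<le> \<mu> / 8 * \<epsilon> * N" by (rule mult_right_mono[OF \<tau>C N(1)])
  finally have "\<mu> / 8 * (N * N) \<le> \<mu> / 8 * (\<epsilon> * N)" by (simp add: power2_eq_square)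
  then have "N * N \<le> \<epsilon> * N" using \<mu>(1) by (simp only: mult_le_cancel_left_pos[of "\<mu> / 8"])
  then have N\<epsilon>: "N \<le> \<epsilon>" using N(1) \<epsilon> by (cases "N = 0") auto
  define s where "s = sqrt (measure lebesgue \<Omega>)"
  have L: "\<Psi> \<in> L2 \<Omega>" "g0 \<in> L2 \<Omega>" "\<zeta> \<in> L2 \<Omega>" "q \<in> L2 \<Omega>" "z None \<in> L2 \<Omega>"
    using continuous_L2[OF continuous_on_subset[OF \<Psi>(2)] \<Psi>(3)] jetsD[OF j(1), of None] jetsD[OF j(2), of None]
      jetsD[OF j(3), of None] jetsD[OF j(4), of None] by auto
  note Lg = L2_diff[OF L(2,3)]
  \<comment> \<open>The difference splits into four pieces: \<open>e1\<close> and \<open>e2\<close>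
    are bounded pointwise by \<open>2 * \<epsilon>\<close>, which gives
    \<open>4 * sqrt (measure lebesgue \<Omega>)\<close>, while \<open>q\<close> and
    \<open>e3\<close> have norm at most \<open>\<epsilon>\<close>.\<close>
  define e1 where "e1 x = \<Psi> x - g0 x" for x
  define e2 where "e2 x = (g0 x - \<zeta> x) - q x" for x
  define e3 where "e3 x = \<zeta> x - z None x" for x
  have E: "e1 \<in> L2 \<Omega>" "e2 \<in> L2 \<Omega>" "e3 \<in> L2 \<Omega>"
    unfolding e1_def[abs_def] e2_def[abs_def] e3_def[abs_def] by (intro L2_diff L)+
  have n1: "lnrm \<Omega> e1 \<le> (2 * \<epsilon>) * s"
    unfolding s_def
  proof (rule lnrm_bound[OF \<Omega>_sets \<Omega>(2) _ _ E(1)])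
    show "cmod (e1 x) \<le> 2 * \<epsilon>" for x
      using norm_triangle_ineq4[of "\<Psi> x" "g0 x"] \<Psi>(3)[of x] g0(2)[of x] by (simp add: e1_def)
  qed (use \<epsilon> in simp)
  have n2: "lnrm \<Omega> e2 \<le> (2 * \<epsilon>) * s"
    unfolding s_def
  proof (rule lnrm_bound[OF \<Omega>_sets \<Omega>(2) _ _ E(2)])
    show "cmod (e2 x) \<le> 2 * \<epsilon>" for x
      using cut_remainder[OF \<epsilon>, of g x] by (simp add: e2_def q_def g_def)
  qed (use \<epsilon> in simp)
  have n3: "lnrm \<Omega> e3 \<le> \<epsilon>"
  proof -
    have "lnrm \<Omega> e3 = lnrm \<Omega> (jcomb 1 z (-1) (jet \<zeta>) None)"
      using lnrm_minus_commute[of \<Omega> \<zeta> "z None"] by (simp add: e3_def[abs_def])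
    then show ?thesis using lnrm_le_jnrm[of \<Omega> "jcomb 1 z (-1) (jet \<zeta>)" None] \<zeta>(2) \<tau>(2) by linarith
  qed
  have n4: "lnrm \<Omega> q \<le> \<epsilon>" using lnrm_le_jnrm[of \<Omega> "jet q" None] N\<epsilon> by (simp add: N_def)
  have t: "lnrm \<Omega> (\<lambda>x. u x + w x) \<le> lnrm \<Omega> u + lnrm \<Omega> w" if "u \<in> L2 \<Omega>" "w \<in> L2 \<Omega>" for u w
    using L2.nrm_comb_le[OF that, of 1 1] by simp
  have s: "(\<lambda>x. u x + w x) \<in> L2 \<Omega>" if "u \<in> L2 \<Omega>" "w \<in> L2 \<Omega>" for u w
    using L2_comb[OF that, of 1 1] by simp
  have "lnrm \<Omega> (\<lambda>x. e1 x + (e2 x + (q x + e3 x))) \<le> lnrm \<Omega> e1 + (lnrm \<Omega> e2 + (lnrm \<Omega> q + lnrm \<Omega> e3))"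
    using t[OF E(1) s[OF E(2) s[OF L(4) E(3)]]] t[OF E(2) s[OF L(4) E(3)]] t[OF L(4) E(3)] by linarith
  also have "\<dots> \<le> (4 * s + 2) * \<epsilon>" using n1 n2 n3 n4 by (simp add: algebra_simps)
  finally show ?thesis by (simp add: e1_def e2_def e3_def s_def)
qed

lemma antidual_form:
  assumes p: "p \<in> jets_loc \<Omega>" and m': "bounded_coef \<Omega> B' m'"
    and bnd: "\<And>v. v \<in> test_functions \<Omega> \<Longrightarrow> cmod (form \<Omega> m' p (jet v)) \<le> K * jnrm \<Omega> (jet v)"
  shows "antidual K (\<lambda>v. form \<Omega> m' p (jet v))"
  unfolding antidual_def using bnd by (auto simp: form_comb_right_loc[OF \<Omega>_sets m' p])

lemma jets0_jets_loc: "p \<in> jets0 \<Omega> \<Longrightarrow> p \<in> jets_loc \<Omega>"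
  by (rule jets_imp_jets_loc[OF \<Omega>_sets jets0_subset])

lemma ell_op_jets0:
  assumes "p \<in> jets0 \<Omega>"
  shows "ell_op \<Omega> a b c c0 (p None) = (\<lambda>v. if v \<in> test_functions \<Omega> then form \<Omega> m p (jet v) else 0)"
proof
  fix v
  show "ell_op \<Omega> a b c c0 (p None) v = (if v \<in> test_functions \<Omega> then form \<Omega> m p (jet v) else 0)"
  proof (cases "v \<in> test_functions \<Omega>")
    case True
    from form_weak_jet(2)[OF jets0_jets_loc[OF assms] jets0_has_weak_partial[OF \<Omega>(1) assms] bounded_m True]
    show ?thesis using True by (simp add: ell_op_eq_form)
  qed (simp add: ell_op_def)
qed

definition not_eigenvalue :: bool where
  "not_eigenvalue \<longleftrightarrow> (\<forall>u\<in>H1_0 \<Omega>. ell_op \<Omega> a b c c0 u = (\<lambda>_. 0) \<longrightarrow> (AE x in lebesgue_on \<Omega>. u x = 0))"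

lemma solve_ex:
  assumes inj: not_eigenvalue
  shows "\<exists>C\<ge>0. \<forall>G K. antidual K G \<longrightarrow> K \<ge> 0 \<longrightarrow>
    (\<exists>p\<in>jets0 \<Omega>. jnrm \<Omega> p \<le> C * K \<and> (\<forall>v\<in>test_functions \<Omega>. form \<Omega> m p (jet v) = G v))"
proof (rule solve)
  show "AE x in lebesgue_on \<Omega>. u x = 0" if "u \<in> H1_0 \<Omega>" "ell_op \<Omega> a b c c0 u = (\<lambda>_. 0)" for u
    using inj that by (auto simp: not_eigenvalue_def)
  fix C assume C: "C \<ge> 0" "\<And>G K. antidual K G \<Longrightarrow> K \<ge> 0 \<Longrightarrow>
    \<exists>p\<in>jets0 \<Omega>. jnrm \<Omega> p \<le> C * K \<and> (\<forall>v\<in>test_functions \<Omega>. form \<Omega> m p (jet v) = G v)"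
  show ?thesis by (intro exI[of _ C] conjI allI impI C)
qed

lemma injective_jets0:
  assumes inj: not_eigenvalue
    and p: "p \<in> jets0 \<Omega>" and z: "\<And>v. v \<in> test_functions \<Omega> \<Longrightarrow> form \<Omega> m p (jet v) = 0"
  shows "AE x in lebesgue_on \<Omega>. p None x = 0"
proof (rule inj[unfolded not_eigenvalue_def, rule_format, OF jets0_H1_0(1)[OF \<Omega>(1) p]])
  show "ell_op \<Omega> a b c c0 (p None) = (\<lambda>_. 0)"
    unfolding ell_op_jets0[OF p] using z by (intro ext) simp
qed

text \<open>Let \<open>z\<close> solve the auxiliary equation for \<open>\<Psi>\<close>. The
  remainder \<open>\<Psi> - z\<close> is small in \<open>L\<^sup>2\<close>, and since the auxiliary
  operator annihilates it, its image under the full operator is a lower-order difference, small in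
  the antidual. Solving for this image gives \<open>y\<close>, and by injectivity
  \<open>p = z + y\<close> almost everywhere.\<close>

lemma solution_estimate:
  assumes inj: not_eigenvalue
  obtains C where "C \<ge> 0"
    "\<And>\<Psi> \<epsilon> p. \<Psi> \<in> H1_loc \<Omega> \<Longrightarrow> continuous_on UNIV \<Psi> \<Longrightarrow> (\<And>x. cmod (\<Psi> x) \<le> \<epsilon>) \<Longrightarrow> \<epsilon> > 0 \<Longrightarrow> p \<in> jets0 \<Omega> \<Longrightarrow>
      (\<And>v. v \<in> test_functions \<Omega> \<Longrightarrow> form \<Omega> m p (jet v) = form \<Omega> m (weak_jet \<Omega> \<Psi>) (jet v)) \<Longrightarrow>
      lnrm \<Omega> (\<lambda>x. \<Psi> x - p None x) \<le> C * \<epsilon>"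
proof -
  obtain C1 where C1: "C1 \<ge> 0"
    "\<forall>G K. antidual K G \<longrightarrow> K \<ge> 0 \<longrightarrow>
      (\<exists>p\<in>jets0 \<Omega>. jnrm \<Omega> p \<le> C1 * K \<and> (\<forall>v\<in>test_functions \<Omega>. form \<Omega> m p (jet v) = G v))"
    using solve_ex[OF inj] by (elim exE conjE)
  obtain C2 where C2: "C2 \<ge> 0" "\<And>p v. p None \<in> L2 \<Omega> \<Longrightarrow> v \<in> test_functions \<Omega> \<Longrightarrow>
    cmod (form \<Omega> m p (jet v) - form \<Omega> m1 p (jet v)) \<le> C2 * lnrm \<Omega> (p None) * jnrm \<Omega> (jet v)"
    by (rule form_difference) blast
  obtain C3 where C3: "C3 > 0" "\<And>S p q. S \<subseteq> \<Omega> \<Longrightarrow> p \<in> jets S \<Longrightarrow> q \<in> jets S \<Longrightarrow> cmod (form S m p q) \<le> C3 * jnrm S p * jnrm S q"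
    by (rule form_bound_const) blast
  define D where "D = 4 * sqrt (measure lebesgue \<Omega>) + 2"
  have D: "D \<ge> 0" by (simp add: D_def)
  show thesis
  proof (rule that)
    show "D + C1 * C2 * D \<ge> 0" using D C1(1) C2(1) by simp
    fix \<Psi> \<epsilon> and p :: "'n jet"
    assume \<Psi>: "\<Psi> \<in> H1_loc \<Omega>" "continuous_on UNIV \<Psi>" "\<And>x. cmod (\<Psi> x) \<le> \<epsilon>" and \<epsilon>: "\<epsilon> > 0"
      and p: "p \<in> jets0 \<Omega>" "\<And>v. v \<in> test_functions \<Omega> \<Longrightarrow> form \<Omega> m p (jet v) = form \<Omega> m (weak_jet \<Omega> \<Psi>) (jet v)"
    let ?w = "weak_jet \<Omega> \<Psi>"
    have wl: "?w \<in> jets_loc \<Omega>" by (rule H1_loc_weak_jet(1)[OF \<Omega>(1) \<Psi>(1)])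
    have \<Psi>L: "\<Psi> \<in> L2 \<Omega>" by (rule continuous_L2[OF continuous_on_subset[OF \<Psi>(2) subset_UNIV] \<Psi>(3)])
    have wL: "?w None \<in> L2 \<Omega>" using \<Psi>L by simp
    \<comment> \<open>This bound involves the norm of \<open>p\<close> and need not be small; it
      serves only to make \<open>z\<close> exist.\<close>
    have "cmod (form \<Omega> m1 ?w (jet v)) \<le> (C2 * lnrm \<Omega> \<Psi> + C3 * jnrm \<Omega> p) * jnrm \<Omega> (jet v)"
      if v: "v \<in> test_functions \<Omega>" for v
    proof -
      have 1: "cmod (form \<Omega> m ?w (jet v) - form \<Omega> m1 ?w (jet v)) \<le> C2 * lnrm \<Omega> \<Psi> * jnrm \<Omega> (jet v)"
        using C2(2)[of ?w, OF wL v] by simp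
      have 2: "cmod (form \<Omega> m ?w (jet v)) \<le> C3 * jnrm \<Omega> p * jnrm \<Omega> (jet v)"
        unfolding p(2)[OF v, symmetric]
        by (rule C3(2)[OF subset_refl jets0_subset[OF p(1)] jet_test_in_jets[OF v \<Omega>_sets]])
      show ?thesis
        using 1 2 norm_triangle_sub[of "form \<Omega> m1 ?w (jet v)" "form \<Omega> m ?w (jet v)"]
          norm_minus_commute[of "form \<Omega> m1 ?w (jet v)" "form \<Omega> m ?w (jet v)"]
        unfolding distrib_right by linarith
    qed
    from antidual_form[OF wl bounded_m1 this]
    have ad: "antidual (C2 * lnrm \<Omega> \<Psi> + C3 * jnrm \<Omega> p) (\<lambda>v. form \<Omega> m1 ?w (jet v))" by blast
    have "0 \<le> C2 * lnrm \<Omega> \<Psi> + C3 * jnrm \<Omega> p" using C2(1) C3(1) by (intro add_nonneg_nonneg mult_nonneg_nonneg) auto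
    then obtain z where z: "z \<in> jets0 \<Omega>" "\<And>v. v \<in> test_functions \<Omega> \<Longrightarrow> form \<Omega> m1 z (jet v) = form \<Omega> m1 ?w (jet v)"
      by (rule solve1[OF ad]) blast
    have est: "lnrm \<Omega> (\<lambda>x. \<Psi> x - z None x) \<le> D * \<epsilon>"
      unfolding D_def by (rule coercive_solution_estimate[OF \<Psi> \<epsilon> z])
    have zL: "z None \<in> L2 \<Omega>" and pL: "p None \<in> L2 \<Omega>" using jetsD[OF jets0_subset] z(1) p(1) by blast+
    define r where "r = jcomb 1 ?w (-1) z"
    have rl: "r \<in> jets_loc \<Omega>" unfolding r_def by (rule jets_loc_comb[OF wl jets0_jets_loc[OF z(1)]])
    have r0: "r None = (\<lambda>x. \<Psi> x - z None x)" by (simp add: r_def)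
    have rm: "form \<Omega> m r (jet v) = form \<Omega> m ?w (jet v) - form \<Omega> m z (jet v)" if "v \<in> test_functions \<Omega>" for v
      unfolding r_def using form_comb_left_loc[OF \<Omega>_sets bounded_m wl jets0_jets_loc[OF z(1)] that, of 1 "-1"] by simp
    have rm1: "form \<Omega> m1 r (jet v) = 0" if "v \<in> test_functions \<Omega>" for v
      unfolding r_def using form_comb_left_loc[OF \<Omega>_sets bounded_m1 wl jets0_jets_loc[OF z(1)] that, of 1 "-1"] z(2)[OF that] by simp
    have "cmod (form \<Omega> m r (jet v)) \<le> (C2 * (D * \<epsilon>)) * jnrm \<Omega> (jet v)" if v: "v \<in> test_functions \<Omega>" for v
    proof -
      have rL: "r None \<in> L2 \<Omega>" unfolding r0 by (rule L2_diff[OF \<Psi>L zL])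
      have "cmod (form \<Omega> m r (jet v)) \<le> C2 * lnrm \<Omega> (r None) * jnrm \<Omega> (jet v)"
        using C2(2)[of r, OF rL v] rm1[OF v] by simp
      also have "\<dots> \<le> (C2 * (D * \<epsilon>)) * jnrm \<Omega> (jet v)"
        using est C2(1) unfolding r0 by (intro mult_right_mono mult_left_mono) auto
      finally show ?thesis .
    qed
    from antidual_form[OF rl bounded_m this]
    have ad': "antidual (C2 * (D * \<epsilon>)) (\<lambda>v. form \<Omega> m r (jet v))" by blast
    have nn: "0 \<le> C2 * (D * \<epsilon>)" using C2(1) D \<epsilon> by simp
    obtain y where y: "y \<in> jets0 \<Omega>" "jnrm \<Omega> y \<le> C1 * (C2 * (D * \<epsilon>))"
      "\<And>v. v \<in> test_functions \<Omega> \<Longrightarrow> form \<Omega> m y (jet v) = form \<Omega> m r (jet v)"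
      using C1(2)[rule_format, OF ad' nn] by blast
    have yL: "y None \<in> L2 \<Omega>" using jetsD[OF jets0_subset] y(1) by blast
    define d where "d = jcomb 1 p (-1) (jcomb 1 z 1 y)"
    have zy: "jcomb 1 z 1 y \<in> jets0 \<Omega>" by (rule V.comb_closed[OF z(1) y(1)])
    have d0: "d \<in> jets0 \<Omega>" unfolding d_def by (rule V.comb_closed[OF p(1) zy])
    have "form \<Omega> m d (jet v) = 0" if v: "v \<in> test_functions \<Omega>" for v
    proof -
      note l = form_comb_left_loc[OF \<Omega>_sets bounded_m jets0_jets_loc jets0_jets_loc v]
      have "form \<Omega> m d (jet v) = form \<Omega> m p (jet v) - (form \<Omega> m z (jet v) + form \<Omega> m y (jet v))"
        unfolding d_def l[OF p(1) zy] l[OF z(1) y(1)] by simp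
      then show ?thesis using p(2)[OF v] y(3)[OF v] rm[OF v] by simp
    qed
    then have "AE x in lebesgue_on \<Omega>. d None x = 0" by (rule injective_jets0[OF inj d0])
    then have ae: "AE x in lebesgue_on \<Omega>. \<Psi> x - p None x = 1 * (\<Psi> x - z None x) + (-1) * y None x"
      by eventually_elim (simp add: d_def algebra_simps)
    have "lnrm \<Omega> (\<lambda>x. \<Psi> x - p None x) = lnrm \<Omega> (\<lambda>x. 1 * (\<Psi> x - z None x) + (-1) * y None x)"
      by (rule lnrm_cong_AE[OF L2_diff[OF \<Psi>L pL] L2_comb[OF L2_diff[OF \<Psi>L zL] yL] ae])
    also have "\<dots> \<le> cmod 1 * lnrm \<Omega> (\<lambda>x. \<Psi> x - z None x) + cmod (-1) * lnrm \<Omega> (y None)"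
      by (rule L2.nrm_comb_le[OF L2_diff[OF \<Psi>L zL] yL])
    also have "\<dots> \<le> D * \<epsilon> + C1 * (C2 * (D * \<epsilon>))"
      using est y(2) lnrm_le_jnrm[of \<Omega> y None] by simp
    also have "\<dots> = (D + C1 * C2 * D) * \<epsilon>" by (simp add: algebra_simps)
    finally show "lnrm \<Omega> (\<lambda>x. \<Psi> x - p None x) \<le> (D + C1 * C2 * D) * \<epsilon>" .
  qed
qed

end

subsection \<open>The Perron solution\<close>

lemma form_cong: "(\<And>i x. x \<in> S \<Longrightarrow> p i x = p' i x) \<Longrightarrow> form S m p q = form S m p' q"
  unfolding form_def by (intro sum.cong refl Bochner_Integration.integral_cong) auto

lemma lnrm_cong: "(\<And>x. x \<in> S \<Longrightarrow> u x = u' x) \<Longrightarrow> lnrm S u = lnrm S u'"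
  unfolding lnrm_def by (intro arg_cong[where f=sqrt] Bochner_Integration.integral_cong) auto

lemma has_weak_partial_cong:
  assumes w: "has_weak_partial \<Omega> k u g" and u': "u' \<in> L1_loc \<Omega>" "\<And>x. x \<in> \<Omega> \<Longrightarrow> u' x = u x"
  shows "has_weak_partial \<Omega> k u' g"
proof -
  have "(LINT x|lebesgue_on \<Omega>. u' x * partial k v x) = (LINT x|lebesgue_on \<Omega>. u x * partial k v x)" for v
    by (intro Bochner_Integration.integral_cong) (auto simp: u'(2))
  then show ?thesis using w u'(1) by (simp add: has_weak_partial_def)
qed

context elliptic
begin

text \<open>The approximation by smooth functions works with a function continuous and bounded by
  \<open>\<epsilon>\<close> on the whole space, so the difference is extended by Tietze's theorem
  with the same bound; its weak gradient on \<open>\<Omega>\<close> is unchanged.\<close>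

lemma bounded_extension:
  assumes Q: "smooth Q" and \<Phi>: "continuous_on (closure \<Omega>) \<Phi>" "\<Phi> \<in> H1_loc \<Omega>" and \<epsilon>: "\<epsilon> > 0"
    and close: "\<And>x. x \<in> closure \<Omega> \<Longrightarrow> cmod (\<Phi> x - Q x) \<le> \<epsilon>"
  obtains \<Psi> where "\<Psi> \<in> H1_loc \<Omega>" "continuous_on UNIV \<Psi>" "\<And>x. cmod (\<Psi> x) \<le> \<epsilon>"
    "\<And>x. x \<in> \<Omega> \<Longrightarrow> \<Psi> x = \<Phi> x - Q x"
    "\<And>v. v \<in> test_functions \<Omega> \<Longrightarrow>
      form \<Omega> m (weak_jet \<Omega> \<Psi>) (jet v) = form \<Omega> m (weak_jet \<Omega> \<Phi>) (jet v) - form \<Omega> m (jet Q) (jet v)"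
proof -
  have cont: "continuous_on (closure \<Omega>) (\<lambda>x. \<Phi> x - Q x)"
    by (intro continuous_on_diff \<Phi>(1) smooth_continuous Q)
  obtain \<Psi> where \<Psi>: "continuous_on UNIV \<Psi>" "\<And>x. x \<in> closure \<Omega> \<Longrightarrow> \<Psi> x = \<Phi> x - Q x" "\<And>x. cmod (\<Psi> x) \<le> \<epsilon>"
    by (rule Tietze[OF cont, of UNIV \<epsilon>]) (use \<epsilon> close in \<open>auto simp: closedin_closed\<close>)
  have \<Psi>\<Omega>: "\<Psi> x = \<Phi> x - Q x" if "x \<in> \<Omega>" for x using \<Psi>(2) that closure_subset by blast
  let ?w = "weak_jet \<Omega> \<Phi>"
  define d where "d = jcomb 1 ?w (-1) (jet Q)"
  define p where "p i = (case i of None \<Rightarrow> \<Psi> | Some k \<Rightarrow> d (Some k))" for i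
  have pN: "p None = \<Psi>" by (simp add: p_def)
  have dl: "d \<in> jets_loc \<Omega>" unfolding d_def
    by (rule jets_loc_comb[OF H1_loc_weak_jet(1)[OF \<Omega>(1) \<Phi>(2)] jet_smooth_in_jets_loc[OF Q]])
  have pl: "p \<in> jets_loc \<Omega>"
  proof -
    have "\<Psi> \<in> L2 \<Omega>" by (rule continuous_L2[OF continuous_on_subset[OF \<Psi>(1) subset_UNIV] \<Psi>(3)])
    then have "\<Psi> \<in> L2_loc \<Omega>" by (rule L2_imp_L2_loc[OF \<Omega>_sets])
    then show ?thesis using dl by (auto simp: jets_loc_def p_def split: option.split)
  qed
  have wp: "has_weak_partial \<Omega> k (p None) (p (Some k))" for k
  proof -
    have "has_weak_partial \<Omega> k (d None) (d (Some k))"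
      using has_weak_partial_comb[OF \<Omega>_sets H1_loc_weak_jet(2)[OF \<Omega>(1) \<Phi>(2)] smooth_has_weak_partial[OF \<Omega>_sets Q], of k 1 "-1"]
      by (simp add: d_def)
    moreover have "\<Psi> \<in> L1_loc \<Omega>" by (rule continuous_L1_loc[OF continuous_on_subset[OF \<Psi>(1) subset_UNIV]])
    ultimately have "has_weak_partial \<Omega> k \<Psi> (d (Some k))"
      by (rule has_weak_partial_cong) (simp add: \<Psi>\<Omega> d_def)
    then show ?thesis by (simp add: p_def)
  qed
  show thesis
  proof (rule that[OF _ \<Psi>(1,3) \<Psi>\<Omega>])
    show "\<Psi> \<in> H1_loc \<Omega>" using form_weak_jet(1)[OF pl wp bounded_m test_zero] by (simp add: p_def)
    fix v assume v: "v \<in> test_functions \<Omega>"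
    have "form \<Omega> m (weak_jet \<Omega> \<Psi>) (jet v) = form \<Omega> m p (jet v)"
      using form_weak_jet(2)[OF pl wp bounded_m v] unfolding pN .
    also have "\<dots> = form \<Omega> m d (jet v)"
      by (rule form_cong) (auto simp: p_def d_def \<Psi>\<Omega> split: option.split)
    also have "\<dots> = form \<Omega> m ?w (jet v) - form \<Omega> m (jet Q) (jet v)"
      unfolding d_def using form_comb_left_loc[OF \<Omega>_sets bounded_m H1_loc_weak_jet(1)[OF \<Omega>(1) \<Phi>(2)] jet_smooth_in_jets_loc[OF Q] v, of 1 "-1"]
      by simp
    finally show "form \<Omega> m (weak_jet \<Omega> \<Psi>) (jet v) = form \<Omega> m ?w (jet v) - form \<Omega> m (jet Q) (jet v)" .
  qed
qed

text \<open>A smooth function has finite energy on the bounded set \<open>\<Omega>\<close>, so the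
  defining property of \<open>T\<close> applies to it; harmonicity of \<open>T Q\<close> gives the
  equation for the difference.\<close>

lemma perron_smooth:
  assumes T: "perron_operator \<Omega> a b c c0 T" and Q: "smooth Q"
  obtains w where "w \<in> jets0 \<Omega>" "w None = (\<lambda>x. Q x - T Q x)"
    "\<And>v. v \<in> test_functions \<Omega> \<Longrightarrow> form \<Omega> m w (jet v) = form \<Omega> m (jet Q) (jet v)"
proof -
  have QH: "Q \<in> H1 \<Omega>"
    using H1I_jet(1)[OF \<Omega>(1) jet_smooth_in_jets[OF Q \<Omega>_sets \<Omega>(2)]] smooth_has_weak_partial[OF \<Omega>_sets Q] by simp
  have H: "(\<lambda>x. Q x - T Q x) \<in> H1_0 \<Omega>" "harmonic \<Omega> a b c c0 (T Q)"
    using T QH smooth_continuous[OF Q] by (simp_all add: perron_operator_def)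
  then have TQ: "T Q \<in> H1_loc \<Omega>" "ell_op \<Omega> a b c c0 (T Q) = (\<lambda>_. 0)" by (auto simp: harmonic_def)
  let ?t = "weak_jet \<Omega> (T Q)"
  define p where "p = jcomb 1 (jet Q) (-1) ?t"
  have tl: "?t \<in> jets_loc \<Omega>" and Ql: "jet Q \<in> jets_loc \<Omega>"
    using H1_loc_weak_jet(1)[OF \<Omega>(1) TQ(1)] jet_smooth_in_jets_loc[OF Q] by auto
  have pl: "p \<in> jets_loc \<Omega>" unfolding p_def by (rule jets_loc_comb[OF Ql tl])
  have p0: "p None = (\<lambda>x. Q x - T Q x)" by (simp add: p_def)
  have wp: "has_weak_partial \<Omega> k (p None) (p (Some k))" for k
    using has_weak_partial_comb[OF \<Omega>_sets smooth_has_weak_partial[OF \<Omega>_sets Q] H1_loc_weak_jet(2)[OF \<Omega>(1) TQ(1)], of k 1 "-1"]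
    by (simp add: p_def)
  show thesis
  proof (rule that[OF H1_0_weak_jet[OF \<Omega>(1) H(1)]])
    fix v assume v: "v \<in> test_functions \<Omega>"
    have "form \<Omega> m ?t (jet v) = 0" using fun_cong[OF TQ(2), of v] by (simp add: ell_op_eq_form[OF v])
    then have "form \<Omega> m p (jet v) = form \<Omega> m (jet Q) (jet v)"
      unfolding p_def using form_comb_left_loc[OF \<Omega>_sets bounded_m Ql tl v, of 1 "-1"] by simp
    then show "form \<Omega> m (weak_jet \<Omega> (\<lambda>x. Q x - T Q x)) (jet v) = form \<Omega> m (jet Q) (jet v)"
      using form_weak_jet(2)[OF pl wp bounded_m v] by (simp add: p0)
  qed simp
qed

text \<open>Compares through \<open>T Q\<close> for a polynomial \<open>Q\<close> close to
  \<open>\<Phi>\<close>: the distance from \<open>T \<phi>\<close> is controlled by continuity of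
  \<open>T\<close>, that from \<open>\<Phi> - p\<close> by \<open>solution_estimate\<close>, as
  \<open>p - w\<close> solves the equation for \<open>\<Phi> - Q\<close>.\<close>

theorem perron_eq:
  assumes inj: not_eigenvalue
    and T: "perron_operator \<Omega> a b c c0 T" and \<phi>: "continuous_on (frontier \<Omega>) \<phi>"
    and \<Phi>: "continuous_on (closure \<Omega>) \<Phi>" "\<Phi> \<in> H1_loc \<Omega>" "\<And>x. x \<in> frontier \<Omega> \<Longrightarrow> \<Phi> x = \<phi> x"
    and p: "p \<in> jets0 \<Omega>" "\<And>v. v \<in> test_functions \<Omega> \<Longrightarrow> form \<Omega> m p (jet v) = form \<Omega> m (weak_jet \<Omega> \<Phi>) (jet v)"
  shows "AE x in lebesgue_on \<Omega>. T \<phi> x = \<Phi> x - p None x"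
proof (cases "\<Omega> = {}")
  case True
  then show ?thesis by (intro AE_I2) simp
next
  case False
  have "\<Omega> \<noteq> UNIV" using \<Omega>(2) not_bounded_UNIV by blast
  \<comment> \<open>The supremum over the frontier is meaningful only over a nonempty set, hence the
    separate treatment of empty \<open>\<Omega>\<close>.\<close>
  then have fr: "frontier \<Omega> \<noteq> {}" using frontier_not_empty False by blast
  have fc: "frontier \<Omega> \<subseteq> closure \<Omega>" by (simp add: frontier_def)
  have cl: "compact (closure \<Omega>)" using \<Omega>(2) by (simp add: compact_closure)
  obtain CT where CT: "\<And>\<psi> x. continuous_on (frontier \<Omega>) \<psi> \<Longrightarrow> x \<in> \<Omega> \<Longrightarrow> cmod (T \<psi> x) \<le> CT * (SUP y\<in>frontier \<Omega>. cmod (\<psi> y))"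
    using T unfolding perron_operator_def by blast
  obtain C where C: "C \<ge> 0"
    "\<And>\<Psi> \<epsilon> p. \<Psi> \<in> H1_loc \<Omega> \<Longrightarrow> continuous_on UNIV \<Psi> \<Longrightarrow> (\<And>x. cmod (\<Psi> x) \<le> \<epsilon>) \<Longrightarrow> \<epsilon> > 0 \<Longrightarrow> p \<in> jets0 \<Omega> \<Longrightarrow>
      (\<And>v. v \<in> test_functions \<Omega> \<Longrightarrow> form \<Omega> m p (jet v) = form \<Omega> m (weak_jet \<Omega> \<Psi>) (jet v)) \<Longrightarrow>
      lnrm \<Omega> (\<lambda>x. \<Psi> x - p None x) \<le> C * \<epsilon>"
    by (rule solution_estimate[OF inj]) blast
  have TL: "T \<psi> \<in> L2 \<Omega>" if \<psi>: "continuous_on (frontier \<Omega>) \<psi>" for \<psi>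
  proof -
    have c: "continuous_on \<Omega> (T \<psi>)" "bounded (T \<psi> ` \<Omega>)" using T \<psi> by (auto simp: perron_operator_def)
    from c(2) obtain B' where "\<And>x. x \<in> \<Omega> \<Longrightarrow> cmod (T \<psi> x) \<le> B'" by (auto simp: bounded_iff)
    then show ?thesis by (rule continuous_L2[OF c(1)])
  qed
  have \<Phi>L: "\<Phi> \<in> L2 \<Omega>"
  proof -
    have "bounded (\<Phi> ` closure \<Omega>)" by (intro compact_imp_bounded compact_continuous_image \<Phi>(1) cl)
    then obtain B' where "\<And>x. x \<in> closure \<Omega> \<Longrightarrow> cmod (\<Phi> x) \<le> B'" by (auto simp: bounded_iff)
    then show ?thesis using closure_subset by (intro continuous_L2[OF continuous_on_subset[OF \<Phi>(1) closure_subset]]) blast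
  qed
  have pL: "p None \<in> L2 \<Omega>" by (rule jetsD[OF jets0_subset[OF p(1)]])
  define u where "u x = \<Phi> x - p None x" for x
  have uL: "u \<in> L2 \<Omega>" unfolding u_def[abs_def] by (rule L2_diff[OF \<Phi>L pL])
  define s where "s = sqrt (measure lebesgue \<Omega>)"
  have le: "lnrm \<Omega> (\<lambda>x. T \<phi> x - u x) \<le> (\<bar>CT\<bar> * s + C) * \<epsilon>" if \<epsilon>: "\<epsilon> > 0" for \<epsilon>
  proof -
    obtain Q where Q: "polynomial_function Q" "\<And>x. x \<in> closure \<Omega> \<Longrightarrow> norm (\<Phi> x - Q x) < \<epsilon>"
      using Stone_Weierstrass_polynomial_function[OF cl \<Phi>(1) \<epsilon>] by blast
    have sQ: "smooth Q" by (rule smooth_polynomial[OF Q(1)])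
    have Qc: "continuous_on (frontier \<Omega>) Q" by (rule smooth_continuous[OF sQ])
    obtain \<Psi> where \<Psi>: "\<Psi> \<in> H1_loc \<Omega>" "continuous_on UNIV \<Psi>" "\<And>x. cmod (\<Psi> x) \<le> \<epsilon>"
      "\<And>x. x \<in> \<Omega> \<Longrightarrow> \<Psi> x = \<Phi> x - Q x"
      "\<And>v. v \<in> test_functions \<Omega> \<Longrightarrow>
        form \<Omega> m (weak_jet \<Omega> \<Psi>) (jet v) = form \<Omega> m (weak_jet \<Omega> \<Phi>) (jet v) - form \<Omega> m (jet Q) (jet v)"
      by (rule bounded_extension[OF sQ \<Phi>(1,2) \<epsilon>], erule less_imp_le[OF Q(2)], blast)
    obtain w where w: "w \<in> jets0 \<Omega>" "w None = (\<lambda>x. Q x - T Q x)"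
      "\<And>v. v \<in> test_functions \<Omega> \<Longrightarrow> form \<Omega> m w (jet v) = form \<Omega> m (jet Q) (jet v)"
      by (rule perron_smooth[OF T sQ]) blast
    have "lnrm \<Omega> (\<lambda>x. \<Psi> x - jcomb 1 p (-1) w None x) \<le> C * \<epsilon>"
    proof (rule C(2)[OF \<Psi>(1-3) \<epsilon> V.comb_closed[OF p(1) w(1)]])
      fix v assume v: "v \<in> test_functions \<Omega>"
      show "form \<Omega> m (jcomb 1 p (-1) w) (jet v) = form \<Omega> m (weak_jet \<Omega> \<Psi>) (jet v)"
        using form_comb_left_loc[OF \<Omega>_sets bounded_m jets0_jets_loc[OF p(1)] jets0_jets_loc[OF w(1)] v, of 1 "-1"]
        by (simp add: \<Psi>(5)[OF v] p(2)[OF v] w(3)[OF v])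
    qed
    moreover have "lnrm \<Omega> (\<lambda>x. \<Psi> x - jcomb 1 p (-1) w None x) = lnrm \<Omega> (\<lambda>x. u x - T Q x)"
      by (rule lnrm_cong) (simp add: \<Psi>(4) w(2) u_def)
    ultimately have 1: "lnrm \<Omega> (\<lambda>x. T Q x - u x) \<le> C * \<epsilon>" using lnrm_minus_commute[of \<Omega> u "T Q"] by simp
    have 2: "lnrm \<Omega> (\<lambda>x. T \<phi> x - T Q x) \<le> (\<bar>CT\<bar> * \<epsilon>) * s"
      unfolding s_def
    proof (rule lnrm_bound[OF \<Omega>_sets \<Omega>(2) _ _ L2_diff[OF TL[OF \<phi>] TL[OF Qc]]])
      fix x assume x: "x \<in> \<Omega>"
      define \<psi> where "\<psi> y = 1 * \<phi> y + (-1) * Q y" for y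
      have lin: "T \<psi> x = 1 * T \<phi> x + (-1) * T Q x"
        using T \<phi> Qc x unfolding perron_operator_def \<psi>_def[abs_def] by blast
      have \<psi>c: "continuous_on (frontier \<Omega>) \<psi>" unfolding \<psi>_def[abs_def] by (intro continuous_intros \<phi> Qc)
      have \<psi>b: "cmod (\<psi> y) \<le> \<epsilon>" if "y \<in> frontier \<Omega>" for y
        using Q(2)[of y] \<Phi>(3)[OF that] that fc by (auto simp: \<psi>_def)
      obtain y0 where y0: "y0 \<in> frontier \<Omega>" using fr by blast
      have S: "(SUP y\<in>frontier \<Omega>. cmod (\<psi> y)) \<le> \<epsilon>" by (rule cSUP_least[OF fr \<psi>b])
      have "cmod (\<psi> y0) \<le> (SUP y\<in>frontier \<Omega>. cmod (\<psi> y))"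
        by (rule cSUP_upper[OF y0]) (use \<psi>b in \<open>auto intro!: bdd_aboveI2\<close>)
      then have S0: "(SUP y\<in>frontier \<Omega>. cmod (\<psi> y)) \<ge> 0" using norm_ge_zero[of "\<psi> y0"] by linarith
      have "cmod (T \<psi> x) \<le> CT * (SUP y\<in>frontier \<Omega>. cmod (\<psi> y))" by (rule CT[OF \<psi>c x])
      \<comment> \<open>The sign of \<open>CT\<close> is not given, so it is replaced by its
        absolute value.\<close>
      also have "\<dots> \<le> \<bar>CT\<bar> * (SUP y\<in>frontier \<Omega>. cmod (\<psi> y))" by (rule mult_right_mono[OF abs_ge_self S0])
      also have "\<dots> \<le> \<bar>CT\<bar> * \<epsilon>" by (rule mult_left_mono[OF S]) simp
      finally show "cmod (T \<phi> x - T Q x) \<le> \<bar>CT\<bar> * \<epsilon>" using lin by simp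
    qed (use \<epsilon> in simp)
    have "lnrm \<Omega> (\<lambda>x. T \<phi> x - u x) \<le> lnrm \<Omega> (\<lambda>x. T \<phi> x - T Q x) + lnrm \<Omega> (\<lambda>x. T Q x - u x)"
      by (rule lnrm_diff_triangle[OF TL[OF \<phi>] TL[OF Qc] uL])
    also have "\<dots> \<le> (\<bar>CT\<bar> * s + C) * \<epsilon>" using 1 2 by (simp add: algebra_simps)
    finally show ?thesis .
  qed
  have D: "\<bar>CT\<bar> * s + C \<ge> 0" using C(1) by (simp add: s_def)
  have "lnrm \<Omega> (\<lambda>x. T \<phi> x - u x) \<le> 0"
  proof (rule field_le_epsilon)
    fix e :: real assume e: "e > 0"
    let ?D = "\<bar>CT\<bar> * s + C"
    have "lnrm \<Omega> (\<lambda>x. T \<phi> x - u x) \<le> ?D * (e / (?D + 1))" by (rule le) (use e D in simp)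
    also have "\<dots> \<le> (?D + 1) * (e / (?D + 1))" using e D by (intro mult_right_mono) auto
    also have "\<dots> = e" using D by simp
    finally show "lnrm \<Omega> (\<lambda>x. T \<phi> x - u x) \<le> 0 + e" by simp
  qed
  then have "lnrm \<Omega> (\<lambda>x. T \<phi> x - u x) = 0" by (simp add: order_antisym)
  then have "AE x in lebesgue_on \<Omega>. T \<phi> x - u x = 0" using lnrm_eq_0_iff[OF L2_diff[OF TL[OF \<phi>] uL]] by simp
  then show ?thesis by eventually_elim (simp add: u_def)
qed

lemma solution_exists:
  assumes inj: not_eigenvalue
    and \<Phi>: "\<Phi> \<in> H1_loc \<Omega>" "ell_op \<Omega> a b c c0 \<Phi> \<in> H_minus_1 \<Omega>"
  obtains p where "p \<in> jets0 \<Omega>" "\<And>v. v \<in> test_functions \<Omega> \<Longrightarrow> form \<Omega> m p (jet v) = form \<Omega> m (weak_jet \<Omega> \<Phi>) (jet v)"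
proof -
  obtain C where C: "C \<ge> 0"
    "\<forall>G K. antidual K G \<longrightarrow> K \<ge> 0 \<longrightarrow>
      (\<exists>p\<in>jets0 \<Omega>. jnrm \<Omega> p \<le> C * K \<and> (\<forall>v\<in>test_functions \<Omega>. form \<Omega> m p (jet v) = G v))"
    using solve_ex[OF inj] by (elim exE conjE)
  obtain K where K: "K > 0" "\<And>v. v \<in> test_functions \<Omega> \<Longrightarrow> cmod (ell_op \<Omega> a b c c0 \<Phi> v) \<le> K * H1_norm \<Omega> v"
    using \<Phi>(2) unfolding H_minus_1_def by blast
  have "antidual K (\<lambda>v. form \<Omega> m (weak_jet \<Omega> \<Phi>) (jet v))"
    by (rule antidual_form[OF H1_loc_weak_jet(1)[OF \<Omega>(1) \<Phi>(1)] bounded_m])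
      (use K(2) in \<open>simp add: ell_op_eq_form H1_norm_test[OF \<Omega>(1)]\<close>)
  from C(2)[rule_format, OF this less_imp_le[OF K(1)]] show thesis using that by blast
qed

lemma solution_unique:
  assumes inj: not_eigenvalue
    and w: "w \<in> H1_0 \<Omega>" and p: "p \<in> jets0 \<Omega>"
    and eq: "\<And>v. v \<in> test_functions \<Omega> \<Longrightarrow> form \<Omega> m p (jet v) = ell_op \<Omega> a b c c0 w v"
  shows "AE x in lebesgue_on \<Omega>. w x = p None x"
proof -
  note wj = H1_0_weak_jet[OF \<Omega>(1) w]
  have "AE x in lebesgue_on \<Omega>. jcomb 1 (weak_jet \<Omega> w) (-1) p None x = 0"
  proof (rule injective_jets0[OF inj V.comb_closed[OF wj p]])
    fix v assume v: "v \<in> test_functions \<Omega>"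
    show "form \<Omega> m (jcomb 1 (weak_jet \<Omega> w) (-1) p) (jet v) = 0"
      using form_comb_left_loc[OF \<Omega>_sets bounded_m jets0_jets_loc[OF wj] jets0_jets_loc[OF p] v, of 1 "-1"]
        eq[OF v] ell_op_eq_form[OF v, of a b c c0 w] by simp
  qed
  then show ?thesis by eventually_elim simp
qed

text \<open>The witness is the zeroth component of the jet solution, chosen independently of
  \<open>T\<close>, so that one \<open>v\<close> serves every Perron operator.\<close>

theorem perron_characterization:
  assumes inj: not_eigenvalue
    and \<phi>: "continuous_on (frontier \<Omega>) \<phi>"
    and \<Phi>: "continuous_on (closure \<Omega>) \<Phi>" "\<Phi> \<in> H1_loc \<Omega>" "\<And>x. x \<in> frontier \<Omega> \<Longrightarrow> \<Phi> x = \<phi> x"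
      "ell_op \<Omega> a b c c0 \<Phi> \<in> H_minus_1 \<Omega>"
  shows "\<exists>v\<in>H1_0 \<Omega>. ell_op \<Omega> a b c c0 v = ell_op \<Omega> a b c c0 \<Phi> \<and>
    (\<forall>w\<in>H1_0 \<Omega>. ell_op \<Omega> a b c c0 w = ell_op \<Omega> a b c c0 \<Phi> \<longrightarrow> (AE x in lebesgue_on \<Omega>. w x = v x)) \<and>
    (\<forall>T. perron_operator \<Omega> a b c c0 T \<longrightarrow> (AE x in lebesgue_on \<Omega>. T \<phi> x = \<Phi> x - v x))"
proof -
  obtain p where p: "p \<in> jets0 \<Omega>" "\<And>v. v \<in> test_functions \<Omega> \<Longrightarrow> form \<Omega> m p (jet v) = form \<Omega> m (weak_jet \<Omega> \<Phi>) (jet v)"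
    by (rule solution_exists[OF inj \<Phi>(2,4)]) blast
  have eq: "ell_op \<Omega> a b c c0 (p None) = ell_op \<Omega> a b c c0 \<Phi>"
  proof
    show "ell_op \<Omega> a b c c0 (p None) v = ell_op \<Omega> a b c c0 \<Phi> v" for v
      unfolding ell_op_jets0[OF p(1)] by (simp add: p(2) ell_op_eq_form) (simp add: ell_op_def)
  qed
  show ?thesis
  proof (intro bexI[of _ "p None"] conjI ballI allI impI)
    show "p None \<in> H1_0 \<Omega>" by (rule jets0_H1_0(1)[OF \<Omega>(1) p(1)])
    show "ell_op \<Omega> a b c c0 (p None) = ell_op \<Omega> a b c c0 \<Phi>" by (rule eq)
    show "AE x in lebesgue_on \<Omega>. w x = p None x" if w: "w \<in> H1_0 \<Omega>" "ell_op \<Omega> a b c c0 w = ell_op \<Omega> a b c c0 \<Phi>" for w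
      by (rule solution_unique[OF inj w(1) p(1)]) (simp add: w(2) p(2) ell_op_eq_form)
    show "AE x in lebesgue_on \<Omega>. T \<phi> x = \<Phi> x - p None x" if "perron_operator \<Omega> a b c c0 T" for T
      by (rule perron_eq[OF inj that \<phi> \<Phi>(1-3) p])
  qed
qed

end

theorem theorem1p3:
  fixes \<Omega> :: "(real^'n::finite) set"
    and a :: "'n \<Rightarrow> 'n \<Rightarrow> real^'n \<Rightarrow> real"
    and b :: "'n \<Rightarrow> real^'n \<Rightarrow> complex"
    and c :: "'n \<Rightarrow> real^'n \<Rightarrow> real"
    and c0 :: "real^'n \<Rightarrow> complex"
    and \<mu> :: real
    and \<phi> :: "real^'n \<Rightarrow> complex"
  assumes "CARD('n) \<ge> 2"
    and "open \<Omega>" and "bounded \<Omega>"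
    and "\<And>k l. a k l \<in> borel_measurable (lebesgue_on \<Omega>)" and "\<And>k l. bounded (a k l ` \<Omega>)"
    and "\<And>k. b k \<in> borel_measurable (lebesgue_on \<Omega>)" and "\<And>k. bounded (b k ` \<Omega>)"
    and "\<And>k. c k \<in> borel_measurable (lebesgue_on \<Omega>)" and "\<And>k. bounded (c k ` \<Omega>)"
    and "c0 \<in> borel_measurable (lebesgue_on \<Omega>)" and "bounded (c0 ` \<Omega>)"
    and "0 < \<mu>" and "\<mu> \<le> 1"
    and "\<And>x (\<xi> :: complex^'n). x \<in> \<Omega> \<Longrightarrow>
           Re (\<Sum>k\<in>UNIV. \<Sum>l\<in>UNIV. of_real (a k l x) * \<xi> $ k * cnj (\<xi> $ l)) \<ge> \<mu> * (norm \<xi>)\<^sup>2"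
    and "\<And>u. u \<in> H1_0 \<Omega> \<Longrightarrow> ell_op \<Omega> a b c c0 u = (\<lambda>_. 0) \<Longrightarrow> AE x in lebesgue_on \<Omega>. u x = 0"
    and "continuous_on (frontier \<Omega>) \<phi>"
  shows "(\<exists>\<Phi>. continuous_on (closure \<Omega>) \<Phi> \<and> \<Phi> \<in> H1_loc \<Omega> \<and>
            (\<forall>x\<in>frontier \<Omega>. \<Phi> x = \<phi> x) \<and> ell_op \<Omega> a b c c0 \<Phi> \<in> H_minus_1 \<Omega>)
    \<and> (\<forall>\<Phi>. continuous_on (closure \<Omega>) \<Phi> \<and> \<Phi> \<in> H1_loc \<Omega> \<and>
            (\<forall>x\<in>frontier \<Omega>. \<Phi> x = \<phi> x) \<and> ell_op \<Omega> a b c c0 \<Phi> \<in> H_minus_1 \<Omega> \<longrightarrow>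
         (\<exists>v\<in>H1_0 \<Omega>. ell_op \<Omega> a b c c0 v = ell_op \<Omega> a b c c0 \<Phi> \<and>
            (\<forall>w\<in>H1_0 \<Omega>. ell_op \<Omega> a b c c0 w = ell_op \<Omega> a b c c0 \<Phi> \<longrightarrow>
               (AE x in lebesgue_on \<Omega>. w x = v x)) \<and>
            (\<forall>T. perron_operator \<Omega> a b c c0 T \<longrightarrow>
               (AE x in lebesgue_on \<Omega>. T \<phi> x = \<Phi> x - v x))))"
proof -
  \<comment> \<open>Collecting the values of all coefficients in one set yields a single bound
    \<open>B\<close>, as the index sets are finite.\<close>
  define S where "S = (\<Union>k l. (\<lambda>x. complex_of_real (a k l x)) ` \<Omega>) \<union> (\<Union>k. b k ` \<Omega>) \<union>
    (\<Union>k. (\<lambda>x. complex_of_real (c k x)) ` \<Omega>) \<union> c0 ` \<Omega>"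
  have "bounded S"
    unfolding S_def
  proof (intro bounded_Un[THEN iffD2] conjI bounded_UN finite ballI)
    show "bounded ((\<lambda>x. complex_of_real (a k l x)) ` \<Omega>)" for k l
      using assms(5)[of k l] by (simp add: bounded_iff)
    show "bounded ((\<lambda>x. complex_of_real (c k x)) ` \<Omega>)" for k
      using assms(9)[of k] by (simp add: bounded_iff)
  qed (rule assms)+
  then obtain B where B: "B > 0" "\<And>z. z \<in> S \<Longrightarrow> cmod z \<le> B" by (auto simp: bounded_pos)
  have aB: "\<bar>a k l x\<bar> \<le> B" if "x \<in> \<Omega>" for k l x
  proof -
    have "complex_of_real (a k l x) \<in> S" using that unfolding S_def by blast
    from B(2)[OF this] show ?thesis by simp
  qed
  have bB: "cmod (b k x) \<le> B" if "x \<in> \<Omega>" for k x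
  proof -
    have "b k x \<in> S" using that unfolding S_def by blast
    from B(2)[OF this] show ?thesis by simp
  qed
  have cB: "\<bar>c k x\<bar> \<le> B" if "x \<in> \<Omega>" for k x
  proof -
    have "complex_of_real (c k x) \<in> (\<Union>k. (\<lambda>x. complex_of_real (c k x)) ` \<Omega>)"
      by (rule UN_I[of k], simp, rule rev_image_eqI[OF that], simp)
    then have "complex_of_real (c k x) \<in> S" unfolding S_def by (intro UnI1 UnI2)
    from B(2)[OF this] show ?thesis by simp
  qed
  have c0B: "cmod (c0 x) \<le> B" if "x \<in> \<Omega>" for x
  proof -
    have "c0 x \<in> S" unfolding S_def by (rule UnI2[OF imageI[OF that]])
    from B(2)[OF this] show ?thesis by simp
  qed
  interpret elliptic \<Omega> a b c c0 \<mu> B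
    by (unfold_locales; (rule assms aB bB cB c0B less_imp_le[OF B(1)]; assumption?))
  have "not_eigenvalue" using assms(15) by (auto simp: not_eigenvalue_def)
  then show ?thesis
    using exists_extension[OF assms(16)] perron_characterization[OF _ assms(16)] by blast
qed

end
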